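(* Let $q_n$ denote the $n$-th positive integer that is a product of exactly two distinct primes. Then \[ \liminf_{n\to\infty}\,(q_{n+1}-q_n)\le 26 . \] *)

theory Defs
  imports "HOL-Computational_Algebra.Primes" "HOL-Library.Extended_Real"
          "HOL-Library.Liminf_Limsup" "HOL-Library.Infinite_Set"
begin

definition E2 :: "nat set" where
  "E2 = {m. \<exists>p r. prime p \<and> prime r \<and> p \<noteq> r \<and> m = p * r}"

text \<open>q n is the n-th element of E2 in increasing order (0-indexed: q 0 = 6).\<close>
definition q :: "nat \<Rightarrow> nat" where
  "q n = enumerate E2 n"

end

theory Submission
 imports Defs "HOL-Number_Theory.Number_Theory" "HOL-Analysis.Analysis" "HOL-Real_Asymp.Real_Asymp" "HOL-Computational_Algebra.Squarefree"
begin

text \<open>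
  The approach is that of Goldston, Graham, Pintz and Yildirim, in an elementary form with logarithmic weights.
  Fix the admissible tuple \<open>H = {0, 2, 6, 8, 12, 18, 20, 26}\<close> and let \<open>w n\<close> be the square of the sum of Selberg
  weights \<open>\<lambda> D\<close> over the divisors \<open>D \<le> R = y ^ 96\<close> of the product of the \<open>n + h\<close>. If the sum of \<open>w n / n\<close>
  over \<open>n\<close> up to about \<open>y ^ 430\<close> and over those \<open>h\<close> with \<open>n + h = p1 * p2\<close> exceeds the plain sum of \<open>w n / n\<close>,
  some \<open>n\<close> admits two such \<open>h\<close>, which gives two almost primes at distance at most 26. The first sum is larger by
  a factor above 1.05: its main term is bounded below by diagonalising the quadratic form and applying
  Cauchy-Schwarz, and a finite numerical inequality remains.

  Since \<open>n + h\<close> is a product of two primes, the error term is a bilinear form in \<open>p1\<close> and \<open>p2\<close>. For large moduli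
  the large sieve replaces the Bombieri-Vinogradov theorem, with one logarithm saved by a Chebyshev bound in dyadic
  blocks; for bounded moduli Dirichlet's theorem in Mertens' form suffices. Because the weights are \<open>1 / n\<close>, sums
  of \<open>ln p / p\<close> over residue classes carry all the information on primes that is needed. Primes up to a huge
  constant \<open>D0\<close> are removed by fixing \<open>n\<close> modulo their product \<open>W\<close>.

  Squarefree moduli are represented by finite sets \<open>V\<close> of primes, standing for \<open>\<Prod>V\<close>.
\<close>

text \<open>All sizes are integer powers of one parameter \<open>y\<close>, so ranges are compared
  through integer exponents and a lost logarithm or divisor factor is paid for by one factor
  \<open>y\<close>. The level of the weights is dictated by the bilinear form. Their squares reach
  moduli \<open>y ^ 192\<close>; for primes in cells of total exponent at least 400 the large sieve
  wins as long as twice the exponent of the modulus, plus 9, is at most 400 and the longer prime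
  exceeds the modulus by about nine powers of \<open>y\<close>. On small moduli no power of
  \<open>y\<close> is to spare and a single surviving logarithm would be fatal. Hence the lower
  bound for sums of reciprocal totients, which together with the dyadic saving turns the large sieve
  into a bound by a constant; the tail beyond a large fixed \<open>D1\<close> is then small.
  Multiplicative characters never meet the large sieve: Ramanujan sums are expanded directly into
  centred residue indicators, which also describe the divisibility conditions left in the weight.
  The larger prime carries the weight \<open>ln p / p\<close>, suitably normalised, which lies below
  \<open>1 / p\<close>: this is the price for knowing primes only through Mertens' form.\<close>

abbreviation rP :: "nat set => real" where "rP V \<equiv> real (\<Prod>V)"
text \<open>Reciprocal of Euler's totient at the squarefree number \<open>\<Prod>V\<close>.\<close>

abbreviation iph :: "nat set => real" where "iph V \<equiv> PROD p:V. 1 / (real p - 1)"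

section \<open>Elementary prime sums\<close>

text \<open>Summation by parts, with the boundary term weighted one step past the end, by
  \<open>g (Suc n)\<close>. The weights of the partial sums are then nonnegative for every length
  and telescope to exactly \<open>g (Suc m)\<close>.\<close>

lemma abel_decreasing_bound:
 fixes a :: "nat => 'a :: real_normed_vector" and g :: "nat => real"
 assumes bound: "!!n. norm (SUM i:{m<..n}. a i) <= B"
  and dec: "!!i j. m < i ==> i <= j ==> g j <= g i" and nonneg: "!!i. m < i ==> 0 <= g i"
 shows "norm (SUM i:{m<..n}. g i *\<^sub>R a i) <= B * g (Suc m)"
proof -
 have B: "0 <= B" using bound[of m] by simp
 define S where "S n = (SUM i:{m<..n}. a i)" for n
 have ivl: "{m<..Suc (m + k)} = insert (Suc (m + k)) {m<..m + k}" for k by auto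
 have Sk: "S (Suc (m + k)) = S (m + k) + a (Suc (m + k))" for k
  unfolding S_def ivl by simp
 have key: "(SUM i:{m<..m + k}. g i *\<^sub>R a i) =
   g (Suc (m + k)) *\<^sub>R S (m + k) + (SUM i:{m<..m + k}. (g i - g (Suc i)) *\<^sub>R S i)" for k
 proof (induction k)
  case (Suc k)
  have "(SUM i:{m<..m + Suc k}. g i *\<^sub>R a i) = g (Suc (m + k)) *\<^sub>R a (Suc (m + k)) +
    (g (Suc (m + k)) *\<^sub>R S (m + k) + (SUM i:{m<..m + k}. (g i - g (Suc i)) *\<^sub>R S i))"
   using Suc by (simp add: ivl)
  also have "... = g (Suc (m + Suc k)) *\<^sub>R S (Suc (m + k)) +
    ((g (Suc (m + k)) - g (Suc (Suc (m + k)))) *\<^sub>R S (Suc (m + k)) +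
    (SUM i:{m<..m + k}. (g i - g (Suc i)) *\<^sub>R S i))"
   by (simp add: Sk scaleR_diff_left scaleR_add_right)
  also have "... = g (Suc (m + Suc k)) *\<^sub>R S (m + Suc k) +
    (SUM i:{m<..m + Suc k}. (g i - g (Suc i)) *\<^sub>R S i)"
   by (simp add: ivl)
  finally show ?case .
 qed (simp add: S_def)
 have tel: "(SUM i:{m<..m + k}. g i - g (Suc i)) = g (Suc m) - g (Suc (m + k))" for k
  by (induction k) (simp_all add: ivl)
 have main: "norm (SUM i:{m<..m + k}. g i *\<^sub>R a i) <= B * g (Suc m)" for k
 proof -
  have "norm (SUM i:{m<..m + k}. g i *\<^sub>R a i) <=
    norm (g (Suc (m + k)) *\<^sub>R S (m + k)) + (SUM i:{m<..m + k}. norm ((g i - g (Suc i)) *\<^sub>R S i))"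
   unfolding key by (intro order.trans[OF norm_triangle_ineq] add_mono norm_sum order.refl)
  also have "... <= g (Suc (m + k)) * B + (SUM i:{m<..m + k}. (g i - g (Suc i)) * B)"
   using bound dec nonneg B unfolding S_def
   by (intro add_mono sum_mono) (auto intro!: mult_mono)
  also have "... = B * g (Suc m)"
   by (simp add: tel flip: sum_distrib_right) (simp add: algebra_simps)
  finally show ?thesis .
 qed
 show ?thesis
 proof (cases "m <= n")
  case True
  thus ?thesis using main[of "n - m"] by simp
 qed (use B nonneg[of "Suc m"] in auto)
qed

text \<open>The Chinese remainder theorem in multiplicative form: a product of local functions,
  summed over residues modulo \<open>\<Prod>V\<close>, factors prime by prime. The local counts for
  characters, for the residue kernels and for the tuple are instances.\<close>

lemma sum_crt_prod:
 fixes g :: "nat => nat => 'a :: comm_semiring_1"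
 assumes "finite V" "!!p. p : V ==> prime p"
 shows "(SUM c<\<Prod>V. PROD p:V. g p (c mod p)) = (PROD p:V. SUM c<p. g p c)"
 using assms
proof (induction V rule: finite_induct)
 case empty
 have "{..<Suc 0} = {0}" by auto
 thus ?case by simp
next
 case (insert qq V)
 let ?m = "\<Prod>V"
 have cop: "coprime qq ?m"
  using insert.hyps insert.prems by (intro prod_coprime_right primes_coprime) auto
 have pos: "0 < qq" "0 < ?m"
  using insert.prems by (auto intro!: prod_pos simp: prime_gt_0_nat)
 let ?f = "%c. (c mod qq, c mod ?m)"
 have inj: "inj_on ?f {..<qq * ?m}"
 proof (rule inj_onI)
  fix x y assume "x : {..<qq * ?m}" "y : {..<qq * ?m}" "?f x = ?f y"
  hence "[x = y] (mod qq)" "[x = y] (mod ?m)" "x < qq * ?m" "y < qq * ?m"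
   by (auto simp: Cong.cong_def)
  thus "x = y"
   using coprime_cong_mult_nat[OF _ _ cop] cong_less_modulus_unique_nat by blast
 qed
 have bij: "bij_betw ?f {..<qq * ?m} ({..<qq} \<times> {..<?m})"
 proof (rule bij_betw_imageI[OF inj], rule card_subset_eq)
  show "?f ` {..<qq * ?m} \<subseteq> {..<qq} \<times> {..<?m}" using pos by auto
  show "card (?f ` {..<qq * ?m}) = card ({..<qq} \<times> {..<?m})"
   using inj by (simp add: card_image)
 qed simp
 have "(SUM c<\<Prod>(insert qq V). PROD p:insert qq V. g p (c mod p)) =
   (SUM c<qq * ?m. g qq (c mod qq) * (PROD p:V. g p ((c mod ?m) mod p)))"
 proof -
  have "c mod ?m mod p = c mod p" if "p : V" for c p
   using that insert.hyps by (intro mod_mod_cancel dvd_prodI) auto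
  thus ?thesis using insert.hyps by simp
 qed
 also have "... = (SUM z:{..<qq} \<times> {..<?m}. g qq (fst z) * (PROD p:V. g p (snd z mod p)))"
  using sum.reindex_bij_betw[OF bij, of "%z. g qq (fst z) * (PROD p:V. g p (snd z mod p))"] by simp
 also have "... = (SUM c<qq. g qq c) * (SUM c<?m. PROD p:V. g p (c mod p))"
  by (simp add: sum_product sum.cartesian_product case_prod_beta)
 finally show ?case using insert by simp
qed

lemma sum_divisors_swap:
 fixes f :: "nat => nat => 'a :: comm_monoid_add"
 shows "(SUM n=1..N. \<Sum>d | d dvd n. f d (n div d)) = (SUM d=1..N. SUM m=1..N div d. f d m)"
proof -
 have "(SUM n=1..N. \<Sum>d | d dvd n. f d (n div d)) = (SUM (n, d):(SIGMA n:{1..N}. {d. d dvd n}). f d (n div d))"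
  by (intro sum.Sigma) auto
 also have "... = (SUM (d, m):(SIGMA d:{1..N}. {1..N div d}). f d m)"
 proof (rule sum.reindex_bij_witness[of _ "%(d, m). (d * m, d)" "%(n, d). (d, n div d)"])
  fix z assume "z : (SIGMA n:{1..N}. {d. d dvd n})"
  then obtain n d where z: "z = (n, d)" "1 <= n" "n <= N" "d dvd n" by auto
  thus "(case case z of (n, d) => (d, n div d) of (d, m) => (d * m, d)) = z"
   "(case z of (n, d) => (d, n div d)) : (SIGMA d:{1..N}. {1..N div d})"
   by (auto simp: Suc_le_eq dvd_div_eq_0_iff intro: div_le_mono dest: dvd_imp_le dvd_pos_nat)
 next
  fix z assume "z : (SIGMA d:{1..N}. {1..N div d})"
  then obtain d m where z: "z = (d, m)" "1 <= d" "d <= N" "1 <= m" "m <= N div d" by auto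
  hence "d * m <= N"
   by (metis mult.commute mult_le_mono1 order.trans times_div_less_eq_dividend)
  with z show "(case case z of (d, m) => (d * m, d) of (n, d) => (d, n div d)) = z"
   "(case z of (d, m) => (d * m, d)) : (SIGMA n:{1..N}. {d. d dvd n})"
   by auto
 qed auto
 also have "... = (SUM d=1..N. SUM m=1..N div d. f d m)"
  by (intro sum.Sigma [symmetric]) auto
 finally show ?thesis .
qed

section \<open>Chebyshev's and Mertens' bounds for the von Mangoldt function\<close>

lemma real_div_bounds:
 assumes "d > 0"
 shows "real (N div d) <= N / d" "N / d < real (N div d) + 1"
proof -
 show "real (N div d) <= N / d" by (rule of_nat_div_le_of_nat)
 have "N < d * (N div d + 1)" using assms by (metis dividend_less_times_div mult.commute add.commute distrib_left mult.right_neutral)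
 hence "real N < real d * (real (N div d) + 1)" 
  by (metis of_nat_1 of_nat_add of_nat_less_iff of_nat_mult)
 thus "N / d < real (N div d) + 1" using assms by (simp add: field_simps)
qed

abbreviation Lam :: "nat => real" where "Lam \<equiv> mangoldt"

lemma ln_fact_eq_sum_Lam: "ln (fact N :: real) = (SUM d=1..N. Lam d * real (N div d))"
proof -
 have "ln (fact N :: real) = (SUM n=1..N. ln (real n))"
  unfolding fact_prod of_nat_prod by (subst ln_prod) auto
 also have "... = (SUM n=1..N. \<Sum>d | d dvd n. Lam d)"
  by (intro sum.cong refl) (simp add: mangoldt_sum)
 also have "... = (SUM d=1..N. Lam d * real (N div d))"
  using sum_divisors_swap[of "%d m. Lam d" N] by (simp add: mult.commute)
 finally show ?thesis .
qed

text \<open>Chebyshev's argument: in the logarithm of the central binomial coefficient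
  \<open>Lam d\<close> has coefficient \<open>2 * n div d - 2 * (n div d)\<close>, which is 1 for
  \<open>d\<close> in \<open>(n, 2 n]\<close> and nonnegative for all other
  \<open>d\<close>.\<close>

lemma Lam_dyadic: "(SUM d:{n<..2*n}. Lam d) <= 2 * real n * ln 2"
proof -
 let ?z1 = "SUM d=1..2*n. Lam d * (real (2 * n div d) - 2 * real (n div d))"
 have *: "(SUM d=1..n. Lam d * real (n div d)) = (SUM d=1..2*n. Lam d * real (n div d))"
  by (intro sum.mono_neutral_left) auto
 have "(SUM d:{n<..2*n}. Lam d) <= ?z1"
 proof -
  have "(SUM d:{n<..2*n}. Lam d) = (SUM d:{n<..2*n}. Lam d * (real (2 * n div d) - 2 * real (n div d)))"
  proof (intro sum.cong refl)
   fix d assume "d : {n<..2*n}"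
   hence "2 * n div d = 1" "n div d = 0" by (auto intro!: div_nat_eqI)
   thus "Lam d = Lam d * (real (2 * n div d) - 2 * real (n div d))" by simp
  qed
  also have "... <= ?z1"
  proof (intro sum_mono2)
   fix d assume "d : {1..2*n} - {n<..2*n}"
   have "2 * (n div d) <= 2 * n div d"
    by (metis div_mult2_eq div_times_less_eq_dividend dividend_less_times_div le_numeral_extra(4)
      less_eq_div_iff_mult_less_eq linorder_not_le mult.assoc mult.commute mult_le_mono2 not_gr_zero
      bot_nat_0.not_eq_extremum div_by_0 mult_0_right mult_less_cancel1)
   hence "2 * real (n div d) <= real (2 * n div d)"
    by (metis of_nat_le_iff of_nat_mult of_nat_numeral)
   thus "0 <= Lam d * (real (2 * n div d) - 2 * real (n div d))"
    by (simp add: mangoldt_nonneg)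
  qed auto
  finally show ?thesis .
 qed
 also have "... = ln (fact (2 * n) :: real) - 2 * ln (fact n :: real)"
  unfolding ln_fact_eq_sum_Lam * by (simp add: sum_subtractf sum_distrib_left algebra_simps)
 also have "... = ln (real (2 * n choose n))"
  by (simp add: binomial_fact ln_div ln_mult)
 also have "... <= ln (2 ^ (2 * n))"
 proof -
  have "real (2 * n choose n) <= 2 ^ (2 * n)"
   using binomial_le_pow2[of "2 * n" n] by (metis of_nat_le_iff of_nat_numeral of_nat_power)
  moreover have "0 < real (2 * n choose n)" by simp
  ultimately show ?thesis by (subst ln_le_cancel_iff) auto
 qed
 also have "... = 2 * real n * ln 2" by (simp add: ln_realpow)
 finally show ?thesis .
qed

lemma chebyshev_psi: "(SUM d=1..N. Lam d) <= 4 * real N"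
proof (induction N rule: less_induct)
 case (less N)
 have ln2: "ln 2 <= (1::real)" using ln_2_less_1 by simp
 show ?case
 proof (cases "N <= 1")
  case True
  hence "N = 0 | N = 1" by auto
  thus ?thesis by auto
 next
  case False
  \<comment> \<open>Half of \<open>N\<close> rounded up; \<open>4 n + 2 n\<close> is still at most
    \<open>4 N\<close> for \<open>N >= 2\<close>.\<close>
  define n where "n = (N + 1) div 2"
  have n: "N <= 2 * n" "2 * n <= N + 1" "n < N" using False unfolding n_def by auto
  have "(SUM d=1..N. Lam d) <= (SUM d=1..2*n. Lam d)"
   using n by (intro sum_mono2) (auto simp: mangoldt_nonneg)
  also have "{1..2*n} = {1..n} Un {n<..2*n}" by auto
  also have "(SUM d:{1..n} Un {n<..2*n}. Lam d) = (SUM d=1..n. Lam d) + (SUM d:{n<..2*n}. Lam d)"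
   by (intro sum.union_disjoint) auto
  also have "... <= 4 * real n + 2 * real n * 1"
   using less.IH[OF n(3)] Lam_dyadic[of n] mult_left_mono[OF ln2, of "2 * real n"] by simp
  also have "... <= 4 * real N" 
   using n False by linarith
  finally show ?thesis .
 qed
qed

lemma ln_fact_bounds:
 assumes "N >= 1"
 shows "ln (fact N :: real) <= N * ln N" "N * ln N - N <= ln (fact N :: real)"
proof -
 show "ln (fact N :: real) <= N * ln N"
 proof -
  have "ln (fact N :: real) = (SUM n=1..N. ln (real n))"
   unfolding fact_prod of_nat_prod by (subst ln_prod) auto
  also have "... <= (SUM n=1..N. ln (real N))" by (intro sum_mono) auto
  finally show ?thesis by simp
 qed
 show "N * ln N - N <= ln (fact N :: real)" using assms
 proof (induction N rule: nat_induct_at_least)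
  case (Suc n)
  have "ln (1 + 1 / real n) <= 1 / real n" using Suc by (intro ln_add_one_self_le_self) auto
  moreover have "1 + 1 / real n = real (Suc n) / real n" using Suc by (simp add: field_simps)
  ultimately have "real n * (ln (real (Suc n)) - ln (real n)) <= 1"
   using Suc by (simp add: ln_div field_simps)
  moreover have "ln (fact (Suc n) :: real) = ln (real (Suc n)) + ln (fact n)"
   unfolding fact_Suc of_nat_mult[symmetric] using fact_gt_zero[of n, where 'a = real]
   by (subst ln_mult) auto
  ultimately show ?case using Suc by (simp add: algebra_simps del: fact_Suc)
 qed simp
qed

text \<open>\<open>ln (fact N)\<close> is evaluated twice. Dropping the floor in
  \<open>N div d\<close> loses nothing for the lower bound; for the upper one it loses
  \<open>psi N <= 4 N\<close>. Both losses fit into the constant 5.\<close>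

lemma mertens_Lam:
 assumes "N >= 1"
 shows "\<bar>(SUM d=1..N. Lam d / d) - ln N\<bar> <= 5"
proof -
 let ?z1 = "SUM d=1..N. Lam d / d"
 have N: "real N > 0" using assms by simp
 have up: "real (N div d) <= N / d" and lo: "N / d - 1 <= real (N div d)" if "d >= 1" for d
  using real_div_bounds[of d N] that by simp_all
 have "ln (fact N :: real) <= (SUM d=1..N. Lam d * (N / d))"
  unfolding ln_fact_eq_sum_Lam by (intro sum_mono mult_left_mono up) (auto simp: mangoldt_nonneg)
 also have "... = N * ?z1" by (simp add: sum_distrib_left mult_ac)
 finally have 1: "N * ln N - N <= N * ?z1"
  using ln_fact_bounds(2)[OF assms] by simp
 have "N * ?z1 - (SUM d=1..N. Lam d) = (SUM d=1..N. Lam d * (N / d - 1))"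
  by (simp add: sum_distrib_left sum_subtractf algebra_simps)
 also have "... <= ln (fact N :: real)"
  unfolding ln_fact_eq_sum_Lam by (intro sum_mono mult_left_mono lo) (auto simp: mangoldt_nonneg)
 finally have "N * ?z1 <= N * ln N + 4 * N"
  using ln_fact_bounds(1)[OF assms] chebyshev_psi[of N] by linarith
 hence "N * ?z1 <= N * (ln N + 4)" by (simp add: algebra_simps)
 moreover have "N * (ln N - 1) <= N * ?z1" using 1 by (simp add: algebra_simps)
 ultimately have "?z1 <= ln N + 4" "ln N - 1 <= ?z1"
  using N mult_le_cancel_left_pos by blast+
 thus ?thesis by linarith
qed

text \<open>Exponents of at least 2 make the sum over prime powers converge. Uniformity in
  \<open>A\<close> is the point: inside any residue class \<open>Lam\<close> may be exchanged for
  \<open>ln\<close> on primes at bounded cost.\<close>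

lemma Lam_nonprime_bounded:
 "EX C>0. ALL A N. (SUM d:{d:{1..N}. d : A & ~ prime d}. Lam d / d) <= C"
proof -
 have summ: "summable (%n. 4 * (real n powr (-(3/2))))"
  by (intro summable_mult) (simp add: summable_real_powr_iff)
 define C where "C = (\<Sum>n. 4 * (real n powr (-(3/2)))) + 1"
 have C: "0 < C" unfolding C_def using suminf_nonneg[OF summ] by simp
 have main: "(SUM d:{d:{1..N}. d : A & ~ prime d}. Lam d / d) <= C" for A N
 proof -
  let ?P = "{p. prime p & p <= N}"
  let ?S = "?P \<times> {2..N}"
  have fin: "finite ?P" by (rule finite_subset[of _ "{..N}"]) auto
  have "(SUM d:{d:{1..N}. d : A & ~ prime d}. Lam d / d) =
    (SUM d:{d:{1..N}. d : A & ~ prime d & primepow d}. Lam d / d)"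
   by (intro sum.mono_neutral_right) (auto simp: mangoldt_def)
  also have "... <= (SUM d:(%(p, k). p ^ k) ` ?S. Lam d / d)"
  proof (intro sum_mono2)
   show "{d : {1..N}. d : A & ~ prime d & primepow d} \<subseteq> (%(p, k). p ^ k) ` ?S"
   proof
    fix d assume d: "d : {d : {1..N}. d : A & ~ prime d & primepow d}"
    then obtain p k where pk: "prime p" "k > 0" "d = p ^ k" unfolding primepow_def by auto
    have "k ~= 1" using d pk by auto
    moreover have "k < p ^ k" by (metis pk(1) less_exp power_mono prime_ge_2_nat order_less_le_trans zero_le)
    moreover have "p <= p ^ k" using pk by (simp add: prime_gt_0_nat self_le_power Suc_leI)
    ultimately have "(p, k) : ?S" using pk d by auto
    thus "d : (%(p, k). p ^ k) ` ?S" using pk by force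
   qed
  qed (use fin in \<open>auto simp: mangoldt_nonneg\<close>)
  also have "... <= (SUM z:?S. (Lam ((%(p, k). p ^ k) z)) / ((%(p, k). p ^ k) z))"
   using sum_image_le[of ?S "%d. Lam d / d" "%(p, k). p ^ k"] fin by (auto simp: o_def mangoldt_nonneg)
  also have "... = (SUM p:?P. SUM k=2..N. Lam (p ^ k) / p ^ k)"
   unfolding sum.cartesian_product by (intro sum.cong) auto
  also have "... <= (SUM p:?P. 4 * (real p powr (-(3/2))))"
  proof (intro sum_mono)
   fix p assume "p : ?P"
   hence p: "prime p" by auto
   hence p2: "real p >= 2" using prime_ge_2_nat by force
   have "(SUM k=2..N. Lam (p ^ k) / p ^ k) = ln p * (SUM k=2..N. (1 / real p) ^ k)"
    unfolding sum_distrib_left using p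
    by (intro sum.cong) (auto simp: mangoldt_primepow power_one_over field_simps)
   also have "... <= (2 * real p powr (1/2)) * (2 / real p ^ 2)"
   proof (intro mult_mono)
    show "ln (real p) <= 2 * real p powr (1/2)"
     using ln_powr_bound[of "real p" "1/2"] p2 by simp
    show "(SUM k=2..N. (1 / real p) ^ k) <= 2 / real p ^ 2"
   proof (cases "2 <= N")
    case True
    hence "(SUM k=2..N. (1 / real p) ^ k) = ((1 / p) ^ 2 - (1 / p) ^ Suc N) / (1 - 1 / p)"
     using sum_gp[of "1 / real p" 2 N] p2 by auto
    also have "... <= (1 / p) ^ 2 / (1 / 2)"
     using p2 by (intro frac_le) (auto simp: field_simps)
    finally show ?thesis by (simp add: power_divide)
   qed auto
   qed (auto intro!: sum_nonneg)
   also have "... = 4 * (real p powr (1/2) / real p powr 2)" using p2 by simp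
   also have "real p powr (1/2) / real p powr 2 = real p powr (1/2 - 2)" by (rule powr_diff [symmetric])
   also have "(1/2 - 2 :: real) = -(3/2)" by simp
   finally show "(SUM k=2..N. Lam (p ^ k) / p ^ k) <= 4 * (real p powr (-(3/2)))" .
  qed
  also have "... <= C"
  proof -
   have "(SUM p:?P. 4 * (real p powr (-(3/2)))) <= (\<Sum>n. 4 * (real n powr (-(3/2))))"
    by (intro sum_le_suminf summ fin) auto
   thus ?thesis by (simp add: C_def)
  qed
  finally show ?thesis .
 qed
 show ?thesis using C main by blast
qed

section \<open>Characters and Dirichlet's theorem in Mertens' form\<close>

definition proot :: "nat => nat" where "proot p = (SOME g. residue_primroot p g)"

lemma residue_primroot_proot:
 assumes "prime p" shows "residue_primroot p (proot p)"
proof -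
 have "EX g. residue_primroot p g"
  by (rule prime_primitive_root_exists) (use assms prime_gt_1_nat[OF assms] in auto)
 thus ?thesis unfolding proot_def by (rule someI_ex)
qed

text \<open>The discrete logarithm of \<open>n\<close> to the base \<open>proot p\<close>,
  meaningful when \<open>p\<close> does not divide \<open>n\<close>.\<close>

definition pind :: "nat => nat => nat" where
 "pind p n = (SOME k. k < p - 1 & proot p ^ k mod p = n mod p)"

lemma proot_pow_bij:
 assumes "prime p" shows "bij_betw (%i. proot p ^ i mod p) {..<p - 1} {0<..<p}"
 using residue_primroot_is_generator[of p "proot p"] assms residue_primroot_proot[OF assms]
  prime_gt_1_nat[OF assms]
 by (simp add: totient_prime totatives_prime)

lemma pind:
 assumes "prime p" "~ p dvd n"
 shows "pind p n < p - 1" "proot p ^ pind p n mod p = n mod p"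
proof -
 have "n mod p : {0<..<p}" using assms by (auto simp: dvd_eq_mod_eq_0 prime_gt_0_nat)
 hence "n mod p : (%i. proot p ^ i mod p) ` {..<p - 1}"
  using proot_pow_bij[OF assms(1)] by (simp add: bij_betw_def)
 hence "EX k. k < p - 1 & proot p ^ k mod p = n mod p" by auto
 from someI_ex[OF this] show "pind p n < p - 1" "proot p ^ pind p n mod p = n mod p"
  unfolding pind_def by auto
qed

lemma proot_pow_cong_iff:
 assumes "prime p"
 shows "proot p ^ a mod p = proot p ^ b mod p \<longleftrightarrow> [a = b] (mod (p - 1))"
 using order_divides_expdiff[of p "proot p" a b] residue_primroot_proot[OF assms] assms
 by (simp add: residue_primroot_def Cong.cong_def totient_prime)

lemma pind_mod: "pind p (n mod p) = pind p n"
 by (simp add: pind_def)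

lemma pind_mult:
 assumes "prime p" "~ p dvd m" "~ p dvd n"
 shows "[pind p (m * n) = pind p m + pind p n] (mod (p - 1))"
proof -
 have mn: "~ p dvd m * n" using assms prime_dvd_mult_iff by blast
 have "proot p ^ pind p (m * n) mod p = ((m mod p) * (n mod p)) mod p"
  using pind(2)[OF assms(1) mn] by (simp add: mod_mult_eq)
 also have "... = proot p ^ (pind p m + pind p n) mod p"
  by (simp add: pind(2)[OF assms(1,2), symmetric] pind(2)[OF assms(1,3), symmetric] power_add mod_mult_eq)
 finally show ?thesis using proot_pow_cong_iff[OF assms(1)] by blast
qed

text \<open>The Dirichlet characters modulo \<open>p\<close>: the unit group is cyclic with
  generator \<open>proot p\<close>, so they are indexed by \<open>j < p - 1\<close>, with
  \<open>j = 0\<close> principal.\<close>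

definition pchar :: "nat => nat => nat => complex" where
 "pchar p j n = (if p dvd n then 0 else cis (2 * pi * (real (j * pind p n) / real (p - 1))))"

lemma cis_frac_cong:
 assumes "[a = b] (mod m)"
 shows "cis (2 * pi * (real a / real m)) = cis (2 * pi * (real b / real m))"
proof (cases "m = 0")
 case False
 from assms have "[int a = int b] (mod int m)" by (simp add: cong_int_iff)
 then obtain k where k: "int a = int b + int m * k"
  by (metis cong_iff_lin cong_sym)
 have "real_of_int (int a) = real_of_int (int b + int m * k)" using k by simp
 hence "real a = real b + real m * real_of_int k" by simp
 hence "2 * pi * (real a / real m) = 2 * pi * (real b / real m) + 2 * pi * real_of_int k"
  using False by (simp add: field_simps)
 thus ?thesis by (simp add: cis_mult[symmetric])
qed simp

lemma pchar_mod: "pchar p j (n mod p) = pchar p j n"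
 by (simp add: pchar_def pind_mod dvd_mod_iff)

lemma pchar_mult:
 assumes "prime p" shows "pchar p j (m * n) = pchar p j m * pchar p j n"
proof (cases "p dvd m | p dvd n")
 case True thus ?thesis by (auto simp: pchar_def)
next
 case False
 have "[j * pind p (m * n) = j * (pind p m + pind p n)] (mod (p - 1))"
  using pind_mult[OF assms] False by (intro cong_scalar_left) auto
 from cis_frac_cong[OF this] have "cis (2 * pi * (real (j * pind p (m * n)) / real (p - 1))) =
  cis (2 * pi * (real (j * pind p m) / real (p - 1))) * cis (2 * pi * (real (j * pind p n) / real (p - 1)))"
  by (simp add: cis_mult distrib_left add_divide_distrib)
 thus ?thesis using False assms prime_dvd_mult_iff[of p m n] by (simp add: pchar_def)
qed

lemma pchar_norm: "norm (pchar p j n) = (if p dvd n then 0 else 1)"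
 by (simp add: pchar_def)

lemma sum_cis_period:
 assumes "m > 0"
 shows "(SUM k<m. cis (2 * pi * (real (j * k) / real m))) = (if m dvd j then of_nat m else 0)"
proof -
 let ?z = "cis (2 * pi * (real j / real m))"
 have pow: "cis (2 * pi * (real (j * k) / real m)) = ?z ^ k" for k
  by (subst Complex.DeMoivre) (simp add: field_simps)
 show ?thesis
 proof (cases "m dvd j")
  case True
  then obtain t where "j = m * t" by auto
  hence "?z = 1" using assms by simp
  thus ?thesis using True unfolding pow by simp
 next
  case False
  have "?z ~= 1"
  proof
   assume "?z = 1"
   hence "cos (2 * pi * (real j / real m)) = 1" by (simp add: complex_eq_iff)
   then obtain n :: int where "2 * pi * (real j / real m) = of_int n * 2 * pi"
    using cos_one_2pi_int by blast
   hence "real j = of_int n * real m" using assms by (simp add: field_simps)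
   hence "int j = n * int m" by (metis of_int_eq_iff of_int_mult of_int_of_nat_eq)
   hence "int m dvd int j" by simp
   with False show False by simp
  qed
  moreover have "?z ^ m = 1" 
   using pow[of m, symmetric] assms by simp
  ultimately show ?thesis using False unfolding pow by (simp add: sum_gp_strict)
 qed
qed

lemma pchar_sum_residues:
 assumes "prime p" "0 < j" "j < p - 1"
 shows "(SUM c<p. pchar p j c) = 0"
proof -
 have "(SUM c<p. pchar p j c) = (SUM c:{0<..<p}. pchar p j c)"
  by (intro sum.mono_neutral_right) (auto simp: pchar_def)
 also have "... = (SUM k<p - 1. pchar p j (proot p ^ k mod p))"
  by (rule sum.reindex_bij_betw[OF proot_pow_bij[OF assms(1)], symmetric])
 also have "... = (SUM k<p - 1. cis (2 * pi * (real (j * k) / real (p - 1))))"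
 proof (intro sum.cong refl)
  fix k assume "k : {..<p - 1}"
  have "proot p ^ k mod p : {0<..<p}"
   using proot_pow_bij[OF assms(1)] \<open>k : {..<p - 1}\<close> by (auto simp: bij_betw_def)
  hence nd: "~ p dvd proot p ^ k" by (auto simp: dvd_eq_mod_eq_0)
  have "[pind p (proot p ^ k) = k] (mod (p - 1))"
   using pind(2)[OF assms(1) nd] proot_pow_cong_iff[OF assms(1)] by blast
  hence "[j * pind p (proot p ^ k) = j * k] (mod (p - 1))" by (rule cong_scalar_left)
  from cis_frac_cong[OF this] show "pchar p j (proot p ^ k mod p) = cis (2 * pi * (real (j * k) / real (p - 1)))"
   using nd unfolding pchar_mod by (simp add: pchar_def)
 qed
 also have "... = 0" using assms by (subst sum_cis_period) (auto dest: dvd_imp_le)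
 finally show ?thesis .
qed

lemma pchar_sum_chars:
 assumes "prime p"
 shows "(SUM j<p - 1. pchar p j n) = (if n mod p = 1 then of_nat (p - 1) else 0)"
proof (cases "p dvd n")
 case True
 thus ?thesis using prime_gt_1_nat[OF assms] by (auto simp: pchar_def)
next
 case False
 have "(SUM j<p - 1. pchar p j n) = (SUM j<p - 1. cis (2 * pi * (real (pind p n * j) / real (p - 1))))"
  using False by (simp add: pchar_def mult.commute)
 also have "... = (if (p - 1) dvd pind p n then of_nat (p - 1) else 0)"
  using prime_gt_1_nat[OF assms] by (intro sum_cis_period) simp
 also have "(p - 1) dvd pind p n \<longleftrightarrow> n mod p = 1"
 proof -
  have "(p - 1) dvd pind p n \<longleftrightarrow> [pind p n = 0] (mod (p - 1))" by (simp add: cong_0_iff)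
  also have "... \<longleftrightarrow> n mod p = 1"
   using proot_pow_cong_iff[OF assms, of "pind p n" 0] pind(2)[OF assms False] prime_gt_1_nat[OF assms] by simp
  finally show ?thesis .
 qed
 finally show ?thesis .
qed

text \<open>Conjugation negates the index modulo \<open>p - 1\<close>; the outer \<open>mod\<close>
  sends \<open>j = 0\<close> to itself. The family being closed under conjugation is what rules out
  a non-real character with vanishing L-value.\<close>

lemma pchar_cnj:
 assumes "prime p" "j < p - 1"
 shows "cnj (pchar p j n) = pchar p ((p - 1 - j) mod (p - 1)) n"
proof (cases "p dvd n")
 case False
 have "[(p - 1 - j) mod (p - 1) * pind p n = (p - 1 - j) * pind p n] (mod (p - 1))"
  by (intro cong_scalar_right) (simp add: Cong.cong_def)
 from cis_frac_cong[OF this]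
 have "cis (2 * pi * (real ((p - 1 - j) mod (p - 1) * pind p n) / real (p - 1))) =
   cis (2 * pi * (real ((p - 1 - j) * pind p n) / real (p - 1)))" .
 also have "2 * pi * (real ((p - 1 - j) * pind p n) / real (p - 1)) = 
   2 * pi * real (pind p n) + - (2 * pi * (real (j * pind p n) / real (p - 1)))"
  using assms by (simp add: of_nat_diff field_simps)
 also have "cis ... = cis (- (2 * pi * (real (j * pind p n) / real (p - 1))))"
  by (subst cis_mult[symmetric]) simp
 finally show ?thesis using False by (simp add: pchar_def cis_cnj)
qed (simp add: pchar_def)

lemma pchar_principal: "pchar p 0 n = (if p dvd n then 0 else 1)"
 by (simp add: pchar_def)

lemma pchar_one: assumes "prime p" shows "pchar p j 1 = 1"
proof -
 have nd: "~ p dvd 1" using assms by auto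
 have "[pind p 1 = 0] (mod (p - 1))"
  using proot_pow_cong_iff[OF assms, of "pind p 1" 0] pind(2)[OF assms nd] by simp
 hence "[j * pind p 1 = j * 0] (mod (p - 1))" by (rule cong_scalar_left)
 from cis_frac_cong[OF this] show ?thesis using nd by (simp add: pchar_def)
qed

text \<open>A character to the squarefree modulus \<open>\<Prod>V\<close> is one index for each
  prime of \<open>V\<close>; the index functions range over a \<open>PiE\<close>, so that
  orthogonality reduces to single primes.\<close>

definition dchar :: "nat set => (nat => nat) => nat => complex" where
 "dchar V j n = (PROD p:V. pchar p (j p) n)"

lemma dchar_mult:
 assumes "!!p. p : V ==> prime p" shows "dchar V j (m * n) = dchar V j m * dchar V j n"
 unfolding dchar_def by (simp add: pchar_mult assms prod.distrib)

lemma dchar_one: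
 assumes "!!p. p : V ==> prime p" shows "dchar V j 1 = 1"
 unfolding dchar_def using pchar_one assms by (intro prod.neutral) auto

lemma dchar_norm:
 assumes "finite V" shows "norm (dchar V j n) = (if EX p:V. p dvd n then 0 else 1)"
 using assms unfolding dchar_def by (auto simp: prod_norm[symmetric] pchar_norm)

lemma dchar_sum_residues:
 assumes "finite V" "!!p. p : V ==> prime p" "qq : V" "0 < j qq" "j qq < qq - 1"
 shows "(SUM c<\<Prod>V. dchar V j c) = 0"
proof -
 have "(SUM c<\<Prod>V. dchar V j c) = (SUM c<\<Prod>V. PROD p:V. pchar p (j p) (c mod p))"
  by (simp add: dchar_def pchar_mod)
 also have "... = (PROD p:V. SUM c<p. pchar p (j p) c)" by (rule sum_crt_prod) (use assms in auto)
 also have "... = 0"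
  using pchar_sum_residues[of qq "j qq"] assms by (intro prod_zero) auto
 finally show ?thesis .
qed

lemma dchar_sum_chars:
 assumes "finite V" "!!p. p : V ==> prime p"
 shows "(SUM j:PiE V (%p. {..<p - 1}). dchar V j n) =
  (if ALL p:V. n mod p = 1 then of_nat (PROD p:V. p - 1) else 0)"
proof -
 have "(SUM j:PiE V (%p. {..<p - 1}). dchar V j n) = (PROD p:V. SUM j<p - 1. pchar p j n)"
  unfolding dchar_def by (subst prod_sum_PiE) (use assms in auto)
 also have "... = (PROD p:V. if n mod p = 1 then of_nat (p - 1) else 0)"
  using assms by (intro prod.cong refl pchar_sum_chars)
 also have "... = (if ALL p:V. n mod p = 1 then of_nat (PROD p:V. p - 1) else 0)"
  using assms(1) by (auto simp: of_nat_prod intro!: prod.cong prod_zero)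
 finally show ?thesis .
qed

section \<open>Logarithmic sums twisted by a character with bounded partial sums\<close>

lemma sum_split_at:
 fixes f :: "nat => 'a :: comm_monoid_add"
 assumes "m <= n" "a <= Suc m"
 shows "sum f {a..n} = sum f {a..m} + sum f {m<..n}"
proof -
 have "sum f ({a..m} Un {m<..n}) = sum f {a..m} + sum f {m<..n}"
  by (rule sum.union_disjoint) auto
 also have "{a..m} Un {m<..n} = {a..n}" using assms by auto
 finally show ?thesis .
qed

text \<open>Complete periods cancel, so an initial sum is at most one period in size, and an
  interval is the difference of two initial sums.\<close>

lemma periodic_sum_bound:
 fixes f :: "nat => complex"
 assumes per: "!!n. f (n + qq) = f n" and zero: "(SUM c<qq. f c) = 0" and qq: "qq > 0"
  and nrm: "!!n. norm (f n) <= 1"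
 shows "norm (SUM i:{m<..n}. f i) <= 2 * real qq"
proof -
 have per': "f (k * qq + r) = f r" for k r
  by (induction k) (use per in \<open>auto simp: algebra_simps\<close>, metis add.assoc add.commute)
 have full: "(SUM i<k * qq. f i) = 0" for k
 proof (induction k)
  case (Suc k)
  have "(SUM i<Suc k * qq. f i) = (SUM i<k * qq. f i) + (SUM i<qq. f (k * qq + i))"
  proof -
   have "(SUM i<Suc k * qq. f i) = (SUM i:{0..<k * qq}. f i) + (SUM i:{k * qq..<k * qq + qq}. f i)"
    using sum.atLeastLessThan_concat[of 0 "k * qq" "k * qq + qq" f]
    by (simp add: atLeast0LessThan add.commute[of qq])
   also have "(SUM i:{k * qq..<k * qq + qq}. f i) = (SUM i:{0..<qq}. f (i + k * qq))"
    using sum.shift_bounds_nat_ivl[of f 0 "k * qq" qq] by (simp add: add.commute[of qq])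
   finally show ?thesis by (simp add: atLeast0LessThan add.commute[of _ "k * qq"])
  qed
  thus ?case using Suc zero per' by simp
 qed simp
 have part: "norm (SUM i<k. f i) <= real qq" for k
 proof -
  have "(SUM i<k. f i) = (SUM i<k div qq * qq. f i) + (SUM i:{k div qq * qq..<k}. f i)"
   by (metis atLeast0LessThan div_times_less_eq_dividend sum.atLeastLessThan_concat zero_le)
  hence "norm (SUM i<k. f i) <= (SUM i:{k div qq * qq..<k}. norm (f i))"
   using full norm_sum by simp
  also have "... <= real (card {k div qq * qq..<k})"
   using sum_bounded_above[of "{k div qq * qq..<k}" "%i. norm (f i)" 1] nrm by simp
  also have "... <= real qq" using qq
   by (simp add: minus_div_mult_eq_mod order.strict_implies_order)
  finally show ?thesis .
 qed
 show ?thesis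
 proof (cases "m <= n")
  case True
  have "(SUM i<Suc n. f i) = (SUM i<Suc m. f i) + (SUM i:{m<..n}. f i)"
   using sum_split_at[OF True, of 0 f] by (simp only: lessThan_Suc_atMost atLeast0AtMost le0 simp_thms)
  hence "(SUM i:{m<..n}. f i) = (SUM i<Suc n. f i) - (SUM i<Suc m. f i)" by simp
  thus ?thesis using part[of "Suc n"] part[of "Suc m"] norm_triangle_ineq4 by (smt (verit))
 qed (use qq in auto)
qed

text \<open>Complete multiplicativity, values in the unit disc and bounded interval sums are all
  that the treatment of L(1, chi) uses; the modulus is felt only through \<open>B\<close>.\<close>

locale nonprincipal =
 fixes ch :: "nat => complex" and B :: real
 assumes chi_mult: "ch (m * n) = ch m * ch n" and chi_1: "ch 1 = 1"
  and chi_norm: "norm (ch n) <= 1"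
  and chi_sum: "norm (SUM i:{m<..n}. ch i) <= B"
begin

text \<open>Partial sums of L(1, chi). The limit \<open>L\<close> is the L-value, approached at rate
  \<open>B / (N + 1)\<close>.\<close>

definition X :: "nat => complex" where "X N = (SUM m=1..N. ch m / of_nat m)"

lemma B_nonneg: "0 <= B"
 using chi_sum[of 0 0] by simp

lemma chi_weighted_sum:
 assumes "!!i j. m < i ==> i <= j ==> g j <= g i" and "!!i. m < i ==> 0 <= g i"
 shows "norm (SUM i:{m<..n}. ch i * of_real (g i)) <= B * g (Suc m)"
 using abel_decreasing_bound[where m = m and a = ch and B = B and g = g and n = n] chi_sum assms by (simp add: scaleR_conv_of_real mult.commute)

lemma X_diff: "norm (X n - X m) <= B / (m + 1)" if "m <= n" for m n
proof -
 have "X n = X m + (SUM i:{m<..n}. ch i / of_nat i)"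
  unfolding X_def by (rule sum_split_at) (use that in auto)
 moreover have "norm (SUM i:{m<..n}. ch i * of_real (1 / real i)) <= B * (1 / real (Suc m))"
  by (rule chi_weighted_sum) (auto intro!: divide_left_mono)
 ultimately show ?thesis by simp
qed

lemma X_Cauchy: "Cauchy X"
proof (rule metric_CauchyI)
 fix e :: real assume "0 < e"
 obtain M :: nat where M: "B / e < M" using reals_Archimedean2 by blast
 have *: "norm (X n - X m) < e" if "m >= M" "m <= n" for m n
 proof -
  have "B / (m + 1) < e" using M that \<open>0 < e\<close> B_nonneg
   by (simp add: divide_less_eq) (smt (verit) mult.commute mult_less_cancel_left_pos of_nat_le_iff distrib_left)
  thus ?thesis using X_diff[OF that(2)] by simp
 qed
 show "EX M. ALL m>=M. ALL n>=M. dist (X m) (X n) < e"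
  by (intro exI[of _ M] allI impI) (metis * dist_norm dist_commute le_cases)
qed

definition L :: complex where "L = lim X"

lemma X_L: "norm (X m - L) <= B / (m + 1)"
proof -
 have "X \<longlonglongrightarrow> L" using X_Cauchy unfolding L_def by (simp add: Cauchy_convergent_iff convergent_LIMSEQ_iff)
 hence "(%n. norm (X n - X m)) \<longlonglongrightarrow> norm (L - X m)" by (intro tendsto_intros)
 hence "norm (L - X m) <= B / (m + 1)"
  by (rule tendsto_upperbound) (use X_diff[of m] in \<open>auto simp: eventually_sequentially intro!: exI[of _ m]\<close>)
 thus ?thesis by (simp add: norm_minus_commute)
qed

lemma X_L_div:
 assumes "1 <= d" "d <= N" shows "norm (X (N div d) - L) <= B * d / N"
proof -
 have "norm (X (N div d) - L) <= B / (real (N div d) + 1)" using X_L[of "N div d"] by (simp add: add.commute)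
 also have "... <= B / (N / d)"
  using real_div_bounds[of d N] assms B_nonneg by (intro divide_left_mono) auto
 finally show ?thesis by simp
qed

text \<open>\<open>ln x / x\<close> decreases only from \<open>e\<close> on, so the first two terms
  are split off and Abel summation starts at 3.\<close>

lemma chi_ln_bounded: "EX C. ALL N. norm (SUM n=1..N. ch n * of_real (ln (real n)) / of_nat n) <= C"
proof -
 let ?z1 = "SUM n=1..2. norm (ch n * of_real (ln (real n)) / of_nat n)"
 let ?z2 = "SUM n=1..2. ch n * of_real (ln (real n)) / of_nat n"
 have dec: "ln (real j) / j <= ln (real i) / i" if "3 <= i" "i <= j" for i j
 proof (rule DERIV_nonpos_imp_nonincreasing[of "real i" "real j" "%x. ln x / x"])
  fix x assume "real i <= x" "x <= real j"
  hence x: "3 <= x" using that by linarith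
  have "1 <= ln x" using x exp_le ln_ge_iff[of x 1] by (smt (verit))
  moreover have "((%x. ln x / x) has_real_derivative (1 - ln x) / x\<^sup>2) (at x)"
   using x by (auto intro!: derivative_eq_intros simp: field_simps power2_eq_square)
  ultimately show "EX y. ((%x. ln x / x) has_real_derivative y) (at x) & y <= 0"
   by (intro exI[of _ "(1 - ln x) / x\<^sup>2"]) (auto simp: divide_le_0_iff)
 qed (use that in auto)
 define C where "C = ?z1 + B * (ln 3 / 3)"
 have "norm (SUM n=1..N. ch n * of_real (ln (real n)) / of_nat n) <= C" for N
 proof (cases "N <= 2")
  case True
  have "norm (SUM n=1..N. ch n * of_real (ln (real n)) / of_nat n) <= (SUM n=1..N. norm (ch n * of_real (ln (real n)) / of_nat n))" by (rule norm_sum)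
  also have "... <= ?z1" using True by (intro sum_mono2) auto
  also have "... <= C" using B_nonneg by (simp add: C_def)
  finally show ?thesis .
 next
  case False
  have "(SUM n=1..N. ch n * of_real (ln (real n)) / of_nat n) = ?z2 + (SUM n:{2<..N}. ch n * of_real (ln (real n)) / of_nat n)"
   by (rule sum_split_at) (use False in auto)
  moreover have "norm (SUM n:{2<..N}. ch n * of_real (ln (real n)) / of_nat n) <= B * (ln 3 / 3)"
  proof -
   have "norm (SUM n:{2<..N}. ch n * of_real (ln (real n) / n)) <= B * (ln (real (Suc 2)) / real (Suc 2))"
    by (rule chi_weighted_sum) (auto intro!: dec)
   thus ?thesis by simp
  qed
  moreover have "norm ?z2 <=
    ?z1" by (rule norm_sum)
  ultimately show ?thesis unfolding C_def
   by (metis (no_types, lifting) add_mono norm_triangle_mono)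
 qed
 thus ?thesis by blast
qed

text \<open>Complete multiplicativity splits \<open>ch n / n\<close> along every divisor
  \<open>d\<close> of \<open>n\<close>; the complementary divisor then runs through a partial sum of
  the L-series of length \<open>N div d\<close>.\<close>

lemma chi_convolve:
 "(SUM n=1..N. ch n / n * of_real (\<Sum>d | d dvd n. f d)) = (SUM d=1..N. ch d * of_real (f d) / d * X (N div d))"
proof -
 have "(SUM n=1..N. ch n / n * of_real (\<Sum>d | d dvd n. f d)) =
   (SUM n=1..N. \<Sum>d | d dvd n. ch d * of_real (f d) / d * (ch (n div d) / of_nat (n div d)))"
 proof (intro sum.cong refl)
  fix n assume n: "n : {1..N}"
  have "ch n / n * of_real (f d) = ch d * of_real (f d) / d * (ch (n div d) / of_nat (n div d))" if d: "d dvd n" for d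
  proof -
   obtain m where m: "n = d * m" using d by (rule dvdE)
   with n have "d ~= 0" "m ~= 0" by auto
   with m show ?thesis by (simp add: chi_mult)
  qed
  thus "ch n / n * of_real (\<Sum>d | d dvd n. f d) =
   (\<Sum>d | d dvd n. ch d * of_real (f d) / d * (ch (n div d) / of_nat (n div d)))"
   by (simp add: sum_distrib_left)
 qed
 also have "... = (SUM d=1..N. SUM m=1..N div d. ch d * of_real (f d) / d * (ch m / of_nat m))"
  by (rule sum_divisors_swap)
 finally show ?thesis by (simp add: X_def sum_distrib_left)
qed

text \<open>Since \<open>ln\<close> is the convolution of \<open>Lam\<close> with 1, the bounded sum
  of \<open>ch n * ln n / n\<close> is \<open>L\<close> times the wanted sum plus terms
  \<open>Lam d / d\<close> against \<open>X (N div d) - L\<close>, which is at most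
  \<open>B * d / N\<close>. The factors \<open>d\<close> cancel and Chebyshev's bound leaves
  \<open>4 * B\<close>.\<close>

lemma chi_Lam_bounded:
 assumes "L ~= 0" shows "EX C. ALL N. norm (SUM n=1..N. ch n * of_real (Lam n) / n) <= C"
proof -
 obtain C where C: "!!N. norm (SUM n=1..N. ch n * of_real (ln (real n)) / of_nat n) <= C" using chi_ln_bounded by blast
 have "norm (SUM n=1..N. ch n * of_real (Lam n) / n) <= (C + 4 * B) / norm L" for N
 proof (cases "N = 0")
  case True
  have "0 <= C" using C[of 0] by simp
  thus ?thesis using True B_nonneg by simp
 next
  case False
  have "(SUM n=1..N. ch n * of_real (ln (real n)) / of_nat n) = (SUM n=1..N. ch n / n * of_real (\<Sum>d | d dvd n. Lam d))"
   by (intro sum.cong refl) (simp add: mangoldt_sum)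
  also have "... = (SUM d=1..N. ch d * of_real (Lam d) / d * X (N div d))" by (rule chi_convolve)
  also have "... = (SUM d=1..N. ch d * of_real (Lam d) / d) * L +
    (SUM d=1..N. ch d * of_real (Lam d) / d * (X (N div d) - L))"
   unfolding sum_distrib_right sum.distrib[symmetric]
   by (intro sum.cong refl) (simp add: algebra_simps diff_divide_distrib)
  finally have eq: "(SUM d=1..N. ch d * of_real (Lam d) / d) * L = (SUM n=1..N. ch n * of_real (ln (real n)) / of_nat n) - 
    (SUM d=1..N. ch d * of_real (Lam d) / d * (X (N div d) - L))" by simp
  have "norm (SUM d=1..N. ch d * of_real (Lam d) / d * (X (N div d) - L)) <=
    (SUM d=1..N. 1 * Lam d / d * (B * d / N))"
  proof (intro order.trans[OF norm_sum] sum_mono)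
   fix d assume d: "d : {1..N}"
   have "norm (ch d * of_real (Lam d) / d * (X (N div d) - L)) =
     norm (ch d) * Lam d / d * norm (X (N div d) - L)"
    by (simp add: norm_mult norm_divide)
   also have "... <= 1 * Lam d / d * (B * d / N)"
    using X_L_div[of d N] d chi_norm by (intro mult_mono divide_right_mono mult_right_mono) (auto simp: mangoldt_nonneg)
   finally show "norm (ch d * of_real (Lam d) / d * (X (N div d) - L)) <= 1 * Lam d / d * (B * d / N)" .
  qed
  also have "... = B / N * (SUM d=1..N. Lam d)"
   unfolding sum_distrib_left by (intro sum.cong) auto
  also have "... <= B / N * (4 * N)"
   using chebyshev_psi[of N] B_nonneg by (intro mult_left_mono) auto
  also have "... = 4 * B" using False by simp
  finally have "norm ((SUM d=1..N. ch d * of_real (Lam d) / d) * L) <= C + 4 * B"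
   unfolding eq using C[of N] norm_triangle_ineq4 by (smt (verit))
  thus ?thesis using assms by (simp add: norm_mult field_simps)
 qed
 thus ?thesis by blast
qed

end

section \<open>Moebius sums and the case of a vanishing L-value\<close>

definition moeb :: "nat => real" where
 "moeb n = (if squarefree n then (-1) ^ card (prime_factors n) else 0)"

lemma prime_factors_prod_primes:
 assumes "finite D" "!!p. p : D ==> prime (p::nat)"
 shows "prime_factors (\<Prod>D) = D" "squarefree (\<Prod>D)" "\<Prod>D > 0"
proof -
 show pos: "\<Prod>D > 0" using assms by (auto intro!: prod_pos simp: prime_gt_0_nat)
 show "squarefree (\<Prod>D)"
  using assms by (intro squarefree_prod_coprime) (auto simp: primes_coprime squarefree_prime)
 show "prime_factors (\<Prod>D) = D"
 proof (rule subset_antisym; rule subsetI)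
  fix p assume "p : prime_factors (\<Prod>D)"
  hence "prime p" "p dvd \<Prod>D" by auto
  then obtain qq where "qq : D" "p dvd qq" using assms(1) prime_dvd_prod_iff[of D p "%x. x"] by auto
  thus "p : D" using assms \<open>prime p\<close> primes_dvd_imp_eq by blast
 next
  fix p assume "p : D"
  hence "prime p" "p dvd \<Prod>D" using assms by (auto intro: dvd_prodI)
  thus "p : prime_factors (\<Prod>D)" using pos by (simp add: prime_factors_dvd)
 qed
qed

lemma prod_prime_factors_squarefree:
 assumes "squarefree (n::nat)" shows "\<Prod>(prime_factors n) = n"
proof -
 have n: "n ~= 0" using assms by (metis not_squarefree_0)
 have "n = (PROD p:prime_factors n. p ^ multiplicity p n)" using n by (simp add: prime_factorization_nat)
 also have "... = (PROD p:prime_factors n. p)"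
 proof (intro prod.cong refl)
  fix p assume "p : prime_factors n"
  hence "multiplicity p n = 1"
   using assms squarefree_factorial_semiring'[OF n] by auto
  thus "p ^ multiplicity p n = p" by simp
 qed
 finally show ?thesis by simp
qed

lemma moeb_sum_eq:
 assumes "n > 0"
 shows "(\<Sum>d | d dvd n. moeb d * f d) = (SUM D:Pow (prime_factors n). (-1) ^ card D * f (\<Prod>D))"
proof -
 have "(\<Sum>d | d dvd n. moeb d * f d) = (\<Sum>d | d dvd n & squarefree d. moeb d * f d)"
  using assms by (intro sum.mono_neutral_right) (auto simp: moeb_def)
 also have "... = (SUM D:Pow (prime_factors n). (-1) ^ card D * f (\<Prod>D))"
 proof (rule sum.reindex_bij_witness[of _ "%D. \<Prod>D" prime_factors])
  fix d assume d: "d : {d. d dvd n & squarefree d}"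
  thus "\<Prod>(prime_factors d) = d" by (simp add: prod_prime_factors_squarefree)
  show "prime_factors d : Pow (prime_factors n)" using d assms by (auto simp: prime_factors_dvd)
  show "(-1) ^ card (prime_factors d) * f (\<Prod>(prime_factors d)) = moeb d * f d"
   using d by (simp add: prod_prime_factors_squarefree moeb_def)
 next
  fix D assume D: "D : Pow (prime_factors n)"
  hence fin: "finite D" and pr: "!!p. p : D ==> prime p" by (auto intro: finite_subset)
  show "prime_factors (\<Prod>D) = D" using prime_factors_prod_primes[OF fin pr] by simp
  have "\<Prod>D dvd \<Prod>(prime_factors n)" using D by (intro prod_dvd_prod_subset) auto
  also have "... dvd n"
  proof -
   have "\<Prod>(prime_factors n) dvd (PROD p:prime_factors n. p ^ multiplicity p n)"
    by (intro prod_dvd_prod dvd_power) (auto simp: prime_factors_multiplicity)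
   thus ?thesis using assms by (simp add: prime_factorization_nat[symmetric])
  qed
  finally show "\<Prod>D : {d. d dvd n & squarefree d}" using prime_factors_prod_primes[OF fin pr] by simp
 qed
 finally show ?thesis .
qed

lemma sum_signs_Pow:
 assumes "finite A" shows "(SUM D:Pow A. (-1) ^ card D) = (if A = {} then 1 else (0::real))"
proof -
 have "(SUM D:Pow A. (-1) ^ card D) = (SUM D:Pow A. (PROD x:D. (-1)) * (PROD x:A - D. (1::real)))" by simp
 also have "... = (PROD x:A. (-1) + 1)" by (rule prod_add[OF assms, symmetric])
 finally show ?thesis using assms by (auto simp: prod_zero_iff card_gt_0_iff)
qed

text \<open>The constant \<open>ln N\<close> produces the indicator of 1 and \<open>- ln d\<close>
  produces \<open>Lam\<close>. Over sets of primes, fixing one \<open>p\<close> in \<open>D\<close>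
  leaves an alternating sum over subsets of the other prime factors, which vanishes unless
  \<open>p\<close> is the only one.\<close>

lemma moeb_ln_sum:
 assumes "n > 0"
 shows "(\<Sum>d | d dvd n. moeb d * (ln N - ln d)) = (if n = 1 then ln N else 0) + Lam n"
proof -
 let ?z1 = "\<Sum>d | d dvd n. moeb d * (ln N - ln d)"
 let ?A = "prime_factors n"
 have pw: "primepow n \<longleftrightarrow> card ?A = 1"
 proof
  assume "primepow n"
  then obtain p k where "prime p" "k > 0" "n = p ^ k" unfolding primepow_def by auto
  hence "?A = {p}" by (auto simp: prime_factors_dvd prime_dvd_power_iff primes_dvd_imp_eq)
  thus "card ?A = 1" by simp
 next
  assume "card ?A = 1"
  then obtain p where A: "?A = {p}" by (auto simp: card_1_singleton_iff)
  have "n = (PROD p:prime_factors n. p ^ multiplicity p n)" using assms by (simp add: prime_factorization_nat)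
  hence "n = p ^ multiplicity p n" using A by simp
  moreover have "prime p" "multiplicity p n > 0" using A by (auto simp: prime_factors_multiplicity)
  ultimately show "primepow n" unfolding primepow_def by auto
 qed
 have lnprod: "ln (rP D) = (SUM p:D. ln (real p))" if "D : Pow ?A" for D
  using that by (subst of_nat_prod, subst ln_prod) (auto intro: finite_subset prime_gt_0_nat)
 have "?z1 = 
  (SUM D:Pow ?A. (-1) ^ card D * (ln N - (SUM p:D. ln (real p))))"
  using moeb_sum_eq[OF assms, of "%d. ln N - ln d"] lnprod by simp
 also have "... = ln N * (SUM D:Pow ?A. (-1) ^ card D) - (SUM D:Pow ?A. SUM p:D. (-1) ^ card D * ln (real p))"
  by (simp add: algebra_simps sum_subtractf sum_distrib_left)
 also have "(SUM D:Pow ?A. SUM p:D. (-1) ^ card D * ln (real p)) = 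
  (SUM p:?A. SUM D:{D:Pow ?A. p : D}. (-1) ^ card D * ln (real p))"
 proof -
  have "(SUM D:Pow ?A. SUM p:D. (-1) ^ card D * ln (real p)) =
    (SUM D:Pow ?A. SUM p:{p:?A. p : D}. (-1) ^ card D * ln (real p))"
   by (intro sum.cong refl) auto
  also have "... = (SUM p:?A. SUM D:{D:Pow ?A. p : D}. (-1) ^ card D * ln (real p))"
   by (rule sum.swap_restrict) auto
  finally show ?thesis .
 qed
 also have "... = (SUM p:?A. (if ?A = {p} then - ln (real p) else 0))"
 proof (intro sum.cong refl)
  fix p assume p: "p : ?A"
  have "(SUM D:{D:Pow ?A. p : D}. (-1) ^ card D * ln (real p)) =
    (SUM D:Pow (?A - {p}). (-1) ^ card (insert p D) * ln (real p))"
   by (rule sum.reindex_bij_witness[of _ "insert p" "%D. D - {p}"])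
    (use p in \<open>auto simp: insert_absorb\<close>)
  also have "... = (SUM D:Pow (?A - {p}). - ln (real p) * (-1) ^ card D)"
  proof (intro sum.cong refl)
   fix D assume D: "D : Pow (?A - {p})"
   hence "finite D" by (auto intro: finite_subset[of D ?A])
   with D have "card (insert p D) = Suc (card D)" by (subst card_insert_disjoint) auto
   thus "(-1) ^ card (insert p D) * ln (real p) = - ln (real p) * (-1) ^ card D" by simp
  qed
  also have "... = - ln (real p) * (if ?A - {p} = {} then 1 else 0)"
   by (simp only: sum_distrib_left[symmetric]) (subst sum_signs_Pow, auto)
  also have "?A - {p} = {} \<longleftrightarrow> ?A = {p}" using p by auto
  finally show "(SUM D:{D:Pow ?A. p : D}. (-1) ^ card D * ln (real p)) = (if ?A = {p} then - ln (real p) else 0)"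
   by simp
 qed
 also have "... = - Lam n"
 proof (cases "card ?A = 1")
  case True
  then obtain p where A: "?A = {p}" by (auto simp: card_1_singleton_iff)
  have "primepow n" using pw True by simp
  hence "Lam n = ln (real (aprimedivisor n))" by (simp add: mangoldt_def)
  moreover have "aprimedivisor n : ?A"
   using assms aprimedivisor_dvd'[of n] prime_aprimedivisor'[of n] primepow_gt_Suc_0[OF \<open>primepow n\<close>]
   by (auto simp: prime_factors_dvd)
  ultimately show ?thesis using A by simp
 next
  case False
  hence "~ primepow n" "!!p. ?A ~= {p}" using pw by auto
  thus ?thesis by (simp add: mangoldt_def)
 qed
 finally have "?z1 = ln N * (SUM D:Pow ?A. (-1) ^ card D) + Lam n" by simp
 also have "(SUM D:Pow ?A. (-1) ^ card D) = (if n = 1 then 1 else (0::real))"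
 proof -
  have "?A = {} \<longleftrightarrow> n = 1" using assms by (auto simp: prime_factorization_empty_iff)
  thus ?thesis by (subst sum_signs_Pow) auto
 qed
 finally show ?thesis by simp
qed

lemma ex_nat_ln_gt: "EX N::nat. N >= 1 & ln (real N) > C"
proof -
 obtain N :: nat where N: "exp C < N" using reals_Archimedean2 by blast
 moreover have "0 < real N" using N by (smt (verit) exp_gt_zero)
 ultimately show ?thesis using ln_less_cancel_iff[of "exp C" "real N"] by (intro exI[of _ N]) auto
qed

context nonprincipal
begin

lemma X_tendsto: "X \<longlonglongrightarrow> L"
 using X_Cauchy unfolding L_def by (simp add: Cauchy_convergent_iff convergent_LIMSEQ_iff)

text \<open>With \<open>L = 0\<close> the partial sums \<open>X (N div d)\<close> are themselves at
  most \<open>B * d / N\<close>; convolving with \<open>moeb d * ln (N / d)\<close> and using that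
  \<open>ln (N / d)\<close> sums to at most \<open>N\<close> gives the bound. The drift
  \<open>- ln N\<close> is what makes two such characters contradictory.\<close>

lemma chi_Lam_zero:
 assumes "L = 0" "1 <= N"
 shows "norm ((SUM n=1..N. ch n * of_real (Lam n) / n) + of_real (ln (real N))) <= B"
proof -
 let ?z1 = "SUM n=1..N. ch n * of_real (Lam n) / n"
 define f where "f d = moeb d * (ln N - ln d)" for d
 have "?z1 + of_real (ln (real N)) =
   (SUM n=1..N. ch n / n * of_real ((if n = 1 then ln (real N) else 0) + Lam n))"
 proof -
  have "(SUM n=1..N. ch n / n * of_real (if n = 1 then ln (real N) else 0)) = 
    (SUM n:{1}. ch n / n * of_real (if n = 1 then ln (real N) else 0))"
   using assms(2) by (intro sum.mono_neutral_right) auto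
  thus ?thesis using chi_1 by (simp add: distrib_left sum.distrib)
 qed
 also have "... = (SUM n=1..N. ch n / n * of_real (\<Sum>d | d dvd n. f d))"
 proof (intro sum.cong refl)
  fix n assume "n : {1..N}"
  hence "n > 0" by simp
  from moeb_ln_sum[OF this, of "real N"]
  show "ch n / n * of_real ((if n = 1 then ln (real N) else 0) + Lam n) = ch n / n * of_real (\<Sum>d | d dvd n. f d)"
   unfolding f_def by simp
 qed
 also have "... = (SUM d=1..N. ch d * of_real (f d) / d * X (N div d))" by (rule chi_convolve)
 finally have eq: "?z1 + of_real (ln (real N)) = ..." .
 have "norm (SUM d=1..N. ch d * of_real (f d) / d * X (N div d)) <=
   (SUM d=1..N. 1 * (ln N - ln d) / d * (B * d / N))"
 proof (intro order.trans[OF norm_sum] sum_mono)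
  fix d assume d: "d : {1..N}"
  have "\<bar>moeb d\<bar> <= 1" by (simp add: moeb_def power_abs)
  moreover have "0 <= ln N - ln d" using d by simp
  ultimately have f: "\<bar>f d\<bar> <= ln N - ln d" unfolding f_def abs_mult by (simp add: mult_left_le_one_le)
  have "norm (ch d * of_real (f d) / d * X (N div d)) = norm (ch d) * \<bar>f d\<bar> / d * norm (X (N div d) - L)"
   by (simp add: norm_mult norm_divide assms)
  also have "... <= 1 * (ln N - ln d) / d * (B * d / N)"
   using X_L_div[of d N] d chi_norm f by (intro mult_mono divide_right_mono) auto
  finally show "norm (ch d * of_real (f d) / d * X (N div d)) <= 1 * (ln N - ln d) / d * (B * d / N)" .
 qed
 also have "... = B / N * (SUM d=1..N. ln N - ln d)"
  unfolding sum_distrib_left by (intro sum.cong) auto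
 also have "(SUM d=1..N. ln N - ln d) = N * ln N - ln (fact N)"
  unfolding fact_prod of_nat_prod by (subst ln_prod) (auto simp: sum_subtractf)
 also have "B / N * ... <= B / N * N"
  using ln_fact_bounds(2)[OF assms(2)] B_nonneg by (intro mult_left_mono) auto
 finally show ?thesis using assms eq by simp
qed

end

section \<open>Nonvanishing of the L-value for real characters\<close>

lemma sqrt_sum_asymp: "EX c0. ALL t>=1. \<bar>(SUM m=1..t. 1 / sqrt (real m)) - 2 * sqrt (real t) - c0\<bar> <= 1 / sqrt (real t)"
proof -
 define h where "h t = (SUM m=1..t. 1 / sqrt (real m)) - 2 * sqrt (real t)" for t
 \<comment> \<open>\<open>h\<close> decreases, \<open>f\<close> increases and their difference tends
   to 0; the common limit \<open>c0\<close> lies between them, which gives the explicit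
   error.\<close>
 define f where "f t = h t - 1 / sqrt (real t)" for t
 have key: "1 / sqrt (real (Suc t)) <= 2 * (sqrt (real (Suc t)) - sqrt (real t))"
  "2 * (sqrt (real (Suc t)) - sqrt (real t)) <= 1 / sqrt (real t)" if "t >= 1" for t
 proof -
  define a b where "a = sqrt (real t)" and "b = sqrt (real (Suc t))"
  have ab: "0 < a" "a <= b" "b\<^sup>2 = a\<^sup>2 + 1" using that unfolding a_def b_def by auto
  hence d: "(b - a) * (b + a) = 1" by (simp add: power2_eq_square algebra_simps)
  hence e: "b - a = 1 / (b + a)" using ab by (simp add: field_simps)
  have "1 / b = 2 * (1 / (2 * b))" using ab by simp
  also have "... <= 2 * (1 / (b + a))" using ab by (intro mult_left_mono divide_left_mono) auto
  finally show "1 / sqrt (real (Suc t)) <= 2 * (sqrt (real (Suc t)) - sqrt (real t))"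
   using e unfolding a_def b_def by simp
  have "2 * (1 / (b + a)) <= 2 * (1 / (2 * a))" using ab by (intro mult_left_mono divide_left_mono) auto
  also have "... = 1 / a" by simp
  finally show "2 * (sqrt (real (Suc t)) - sqrt (real t)) <= 1 / sqrt (real t)"
   using e unfolding a_def b_def by simp
 qed
 have hdec: "h (Suc t) <= h t" and finc: "f t <= f (Suc t)" if "t >= 1" for t
  using key[OF that] unfolding f_def h_def by (simp_all add: algebra_simps)
 have fle: "f t <= h t" for t unfolding f_def by simp
 have fmono: "f s <= f t" if "1 <= s" "s <= t" for s t
  using that(2,1) by (induction rule: dec_induct) (auto intro: order.trans[OF _ finc])
 have hmono: "h t <= h s" if "1 <= s" "s <= t" for s t
  using that(2,1) by (induction rule: dec_induct) (auto intro: order.trans[OF hdec])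
 have bdd: "f 1 <= h (Suc t)" for t using fmono[of 1 "Suc t"] fle[of "Suc t"] by linarith
 have "decseq (%t. h (Suc t))" by (intro decseq_SucI hdec) auto
 then obtain c0 where c0: "(%t. h (Suc t)) \<longlonglongrightarrow> c0"
  using decseq_convergent[of "%t. h (Suc t)" "f 1"] bdd by blast
 have "f t <= c0" "c0 <= h t" if "t >= 1" for t
 proof -
  have "f t <= h (Suc n)" if "n >= t" for n
   using fmono[of t "Suc n"] fle[of "Suc n"] that \<open>t >= 1\<close> by linarith
  thus "f t <= c0"
   by (intro tendsto_lowerbound[OF c0]) (auto simp: eventually_sequentially)
  show "c0 <= h t"
   by (rule tendsto_upperbound[OF c0]) (use hmono[OF that] in \<open>auto simp: eventually_sequentially intro!: exI[of _ t]\<close>)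
 qed
 thus ?thesis unfolding f_def h_def
  by (intro exI[of _ c0]) (auto simp: abs_le_iff algebra_simps)
qed

lemma sqrt_sum_le: "(SUM m=1..t. 1 / sqrt (real m)) <= 2 * sqrt (real t)"
proof (induction t)
 case (Suc t)
 define a b where "a = sqrt (real t)" and "b = sqrt (real (Suc t))"
 have ab: "0 <= a" "a <= b" "0 < b" "b\<^sup>2 = a\<^sup>2 + 1" unfolding a_def b_def by auto
 hence "(b - a) * (b + a) = 1" by (simp add: power2_eq_square algebra_simps)
 hence e: "b - a = 1 / (b + a)" using ab by (simp add: field_simps)
 have "1 / b = 2 * (1 / (2 * b))" using ab by simp
 also have "... <= 2 * (1 / (b + a))" using ab by (intro mult_left_mono divide_left_mono) auto
 finally have "1 / b <= 2 * b - 2 * a" using e by simp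
 thus ?case using Suc unfolding a_def b_def by simp
qed simp

lemma sum_divisors_prime_power_mult:
 fixes s :: "nat => real"
 assumes p: "prime p" and m: "~ p dvd m" "m > 0" and mult: "!!a b. s (a * b) = s a * s b" and s1: "s 1 = 1"
 shows "(\<Sum>d | d dvd p ^ k * m. s d) = (SUM i<=k. s p ^ i) * (\<Sum>d | d dvd m. s d)"
proof -
 let ?z1 = "{..k} \<times> {d. d dvd m}"
 have spow: "s (p ^ i) = s p ^ i" for i by (induction i) (simp_all add: mult s1[simplified])
 have pnz: "p ~= 0" using p by auto
 have mu: "multiplicity p (p ^ i * d) = i" if "d dvd m" for i d
 proof -
  have "~ p dvd d" using that m dvd_trans by blast
  moreover have "d ~= 0" using that m by auto
  ultimately show ?thesis using p pnz
   by (subst prime_elem_multiplicity_mult_distrib) (auto simp: not_dvd_imp_multiplicity_0 multiplicity_same_power)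
 qed
 have inj: "inj_on (%(i, d). p ^ i * d) ?z1"
 proof (rule inj_onI, clarify)
  fix i d i' d' assume "d dvd m" "d' dvd m" "p ^ i * d = p ^ i' * d'"
  thus "i = i' & d = d'" using mu[of d i] mu[of d' i'] pnz by auto
 qed
 have img: "(%(i, d). p ^ i * d) ` ?z1 = {d. d dvd p ^ k * m}"
 proof (rule subset_antisym; rule subsetI)
  fix x assume "x : {d. d dvd p ^ k * m}"
  then obtain b c where bc: "x = b * c" "b dvd p ^ k" "c dvd m" using division_decomp by blast
  then obtain i where "i <= k" "b = p ^ i" using divides_primepow_nat[OF p] by blast
  thus "x : (%(i, d). p ^ i * d) ` ?z1" using bc by force
 qed (auto intro: mult_dvd_mono le_imp_power_dvd)
 have "(\<Sum>d | d dvd p ^ k * m. s d) = (SUM z:{..k} \<times> {d. d dvd m}. s (p ^ fst z * snd z))"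
  unfolding img[symmetric] by (subst sum.reindex[OF inj]) (simp add: case_prod_beta)
 also have "... = (SUM i<=k. \<Sum>d | d dvd m. s p ^ i * s d)"
  unfolding sum.cartesian_product by (intro sum.cong) (auto simp: mult spow)
 finally show ?thesis by (simp add: sum_product)
qed

lemma geometric_sign_sum:
 fixes x :: real
 assumes "x : {0, 1, -1}"
 shows "(SUM i<=k. x ^ i) >= 0" "even k ==> (SUM i<=k. x ^ i) >= 1"
proof -
 have 0: "(SUM i<=k. (0::real) ^ i) = 1" by (induction k) auto
 have 1: "(SUM i<=k. (-1::real) ^ i) = (if even k then 1 else 0)" by (induction k) auto
 show "(SUM i<=k. x ^ i) >= 0" "even k ==> (SUM i<=k. x ^ i) >= 1" using assms 0 1 by auto
qed

text \<open>The divisor sum is multiplicative with local factors \<open>1 + x + ... + x ^ k\<close>,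
  where \<open>x\<close> is 0, 1 or -1. Such a factor is never negative and is at least 1 when
  \<open>k\<close> is even.\<close>

lemma sum_divisors_real_char:
 fixes s :: "nat => real"
 assumes mult: "!!a b. s (a * b) = s a * s b" and s1: "s 1 = 1" and vals: "!!n. s n : {0, 1, -1}"
 shows "n > 0 ==> (\<Sum>d | d dvd n. s d) >= 0" "a > 0 ==> (\<Sum>d | d dvd a\<^sup>2. s d) >= 1"
proof -
 have split: "EX p k m. prime p & ~ p dvd m & m > 0 & m < n & n = p ^ k * m" if n1: "n > 1" for n :: nat
 proof -
  obtain p where p: "prime p" "p dvd n" using \<open>n > 1\<close> prime_factor_nat by (metis less_numeral_extra(4))
  obtain m where m: "n = p ^ multiplicity p n * m" "~ p dvd m"
   using multiplicity_decompose'[of n p] n1 p by (metis not_prime_unit not_less_zero)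
  have "multiplicity p n > 0" using p n1 by (simp add: prime_multiplicity_gt_zero_iff)
  hence "1 < p ^ multiplicity p n" using prime_gt_1_nat[OF p(1)] one_less_power by blast
  moreover have "m > 0" using m(1) n1 by (intro Nat.gr0I) auto
  ultimately have "m < n" by (subst m(1)) simp
  thus ?thesis using p m \<open>m > 0\<close> by blast
 qed
 show "n > 0 ==> (\<Sum>d | d dvd n. s d) >= 0"
 proof (induction n rule: less_induct)
  case (less n)
  show ?case
  proof (cases "n = 1")
   case True
   thus ?thesis using s1 by simp
  next
   case False
   then obtain p k m where "prime p" "~ p dvd m" "m > 0" "m < n" "n = p ^ k * m"
    using split[of n] less.prems by force
   thus ?thesis using less.IH[of m] geometric_sign_sum(1)[OF vals]
    by (simp add: sum_divisors_prime_power_mult[of p m s k] mult s1[simplified])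
  qed
 qed
 show "a > 0 ==> (\<Sum>d | d dvd a\<^sup>2. s d) >= 1"
 proof (induction a rule: less_induct)
  case (less n)
  show ?case
  proof (cases "n = 1")
   case True
   thus ?thesis using s1 by simp
  next
   case False
   then obtain p k m where pk: "prime p" "~ p dvd m" "m > 0" "m < n" "n = p ^ k * m"
    using split[of n] less.prems by force
   hence n2: "n\<^sup>2 = p ^ (2 * k) * m\<^sup>2" by (simp add: power_mult_distrib power_mult[symmetric] mult.commute)
   have "~ p dvd m\<^sup>2" using pk prime_dvd_power by blast
   hence "(\<Sum>d | d dvd n\<^sup>2. s d) = (SUM i<=2 * k. s p ^ i) * (\<Sum>d | d dvd m\<^sup>2. s d)"
    unfolding n2 using pk by (intro sum_divisors_prime_power_mult mult s1) auto
   also have "... >= 1 * 1"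
    using less.IH[of m] pk geometric_sign_sum(2)[OF vals, of "2 * k"]
    by (intro mult_mono) (auto intro: order.trans[OF zero_le_one])
   finally show ?thesis by simp
  qed
 qed
qed

context nonprincipal
begin

text \<open>Dirichlet's hyperbola method for the convolution of 1 and \<open>ch\<close> with weight
  \<open>1 / sqrt n\<close>, split at \<open>d = M\<close>. The main term is
  \<open>2 * M * X M\<close>; it stays bounded because \<open>X M\<close> tends to
  \<open>L = 0\<close> at rate \<open>1 / M\<close>.\<close>

lemma chi_sqrt_hyperbola:
 assumes "L = 0"
 shows "EX C. ALL M>=1. norm (SUM n=1..M\<^sup>2. \<Sum>d | d dvd n. ch d * of_real (1 / sqrt (real n))) <= C"
proof -
 obtain c0 where c0: "!!t. t >= 1 ==> \<bar>(SUM m=1..t. 1 / sqrt (real m)) - 2 * sqrt (real t) - c0\<bar> <= 1 / sqrt (real t)"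
  using sqrt_sum_asymp by blast
 let ?s = "%m. of_real (1 / sqrt (real m)) :: complex" and ?a = "%d. ch d * of_real (1 / sqrt (real d))"
 define h where "h t = (SUM m=1..t. 1 / sqrt (real m))" for t
 have "norm (SUM n=1..M\<^sup>2. \<Sum>d | d dvd n. ch d * ?s n) <= 2 * B + (2 * B + \<bar>c0\<bar> * B + 6)"
  if M: "M >= 1" for M :: nat
 proof -
  let ?N = "M\<^sup>2"
  have MN: "M <= ?N" using M by (simp add: power2_eq_square)
  have "(SUM n=1..?N. \<Sum>d | d dvd n. ch d * ?s n) =
    (SUM n=1..?N. \<Sum>d | d dvd n. ?a d * of_real (1 / sqrt (real (n div d))))"
  proof (intro sum.cong refl)
   fix n d assume "n : {1..?N}" "d : {d. d dvd n}"
   hence "real n = real d * real (n div d)" by (auto simp flip: of_nat_mult)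
   hence "sqrt (real n) = sqrt (real d) * sqrt (real (n div d))" by (simp add: real_sqrt_mult)
   thus "ch d * ?s n = ?a d * of_real (1 / sqrt (real (n div d)))"
    by simp
  qed
  also have "... = (SUM d=1..?N. SUM m=1..?N div d. ?a d * ?s m)"
   by (rule sum_divisors_swap)
  also have "... = (SUM d=1..M. SUM m=1..?N div d. ?a d * ?s m) +
   (SUM d:{M<..?N}. SUM m=1..?N div d. ?a d * ?s m)"
   (is "_ = ?P1 + ?P2") by (rule sum_split_at) (use MN in auto)
  finally have split: "(SUM n=1..?N. \<Sum>d | d dvd n. ch d * ?s n) = ?P1 + ?P2" .
  have wt: "norm (SUM d:{m<..n}. ?a d) <= B / sqrt (real (Suc m))" for m n
   using chi_weighted_sum[of m "%d. 1 / sqrt (real d)" n] by (auto simp: divide_left_mono)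
  \<comment> \<open>For \<open>d > M\<close> the cofactor \<open>m\<close> is at most
    \<open>M\<close>; exchanging the order lets the character be summed over the long variable
    \<open>d\<close>.\<close>
  have "?P2 = (SUM d:{M<..?N}. SUM m:{m:{1..M}. d * m <= ?N}. ?a d * ?s m)"
  proof (intro sum.cong refl)
   fix d assume d: "d : {M<..?N}"
   have "m <= ?N div d \<longleftrightarrow> d * m <= ?N" for m using d by (subst less_eq_div_iff_mult_less_eq) (auto simp: mult.commute)
   moreover have "m <= M" if "d * m <= ?N" for m
   proof (rule ccontr)
    assume "~ m <= M"
    hence "M * M < d * m" using d by (intro mult_strict_mono) auto
    thus False using that by (simp add: power2_eq_square)
   qed
   ultimately show "{1..?N div d} = {m:{1..M}. d * m <= ?N}" by auto
  qed
  also have "... = (SUM m=1..M. SUM d:{d:{M<..?N}. d * m <= ?N}. ?a d * ?s m)"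
   by (rule sum.swap_restrict) auto
  also have "... = (SUM m=1..M. (SUM d:{M<..?N div m}. ?a d) * ?s m)"
  proof (intro sum.cong refl)
   fix m assume m: "m : {1..M}"
   have "d <= ?N div m \<longleftrightarrow> d * m <= ?N" for d using m by (subst less_eq_div_iff_mult_less_eq) auto
   moreover have "d <= ?N" if "d * m <= ?N" for d using that m
    by (metis One_nat_def atLeastAtMost_iff le_trans mult.commute mult_le_mono1 nat_mult_1)
   ultimately have "{d:{M<..?N}. d * m <= ?N} = {M<..?N div m}" by auto
   thus "(SUM d:{d:{M<..?N}. d * m <= ?N}. ?a d * ?s m) =
    (SUM d:{M<..?N div m}. ?a d) * ?s m"
    by (simp add: sum_distrib_right sum_divide_distrib)
  qed
  finally have P2eq: "?P2 = ..." .
  have "norm ?P2 <= (SUM m=1..M. B / sqrt (real M) * (1 / sqrt (real m)))"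
   unfolding P2eq
  proof (intro order.trans[OF norm_sum] sum_mono)
   fix m assume "m : {1..M}"
   have "norm ((SUM d:{M<..?N div m}. ?a d) * ?s m) <=
     B / sqrt (real (Suc M)) * (1 / sqrt (real m))"
    unfolding norm_mult using wt[of M "?N div m"] by (intro mult_mono) (auto simp: B_nonneg norm_divide)
   also have "... <= B / sqrt (real M) * (1 / sqrt (real m))"
    using M B_nonneg by (intro mult_right_mono divide_left_mono) auto
   finally show "norm ((SUM d:{M<..?N div m}. ?a d) * ?s m) <=
     B / sqrt (real M) * (1 / sqrt (real m))" .
  qed
  also have "... <= B / sqrt (real M) * (2 * sqrt (real M))"
   unfolding sum_distrib_left[symmetric] using sqrt_sum_le[of M] B_nonneg by (intro mult_left_mono) auto
  also have "... = 2 * B" using M by simp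
  finally have P2: "norm ?P2 <= 2 * B" .
  \<comment> \<open>The error of the asymptotic formula for \<open>h\<close> at
    \<open>N div d\<close>, with \<open>sqrt (N div d)\<close> already replaced by the exact
    \<open>M / sqrt d\<close>.\<close>
  define E where "E d = h (?N div d) - 2 * (M / sqrt (real d)) - c0" for d
  have E: "\<bar>E d\<bar> <= 6 * sqrt (real d) / M" if d: "1 <= d" "d <= M" for d
  proof -
   define t x where "t = ?N div d" and "x = real ?N / real d"
   have t1: "t >= 1" using d MN unfolding t_def by (simp add: Suc_le_eq div_greater_zero_iff)
   have tx: "real t <= x" "x < real t + 1" using real_div_bounds[of d ?N] d unfolding t_def x_def by auto
   have sx: "sqrt x = M / sqrt (real d)" unfolding x_def by (simp add: real_sqrt_divide)
   define a b where "a = sqrt (real t)" and "b = sqrt x"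
   have ab: "0 < a" "a <= b" "b\<^sup>2 < a\<^sup>2 + 1" "1 <= a"
    using t1 tx unfolding a_def b_def by auto
   have "(b - a) * (b + a) < 1" using ab by (simp add: power2_eq_square algebra_simps)
   moreover have "(b - a) * a <= (b - a) * (b + a)" using ab by (intro mult_left_mono) auto
   ultimately have "(b - a) * a < 1" by linarith
   hence ba: "b - a <= 1 / a" using ab by (simp add: pos_le_divide_eq)
   have "b\<^sup>2 <= (2 * a)\<^sup>2"
   proof -
    have "1 <= a\<^sup>2" using ab by simp
    hence "b\<^sup>2 <= 4 * a\<^sup>2" using ab(3) by linarith
    thus ?thesis by (simp add: power_mult_distrib)
   qed
   hence b2: "b <= 2 * a" using ab by (intro power2_le_imp_le[of b "2 * a"]) auto
   hence a2: "1 / a <= 2 / b" using ab by (simp add: field_simps)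
   have "\<bar>h t - 2 * a - c0\<bar> <= 1 / a" using c0[OF t1] unfolding a_def h_def .
   hence "\<bar>E d\<bar> <= 3 * (1 / a)" using ba ab unfolding E_def t_def[symmetric] sx[symmetric] b_def[symmetric] by linarith
   also have "... <= 3 * (2 / b)" using a2 by simp
   also have "... = 6 * sqrt (real d) / M" unfolding b_def sx by simp
   finally show ?thesis .
  qed
  have "?P1 = (SUM d=1..M. ?a d * of_real (h (?N div d)))"
   by (simp add: h_def sum_distrib_left)
  also have "... = (SUM d=1..M. 2 * M * (ch d / of_nat d) + of_real c0 * (?a d) +
    ch d * of_real (E d / sqrt (real d)))"
  proof (intro sum.cong refl)
   fix d assume d: "d : {1..M}"
   have "(of_real (sqrt (real d)))\<^sup>2 = (of_nat d :: complex)"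
    by (metis of_nat_0_le_iff of_real_of_nat_eq of_real_power real_sqrt_pow2)
   hence sq: "(of_nat d :: complex) = of_real (sqrt (real d)) * of_real (sqrt (real d))" by (simp add: power2_eq_square)
   have nz: "(of_real (sqrt (real d)) :: complex) ~= 0" using d by simp
   have "h (?N div d) = E d + 2 * (M / sqrt (real d)) + c0" by (simp add: E_def)
   hence "?a d * of_real (h (?N div d)) = 
    ?a d * (of_real (E d) + 2 * (of_nat M / of_real (sqrt (real d))) + of_real c0)"
    by simp
   also have "... = 2 * M * (ch d / of_nat d) + of_real c0 * (?a d) +
    ch d * of_real (E d / sqrt (real d))"
    unfolding sq using nz by (simp add: field_simps)
   finally show "?a d * of_real (h (?N div d)) = 2 * M * (ch d / of_nat d) +
    of_real c0 * (?a d) + ch d * of_real (E d / sqrt (real d))" .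
  qed
  also have "... = 2 * M * X M + of_real c0 * (SUM d:{0<..M}. ?a d) +
    (SUM d=1..M. ch d * of_real (E d / sqrt (real d)))"
  proof -
   have "{0<..M} = {1..M}" by auto
   thus ?thesis by (simp add: sum.distrib sum_distrib_left X_def)
  qed
  finally have P1eq: "?P1 = ..." .
  have a1: "norm (2 * M * X M) <= 2 * B"
  proof -
   have "norm (X M) <= B / (M + 1)" using X_L[of M] assms by simp
   hence "2 * real M * norm (X M) <= 2 * real M * (B / (M + 1))" by (intro mult_left_mono) auto
   also have "... <= 2 * B" using B_nonneg by (simp add: field_simps)
   finally show ?thesis by (simp add: norm_mult)
  qed
  have a2: "norm (of_real c0 * (SUM d:{0<..M}. ?a d)) <= \<bar>c0\<bar> * B"
   using wt[of 0 M] by (simp add: norm_mult mult_left_mono)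
  have a3: "norm (SUM d=1..M. ch d * of_real (E d / sqrt (real d))) <= 6"
  proof -
   have "norm (SUM d=1..M. ch d * of_real (E d / sqrt (real d))) <= (SUM d=1..M. 6 / M)"
   proof (intro order.trans[OF norm_sum] sum_mono)
    fix d assume d: "d : {1..M}"
    have "norm (ch d * of_real (E d / sqrt (real d))) <= 1 * (\<bar>E d\<bar> / sqrt (real d))"
     unfolding norm_mult using chi_norm by (intro mult_mono) (auto simp: norm_divide)
    also have "... <= 1 * ((6 * sqrt (real d) / M) / sqrt (real d))"
     using E[of d] d by (intro mult_left_mono divide_right_mono) auto
    also have "... = 6 / M" using d by simp
    finally show "norm (ch d * of_real (E d / sqrt (real d))) <= 6 / M" .
   qed
   thus ?thesis using M by simp
  qed
  have "norm ?P1 <= 2 * B + \<bar>c0\<bar> * B + 6"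
   unfolding P1eq by (intro norm_triangle_le add_mono a1 a2 a3)
  thus ?thesis unfolding split using P2 by (intro norm_triangle_le) simp
 qed
 thus ?thesis by blast
qed

text \<open>The sum bounded by the hyperbola method has nonnegative terms, and those at squares
  \<open>m ^ 2\<close> are at least \<open>1 / m\<close>; so it dominates the harmonic sum, which is
  unbounded.\<close>

lemma L_nonzero_real:
 assumes "!!n. ch n : {0, 1, -1}"
 shows "L ~= 0"
proof
 assume "L = 0"
 then obtain C where C: "!!M. M >= 1 ==> norm (SUM n=1..M\<^sup>2. \<Sum>d | d dvd n. ch d * of_real (1 / sqrt (real n))) <= C"
  using chi_sqrt_hyperbola by blast
 define s where "s n = Re (ch n)" for n
 have chs: "ch n = of_real (s n)" for n using assms[of n] by (auto simp: s_def)
 have s_mult: "s (a * b) = s a * s b" for a b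
  using chi_mult[of a b] unfolding chs by (metis of_real_eq_iff of_real_mult)
 have s1: "s 1 = 1" using chi_1 by (simp add: s_def)
 have sv: "s n : {0, 1, -1}" for n using assms[of n] by (auto simp: s_def)
 note r = sum_divisors_real_char[of s, OF s_mult s1 sv]
 have "ln (real M) <= C" if M: "M >= 1" for M :: nat
 proof -
  have "ln (real M) <= harm M" using ln_le_harm[of M] M by (smt (verit) ln_mono of_nat_0_less_iff less_le_trans zero_less_one_class.zero_less_one Suc_le_eq One_nat_def)
  also have "harm M = (SUM m=1..M. 1 / real m)" by (simp add: harm_def inverse_eq_divide)
  also have "... <= (SUM m=1..M. (\<Sum>d | d dvd m\<^sup>2. s d) / sqrt (real (m\<^sup>2)))"
   using r(2) by (intro sum_mono) (auto simp: intro!: divide_right_mono)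
  also have "... = (SUM n:(%m. m\<^sup>2) ` {1..M}. (\<Sum>d | d dvd n. s d) / sqrt (real n))"
   by (subst sum.reindex) (auto simp: inj_on_def)
  also have "... <= (SUM n=1..M\<^sup>2. (\<Sum>d | d dvd n. s d) / sqrt (real n))"
   using r(1) by (intro sum_mono2) (auto intro!: divide_nonneg_nonneg power_mono)
  also have "... = Re (SUM n=1..M\<^sup>2. \<Sum>d | d dvd n. ch d * of_real (1 / sqrt (real n)))"
   by (simp add: chs sum_divide_distrib)
  also have "... <= C" using C[OF M] complex_Re_le_cmod order.trans by blast
  finally show ?thesis .
 qed
 thus False using ex_nat_ln_gt[of C] by (meson not_less)
qed

end

section \<open>Nonvanishing for all characters, and primes in residue classes\<close>

lemma dchar_mod_eq:
 assumes "!!p. p : V ==> m mod p = n mod p"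
 shows "dchar V j m = dchar V j n"
 unfolding dchar_def using assms pchar_mod by (intro prod.cong refl) metis

lemma nonprincipal_dchar:
 assumes V: "finite V" "!!p. p : V ==> prime p" and qq: "qq : V" "0 < j qq" "j qq < qq - 1"
 shows "nonprincipal (dchar V j) (2 * rP V)"
proof
 show "dchar V j (m * n) = dchar V j m * dchar V j n" for m n using V by (simp add: dchar_mult)
 show "dchar V j 1 = 1" using V by (simp add: dchar_one[simplified])
 show nrm: "norm (dchar V j n) <= 1" for n using V by (simp add: dchar_norm)
 have pos: "\<Prod>V > 0" using V by (auto intro!: prod_pos simp: prime_gt_0_nat)
 show "norm (SUM i:{m<..n}. dchar V j i) <= 2 * rP V" for m n
 proof (rule periodic_sum_bound[OF _ _ pos nrm])
  show "dchar V j (n + \<Prod>V) = dchar V j n" for n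
  proof (rule dchar_mod_eq)
   fix p assume "p : V"
   then obtain t where "\<Prod>V = p * t" using dvd_prodI[OF V(1), of p "%x. x"] by (auto elim: dvdE)
   thus "(n + \<Prod>V) mod p = n mod p" by simp
  qed
  show "(SUM c<\<Prod>V. dchar V j c) = 0" by (rule dchar_sum_residues) (use V qq in auto)
 qed
qed

lemma sum_Lam_noncoprime_bounded:
 assumes V: "finite V" "!!p. p : V ==> prime (p::nat)"
 shows "EX C. ALL N. (SUM n:{n:{1..N}. EX p:V. p dvd n}. Lam n / n) <= C"
proof -
 obtain C where C: "!!A N. (SUM d:{d:{1..N}. d : A & ~ prime d}. Lam d / d) <= C"
  using Lam_nonprime_bounded by blast
 have "(SUM n:{n:{1..N}. EX p:V. p dvd n}. Lam n / n) <= (SUM p:V. Lam p / p) + C" for N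
 proof -
  let ?A = "{n. EX p:V. p dvd n}"
  have "{n:{1..N}. EX p:V. p dvd n} = {n:{1..N}. n : ?A & prime n} Un {n:{1..N}. n : ?A & ~ prime n}" by auto
  hence "(SUM n:{n:{1..N}. EX p:V. p dvd n}. Lam n / n) = 
    (SUM n:{n:{1..N}. n : ?A & prime n} Un {n:{1..N}. n : ?A & ~ prime n}. Lam n / n)" by metis
  also have "... = (SUM n:{n:{1..N}. n : ?A & prime n}. Lam n / n) + (SUM n:{n:{1..N}. n : ?A & ~ prime n}. Lam n / n)"
   by (rule sum.union_disjoint) auto
  also have "(SUM n:{n:{1..N}. n : ?A & prime n}. Lam n / n) <= (SUM p:V. Lam p / p)"
   using V primes_dvd_imp_eq
   by (intro sum_mono2) (auto intro!: divide_nonneg_nonneg simp: mangoldt_nonneg simp del: mangoldt_prime)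
  finally show ?thesis using C[of N ?A] by simp
 qed
 thus ?thesis by blast
qed

lemma principal_Lam:
 assumes V: "finite V" "!!p. p : V ==> prime (p::nat)"
 shows "EX C. ALL N>=1. \<bar>(SUM n:{n:{1..N}. ALL p:V. ~ p dvd n}. Lam n / n) - ln (real N)\<bar> <= C"
proof -
 obtain C where C: "!!N. (SUM n:{n:{1..N}. EX p:V. p dvd n}. Lam n / n) <= C"
  using sum_Lam_noncoprime_bounded[of V] V by blast
 have "\<bar>(SUM n:{n:{1..N}. ALL p:V. ~ p dvd n}. Lam n / n) - ln (real N)\<bar> <= 5 + C" if "N >= 1" for N
 proof -
  have "{1..N} = {n:{1..N}. ALL p:V. ~ p dvd n} Un {n:{1..N}. EX p:V. p dvd n}" by auto
  hence "(SUM n=1..N. Lam n / n) = (SUM n:{n:{1..N}. ALL p:V. ~ p dvd n} Un {n:{1..N}. EX p:V. p dvd n}. Lam n / n)"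
   by metis
  also have "... = (SUM n:{n:{1..N}. ALL p:V. ~ p dvd n}. Lam n / n) + (SUM n:{n:{1..N}. EX p:V. p dvd n}. Lam n / n)"
   by (rule sum.union_disjoint) auto
  moreover have "0 <= (SUM n:{n:{1..N}. EX p:V. p dvd n}. Lam n / n)"
   by (intro sum_nonneg) (simp add: mangoldt_nonneg)
  ultimately show ?thesis using C[of N] mertens_Lam[OF that] by linarith
 qed
 thus ?thesis by blast
qed

text \<open>Detecting the residue 1 by all characters gives a nonnegative sum, to which the
  principal character contributes at most \<open>ln N + 5\<close> and each character with vanishing
  L-value \<open>- ln N\<close>, up to bounded terms. Hence at most one such character exists. Its
  conjugate is another one, so it is real, and real characters have been excluded.\<close>

lemma dchar_L_nonzero:
 assumes V: "finite V" "!!p. p : V ==> prime p" and j: "j : PiE V (%p. {..<p - 1})" and nt: "EX qq:V. j qq ~= 0"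
 shows "nonprincipal.L (dchar V j) ~= 0"
proof
 let ?J = "PiE V (%p. {..<p - 1})"
 define j0 where "j0 = (\<lambda>p\<in>V. 0::nat)"
 define S where "S j N = (SUM n=1..N. dchar V j n * of_real (Lam n) / n)" for j N
 define Z where "Z = {j:?J - {j0}. nonprincipal.L (dchar V j) = 0}"
 assume L0: "nonprincipal.L (dchar V j) = 0"
 have finJ: "finite ?J" using V by (intro finite_PiE) auto
 have j0: "j0 : ?J" unfolding j0_def using V prime_gt_Suc_0_nat by auto
 have np: "nonprincipal (dchar V i) (2 * rP V)" if "i : ?J - {j0}" for i
 proof -
  have "EX qq:V. i qq ~= 0"
  proof (rule ccontr)
   assume "~ (EX qq:V. i qq ~= 0)"
   hence "i = j0" using that unfolding j0_def by (auto simp: PiE_def extensional_def)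
   with that show False by simp
  qed
  then obtain qq where "qq : V" "i qq ~= 0" by blast
  moreover have "i qq < qq - 1" using that \<open>qq : V\<close> by auto
  ultimately show ?thesis using nonprincipal_dchar[of V qq i] V by auto
 qed
 have "EX C. ALL N>=1. norm (S i N + (if i : Z then of_real (ln (real N)) else 0)) <= C" if i: "i : ?J - {j0}" for i
 proof -
  interpret nonprincipal "dchar V i" "2 * rP V" by (rule np[OF i])
  show ?thesis
  proof (cases "i : Z")
   case True
   hence "L = 0" unfolding Z_def by simp
   thus ?thesis using chi_Lam_zero True unfolding S_def by auto
  next
   case False
   hence "L ~= 0" using i unfolding Z_def by simp
   thus ?thesis using chi_Lam_bounded False unfolding S_def by auto
  qed
 qed
 then obtain C where C: "!!i N. i : ?J - {j0} ==> N >= 1 ==> 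
   norm (S i N + (if i : Z then of_real (ln (real N)) else 0)) <= C i" by metis
 have finZ: "finite Z" unfolding Z_def using finJ by auto
 have card: "card Z <= 1"
 proof (rule ccontr)
  assume "~ card Z <= 1"
  hence cZ: "card Z >= 2" by simp
  have "ln (real N) <= 5 + (SUM i:?J - {j0}. C i)" if N: "N >= 1" for N
  proof -
   have "(SUM i:?J. S i N) = (SUM n=1..N. (SUM i:?J. dchar V i n) * of_real (Lam n) / n)"
    unfolding S_def by (subst sum.swap) (simp add: sum_distrib_right sum_divide_distrib)
   also have "... = (SUM n=1..N. of_real ((if ALL p:V. n mod p = 1 then real (PROD p:V. p - 1) else 0) * Lam n / n))"
    by (intro sum.cong refl) (subst dchar_sum_chars[OF V], auto)
   finally have "Re (SUM i:?J. S i N) = Re (SUM n=1..N. of_real ((if ALL p:V. n mod p = 1 then real (PROD p:V. p - 1) else 0) * Lam n / n))"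
    by (rule arg_cong)
   also have "... = (SUM n=1..N. (if ALL p:V. n mod p = 1 then real (PROD p:V. p - 1) else 0) * Lam n / n)"
    by (simp only: Re_sum Re_complex_of_real)
   also have "... >= 0"
    by (intro sum_nonneg divide_nonneg_nonneg mult_nonneg_nonneg) (auto simp: mangoldt_nonneg intro!: prod_nonneg)
   finally have "0 <= Re (SUM i:?J. S i N)" .
   also have "(SUM i:?J. S i N) = S j0 N + (SUM i:?J - {j0}. S i N)" 
    using sum.remove[OF finJ j0] by simp
   also have "Re ... <= (ln (real N) + 5) + (SUM i:?J - {j0}. C i - (if i : Z then ln (real N) else 0))"
    unfolding plus_complex.sel Re_sum
   proof (intro add_mono sum_mono)
    have "Re (S j0 N) <= norm (S j0 N)" by (rule complex_Re_le_cmod)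
    also have "... <= (SUM n=1..N. 1 * Lam n / n)" unfolding S_def
    proof (intro order.trans[OF norm_sum] sum_mono)
     fix n assume "n : {1..N}"
     show "norm (dchar V j0 n * of_real (Lam n) / n) <= 1 * Lam n / n"
      unfolding norm_divide norm_mult using dchar_norm[OF V(1)]
      by (auto intro!: divide_right_mono simp: mangoldt_nonneg)
    qed
    also have "... <= ln (real N) + 5" using mertens_Lam[OF N] by simp
    finally show "Re (S j0 N) <= ln (real N) + 5" .
   next
    fix i assume i: "i : ?J - {j0}"
    have "Re (S i N + (if i : Z then of_real (ln (real N)) else 0)) <= C i"
     using C[OF i N] complex_Re_le_cmod order.trans by blast
    thus "Re (S i N) <= C i - (if i : Z then ln (real N) else 0)" by (auto split: if_splits)
   qed
   also have "(SUM i:?J - {j0}. C i - (if i : Z then ln (real N) else 0)) = (SUM i:?J - {j0}. C i) - card Z * ln (real N)"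
   proof -
    have "(SUM i:?J - {j0}. (if i : Z then ln (real N) else 0)) = (SUM i:Z. ln (real N))"
     using finJ by (intro sum.mono_neutral_cong_right) (auto simp: Z_def)
    thus ?thesis by (simp add: sum_subtractf)
   qed
   finally have "0 <= ln (real N) + 5 + ((SUM i:?J - {j0}. C i) - card Z * ln (real N))" .
   moreover have "2 * ln (real N) <= card Z * ln (real N)" using cZ N by (intro mult_right_mono) auto
   ultimately show ?thesis by linarith
  qed
  thus False using ex_nat_ln_gt by (meson not_less)
 qed
 have jj0: "j ~= j0" using nt unfolding j0_def by auto
 have jZ: "j : Z" unfolding Z_def using j jj0 L0 by auto
 \<comment> \<open>Index vector of the conjugate character.\<close>
 define jc where "jc = (\<lambda>p\<in>V. (p - 1 - j p) mod (p - 1))"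
 have jcJ: "jc : ?J" unfolding jc_def
 proof (rule restrict_PiE_iff[THEN iffD2], rule ballI)
  fix p assume "p : V"
  hence "1 < p" using V prime_gt_1_nat by blast
  thus "(p - 1 - j p) mod (p - 1) : {..<p - 1}" by simp
 qed
 have jcc: "dchar V jc n = cnj (dchar V j n)" for n
 proof -
  have "cnj (dchar V j n) = (PROD p:V. cnj (pchar p (j p) n))" by (simp add: dchar_def)
  also have "... = (PROD p:V. pchar p (jc p) n)"
  proof (intro prod.cong refl)
   fix p assume "p : V"
   thus "cnj (pchar p (j p) n) = pchar p (jc p) n"
    using pchar_cnj[of p "j p" n] V j unfolding jc_def by auto
  qed
  finally show ?thesis by (simp add: dchar_def)
 qed
 have jcj0: "jc ~= j0"
 proof
  assume eq: "jc = j0"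
  obtain qq where qq: "qq : V" "j qq ~= 0" using nt by blast
  have "j qq < qq - 1" using j qq by auto
  hence "jc qq = qq - 1 - j qq" unfolding jc_def using qq by simp
  hence "jc qq ~= 0" using \<open>j qq < qq - 1\<close> by simp
  thus False using eq qq unfolding j0_def by simp
 qed
 interpret A: nonprincipal "dchar V j" "2 * rP V" by (rule np) (use j jj0 in auto)
 interpret Bc: nonprincipal "dchar V jc" "2 * rP V" by (rule np) (use jcJ jcj0 in auto)
 have "Bc.X = (%n. cnj (A.X n))"
  by (intro ext) (simp add: Bc.X_def A.X_def jcc)
 moreover have "(%n. cnj (A.X n)) \<longlonglongrightarrow> cnj A.L" using A.X_tendsto by (rule tendsto_cnj)
 ultimately have "Bc.L = cnj A.L" using Bc.X_tendsto LIMSEQ_unique by metis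
 hence "jc : Z" unfolding Z_def using jcJ jcj0 L0 by auto
 hence "jc = j" using card jZ finZ by (metis card_le_Suc0_iff_eq One_nat_def)
 hence rl: "cnj (dchar V j n) = dchar V j n" for n using jcc[of n] by simp
 have "dchar V j n : {0, 1, -1}" for n
 proof -
  have "Im (dchar V j n) = 0" using rl[of n] by (simp add: complex_eq_iff)
  moreover from this have "norm (dchar V j n) = \<bar>Re (dchar V j n)\<bar>" by (simp add: norm_complex_def)
  moreover have "norm (dchar V j n) : {0, 1}" using dchar_norm[OF V(1)] by auto
  ultimately show ?thesis by (auto simp: complex_eq_iff abs_if split: if_splits)
 qed
 thus False using A.L_nonzero_real L0 by blast
qed

text \<open>Orthogonality is applied to \<open>a' * n\<close> with \<open>a'\<close> inverse to
  \<open>a\<close>, so that only the residue 1 has to be detected. Nonprincipal characters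
  contribute boundedly because their L-values do not vanish.\<close>

lemma dirichlet_Lam:
 assumes V: "finite V" "!!p. p : V ==> prime (p::nat)" and a: "!!p. p : V ==> ~ p dvd a"
 shows "EX C. ALL N>=1. \<bar>(SUM n:{n:{1..N}. ALL p:V. n mod p = a mod p}. Lam n / n) - ln (real N) / (PROD p:V. real (p - 1))\<bar> <= C"
proof -
 let ?J = "PiE V (%p. {..<p - 1})"
 define j0 where "j0 = (\<lambda>p\<in>V. 0::nat)"
 define S where "S j N = (SUM n=1..N. dchar V j n * of_real (Lam n) / n)" for j N
 have finJ: "finite ?J" using V by (intro finite_PiE) auto
 have j0: "j0 : ?J" unfolding j0_def using V prime_gt_Suc_0_nat by auto
 have "coprime a (\<Prod>V)"
  using V a by (intro prod_coprime_right) (metis coprime_commute prime_imp_coprime)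
 then obtain a' where a': "[a * a' = 1] (mod \<Prod>V)" using cong_solve_coprime_nat[of a "\<Prod>V"] by auto
 have inv: "a * a' mod p = 1 mod p" if "p : V" for p
  using a' that V by (meson Cong.cong_def cong_dvd_modulus_nat dvd_prodI)
 have iff: "(a' * n) mod p = 1 \<longleftrightarrow> n mod p = a mod p" if p: "p : V" for p n
 proof -
  have p1: "1 < p" using prime_gt_1_nat V(2)[OF p] by blast
  have i: "[a * a' = 1] (mod p)" using inv[OF p] by (simp add: Cong.cong_def)
  have "[a' * n = 1] (mod p) \<longleftrightarrow> [n = a] (mod p)"
  proof
   assume "[a' * n = 1] (mod p)"
   hence "[a * (a' * n) = a * 1] (mod p)" by (rule cong_scalar_left)
   moreover have "[a * a' * n = 1 * n] (mod p)" using i by (rule cong_scalar_right)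
   ultimately show "[n = a] (mod p)" by (simp add: mult.assoc) (meson cong_sym cong_trans)
  next
   assume "[n = a] (mod p)"
   hence "[a' * n = a' * a] (mod p)" by (rule cong_scalar_left)
   thus "[a' * n = 1] (mod p)" using i by (metis cong_trans mult.commute)
  qed
  thus ?thesis using p1 by (simp add: Cong.cong_def)
 qed
 have "EX C. ALL N>=1. norm (S i N) <= C" if i: "i : ?J - {j0}" for i
 proof -
  have nt: "EX qq:V. i qq ~= 0"
  proof (rule ccontr)
   assume "~ (EX qq:V. i qq ~= 0)"
   hence "i = j0" using i unfolding j0_def by (auto simp: PiE_def extensional_def)
   with i show False by simp
  qed
  then obtain qq where qq: "qq : V" "i qq ~= 0" by blast
  moreover have "i qq < qq - 1" using i \<open>qq : V\<close> by auto
  ultimately interpret nonprincipal "dchar V i" "2 * rP V" 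
   using nonprincipal_dchar[of V qq i] V by auto
  have "L ~= 0" by (rule dchar_L_nonzero) (use V i nt in auto)
  thus ?thesis using chi_Lam_bounded unfolding S_def by auto
 qed
 then obtain C where C: "!!i N. i : ?J - {j0} ==> N >= 1 ==> norm (S i N) <= C i" by metis
 obtain C0 where C0: "!!N. N >= 1 ==> \<bar>(SUM n:{n:{1..N}. ALL p:V. ~ p dvd n}. Lam n / n) - ln (real N)\<bar> <= C0"
  using principal_Lam[of V] V by blast
 define K where "K = C0 + (SUM i:?J - {j0}. C i)"
 define \<phi> where "\<phi> = (PROD p:V. real (p - 1))"
 have phi1: "\<phi> >= 1" unfolding \<phi>_def
 proof (rule prod_ge_1)
  fix p assume "p : V"
  hence "1 < p" using V prime_gt_1_nat by blast
  thus "1 <= real (p - 1)" by simp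
 qed
 have "\<bar>(SUM n:{n:{1..N}. ALL p:V. n mod p = a mod p}. Lam n / n) - ln (real N) / \<phi>\<bar> <= K" if N: "N >= 1" for N
 proof -
  let ?T = "SUM n:{n:{1..N}. ALL p:V. n mod p = a mod p}. Lam n / n"
  have pj0: "pchar p (j0 p) n = (if p dvd n then 0 else 1)" if "p : V" for p n
   using that by (simp add: j0_def pchar_principal)
  have dj0: "dchar V j0 n = (if ALL p:V. ~ p dvd n then 1 else 0)" for n
   unfolding dchar_def using V(1) by (auto simp: pj0 prod_zero_iff intro!: prod.neutral)
  have Sj0: "S j0 N = of_real (SUM n:{n:{1..N}. ALL p:V. ~ p dvd n}. Lam n / n)"
   unfolding S_def dj0 of_real_sum by (intro sum.mono_neutral_cong_right) auto
  have da': "dchar V j0 a' = 1"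
  proof -
   have "~ p dvd a'" if p: "p : V" for p
   proof
    assume "p dvd a'"
    hence "a * a' mod p = 0" by simp
    thus False using inv[OF p] V p by (metis mod_less one_neq_zero prime_gt_1_nat)
   qed
   thus ?thesis by (simp add: dj0)
  qed
  have "(SUM i:?J. dchar V i a' * S i N) = (SUM n=1..N. (SUM i:?J. dchar V i (a' * n)) * of_real (Lam n) / n)"
   unfolding S_def sum_distrib_left using V
   by (subst sum.swap) (simp add: sum_distrib_right sum_divide_distrib dchar_mult mult.assoc)
  also have "... = (SUM n=1..N. of_real ((if ALL p:V. n mod p = a mod p then \<phi> else 0) * Lam n / n))"
  proof (intro sum.cong refl)
   fix n
   have e: "(SUM i:?J. dchar V i (a' * n)) = (if ALL p:V. (a' * n) mod p = 1 then of_nat (PROD p:V. p - 1) else 0)"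
    by (rule dchar_sum_chars) (use V in auto)
   have cond: "(ALL p:V. (a' * n) mod p = 1) \<longleftrightarrow> (ALL p:V. n mod p = a mod p)" using iff by blast
   show "(SUM i:?J. dchar V i (a' * n)) * of_real (Lam n) / of_nat n =
     of_real ((if ALL p:V. n mod p = a mod p then \<phi> else 0) * Lam n / n)"
    unfolding e cond by (simp add: \<phi>_def of_nat_prod)
  qed
  also have "... = of_real (\<phi> * ?T)"
   unfolding sum_distrib_left of_real_sum by (intro sum.mono_neutral_cong_right) auto
  finally have "of_real (\<phi> * ?T) = dchar V j0 a' * S j0 N + (SUM i:?J - {j0}. dchar V i a' * S i N)"
   using sum.remove[OF finJ j0, of "%i. dchar V i a' * S i N"] by simp
  hence "of_real (\<phi> * ?T - ln (real N)) = of_real ((SUM n:{n:{1..N}. ALL p:V. ~ p dvd n}. Lam n / n) - ln (real N)) + 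
   (SUM i:?J - {j0}. dchar V i a' * S i N)" by (simp add: da' Sj0)
  hence "norm (of_real (\<phi> * ?T - ln (real N)) :: complex) = 
   norm (of_real ((SUM n:{n:{1..N}. ALL p:V. ~ p dvd n}. Lam n / n) - ln (real N)) + 
   (SUM i:?J - {j0}. dchar V i a' * S i N))" by (rule arg_cong)
  hence "\<bar>\<phi> * ?T - ln (real N)\<bar> = 
   norm (of_real ((SUM n:{n:{1..N}. ALL p:V. ~ p dvd n}. Lam n / n) - ln (real N)) + 
   (SUM i:?J - {j0}. dchar V i a' * S i N))" by (simp only: norm_of_real)
  also have "... <= C0 + (SUM i:?J - {j0}. 1 * C i)"
  proof (intro norm_triangle_le add_mono order.trans[OF norm_sum] sum_mono)
   show "norm (complex_of_real ((SUM n:{n:{1..N}. ALL p:V. ~ p dvd n}. Lam n / n) - ln (real N))) <= C0"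
    unfolding norm_of_real by (rule C0[OF N])
   fix i assume i: "i : ?J - {j0}"
   show "norm (dchar V i a' * S i N) <= 1 * C i" unfolding norm_mult
    using C[OF i N] dchar_norm[OF V(1)] by (intro mult_mono) auto
  qed
  finally have "\<bar>\<phi> * ?T - ln (real N)\<bar> <= K" by (simp add: K_def)
  moreover have "\<phi> * ?T - ln (real N) = \<phi> * (?T - ln (real N) / \<phi>)" using phi1 by (simp add: right_diff_distrib)
  ultimately have "\<phi> * \<bar>?T - ln (real N) / \<phi>\<bar> <= K" using phi1 by (simp add: abs_mult)
  moreover have "1 * \<bar>?T - ln (real N) / \<phi>\<bar> <= \<phi> * \<bar>?T - ln (real N) / \<phi>\<bar>" using phi1 by (intro mult_right_mono) auto
  moreover have "x <= y" if "\<phi> * x <= y" "1 * x <= \<phi> * x" for x y using that by linarith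
  ultimately show ?thesis by blast
 qed
 thus ?thesis unfolding \<phi>_def by blast
qed

theorem dirichlet_mertens:
 assumes V: "finite V" "!!p. p : V ==> prime (p::nat)" and a: "!!p. p : V ==> ~ p dvd a"
 shows "EX C. ALL N>=1. \<bar>(SUM p:{p:{1..N}. prime p & (ALL qq:V. p mod qq = a mod qq)}. ln (real p) / real p) -
  ln (real N) / (PROD p:V. real (p - 1))\<bar> <= C"
proof -
 obtain C1 where C1: "!!N. N >= 1 ==> \<bar>(SUM n:{n:{1..N}. ALL p:V. n mod p = a mod p}. Lam n / n) - ln (real N) / (PROD p:V. real (p - 1))\<bar> <= C1"
  using dirichlet_Lam[OF V a] by blast
 obtain C2 where C2: "!!A N. (SUM d:{d:{1..N}. d : A & ~ prime d}. Lam d / d) <= C2"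
  using Lam_nonprime_bounded by blast
 have "\<bar>(SUM p:{p:{1..N}. prime p & (ALL qq:V. p mod qq = a mod qq)}. ln (real p) / real p) - ln (real N) / (PROD p:V. real (p - 1))\<bar> <= C1 + C2"
  if N: "N >= 1" for N
 proof -
  let ?A = "{n. ALL p:V. n mod p = a mod p}"
  have "{n:{1..N}. ALL p:V. n mod p = a mod p} = {n:{1..N}. n : ?A & prime n} Un {n:{1..N}. n : ?A & ~ prime n}" by auto
  hence "(SUM n:{n:{1..N}. ALL p:V. n mod p = a mod p}. Lam n / n) = 
    (SUM n:{n:{1..N}. n : ?A & prime n} Un {n:{1..N}. n : ?A & ~ prime n}. Lam n / n)" by metis
  also have "... = (SUM n:{n:{1..N}. n : ?A & prime n}. Lam n / n) + (SUM n:{n:{1..N}. n : ?A & ~ prime n}. Lam n / n)"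
   by (rule sum.union_disjoint) auto
  also have "(SUM n:{n:{1..N}. n : ?A & prime n}. Lam n / n) = (SUM p:{p:{1..N}. prime p & (ALL qq:V. p mod qq = a mod qq)}. ln (real p) / real p)"
   by (intro sum.cong) auto
  finally have 1: "(SUM n:{n:{1..N}. ALL p:V. n mod p = a mod p}. Lam n / n) =
   (SUM p:{p:{1..N}. prime p & (ALL qq:V. p mod qq = a mod qq)}. ln (real p) / real p) +
   (SUM n:{n:{1..N}. n : ?A & ~ prime n}. Lam n / n)" .
  have 2: "0 <= (SUM n:{n:{1..N}. n : ?A & ~ prime n}. Lam n / n)"
   by (intro sum_nonneg) (simp add: mangoldt_nonneg)
  have arith: "\<bar>y - l\<bar> <= c1 + c2" if "x = y + z" "0 <= z" "z <= c2" "\<bar>x - l\<bar> <= c1" for x y z l c1 c2 :: real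
   using that by linarith
  show ?thesis by (rule arith[OF 1 2 C2 C1[OF N]])
 qed
 thus ?thesis by blast
qed

section \<open>The large sieve\<close>

lemma sin_ge_half:
 assumes "0 <= x" "x <= pi / 2" shows "x / 2 <= sin (x::real)"
proof (cases "x <= pi / 3")
 case True
 have "(%x. sin x - x / 2) 0 <= (%x. sin x - x / 2) x"
 proof (rule DERIV_nonneg_imp_nondecreasing[OF assms(1)])
  fix t assume t: "0 <= t" "t <= x"
  hence "cos (pi / 3) <= cos t" using True by (intro cos_monotone_0_pi_le) auto
  hence "0 <= cos t - 1 / 2" by (simp add: cos_60)
  moreover have "((%x. sin x - x / 2) has_real_derivative (cos t - 1 / 2)) (at t)"
   by (auto intro!: derivative_eq_intros)
  ultimately show "EX y. ((%x. sin x - x / 2) has_real_derivative y) (at t) & 0 <= y" by blast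
 qed
 thus ?thesis by simp
next
 case False
 have "sin (pi / 3) <= sin x" using False assms by (intro sin_monotone_2pi_le) auto
 moreover have "sqrt 3 / 2 >= 4 / 5" by (intro order.trans[OF _ divide_right_mono[OF real_le_rsqrt[of "8/5"]]]) (auto simp: power2_eq_square)
 ultimately have "4 / 5 <= sin x" by (simp add: sin_60)
 moreover have "pi < 3.2" using pi_approx by simp
 ultimately show ?thesis using assms by linarith
qed

text \<open>The usual bound by the reciprocal distance to the nearest integer, with the smaller of
  \<open>frac \<delta>\<close> and \<open>1 - frac \<delta>\<close> replaced by a sum of two
  reciprocals: the two halves can then be summed over spaced points separately.\<close>

lemma geometric_cis_bound:
 assumes f: "frac \<delta> > 0"
 shows "norm (SUM n:{M<..M + N}. cis (2 * pi * (real n * \<delta>))) <= 1 / frac \<delta> + 1 / (1 - frac \<delta>)"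
proof -
 define \<phi> where "\<phi> = frac \<delta>"
 have phi: "0 < \<phi>" "\<phi> < 1" using f by (auto simp: \<phi>_def frac_lt_1)
 define z where "z = cis (2 * pi * \<delta>)"
 have pw: "cis (2 * pi * (real n * \<delta>)) = z ^ n" for n
  unfolding z_def by (subst Complex.DeMoivre) (simp add: mult_ac)
 have zphi: "z = cis (2 * pi * \<phi>)"
 proof -
  have "2 * pi * \<delta> = 2 * pi * \<phi> + 2 * pi * of_int \<lfloor>\<delta>\<rfloor>" by (simp add: \<phi>_def frac_def algebra_simps)
  thus ?thesis unfolding z_def by (simp add: cis_mult[symmetric])
 qed
 have nz: "norm (1 - z) = 2 * sin (pi * \<phi>)"
 proof -
  have "(norm (1 - z))\<^sup>2 = (1 - cos (2 * pi * \<phi>))\<^sup>2 + (sin (2 * pi * \<phi>))\<^sup>2"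
   unfolding zphi cmod_power2 by simp
  also have "... = 2 - 2 * cos (2 * (pi * \<phi>))" 
   using sin_cos_squared_add[of "2 * pi * \<phi>"] by (simp add: power2_eq_square algebra_simps)
  also have "... = (2 * sin (pi * \<phi>))\<^sup>2" by (simp add: cos_double_sin power2_eq_square)
  finally have "(norm (1 - z))\<^sup>2 = (2 * sin (pi * \<phi>))\<^sup>2" .
  moreover have "sin (pi * \<phi>) >= 0" using phi by (intro sin_ge_zero) auto
  ultimately show ?thesis by (intro power2_eq_imp_eq[of "norm (1 - z)"]) auto
 qed
 have spos: "sin (pi * \<phi>) > 0" using phi by (intro sin_gt_zero) auto
 have "z ~= 1" using nz spos by auto
 have "(SUM n:{M<..M + N}. z ^ n) = z ^ (M + 1) * (SUM n<N. z ^ n)"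
  unfolding sum_distrib_left
  by (rule sum.reindex_bij_witness[of _ "%n. n + (M + 1)" "%n. n - (M + 1)"]) (auto simp flip: power_add power_Suc)
 also have "(SUM n<N. z ^ n) = (1 - z ^ N) / (1 - z)" using \<open>z ~= 1\<close> by (simp add: sum_gp_strict)
 finally have "norm (SUM n:{M<..M + N}. z ^ n) = norm (1 - z ^ N) / norm (1 - z)"
  by (simp add: norm_mult norm_divide norm_power z_def)
 also have "... <= 2 / (2 * sin (pi * \<phi>))"
  unfolding nz using spos norm_triangle_ineq4[of 1 "z ^ N"] 
  by (intro divide_right_mono) (auto simp: norm_power z_def)
 also have "... = 1 / sin (pi * \<phi>)" by simp
 also have "... <= 1 / \<phi> + 1 / (1 - \<phi>)"
 proof (cases "\<phi> <= 1 / 2")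
  case True
  have "\<phi> <= pi * \<phi> / 2" using phi pi_gt3 by simp
  also have "... <= sin (pi * \<phi>)" using True phi by (intro sin_ge_half) auto
  finally have "1 / sin (pi * \<phi>) <= 1 / \<phi>" using phi by (intro divide_left_mono) auto
  thus ?thesis using phi by (smt (verit) divide_nonneg_nonneg)
 next
  case False
  have "2 * (1 - \<phi>) <= pi * (1 - \<phi>)" using phi pi_gt3 by (intro mult_right_mono) auto
  hence "1 - \<phi> <= pi * (1 - \<phi>) / 2" by simp
  also have "... <= sin (pi * (1 - \<phi>))" using False phi by (intro sin_ge_half) (auto simp: mult_left_le)
  also have "sin (pi * (1 - \<phi>)) = sin (pi * \<phi>)" by (simp add: right_diff_distrib sin_diff)
  finally have "1 / sin (pi * \<phi>) <= 1 / (1 - \<phi>)" using phi by (intro divide_left_mono) auto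
  thus ?thesis using phi by (smt (verit) divide_nonneg_nonneg)
 qed
 finally show ?thesis unfolding pw \<phi>_def .
qed

text \<open>Duality: the sum of squares \<open>X\<close> is a linear form in \<open>\<alpha>\<close>
  with coefficients \<open>T m\<close>. Cauchy-Schwarz and Schur's test for the Hermitian kernel
  \<open>D\<close> bound the square sum of the \<open>T m\<close> by \<open>B * X\<close>, and one
  \<open>X\<close> cancels. The support \<open>A\<close> is enlarged to a full interval only on the
  dual side, where all terms are squares.\<close>

lemma dual_large_sieve:
 fixes \<alpha> :: "nat => real" and \<theta> :: "'i => real"
 assumes I: "finite I" and A: "A \<subseteq> {M<..M + N}"
  and schur: "!!x. x : I ==> (SUM y:I. norm (SUM n:{M<..M + N}. cis (2 * pi * (real n * (\<theta> x - \<theta> y))))) <= B"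
  and B: "B >= 0"
 shows "(SUM x:I. (norm (SUM m:A. \<alpha> m * cis (2 * pi * (real m * \<theta> x))))\<^sup>2) <= B * (SUM m:A. (\<alpha> m)\<^sup>2)"
proof -
 let ?z1 = "SUM m:A. \<bar>\<alpha> m\<bar>\<^sup>2"
 define S where "S x = (SUM m:A. \<alpha> m * cis (2 * pi * (real m * \<theta> x)))" for x
 define z where "z x = cnj (S x)" for x
 define X where "X = (SUM x:I. (norm (S x))\<^sup>2)"
 define T where "T n = (SUM x:I. z x * cis (2 * pi * (real n * \<theta> x)))" for n
 define D where "D x y = (SUM n:{M<..M + N}. cis (2 * pi * (real n * (\<theta> x - \<theta> y))))" for x y
 have finA: "finite A" using A finite_subset by blast
 have X0: "X >= 0" unfolding X_def by (intro sum_nonneg) auto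
 have "complex_of_real X = (SUM x:I. S x * z x)"
  unfolding X_def z_def by (simp add: complex_norm_square flip: of_real_power)
 also have "... = (SUM m:A. \<alpha> m * T m)"
  unfolding S_def T_def sum_distrib_left sum_distrib_right by (subst sum.swap) (simp add: mult_ac)
 finally have "X = norm (SUM m:A. \<alpha> m * T m)" using X0 by (metis norm_of_real abs_of_nonneg)
 also have "... <= (SUM m:A. \<bar>\<alpha> m\<bar> * norm (T m))" by (intro order.trans[OF norm_sum]) (simp add: norm_mult)
 finally have "X\<^sup>2 <= (SUM m:A. \<bar>\<alpha> m\<bar> * norm (T m))\<^sup>2" using X0 by (intro power_mono) auto
 also have "... <= ?z1 * (SUM m:A. (norm (T m))\<^sup>2)" by (rule Cauchy_Schwarz_ineq_sum)
 also have "... <= ?z1 * (B * X)"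
 proof (intro mult_left_mono sum_nonneg)
  have "(SUM m:A. (norm (T m))\<^sup>2) <= (SUM n:{M<..M + N}. (norm (T n))\<^sup>2)"
   using A by (intro sum_mono2) auto
  also have "... = Re (SUM n:{M<..M + N}. T n * cnj (T n))"
   by (simp add: complex_norm_square[symmetric] flip: of_real_power)
  also have "(SUM n:{M<..M + N}. T n * cnj (T n)) = (SUM x:I. SUM y:I. z x * cnj (z y) * D x y)"
  proof -
   have "T n * cnj (T n) = (SUM x:I. SUM y:I. z x * cnj (z y) * cis (2 * pi * (real n * (\<theta> x - \<theta> y))))" for n
   proof -
    have c: "cis (2 * pi * (real n * (\<theta> x - \<theta> y))) = cis (2 * pi * (real n * \<theta> x)) * cnj (cis (2 * pi * (real n * \<theta> y)))" for x y
     by (simp add: cis_cnj cis_mult right_diff_distrib)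
    show ?thesis unfolding T_def c cnj_sum sum_product by (simp add: mult_ac)
   qed
   hence "(SUM n:{M<..M + N}. T n * cnj (T n)) = 
    (SUM n:{M<..M + N}. SUM x:I. SUM y:I. z x * cnj (z y) * cis (2 * pi * (real n * (\<theta> x - \<theta> y))))" by simp
   also have "... = (SUM x:I. SUM n:{M<..M + N}. SUM y:I. z x * cnj (z y) * cis (2 * pi * (real n * (\<theta> x - \<theta> y))))"
    by (rule sum.swap)
   also have "... = (SUM x:I. SUM y:I. SUM n:{M<..M + N}. z x * cnj (z y) * cis (2 * pi * (real n * (\<theta> x - \<theta> y))))"
    by (intro sum.cong refl sum.swap)
   finally show ?thesis by (simp add: D_def sum_distrib_left)
  qed
  also have "Re ... <= (SUM x:I. SUM y:I. norm (z x) * norm (z y) * norm (D x y))"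
   by (intro order.trans[OF complex_Re_le_cmod] order.trans[OF norm_sum] sum_mono) (auto simp: norm_mult)
  also have "... <= (SUM x:I. SUM y:I. ((norm (z x))\<^sup>2 / 2 + (norm (z y))\<^sup>2 / 2) * norm (D x y))"
  proof (intro sum_mono mult_right_mono)
   fix x y
   have "0 <= (norm (z x) - norm (z y))\<^sup>2" by simp
   thus "norm (z x) * norm (z y) <= (norm (z x))\<^sup>2 / 2 + (norm (z y))\<^sup>2 / 2"
    by (simp add: power2_diff)
  qed auto
  also have "... = (SUM x:I. (norm (z x))\<^sup>2 / 2 * (SUM y:I. norm (D x y))) + (SUM x:I. SUM y:I. (norm (z y))\<^sup>2 / 2 * norm (D x y))"
   by (simp add: distrib_right sum.distrib sum_distrib_left)
  also have "(SUM x:I. SUM y:I. (norm (z y))\<^sup>2 / 2 * norm (D x y)) = (SUM y:I. (norm (z y))\<^sup>2 / 2 * (SUM x:I. norm (D y x)))"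
  proof -
   have "norm (D x y) = norm (D y x)" for x y
   proof -
    have "D y x = cnj (D x y)" unfolding D_def cnj_sum by (intro sum.cong refl) (simp add: cis_cnj algebra_simps)
    thus ?thesis by simp
   qed
   thus ?thesis by (subst sum.swap) (simp add: sum_distrib_left)
  qed
  also have "(SUM x:I. (norm (z x))\<^sup>2 / 2 * (SUM y:I. norm (D x y))) + (SUM x:I. (norm (z x))\<^sup>2 / 2 * (SUM y:I. norm (D x y))) <=
    (SUM x:I. (norm (z x))\<^sup>2 / 2 * B) + (SUM x:I. (norm (z x))\<^sup>2 / 2 * B)"
   using schur unfolding D_def by (intro add_mono sum_mono mult_left_mono) auto
  also have "... = B * X"
   by (simp add: X_def z_def sum_distrib_left mult.commute flip: sum.distrib)
  finally show "(SUM m:A. (norm (T m))\<^sup>2) <= B * X" .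
 qed auto
 finally have le: "X * X <= (B * (SUM m:A. (\<alpha> m)\<^sup>2)) * X" by (simp add: power2_eq_square mult_ac)
 have "X <= B * (SUM m:A. (\<alpha> m)\<^sup>2)"
 proof (cases "X = 0")
  case True
  thus ?thesis using B by (simp add: sum_nonneg)
 next
  case False
  thus ?thesis using le X0 by (simp add: mult_le_cancel_right)
 qed
 thus ?thesis by (simp add: X_def S_def)
qed

text \<open>The spacing makes the integer parts of \<open>qq * f y\<close> distinct, so the sum is
  dominated by \<open>qq\<close> times a harmonic sum.\<close>

lemma spaced_reciprocal_sum:
 assumes I: "finite I" and qq: "qq >= 1" and f: "!!y. y : I ==> f y < 1" "!!y. y : I ==> 1 / real qq <= f y"
  and sp: "!!y y'. y : I ==> y' : I ==> y ~= y' ==> \<bar>f y - f y'\<bar> >= 1 / real qq"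
 shows "(SUM y:I. 1 / f y) <= real qq * harm qq"
proof -
 define k where "k y = nat \<lfloor>f y * real qq\<rfloor>" for y
 have f0: "f y > 0" if "y : I" for y using f(2)[OF that] qq by (smt (verit) divide_pos_pos of_nat_0_less_iff zero_less_one_class.zero_less_one less_le_trans not_one_le_zero neq0_conv of_nat_0)
 have kb: "1 <= k y" "k y <= qq" "real (k y) <= f y * real qq" "f y * real qq < real (k y) + 1" if y: "y : I" for y
 proof -
  have 1: "1 <= f y * real qq" using f(2)[OF y] qq by (simp add: divide_le_eq)
  hence fl: "1 <= \<lfloor>f y * real qq\<rfloor>" by (simp add: le_floor_iff)
  thus "1 <= k y" unfolding k_def by linarith
  have r: "real (k y) = of_int \<lfloor>f y * real qq\<rfloor>" unfolding k_def using fl by simp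
  show a: "real (k y) <= f y * real qq" unfolding r by simp
  show "f y * real qq < real (k y) + 1" unfolding r by linarith
  have "f y * real qq <= 1 * real qq" using f(1)[OF y] by (intro mult_right_mono) auto
  thus "k y <= qq" using a by linarith
 qed
 have inj: "inj_on k I"
 proof (rule inj_onI, rule ccontr)
  fix y y' assume y: "y : I" "y' : I" "k y = k y'" "y ~= y'"
  have "\<bar>f y * real qq - f y' * real qq\<bar> < 1" using kb[OF y(1)] kb[OF y(2)] y(3) by linarith
  moreover have "\<bar>f y * real qq - f y' * real qq\<bar> = \<bar>f y - f y'\<bar> * real qq" 
   by (simp add: abs_mult flip: left_diff_distrib)
  moreover have "\<bar>f y - f y'\<bar> * real qq >= 1 / real qq * real qq" using sp[OF y(1,2,4)] by (intro mult_right_mono) auto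
  ultimately show False using qq by simp
 qed
 have "(SUM y:I. 1 / f y) <= (SUM y:I. real qq / real (k y))"
 proof (intro sum_mono)
  fix y assume y: "y : I"
  have "1 / f y = real qq / (f y * real qq)" using qq by simp
  also have "... <= real qq / real (k y)" using kb[OF y] f0[OF y] by (intro divide_left_mono) auto
  finally show "1 / f y <= real qq / real (k y)" .
 qed
 also have "... = (SUM j:k ` I. real qq / real j)" by (subst sum.reindex[OF inj]) simp
 also have "... <= (SUM j=1..qq. real qq / real j)" using kb by (intro sum_mono2) auto
 also have "... = real qq * harm qq" by (simp add: harm_def sum_distrib_left divide_inverse)
 finally show ?thesis .
qed

section \<open>Farey fractions with squarefree denominators\<close>

definition fpt :: "nat set \<times> (nat => nat) => real" where
 "fpt x = (SUM p:fst x. real (snd x p) / real p)"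

text \<open>By the Chinese remainder theorem the values of \<open>fpt\<close> at these pairs are,
  modulo 1, the reduced fractions with denominator \<open>\<Prod>V\<close>.\<close>

definition fpts :: "nat set set => (nat set \<times> (nat => nat)) set" where
 "fpts \<V> = (SIGMA V:\<V>. PiE V (%p. {1..<p}))"

text \<open>Multiplied by both denominators the difference is an integer, so only its nonvanishing
  is at stake. Clearing all denominators but one prime \<open>qq\<close> shows that
  \<open>qq\<close> divides the difference of the numerators at \<open>qq\<close>; two points that
  agree modulo 1 thus have the same support and the same numerators. The integer \<open>k\<close>
  makes this a spacing modulo 1.\<close>

lemma fpt_spacing:
 fixes k :: int
 assumes \<V>: "!!V. V : \<V> ==> finite V" "!!V p. V : \<V> ==> p : V ==> prime p" "!!V. V : \<V> ==> \<Prod>V <= Q"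
  and x: "x : fpts \<V>" and y: "y : fpts \<V>" and ne: "x ~= y"
 shows "1 / real (Q\<^sup>2) <= \<bar>fpt x - fpt y - of_int k\<bar>"
proof -
 obtain V a U b where xy: "x = (V, a)" "y = (U, b)" "V : \<V>" "U : \<V>" 
  "a : PiE V (%p. {1..<p})" "b : PiE U (%p. {1..<p})"
  using x y unfolding fpts_def by auto
 have fin: "finite V" "finite U" using xy \<V> by auto
 have pr: "p : V Un U ==> prime p" for p using xy \<V> by auto
 define a' where "a' p = (if p : V then int (a p) else 0)" for p
 define b' where "b' p = (if p : U then int (b p) else 0)" for p
 have ab: "0 <= a' p" "a' p < int p" "0 <= b' p" "b' p < int p" if "p : V Un U" for p
  using xy prime_gt_0_nat[OF pr[OF that]] unfolding a'_def b'_def by (auto simp: PiE_def Pi_def)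
 let ?W = "V Un U"
 have diff: "fpt x - fpt y = (SUM p:?W. of_int (a' p - b' p) / real p)"
 proof -
  have "fpt x = (SUM p:?W. of_int (a' p) / real p)"
   unfolding fpt_def xy fst_conv snd_conv a'_def using fin by (intro sum.mono_neutral_cong_left) auto
  moreover have "fpt y = (SUM p:?W. of_int (b' p) / real p)"
   unfolding fpt_def xy fst_conv snd_conv b'_def using fin by (intro sum.mono_neutral_cong_left) auto
  ultimately show ?thesis by (simp add: sum_subtractf diff_divide_distrib)
 qed
 have Vd: "fpt z * rP (fst z) : \<int>" if "finite (fst z)" for z :: "nat set \<times> (nat => nat)"
 proof -
  have "fpt z * rP (fst z) = (SUM p:fst z. real (snd z p) / real p * rP (fst z))"
   by (simp add: fpt_def sum_distrib_right)
  also have "... : \<int>"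
  proof (intro Ints_sum)
   fix p assume p: "p : fst z"
   have "\<Prod>(fst z) = p * \<Prod>(fst z - {p})" using that p by (simp add: prod.remove)
   hence "real (snd z p) / real p * rP (fst z) = real (if p = 0 then 0 else snd z p * \<Prod>(fst z - {p}))"
    by simp
   thus "real (snd z p) / real p * rP (fst z) : \<int>" by (simp only: Ints_of_nat)
  qed
  finally show ?thesis .
 qed
 let ?N = "rP V * rP U"
 have pos: "\<Prod>V > 0" "\<Prod>U > 0" using pr fin by (auto intro!: prod_pos simp: prime_gt_0_nat)
 have "(fpt x - fpt y - of_int k) * ?N = fpt x * rP (fst x) * rP U - fpt y * rP (fst y) * rP V - of_int k * ?N"
  by (simp add: xy algebra_simps)
 also have "... : \<int>"
 proof -
  have "fpt x * rP (fst x) * rP U : \<int>" by (rule Ints_mult[OF Vd Ints_of_nat]) (use fin xy in auto)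
  moreover have "fpt y * rP (fst y) * rP V : \<int>" by (rule Ints_mult[OF Vd Ints_of_nat]) (use fin xy in auto)
  moreover have "of_int k * ?N : \<int>" by (intro Ints_mult Ints_of_nat Ints_of_int)
  ultimately show ?thesis by (intro Ints_diff)
 qed
 finally have int: "(fpt x - fpt y - of_int k) * ?N : \<int>" .
 have nz: "fpt x - fpt y - of_int k ~= 0"
 proof
  assume z: "fpt x - fpt y - of_int k = 0"
  have eq: "a' qq = b' qq" if qq: "qq : ?W" for qq
  proof -
   define M where "M = \<Prod>(?W - {qq})"
   have q0: "real qq ~= 0" using prime_gt_0_nat[OF pr[OF qq]] by simp
   have "fpt x - fpt y = of_int (a' qq - b' qq) / real qq + (SUM p:?W - {qq}. of_int (a' p - b' p) / real p)"
    unfolding diff using fin qq by (subst sum.remove[of _ qq]) auto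
   hence "of_int (a' qq - b' qq) / real qq = of_int k - (SUM p:?W - {qq}. of_int (a' p - b' p) / real p)"
    using z by simp
   moreover have "d * M = qq * (k * M - s * M)" if "d / qq = k - s" "qq ~= 0" for d qq k s M :: real
   proof -
    have d: "d = qq * (k - s)" using that by (simp add: field_simps)
    show ?thesis by (subst d) (simp add: algebra_simps)
   qed
   ultimately have "of_int (a' qq - b' qq) * real M = real qq * (of_int k * real M - (SUM p:?W - {qq}. of_int (a' p - b' p) / real p) * real M)"
    using q0 by blast
   hence "of_int (a' qq - b' qq) * real M = real qq * (of_int k * real M - (SUM p:?W - {qq}. of_int (a' p - b' p) / real p * real M))"
    by (simp only: sum_distrib_right)
   moreover have "(SUM p:?W - {qq}. of_int (a' p - b' p) / real p * real M) = 
    of_int (SUM p:?W - {qq}. (a' p - b' p) * int (\<Prod>(?W - {qq} - {p})))"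
   proof -
    have "of_int (a' p - b' p) / real p * real M = of_int (a' p - b' p) * rP (?W - {qq} - {p})" if "p : ?W - {qq}" for p
    proof -
     have "M = p * \<Prod>(?W - {qq} - {p})" unfolding M_def using that fin by (subst prod.remove[of _ p]) auto
     thus ?thesis using prime_gt_0_nat[of p] pr[of p] that by simp
    qed
    thus ?thesis by (simp add: of_int_sum)
   qed
   ultimately have "real_of_int ((a' qq - b' qq) * int M) = 
    real_of_int (int qq * (k * int M - (SUM p:?W - {qq}. (a' p - b' p) * int (\<Prod>(?W - {qq} - {p})))))"
    by (simp only: of_int_mult of_int_diff of_int_of_nat_eq)
   hence "(a' qq - b' qq) * int M = int qq * (k * int M - (SUM p:?W - {qq}. (a' p - b' p) * int (\<Prod>(?W - {qq} - {p}))))"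
    by (rule of_int_eq_iff[THEN iffD1])
   hence "int qq dvd (a' qq - b' qq) * int M" by (rule dvdI)
   moreover have "coprime (int qq) (int M)"
   proof -
    have "coprime qq M" unfolding M_def using pr qq by (intro prod_coprime_right primes_coprime) auto
    thus ?thesis by simp
   qed
   ultimately have "int qq dvd a' qq - b' qq" using coprime_dvd_mult_left_iff by blast
   moreover have "\<bar>a' qq - b' qq\<bar> < int qq" using ab[OF qq] by linarith
   ultimately show ?thesis using dvd_imp_le_int[of "a' qq - b' qq" "int qq"] by auto
  qed
  have "V = U"
  proof (rule subset_antisym; rule subsetI)
   fix p assume p: "p : V"
   hence "a' p >= 1" using xy unfolding a'_def by (auto simp: PiE_def Pi_def Suc_le_eq)
   thus "p : U" using eq[of p] p unfolding b'_def by (auto split: if_splits)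
  next
   fix p assume p: "p : U"
   hence "b' p >= 1" using xy unfolding b'_def by (auto simp: PiE_def Pi_def Suc_le_eq)
   thus "p : V" using eq[of p] p unfolding a'_def by (auto split: if_splits)
  qed
  moreover have "a = b"
  proof (rule PiE_ext[OF xy(5)])
   show "b : PiE V (%p. {1..<p})" using xy \<open>V = U\<close> by simp
   fix p assume "p : V"
   thus "a p = b p" using eq[of p] \<open>V = U\<close> unfolding a'_def b'_def by simp
  qed
  ultimately show False using ne xy by simp
 qed
 moreover have "?N > 0" using pos by (intro mult_pos_pos) (simp_all only: of_nat_0_less_iff)
 moreover have "d * N ~= 0" if "d ~= 0" "N > 0" for d N :: real using that by simp
 ultimately have "(fpt x - fpt y - of_int k) * ?N ~= 0" by blast
 with int have "1 <= \<bar>(fpt x - fpt y - of_int k) * ?N\<bar>" by (rule Ints_nonzero_abs_ge1)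
 also have "... = \<bar>fpt x - fpt y - of_int k\<bar> * ?N" unfolding abs_mult by (simp only: abs_of_nat)
 also have "... <= \<bar>fpt x - fpt y - of_int k\<bar> * real (Q\<^sup>2)"
 proof (intro mult_left_mono)
  have "\<Prod>V * \<Prod>U <= Q * Q" using \<V>(3) xy by (intro mult_mono) auto
  thus "?N <= real (Q\<^sup>2)" unfolding power2_eq_square of_nat_mult[symmetric] by (simp only: of_nat_le_iff)
 qed auto
 finally have "1 <= \<bar>fpt x - fpt y - of_int k\<bar> * real (Q\<^sup>2)" .
 moreover have "real (Q\<^sup>2) > 0"
 proof -
  have "Q >= 1" using \<V>(3)[OF xy(3)] pos by linarith
  thus ?thesis by simp
 qed
 ultimately show ?thesis by (simp only: divide_le_eq if_True)
qed

text \<open>Ramanujan's sum of modulus \<open>\<Prod>V\<close> at \<open>m - m'\<close>.\<close>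

definition ckern :: "nat set => nat => nat => real" where
 "ckern V m m' = (PROD p:V. (if m mod p = m' mod p then real p else 0) - 1)"

lemma fpts_sum_eq_ckern:
 assumes V: "finite V" "!!p. p : V ==> prime (p::nat)"
 shows "(SUM a:PiE V (%p. {1..<p}). (norm (SUM m:A. of_real (\<alpha> m) * cis (2 * pi * (real m * fpt (V, a)))))\<^sup>2) =
  (SUM m:A. SUM m':A. \<alpha> m * \<alpha> m' * ckern V m m')"
proof -
 let ?J = "PiE V (%p. {1..<p})"
 define e where "e m a = cis (2 * pi * (real m * fpt (V, a)))" for m a
 \<comment> \<open>\<open>m + (p - 1) * m'\<close> stands for \<open>m - m'\<close> modulo
   \<open>p\<close> within the naturals.\<close>
 have e_prod: "e m a * cnj (e m' a) = (PROD p:V. cis (2 * pi * (real ((m + (p - 1) * m') * a p) / real p)))" for m m' a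
 proof -
  have "cis (2 * pi * (real ((m + (p - 1) * m') * a p) / real p)) =
   cis (2 * pi * (real m * (real (a p) / real p)) - 2 * pi * (real m' * (real (a p) / real p)))" if "p : V" for p
  proof -
   have p: "p > 0" using V that by (auto simp: prime_gt_0_nat)
   have "2 * pi * (real ((m + (p - 1) * m') * a p) / real p) = 
    (2 * pi * (real m * (real (a p) / real p)) - 2 * pi * (real m' * (real (a p) / real p))) + 2 * pi * real (m' * a p)"
    using p by (simp add: of_nat_diff field_simps)
   thus ?thesis by (simp only: cis_mult[symmetric]) simp
  qed
  hence "(PROD p:V. cis (2 * pi * (real ((m + (p - 1) * m') * a p) / real p))) =
    (PROD p:V. cis (2 * pi * (real m * (real (a p) / real p)) - 2 * pi * (real m' * (real (a p) / real p))))" by simp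
  also have "... = cis (SUM p:V. 2 * pi * (real m * (real (a p) / real p)) - 2 * pi * (real m' * (real (a p) / real p)))"
  proof -
   have "(PROD p:V. cis (g p)) = cis (sum g V)" for g
    using V(1) by (induction V rule: finite_induct) (simp_all add: cis_mult)
   thus ?thesis .
  qed
  also have "... = e m a * cnj (e m' a)"
   unfolding e_def fpt_def by (simp add: cis_cnj cis_mult sum_subtractf sum_distrib_left)
  finally show ?thesis by simp
 qed
 have inner: "(SUM a:?J. e m a * cnj (e m' a)) = of_real (ckern V m m')" for m m'
 proof -
  have "(SUM a:?J. e m a * cnj (e m' a)) = (PROD p:V. SUM c:{1..<p}. cis (2 * pi * (real ((m + (p - 1) * m') * c) / real p)))"
   unfolding e_prod by (subst prod_sum_PiE) (use V in auto)
  also have "... = (PROD p:V. of_real ((if m mod p = m' mod p then real p else 0) - 1))"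
  proof (intro prod.cong refl)
   fix p assume "p : V"
   hence p: "p > 0" using V by (auto simp: prime_gt_0_nat)
   let ?f = "%c. cis (2 * pi * (real ((m + (p - 1) * m') * c) / real p))"
   have "{..<p} = insert 0 {1..<p}" using p by auto
   hence "(SUM c<p. ?f c) = ?f 0 + (SUM c:{1..<p}. ?f c)" by simp
   moreover have "(SUM c<p. ?f c) = (if p dvd (m + (p - 1) * m') then of_nat p else 0)"
    by (rule sum_cis_period[OF p])
   moreover have "p dvd (m + (p - 1) * m') \<longleftrightarrow> m mod p = m' mod p"
   proof -
    have eq: "m + (p - 1) * m' + m' = m + p * m'" using p by (cases p) auto
    have "[m + (p - 1) * m' + m' = m] (mod p)" unfolding Cong.cong_def eq by simp
    hence "p dvd (m + (p - 1) * m') \<longleftrightarrow> [m + (p - 1) * m' + m' = 0 + m'] (mod p)"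
     unfolding cong_add_rcancel_nat by (simp add: cong_0_iff)
    also have "... \<longleftrightarrow> [m = m'] (mod p)"
     using \<open>[m + (p - 1) * m' + m' = m] (mod p)\<close> by (metis add_0 cong_sym cong_trans)
    finally show ?thesis by (simp add: Cong.cong_def)
   qed
   ultimately show "(SUM c:{1..<p}. ?f c) = of_real ((if m mod p = m' mod p then real p else 0) - 1)"
    by (auto simp: algebra_simps)
  qed
  finally show ?thesis by (simp add: ckern_def)
 qed
 have "complex_of_real (SUM a:?J. (norm (SUM m:A. of_real (\<alpha> m) * e m a))\<^sup>2) = 
  (SUM a:?J. SUM m:A. SUM m':A. of_real (\<alpha> m * \<alpha> m') * (e m a * cnj (e m' a)))"
  by (simp add: complex_norm_square sum_product mult_ac flip: of_real_power)
 also have "... = (SUM m:A. SUM a:?J. SUM m':A. of_real (\<alpha> m * \<alpha> m') * (e m a * cnj (e m' a)))"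
  by (rule sum.swap)
 also have "... = (SUM m:A. SUM m':A. SUM a:?J. of_real (\<alpha> m * \<alpha> m') * (e m a * cnj (e m' a)))"
  by (intro sum.cong refl sum.swap)
 also have "... = (SUM m:A. SUM m':A. of_real (\<alpha> m * \<alpha> m') * of_real (ckern V m m'))"
  by (simp only: sum_distrib_left[symmetric] inner)
 also have "... = complex_of_real (SUM m:A. SUM m':A. \<alpha> m * \<alpha> m' * ckern V m m')" by simp
 finally show ?thesis unfolding e_def by (simp only: of_real_eq_iff)
qed

text \<open>The harmonic factor is the price of estimating the off-diagonal absolutely. Its
  logarithm does no harm later, since it is absorbed into one factor \<open>y\<close>.\<close>

theorem large_sieve:
 assumes fin: "finite \<V>" and \<V>: "!!V. V : \<V> ==> finite V" "!!V p. V : \<V> ==> p : V ==> prime p" "!!V. V : \<V> ==> \<Prod>V <= Q"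
  and A: "A \<subseteq> {M<..M + N}" and Q: "Q >= 1"
 shows "(SUM V:\<V>. SUM m:A. SUM m':A. \<alpha> m * \<alpha> m' * ckern V m m') <= (real N + 2 * real (Q\<^sup>2) * harm (Q\<^sup>2)) * (SUM m:A. (\<alpha> m)\<^sup>2)"
proof -
 let ?I = "fpts \<V>" and ?qq = "Q\<^sup>2"
 have finI: "finite ?I" unfolding fpts_def using fin \<V>(1) by (intro finite_SigmaI finite_PiE) auto
 have "(SUM V:\<V>. SUM m:A. SUM m':A. \<alpha> m * \<alpha> m' * ckern V m m') =
   (SUM V:\<V>. SUM a:PiE V (%p. {1..<p}). (norm (SUM m:A. of_real (\<alpha> m) * cis (2 * pi * (real m * fpt (V, a)))))\<^sup>2)"
  using \<V> by (intro sum.cong refl) (subst fpts_sum_eq_ckern, auto)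
 also have "... = (SUM x:?I. (norm (SUM m:A. of_real (\<alpha> m) * cis (2 * pi * (real m * fpt x))))\<^sup>2)"
  unfolding fpts_def using fin \<V>(1) by (subst sum.Sigma) (auto intro!: finite_PiE simp: case_prod_beta)
 also have "... <= (real N + 2 * real (Q\<^sup>2) * harm (Q\<^sup>2)) * (SUM m:A. (\<alpha> m)\<^sup>2)"
 proof (rule dual_large_sieve[OF finI A])
  fix x assume x: "x : ?I"
  let ?D = "%y. norm (SUM n:{M<..M + N}. cis (2 * pi * (real n * (fpt x - fpt y))))"
  define f where "f y = frac (fpt x - fpt y)" for y
  have flo: "1 / real ?qq <= f y" and fhi: "1 / real ?qq <= 1 - f y" if y: "y : ?I - {x}" for y
  proof -
   have *: "1 / real ?qq <= \<bar>fpt x - fpt y - of_int k\<bar>" for k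
    by (rule fpt_spacing[of \<V>]) (use \<V> x y in auto)
   show "1 / real ?qq <= f y" using *[of "\<lfloor>fpt x - fpt y\<rfloor>"] frac_ge_0[of "fpt x - fpt y"] by (simp add: f_def frac_def)
   show "1 / real ?qq <= 1 - f y" using *[of "\<lfloor>fpt x - fpt y\<rfloor> + 1"] frac_lt_1[of "fpt x - fpt y"] 
    by (simp add: f_def frac_def)
  qed
  have qpos: "1 / real ?qq > 0" using Q by simp
  have sp: "1 / real ?qq <= \<bar>f y - f y'\<bar>" if "y : ?I - {x}" "y' : ?I - {x}" "y ~= y'" for y y'
  proof -
   have "1 / real ?qq <= \<bar>fpt y' - fpt y - of_int (\<lfloor>fpt x - fpt y\<rfloor> - \<lfloor>fpt x - fpt y'\<rfloor>)\<bar>"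
    by (rule fpt_spacing[of \<V>]) (use \<V> that in auto)
   also have "fpt y' - fpt y - of_int (\<lfloor>fpt x - fpt y\<rfloor> - \<lfloor>fpt x - fpt y'\<rfloor>) = f y - f y'"
    by (simp add: f_def frac_def)
   finally show ?thesis .
  qed
  have s1: "(SUM y:?I - {x}. 1 / f y) <= real ?qq * harm ?qq"
  proof (rule spaced_reciprocal_sum)
   show "f y < 1" for y by (simp add: f_def frac_lt_1)
  qed (use finI Q flo sp in auto)
  have s2: "(SUM y:?I - {x}. 1 / (1 - f y)) <= real ?qq * harm ?qq"
  proof (rule spaced_reciprocal_sum)
   show "1 - f y < 1" if "y : ?I - {x}" for y using flo[OF that] qpos by linarith
   show "1 / real ?qq <= \<bar>(1 - f y) - (1 - f y')\<bar>" if "y : ?I - {x}" "y' : ?I - {x}" "y ~= y'" for y y'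
    using sp[OF that] by linarith
  qed (use finI Q fhi in auto)
  have "(SUM y:?I. ?D y) = ?D x + (SUM y:?I - {x}. ?D y)" using finI x by (rule sum.remove)
  also have "... <= real N + (SUM y:?I - {x}. 1 / f y + 1 / (1 - f y))"
  proof (intro add_mono sum_mono)
   show "?D x <= real N" by simp
   fix y assume y: "y : ?I - {x}"
   show "?D y <= 1 / f y + 1 / (1 - f y)" unfolding f_def
    by (rule geometric_cis_bound) (rule less_le_trans[OF qpos flo[OF y], unfolded f_def])
  qed
  also have "... <= real N + 2 * real ?qq * harm ?qq" using s1 s2 by (simp add: sum.distrib)
  finally show "(SUM y:?I. ?D y) <= real N + 2 * real (Q\<^sup>2) * harm (Q\<^sup>2)" .
 qed (auto intro!: add_nonneg_nonneg mult_nonneg_nonneg harm_nonneg)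
 finally show ?thesis .
qed

text \<open>For \<open>m\<close> and \<open>m'\<close> prime to \<open>\<Prod>V\<close> this is the
  sum of chi(m) times the conjugate of chi(m') over the characters that are nonprincipal at every
  prime of \<open>V\<close>, divided by the totient of \<open>\<Prod>V\<close>.\<close>

definition kkern :: "nat set => nat => nat => real" where
 "kkern V m m' = (PROD p:V. (if m mod p = m' mod p then 1 else 0) - 1 / (real p - 1))"

text \<open>The indicator of \<open>c * m = e\<close> modulo \<open>p\<close>, centred at its mean
  over the residues prime to \<open>p\<close> and cut to 0 when \<open>p\<close> divides
  \<open>c\<close>.\<close>

definition eker :: "nat => nat => nat => nat => real" where
 "eker p e c m = (if p dvd c then 0 else (if c * m mod p = e mod p then 1 else 0) - 1 / (real p - 1))"

lemma unique_quotient: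
 assumes p: "prime (p::nat)" and m: "~ p dvd m" and e: "~ p dvd e"
 shows "EX c0:{0<..<p}. ALL c:{0<..<p}. c * m mod p = e mod p \<longleftrightarrow> c = c0"
proof -
 have cop: "coprime m p" using p m by (metis coprime_commute prime_imp_coprime)
 obtain y where y: "[m * y = 1] (mod p)" using cong_solve_coprime_nat[OF cop] by auto
 define x where "x = y * e"
 have "[m * y * e = 1 * e] (mod p)" using y by (rule cong_scalar_right)
 hence x: "[x * m = e] (mod p)" by (simp add: x_def mult_ac)
 let ?c = "x mod p"
 have p0: "p > 0" using p by (simp add: prime_gt_0_nat)
 have c: "[?c * m = e] (mod p)" using x by (simp add: Cong.cong_def mod_mult_left_eq)
 have "~ p dvd ?c" 
 proof
  assume "p dvd ?c"
  hence "p dvd ?c * m" by simp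
  hence "p dvd e" using c cong_dvd_iff by blast
  thus False using e by simp
 qed
 hence cin: "?c : {0<..<p}" using p0 by (auto intro!: Nat.gr0I)
 show ?thesis
 proof (intro bexI[OF _ cin] ballI)
  fix c' assume c': "c' : {0<..<p}"
  show "c' * m mod p = e mod p \<longleftrightarrow> c' = ?c"
  proof
   assume "c' * m mod p = e mod p"
   hence "[c' * m = ?c * m] (mod p)" using c by (simp add: Cong.cong_def)
   hence "[c' = ?c] (mod p)" using cop cong_mult_rcancel_nat by blast
   thus "c' = ?c" using c' by (simp add: Cong.cong_def)
  qed (use c in \<open>auto simp: Cong.cong_def\<close>)
 qed
qed

lemma sum_eker_zero:
 assumes p: "prime (p::nat)" and c: "~ p dvd c" and e: "~ p dvd e"
 shows "(SUM m:{0<..<p}. eker p e c m) = 0"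
proof -
 obtain c0 where c0: "c0 : {0<..<p}" "!!m. m : {0<..<p} ==> m * c mod p = e mod p \<longleftrightarrow> m = c0"
  using unique_quotient[OF p c e] by blast
 have "(SUM m:{0<..<p}. eker p e c m) = (SUM m:{0<..<p}. (if m = c0 then 1 else 0) - 1 / (real p - 1))"
  using c0 c by (intro sum.cong refl) (auto simp: eker_def mult.commute)
 also have "... = 0" using c0 prime_gt_1_nat[OF p] by (simp add: sum_subtractf of_nat_diff)
 finally show ?thesis .
qed

text \<open>Each indicator selects a unique residue \<open>c\<close>, the same for both exactly when
  \<open>m\<close> and \<open>m'\<close> agree modulo \<open>p\<close>. The correlation over
  \<open>c\<close> therefore does not depend on \<open>e\<close>.\<close>

lemma sum_eker_eker:
 assumes p: "prime (p::nat)" and m: "~ p dvd m" "~ p dvd m'" and e: "~ p dvd e"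
 shows "(SUM c<p. eker p e c m * eker p e c m') = (if m mod p = m' mod p then 1 else 0) - 1 / (real p - 1)"
proof -
 have p1: "p > 1" using p by (rule prime_gt_1_nat)
 obtain c0 where c0: "c0 : {0<..<p}" "!!c. c : {0<..<p} ==> c * m mod p = e mod p \<longleftrightarrow> c = c0"
  using unique_quotient[OF p m(1) e] by blast
 obtain c1 where c1: "c1 : {0<..<p}" "!!c. c : {0<..<p} ==> c * m' mod p = e mod p \<longleftrightarrow> c = c1"
  using unique_quotient[OF p m(2) e] by blast
 have eq: "c0 = c1 \<longleftrightarrow> m mod p = m' mod p"
 proof
  assume "c0 = c1"
  hence "c0 * m mod p = c0 * m' mod p" using c0 c1 by metis
  hence "[c0 * m = c0 * m'] (mod p)" by (simp add: Cong.cong_def)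
  moreover have "coprime c0 p" using c0 p by (metis coprime_commute greaterThanLessThan_iff nat_dvd_not_less prime_imp_coprime)
  ultimately have "[m = m'] (mod p)" using cong_mult_lcancel_nat by blast
  thus "m mod p = m' mod p" by (simp add: Cong.cong_def)
 next
  assume "m mod p = m' mod p"
  hence "c0 * m' mod p = e mod p" using c0 by (metis mod_mult_right_eq)
  thus "c0 = c1" using c1(2)[OF c0(1)] by simp
 qed
 define t where "t = 1 / (real p - 1)"
 have tp: "t * (real p - 1) = 1" using p1 by (simp add: t_def)
 have "(SUM c<p. eker p e c m * eker p e c m') = (SUM c:{0<..<p}. eker p e c m * eker p e c m')"
  by (intro sum.mono_neutral_right) (auto simp: eker_def)
 also have "... = (SUM c:{0<..<p}. ((if c = c0 then 1 else 0) - t) * ((if c = c1 then 1 else 0) - t))"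
  using c0 c1 by (intro sum.cong refl) (auto simp: eker_def t_def dest: nat_dvd_not_less)
 also have "... = (SUM c:{0<..<p}. (if c = c0 then (if c0 = c1 then 1 else 0) else 0) - t * (if c = c0 then 1 else 0) - 
   t * (if c = c1 then 1 else 0) + t * t)"
  by (intro sum.cong refl) (auto simp: algebra_simps)
 also have "... = (if c0 = c1 then 1 else 0) - t - t + (real p - 1) * (t * t)"
  using c0(1) c1(1) p1 by (simp add: sum.distrib sum_subtractf sum_distrib_left[symmetric] of_nat_diff)
 also have "(real p - 1) * (t * t) = t" using tp by (metis mult.commute mult.left_commute mult.right_neutral)
 finally show ?thesis using eq by (simp add: t_def)
qed

text \<open>On \<open>A\<close> prime to \<open>\<Prod>V\<close> this is the mean square of the
  character sums of \<open>\<alpha>\<close> over the primitive characters, written without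
  characters.\<close>

definition Hform :: "nat set => (nat => real) => nat set => real" where
 "Hform A \<alpha> V = (SUM m:A. SUM m':A. \<alpha> m * \<alpha> m' * kkern V m m')"

text \<open>The right side does not involve the residues \<open>e\<close>: the form is nonnegative,
  and one and the same \<open>Hform\<close> controls the error sums for every choice of
  shifts.\<close>

lemma Hform_eq_square_sum:
 assumes V: "finite V" "!!p. p : V ==> prime (p::nat)" and A: "!!m p. m : A ==> p : V ==> ~ p dvd m"
  and e: "!!p. p : V ==> ~ p dvd e p"
 shows "(SUM c<\<Prod>V. (SUM m:A. \<alpha> m * (PROD p:V. eker p (e p) c m))\<^sup>2) = Hform A \<alpha> V"
proof -
 have emod: "eker p (e p) (c mod p) m = eker p (e p) c m" for p c m
  by (simp add: eker_def dvd_mod_iff mod_mult_left_eq)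
 have "(SUM c<\<Prod>V. (SUM m:A. \<alpha> m * (PROD p:V. eker p (e p) c m))\<^sup>2) =
   (SUM c<\<Prod>V. SUM m:A. SUM m':A. \<alpha> m * \<alpha> m' * (PROD p:V. eker p (e p) c m * eker p (e p) c m'))"
  by (simp add: power2_eq_square sum_product prod.distrib mult_ac)
 also have "... = (SUM m:A. SUM c<\<Prod>V. SUM m':A. \<alpha> m * \<alpha> m' * (PROD p:V. eker p (e p) c m * eker p (e p) c m'))"
  by (rule sum.swap)
 also have "... = (SUM m:A. SUM m':A. SUM c<\<Prod>V. \<alpha> m * \<alpha> m' * (PROD p:V. eker p (e p) c m * eker p (e p) c m'))"
  by (intro sum.cong refl sum.swap)
 also have "... = Hform A \<alpha> V"
  unfolding Hform_def sum_distrib_left[symmetric]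
 proof (intro sum.cong refl arg_cong2[of _ _ _ _ "(*)"])
  fix m m' assume m: "m : A" "m' : A"
  have "(SUM c<\<Prod>V. PROD p:V. eker p (e p) c m * eker p (e p) c m') =
    (SUM c<\<Prod>V. PROD p:V. eker p (e p) (c mod p) m * eker p (e p) (c mod p) m')" by (simp add: emod)
  also have "... = (PROD p:V. SUM c<p. eker p (e p) c m * eker p (e p) c m')" by (rule sum_crt_prod) (use V in auto)
  also have "... = kkern V m m'" unfolding kkern_def
   using V m A e by (intro prod.cong refl sum_eker_eker) auto
  finally show "(SUM c<\<Prod>V. PROD p:V. eker p (e p) c m * eker p (e p) c m') = kkern V m m'" .
 qed
 finally show ?thesis .
qed

lemma Hform_nonneg:
 assumes V: "finite V" "!!p. p : V ==> prime (p::nat)" and A: "!!m p. m : A ==> p : V ==> ~ p dvd m"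
 shows "0 <= Hform A \<alpha> V"
proof -
 have "~ p dvd 1" if "p : V" for p using V(2)[OF that] by auto
 hence "Hform A \<alpha> V = (SUM c<\<Prod>V. (SUM m:A. \<alpha> m * (PROD p:V. eker p 1 c m))\<^sup>2)"
  using V A by (intro Hform_eq_square_sum[where e = "%_. 1", symmetric]) auto
 thus ?thesis by (simp add: sum_nonneg)
qed

text \<open>The local factor is \<open>p\<close> times the centred indicator plus
  \<open>1 / (p - 1)\<close>, and the product is multiplied out. This replaces Gauss sums: the
  additive kernel is a nonnegative combination of the multiplicative ones, so the large sieve bounds
  \<open>Hform\<close> with weight \<open>\<Prod>S\<close>.\<close>

lemma ckern_expand:
 assumes V: "finite V" "!!p. p : V ==> prime (p::nat)"
 shows "ckern V m m' = (SUM S:Pow V. rP S * kkern S m m' * iph (V - S))"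
proof -
 have "ckern V m m' = (PROD p:V. real p * ((if m mod p = m' mod p then 1 else 0) - 1 / (real p - 1)) + 1 / (real p - 1))"
  unfolding ckern_def
 proof (intro prod.cong refl)
  fix p assume "p : V"
  hence "real p - 1 > 0" using V prime_gt_1_nat by force
  thus "(if m mod p = m' mod p then real p else 0) - 1 = 
   real p * ((if m mod p = m' mod p then 1 else 0) - 1 / (real p - 1)) + 1 / (real p - 1)"
   by (simp add: field_simps)
 qed
 also have "... = (SUM S:Pow V. (PROD p:S. real p * ((if m mod p = m' mod p then 1 else 0) - 1 / (real p - 1))) * iph (V - S))"
  by (rule prod_add[OF V(1)])
 finally show ?thesis by (simp add: prod.distrib kkern_def)
qed

lemma ckern_form_expand:
 assumes V: "finite V" "!!p. p : V ==> prime (p::nat)"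
 shows "(SUM m:A. SUM m':A. \<alpha> m * \<alpha> m' * ckern V m m') =
  (SUM S:Pow V. rP S * Hform A \<alpha> S * iph (V - S))"
proof -
 have "(SUM m:A. SUM m':A. \<alpha> m * \<alpha> m' * ckern V m m') =
   (SUM m:A. SUM m':A. SUM S:Pow V. \<alpha> m * \<alpha> m' * (rP S * kkern S m m' * iph (V - S)))"
  using ckern_expand[of V] V by (simp add: sum_distrib_left)
 also have "... = (SUM m:A. SUM S:Pow V. SUM m':A. \<alpha> m * \<alpha> m' * (rP S * kkern S m m' * iph (V - S)))"
  by (intro sum.cong refl sum.swap)
 also have "... = (SUM S:Pow V. SUM m:A. SUM m':A. \<alpha> m * \<alpha> m' * (rP S * kkern S m m' * iph (V - S)))"
  by (rule sum.swap)
 also have "... = (SUM S:Pow V. rP S * Hform A \<alpha> S * iph (V - S))"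
  unfolding Hform_def sum_distrib_left sum_distrib_right by (intro sum.cong refl) simp
 finally show ?thesis .
qed

text \<open>The same expansion for the plain congruence indicator; it bounds weighted counts of
  congruent pairs by the forms that the large sieve controls.\<close>

lemma congruent_pairs_expand:
 assumes V: "finite V"
 shows "(SUM m:A. SUM m':A. \<alpha> m * \<alpha> m' * (if ALL p:V. m mod p = m' mod p then 1 else 0)) =
  (SUM S:Pow V. Hform A \<alpha> S * iph (V - S))"
proof -
 have *: "(if ALL p:V. m mod p = m' mod p then 1 else 0) = (SUM S:Pow V. kkern S m m' * iph (V - S))" for m m'
 proof -
  have "(if ALL p:V. m mod p = m' mod p then 1 else (0::real)) = (PROD p:V. if m mod p = m' mod p then 1 else 0)"
   using V by (auto intro: prod_zero)
  also have "... = (PROD p:V. ((if m mod p = m' mod p then 1 else 0) - 1 / (real p - 1)) + 1 / (real p - 1))" by simp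
  also have "... = (SUM S:Pow V. kkern S m m' * iph (V - S))"
   unfolding kkern_def by (rule prod_add[OF V])
  finally show ?thesis .
 qed
 have "(SUM m:A. SUM m':A. \<alpha> m * \<alpha> m' * (if ALL p:V. m mod p = m' mod p then 1 else 0)) =
   (SUM m:A. SUM m':A. SUM S:Pow V. \<alpha> m * \<alpha> m' * (kkern S m m' * iph (V - S)))"
  unfolding * by (simp add: sum_distrib_left)
 also have "... = (SUM m:A. SUM S:Pow V. SUM m':A. \<alpha> m * \<alpha> m' * (kkern S m m' * iph (V - S)))"
  by (intro sum.cong refl sum.swap)
 also have "... = (SUM S:Pow V. SUM m:A. SUM m':A. \<alpha> m * \<alpha> m' * (kkern S m m' * iph (V - S)))"
  by (rule sum.swap)
 also have "... = (SUM S:Pow V. Hform A \<alpha> S * iph (V - S))"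
  unfolding Hform_def sum_distrib_left sum_distrib_right by (intro sum.cong refl) simp
 finally show ?thesis .
qed

section \<open>Sums over integers free of small primes\<close>

lemma le_nat_floor_iff:
 assumes "Suc 0 <= r" shows "r <= nat \<lfloor>z\<rfloor> \<longleftrightarrow> real r <= z"
proof (cases "0 <= \<lfloor>z\<rfloor>")
 case True
 thus ?thesis by (simp add: le_nat_iff le_floor_iff)
next
 case False
 hence "z < 0" by simp
 thus ?thesis using assms False by (auto simp: le_nat_floor)
qed

section \<open>Logarithmic sums over the integers prime to W\<close>

locale presieve =
 fixes D0 :: nat
 assumes D0: "D0 >= 1"
begin

definition W0 :: "nat set" where "W0 = {p. prime p & p <= D0}"
definition W :: nat where "W = \<Prod>W0"
definition cop :: "nat => bool" where "cop n \<longleftrightarrow> (ALL p:W0. ~ p dvd n)"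
definition phiW :: real where "phiW = (PROD p:W0. real (p - 1))"
text \<open>The density of the integers prime to \<open>W\<close>.\<close>

definition cW :: real where "cW = phiW / W"

lemma finite_W0 [simp]: "finite W0"
 by (rule finite_subset[of _ "{..D0}"]) (auto simp: W0_def)

lemma prime_W0: "p : W0 ==> prime p" by (simp add: W0_def)

lemma W_pos: "W > 0"
 unfolding W_def by (rule prime_factors_prod_primes(3)) (auto simp: prime_W0)

lemma phiW_pos: "phiW > 0"
 unfolding phiW_def using prime_W0 prime_gt_1_nat by (intro prod_pos) force

lemma cW_pos: "cW > 0"
 unfolding cW_def using W_pos phiW_pos by simp

lemma cW_le_1: "cW <= 1"
proof -
 have "phiW <= (PROD p:W0. real p)" unfolding phiW_def by (intro prod_mono) auto
 also have "... = real W" by (simp add: W_def)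
 finally show ?thesis unfolding cW_def using W_pos by simp
qed

lemma cop_mod: assumes "[m = n] (mod W)" shows "cop m \<longleftrightarrow> cop n"
proof -
 have "p dvd m \<longleftrightarrow> p dvd n" if p: "p : W0" for p
 proof -
  have "p dvd W" unfolding W_def using p by (intro dvd_prodI) auto
  hence "[m = n] (mod p)" using assms cong_dvd_modulus_nat by blast
  thus ?thesis by (rule cong_dvd_iff)
 qed
 thus ?thesis by (simp add: cop_def)
qed

lemma card_cop: "real (card {a:{1..W}. cop a}) = phiW"
proof -
 have "real (card {a:{1..W}. cop a}) = (SUM a:{1..W}. if cop a then 1 else 0)"
  by (simp add: sum.If_cases Int_def)
 also have "... = (SUM a<W. if cop a then 1 else 0)"
 proof -
  have e: "cop W = cop 0" by (rule cop_mod) (simp add: Cong.cong_def)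
  have "{1..W} = insert W {1..<W}" "{..<W} = insert 0 {1..<W}" using W_pos by auto
  thus ?thesis using e by simp
 qed
 also have "... = (SUM a<\<Prod>W0. PROD p:W0. if p dvd a mod p then 0 else 1)"
  unfolding W_def[symmetric] by (intro sum.cong refl) (auto simp: cop_def dvd_mod_iff prod_zero_iff)
 also have "... = (PROD p:W0. SUM a<p. if p dvd a then 0 else 1)"
  by (rule sum_crt_prod) (auto simp: prime_W0)
 also have "... = phiW" unfolding phiW_def
 proof (intro prod.cong refl)
  fix p assume "p : W0"
  hence p: "p > 1" using prime_W0 prime_gt_1_nat by blast
  have "(SUM a<p. if p dvd a then 0 else 1::real) = (SUM a:{0<..<p}. 1)"
   by (intro sum.mono_neutral_cong_right) (auto dest: dvd_imp_le)
  thus "(SUM a<p. if p dvd a then 0 else 1) = real (p - 1)" by simp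
 qed
 finally show ?thesis .
qed

text \<open>\<open>G\<close> is an antiderivative of the decreasing \<open>h\<close>, so its
  increments are compared with \<open>h\<close> by the mean value theorem. Both are cut off at
  \<open>z\<close>, which covers a step that straddles \<open>z\<close>.\<close>

lemma log_power_step:
 fixes z :: real and j :: nat
 defines "h \<equiv> %t. if t <= z then (ln (z / t)) ^ j / t else 0"
 defines "G \<equiv> %t. if t <= z then - ((ln (z / t)) ^ Suc j) / Suc j else 0"
 assumes st: "1 <= s" "s < t"
 shows "h t * (t - s) <= G t - G s" "G t - G s <= h s * (t - s)"
proof -
 have inner: "(ln (z / t)) ^ j / t * (t - s) <= - ((ln (z / t)) ^ Suc j) / Suc j - (- ((ln (z / s)) ^ Suc j) / Suc j) &
   - ((ln (z / t)) ^ Suc j) / Suc j - (- ((ln (z / s)) ^ Suc j) / Suc j) <= (ln (z / s)) ^ j / s * (t - s)"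
  if st: "1 <= s" "s < t" and tz: "t <= z" for s t
 proof -
  have "((%x. - ((ln (z / x)) ^ Suc j) / Suc j) has_real_derivative (ln (z / x)) ^ j / x) (at x)" if "s <= x" "x <= t" for x
  proof -
   have x: "x > 0" "z > 0" using that st tz by auto
   have "((%x. ln (z / x)) has_real_derivative (- 1 / x)) (at x)"
    using x by (auto intro!: derivative_eq_intros simp: field_simps power2_eq_square)
   from DERIV_power[OF this, of "Suc j"]
   have "((%x. (ln (z / x)) ^ Suc j) has_real_derivative (real (Suc j) * (- 1 / x * ln (z / x) ^ j))) (at x)" by simp
   from DERIV_cmult[OF this, of "- 1 / Suc j"]
   have "((%x. - 1 / Suc j * (ln (z / x)) ^ Suc j) has_real_derivative
    (- 1 / Suc j * (real (Suc j) * (- 1 / x * ln (z / x) ^ j)))) (at x)" .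
   moreover have "- 1 / qq * (qq * (- 1 / x * L)) = L / x" if "qq ~= 0" for qq L :: real using that by simp
   hence "- 1 / Suc j * (real (Suc j) * (- 1 / x * ln (z / x) ^ j)) = ln (z / x) ^ j / x" by (metis of_nat_eq_0_iff nat.distinct(1))
   ultimately show ?thesis by simp
  qed
  from MVT2[OF st(2) this] obtain y where y: "s < y" "y < t"
   "- ((ln (z / t)) ^ Suc j) / Suc j - - ((ln (z / s)) ^ Suc j) / Suc j = (t - s) * ((ln (z / y)) ^ j / y)" by blast
  have "(ln (z / t)) ^ j / t <= (ln (z / y)) ^ j / y" "(ln (z / y)) ^ j / y <= (ln (z / s)) ^ j / s"
   using y st tz by (auto intro!: frac_le power_mono ln_mono divide_left_mono)
  hence "(ln (z / t)) ^ j / t * (t - s) <= (ln (z / y)) ^ j / y * (t - s)"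
   "(ln (z / y)) ^ j / y * (t - s) <= (ln (z / s)) ^ j / s * (t - s)"
   using st by (intro mult_right_mono; simp)+
  thus ?thesis using y(3) by (simp only: mult.commute[of "t - s"])
 qed
 have h0: "0 <= (ln (z / s)) ^ j / s" if "s <= z" using that st by (auto intro!: divide_nonneg_nonneg)
 show "h t * (t - s) <= G t - G s"
 proof (cases "t <= z")
  case True thus ?thesis using inner[OF st True] st unfolding h_def G_def by auto
 next
  case False
  thus ?thesis using st unfolding h_def G_def by auto
 qed
 show "G t - G s <= h s * (t - s)"
 proof (cases "t <= z")
  case True thus ?thesis using inner[OF st True] st unfolding h_def G_def by auto
 next
  case F: False
  show ?thesis
  proof (cases "s < z")
   case True
   from inner[OF st(1) True order.refl] have "(ln (z / s)) ^ Suc j / Suc j <= (ln (z / s)) ^ j / s * (z - s)" 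
    using st True by simp
   also have "... <= (ln (z / s)) ^ j / s * (t - s)" using h0 True F by (intro mult_left_mono) auto
   finally show ?thesis using F True unfolding h_def G_def by simp
  next
   case False
   thus ?thesis using F st h0 unfolding h_def G_def by auto
  qed
 qed
qed

text \<open>Sum against integral for a decreasing function: both Riemann sums telescope in
  \<open>G\<close>, and they differ only by the first term, the last one being beyond
  \<open>z\<close>.\<close>

lemma progression_log_sum:
 fixes z :: real and a j w K :: nat
 assumes a: "1 <= a" and w: "w > 0" and K: "real (K * w) >= z"
 shows "\<bar>(SUM m<K. if real (a + m * w) <= z then (ln (z / (a + m * w))) ^ j / (a + m * w) else 0) -
  (if real a <= z then (ln (z / a)) ^ Suc j / (w * Suc j) else 0)\<bar> <= (if real a <= z then (ln (z / a)) ^ j / a else 0)"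
proof -
 define h where "h t = (if t <= z then (ln (z / t)) ^ j / t else 0)" for t :: real
 define G where "G t = (if t <= z then - ((ln (z / t)) ^ Suc j) / Suc j else 0)" for t :: real
 note step = log_power_step[of "real (a + m * w)" "real (a + Suc m * w)" z j for m, folded h_def G_def]
 have d: "real (a + Suc m * w) - real (a + m * w) = real w" for m by simp
 have lt: "real (a + m * w) < real (a + Suc m * w)" "1 <= real (a + m * w)" for m 
  using w a by (auto intro: add_increasing2)
 have s1: "h (a + Suc m * w) * w <= G (a + Suc m * w) - G (a + m * w)" 
  and s2: "G (a + Suc m * w) - G (a + m * w) <= h (a + m * w) * w" for m
  using step[OF lt(2) lt(1), unfolded d] by auto
 have tel: "(SUM m<K. G (a + Suc m * w) - G (a + m * w)) = G (a + K * w) - G a"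
  using sum_lessThan_telescope[of "%m. G (a + m * w)" K] by simp
 have "z < a + K * w" using a K by linarith
 hence Gend: "G (a + K * w) = 0" "h (a + K * w) = 0" unfolding G_def h_def by auto
 have "(SUM m<K. G (a + Suc m * w) - G (a + m * w)) <= (SUM m<K. h (a + m * w) * w)"
  by (intro sum_mono s2)
 hence up: "- G a <= (SUM m<K. h (a + m * w)) * w" unfolding tel Gend sum_distrib_right by simp
 have "(SUM m<K. h (a + Suc m * w) * w) <= (SUM m<K. G (a + Suc m * w) - G (a + m * w))"
  by (intro sum_mono s1)
 hence "(SUM m<K. h (a + Suc m * w)) * w <= - G a" unfolding tel Gend sum_distrib_right by simp
 moreover have "(SUM m<K. h (a + Suc m * w)) = (SUM m<K. h (a + m * w)) + h (a + K * w) - h a"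
  using sum.lessThan_Suc_shift[of "%m. h (a + m * w)" K] by simp
 ultimately have lo: "((SUM m<K. h (a + m * w)) - h a) * w <= - G a" using Gend by simp
 have w0: "real w > 0" using w by simp
 have "- G a / w <= (SUM m<K. h (a + m * w))" unfolding pos_divide_le_eq[OF w0] by (rule up)
 moreover have "(SUM m<K. h (a + m * w)) - h a <= - G a / w" unfolding pos_le_divide_eq[OF w0] by (rule lo)
 moreover have "- G a / w = (if real a <= z then (ln (z / a)) ^ Suc j / (w * Suc j) else 0)"
  unfolding G_def by (simp add: algebra_simps)
 ultimately show ?thesis unfolding h_def by (auto simp: abs_le_iff)
qed

lemma power_diff_log_bound:
 assumes "0 <= y" "y <= (x::real)"
 shows "x ^ Suc j - y ^ Suc j <= (x - y) * Suc j * x ^ j"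
proof (induction j)
 case (Suc j)
 have "x ^ Suc (Suc j) - y ^ Suc (Suc j) = x * (x ^ Suc j - y ^ Suc j) + (x - y) * y ^ Suc j"
  by (simp add: algebra_simps)
 also have "... <= x * ((x - y) * Suc j * x ^ j) + (x - y) * x ^ Suc j"
  using Suc assms by (intro add_mono mult_left_mono power_mono) auto
 finally show ?case by (simp add: algebra_simps)
qed simp

text \<open>One progression for each of the \<open>phiW\<close> reduced classes modulo
  \<open>W\<close>. Replacing \<open>ln (z / a)\<close> by \<open>ln z\<close> in the main term
  costs one power of the logarithm.\<close>

lemma cop_log_sum:
 "EX C>=0. ALL z>=1. \<bar>(SUM r:{r:{1..nat \<lfloor>z\<rfloor>}. cop r}. (ln (z / r)) ^ j / r) - cW * (ln z) ^ Suc j / Suc j\<bar> <= C * (1 + ln z) ^ j"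
proof -
 let ?A = "{a:{1..W}. cop a}"
 define C where "C = real W * (1 + ln W) + real W * (1 + ln W)"
 have W1: "real W >= 1" using W_pos by simp
 have C0: "C >= 0" unfolding C_def using W1 by simp
 have "\<bar>(SUM r:{r:{1..nat \<lfloor>z\<rfloor>}. cop r}. (ln (z / r)) ^ j / r) - cW * (ln z) ^ Suc j / Suc j\<bar> <= C * (1 + ln z) ^ j"
  if z: "z >= 1" for z :: real
 proof -
  \<comment> \<open>The range is extended to \<open>K\<close> full periods of length
    \<open>W\<close>; the cut-off in \<open>h\<close> makes the added terms vanish.\<close>
  obtain K :: nat where K: "z <= K" using real_arch_simple by blast
  have KW: "z <= real (K * W)" using K W1 mult_left_mono[of 1 "real W" "real K"] by simp
  define h where "h r = (if real r <= z then (ln (z / r)) ^ j / r else 0)" for r :: nat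
  have "(SUM r:{r:{1..nat \<lfloor>z\<rfloor>}. cop r}. (ln (z / r)) ^ j / r) = (SUM r:{r:{1..K * W}. cop r}. h r)"
  proof (rule sum.mono_neutral_cong_left)
   have iff: "r <= nat \<lfloor>z\<rfloor> \<longleftrightarrow> real r <= z" for r using z by (simp add: le_nat_iff le_floor_iff)
   show "{r : {1..nat \<lfloor>z\<rfloor>}. cop r} \<subseteq> {r : {1..K * W}. cop r}"
   proof
    fix r assume r: "r : {r : {1..nat \<lfloor>z\<rfloor>}. cop r}"
    hence "real r <= real (K * W)" using iff KW by fastforce
    thus "r : {r : {1..K * W}. cop r}" using r by (simp only: of_nat_le_iff) auto
   qed
   show "ALL i:{r : {1..K * W}. cop r} - {r : {1..nat \<lfloor>z\<rfloor>}. cop r}. h i = 0"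
    using iff by (auto simp: h_def)
   show "(ln (z / real r)) ^ j / real r = h r" if "r : {r : {1..nat \<lfloor>z\<rfloor>}. cop r}" for r
    using that iff by (auto simp: h_def)
  qed auto
  also have "... = (SUM x:?A \<times> {..<K}. h (fst x + snd x * W))"
  proof (rule sum.reindex_bij_witness[of _ "%x. fst x + snd x * W" "%r. ((r - 1) mod W + 1, (r - 1) div W)"])
   fix r assume r: "r : {r : {1..K * W}. cop r}"
   have id: "(r - 1) mod W + 1 + (r - 1) div W * W = r" using r by simp
   thus "fst ((r - 1) mod W + 1, (r - 1) div W) + snd ((r - 1) mod W + 1, (r - 1) div W) * W = r" by simp
   have "[(r - 1) mod W + 1 = (r - 1) + 1] (mod W)"
    by (intro cong_add) (simp_all add: Cong.cong_def)
   hence "[(r - 1) mod W + 1 = r] (mod W)" using r by simp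
   hence "cop ((r - 1) mod W + 1)" using cop_mod r by blast
   moreover have "(r - 1) div W < K" using r W_pos by (simp add: div_less_iff_less_mult) linarith
   moreover have "(r - 1) mod W + 1 <= W" using W_pos by (simp add: Suc_leI)
   ultimately show "((r - 1) mod W + 1, (r - 1) div W) : ?A \<times> {..<K}" by auto
  next
   fix x assume x: "x : ?A \<times> {..<K}"
   obtain a m where am: "x = (a, m)" "1 <= a" "a <= W" "cop a" "m < K" using x by auto
   have e: "a + m * W - 1 = (a - 1) + m * W" using am by simp
   have "(a' + m * W) mod W = a'" "(a' + m * W) div W = m" if "a' < W" for a' using that W_pos by auto
   moreover have "a - 1 < W" using am by linarith
   ultimately have "(a - 1 + m * W) mod W = a - 1" "(a - 1 + m * W) div W = m" by blast+
   thus "(((fst x + snd x * W) - 1) mod W + 1, ((fst x + snd x * W) - 1) div W) = x" using am e by simp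
   have "[a + m * W = a] (mod W)" by (simp add: Cong.cong_def)
   hence "cop (a + m * W)" using cop_mod am by blast
   moreover have "a + m * W <= K * W"
   proof -
    have "a + m * W <= Suc m * W" using am by simp
    also have "... <= K * W" using am by (intro mult_right_mono) auto
    finally show ?thesis .
   qed
   ultimately show "fst x + snd x * W : {r : {1..K * W}. cop r}" using am by auto
  qed auto
  also have "... = (SUM a:?A. SUM m<K. h (a + m * W))" by (simp add: sum.cartesian_product case_prod_beta)
  finally have eq: "(SUM r:{r:{1..nat \<lfloor>z\<rfloor>}. cop r}. (ln (z / r)) ^ j / r) = (SUM a:?A. SUM m<K. h (a + m * W))" .
  have main: "\<bar>(SUM m<K. h (a + m * W)) - (ln z) ^ Suc j / (W * Suc j)\<bar> <= (1 + ln W) * (1 + ln z) ^ j + (1 + ln W) * (1 + ln z) ^ j" if a: "a : ?A" for a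
  proof -
   have a1: "1 <= a" "a <= W" using a by auto
   have lz: "0 <= ln z" using z by simp
   have lw: "ln a <= ln W" "0 <= ln (real a)" using a1 by auto
   define u where "u = (if real a <= z then ln (z / a) else 0)"
   have u: "0 <= u" "u <= ln z" "ln z - u <= ln W"
    using a1 z lw by (auto simp: u_def ln_div intro: order.trans[OF ln_mono])
   have "\<bar>(SUM m<K. h (a + m * W)) - (if real a <= z then (ln (z / a)) ^ Suc j / (W * Suc j) else 0)\<bar> <= (if real a <= z then (ln (z / a)) ^ j / a else 0)"
    using progression_log_sum[OF a1(1) W_pos KW, of j] unfolding h_def by simp
   also have "(if real a <= z then (ln (z / a)) ^ Suc j / (W * Suc j) else 0) = u ^ Suc j / (W * Suc j)" by (simp add: u_def)
   also have "(if real a <= z then (ln (z / a)) ^ j / a else 0) <= (1 + ln W) * (1 + ln z) ^ j"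
   proof (cases "real a <= z")
    case True
    hence "0 <= ln (z / a)" "ln (z / a) <= 1 + ln z" using u by (auto simp: u_def)
    hence "(ln (z / a)) ^ j / a <= (1 + ln z) ^ j / 1"
     using a1 lz by (intro frac_le power_mono) auto
    also have "... <= (1 + ln W) * (1 + ln z) ^ j" using lw lz by simp
    finally show ?thesis using True by simp
   qed (use lz lw in auto)
   finally have 1: "\<bar>(SUM m<K. h (a + m * W)) - u ^ Suc j / (W * Suc j)\<bar> <= (1 + ln W) * (1 + ln z) ^ j" .
   have "(ln z) ^ Suc j - u ^ Suc j <= (ln z - u) * Suc j * (ln z) ^ j" by (rule power_diff_log_bound[OF u(1,2)])
   also have "... <= ln W * Suc j * (1 + ln z) ^ j" using u lz lw by (intro mult_mono power_mono) auto
   finally have num: "(ln z) ^ Suc j - u ^ Suc j <= ln W * Suc j * (1 + ln z) ^ j" .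
   have "((ln z) ^ Suc j - u ^ Suc j) / (W * Suc j) <= (ln W * Suc j * (1 + ln z) ^ j) / (1 * Suc j)"
   proof (rule frac_le[OF _ num])
    show "real (1 * Suc j) <= real (W * Suc j)" using W_pos by (intro of_nat_mono mult_right_mono) auto
   qed (use lz lw in \<open>auto intro!: mult_nonneg_nonneg\<close>)
   also have "... = ln W * (1 + ln z) ^ j" by simp
   also have "... <= (1 + ln W) * (1 + ln z) ^ j" using lz by (intro mult_right_mono) auto
   finally have 2: "(ln z) ^ Suc j / (W * Suc j) - u ^ Suc j / (W * Suc j) <= (1 + ln W) * (1 + ln z) ^ j"
    by (simp add: diff_divide_distrib)
   have 3: "u ^ Suc j / (W * Suc j) <= (ln z) ^ Suc j / (W * Suc j)"
    using u by (intro divide_right_mono power_mono) auto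
   show ?thesis using 1 2 3 by linarith
  qed
  have cA: "real (card ?A) = phiW" by (rule card_cop)
  have "cW * (ln z) ^ Suc j / Suc j = (SUM a:?A. (ln z) ^ Suc j / (W * Suc j))"
   unfolding sum_constant cA cW_def by (simp add: algebra_simps)
  hence "\<bar>(SUM a:?A. SUM m<K. h (a + m * W)) - cW * (ln z) ^ Suc j / Suc j\<bar> = 
   \<bar> SUM a:?A. (SUM m<K. h (a + m * W)) - (ln z) ^ Suc j / (W * Suc j)\<bar>" by (simp add: sum_subtractf)
  also have "... <= (SUM a:?A. (1 + ln W) * (1 + ln z) ^ j + (1 + ln W) * (1 + ln z) ^ j)"
   by (intro order.trans[OF sum_abs] sum_mono main)
  also have "... = real (card ?A) * ((1 + ln W) * (1 + ln z) ^ j + (1 + ln W) * (1 + ln z) ^ j)" by simp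
  also have "... <= real W * ((1 + ln W) * (1 + ln z) ^ j + (1 + ln W) * (1 + ln z) ^ j)"
  proof (intro mult_right_mono)
   have "card ?A <= card {1..W}" by (intro card_mono) auto
   thus "real (card ?A) <= real W" by simp
  qed (use W1 z in auto)
  also have "... = C * (1 + ln z) ^ j" by (simp add: C_def algebra_simps)
  finally show ?thesis unfolding eq .
 qed
 thus ?thesis using C0 by blast
qed

text \<open>Sum of \<open>(ln (z / r)) ^ j / r\<close> over ordered \<open>k\<close>-tuples of
  integers prime to \<open>W\<close> with product \<open>r <= z\<close>, so the
  \<open>k\<close>-fold divisor function is the weight. Integers in place of primes keep the
  asymptotics elementary.\<close>

fun Bz :: "nat => nat => real => real" where
 "Bz 0 j z = (if z >= 1 then (ln z) ^ j else 0)"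
| "Bz (Suc k) j z = (SUM r:{r:{1..nat \<lfloor>z\<rfloor>}. cop r}. Bz k j (z / r) / r)"

lemma Bz_less_1: "z < 1 ==> Bz k j z = 0"
 by (cases k) (auto intro!: sum.neutral simp: nat_le_iff)

lemma Bz_nonneg: "0 <= Bz k j z"
 by (induction k arbitrary: z) (auto intro!: sum_nonneg divide_nonneg_nonneg)

lemma Bz_mono: "y <= z ==> Bz k j y <= Bz k j z"
proof (induction k arbitrary: y z)
 case 0
 thus ?case by (auto intro!: power_mono)
next
 case (Suc k)
 have "Bz (Suc k) j y <= (SUM r:{r:{1..nat \<lfloor>y\<rfloor>}. cop r}. Bz k j (z / r) / r)"
  unfolding Bz.simps by (intro sum_mono divide_right_mono Suc.IH) (use Suc.prems in auto)
 also have "... <= Bz (Suc k) j z"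
  unfolding Bz.simps using Suc.prems by (intro sum_mono2) (auto intro!: divide_nonneg_nonneg Bz_nonneg simp: nat_mono floor_mono order.trans[OF _ nat_mono[OF floor_mono]])
 finally show ?case .
qed

lemma Bz_Suc_ge:
 fixes X :: "nat set"
 assumes "finite X" "!!r. r : X ==> r >= 1 & cop r"
 shows "(SUM r:X. Bz k j (z / r) / r) <= Bz (Suc k) j z"
proof -
 have "(SUM r:X. Bz k j (z / r) / r) = (SUM r:{r:X. real r <= z}. Bz k j (z / r) / r)"
  using assms by (intro sum.mono_neutral_right) (auto intro!: Bz_less_1 simp: not_le divide_less_eq)
 also have "... <= Bz (Suc k) j z"
  unfolding Bz.simps using assms by (intro sum_mono2) (auto intro!: divide_nonneg_nonneg Bz_nonneg simp: le_nat_floor)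
 finally show ?thesis .
qed

text \<open>Each step of the recursion integrates a power of the logarithm. This yields one factor
  \<open>cW\<close> and builds up the quotient of factorials, while the error stays one logarithm
  below the main term.\<close>

theorem Bz_asymp:
 "EX C>=0. ALL z>=1. \<bar>Bz (Suc k) j z - cW ^ Suc k * (fact j / fact (Suc k + j)) * (ln z) ^ (Suc k + j)\<bar> <= C * (1 + ln z) ^ (k + j)"
proof (induction k)
 case 0
 obtain C where C: "C >= 0" "!!z. z >= 1 ==> \<bar>(SUM r:{r:{1..nat \<lfloor>z\<rfloor>}. cop r}. (ln (z / r)) ^ j / r) - cW * (ln z) ^ Suc j / Suc j\<bar> <= C * (1 + ln z) ^ j"
  using cop_log_sum[of j] by blast
 have "Bz (Suc 0) j z = (SUM r:{r:{1..nat \<lfloor>z\<rfloor>}. cop r}. (ln (z / r)) ^ j / r)" for z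
  by (auto intro!: sum.cong simp: le_nat_floor_iff)
 moreover have "cW ^ Suc 0 * (fact j / fact (Suc 0 + j)) * (ln z) ^ (Suc 0 + j) = cW * (ln z) ^ Suc j / Suc j" for z :: real
  by simp
 ultimately show ?case using C by (intro exI[of _ C]) (simp del: Bz.simps)
next
 case (Suc k)
 then obtain C where C: "C >= 0" "!!z. z >= 1 ==> 
  \<bar>Bz (Suc k) j z - cW ^ Suc k * (fact j / fact (Suc k + j)) * (ln z) ^ (Suc k + j)\<bar> <= C * (1 + ln z) ^ (k + j)" by blast
 let ?J = "Suc k + j"
 let ?A = "cW ^ Suc k * (fact j / fact (Suc k + j))"
 obtain C' where C': "C' >= 0" "!!z. z >= 1 ==> \<bar>(SUM r:{r:{1..nat \<lfloor>z\<rfloor>}. cop r}. (ln (z / r)) ^ ?J / r) - cW * (ln z) ^ Suc ?J / Suc ?J\<bar> <= C' * (1 + ln z) ^ ?J"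
  using cop_log_sum[of ?J] by blast
 obtain C'' where C'': "C'' >= 0" "!!z. z >= 1 ==> \<bar>(SUM r:{r:{1..nat \<lfloor>z\<rfloor>}. cop r}. (ln (z / r)) ^ 0 / r) - cW * (ln z) ^ Suc 0 / Suc 0\<bar> <= C'' * (1 + ln z) ^ 0"
  using cop_log_sum[of 0] by blast
 have A0: "?A >= 0" using cW_pos by simp
 have nn: "0 <= C * (C'' + 1) + ?A * C'" 
  using C(1) C'(1) C''(1) A0 by (intro add_nonneg_nonneg mult_nonneg_nonneg[OF A0] mult_nonneg_nonneg) linarith+
 have main: "\<bar>Bz (Suc (Suc k)) j z - cW ^ Suc (Suc k) * (fact j / fact (Suc (Suc k) + j)) * (ln z) ^ (Suc (Suc k) + j)\<bar> <= 
   (C * (C'' + 1) + ?A * C') * (1 + ln z) ^ (Suc k + j)" if z: "z >= 1" for z :: real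
 proof -
  let ?X = "{r:{1..nat \<lfloor>z\<rfloor>}. cop r}"
  have lz: "0 <= ln z" using z by simp
  have rz: "1 <= real r" "real r <= z" "1 <= z / r" "0 <= ln (z / r)" "ln (z / r) <= ln z" if "r : ?X" for r
  proof -
   show r: "1 <= real r" "real r <= z" using that by (auto simp: le_nat_floor_iff)
   thus "1 <= z / r" by simp
   thus "0 <= ln (z / r)" by simp
   show "ln (z / r) <= ln z" using r z by (intro ln_mono) (auto simp: divide_le_eq)
  qed
  have e1: "\<bar>Bz (Suc (Suc k)) j z - ?A * (SUM r:?X. (ln (z / r)) ^ ?J / r)\<bar> <= C * (C'' + 1) * (1 + ln z) ^ (Suc k + j)"
  proof -
   have "\<bar>Bz (Suc (Suc k)) j z - ?A * (SUM r:?X. (ln (z / r)) ^ ?J / r)\<bar> =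
     \<bar> SUM r:?X. (Bz (Suc k) j (z / r) - ?A * (ln (z / r)) ^ ?J) / r\<bar>"
    unfolding Bz.simps(2)[of "Suc k"] by (simp add: sum_distrib_left sum_subtractf diff_divide_distrib del: Bz.simps)
   also have "... <= (SUM r:?X. C * (1 + ln z) ^ (k + j) * ((ln (z / r)) ^ 0 / r))"
   proof (intro order.trans[OF sum_abs] sum_mono)
    fix r assume r: "r : ?X"
    have "\<bar>(Bz (Suc k) j (z / r) - ?A * (ln (z / r)) ^ ?J) / r\<bar> = \<bar>Bz (Suc k) j (z / r) - ?A * (ln (z / r)) ^ ?J\<bar> / r"
     by simp
    also have "... <= C * (1 + ln (z / r)) ^ (k + j) / r"
     using C(2)[OF rz(3)[OF r]] by (intro divide_right_mono) auto
    also have "... <= C * (1 + ln z) ^ (k + j) / r"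
     using C(1) rz[OF r] by (intro divide_right_mono mult_left_mono power_mono) auto
    finally show "\<bar>(Bz (Suc k) j (z / r) - ?A * (ln (z / r)) ^ ?J) / r\<bar> <= C * (1 + ln z) ^ (k + j) * ((ln (z / r)) ^ 0 / r)" by simp
   qed
   also have "... = C * (1 + ln z) ^ (k + j) * (SUM r:?X. (ln (z / r)) ^ 0 / r)" by (simp add: sum_distrib_left)
   also have "... <= C * (1 + ln z) ^ (k + j) * ((C'' + 1) * (1 + ln z))"
   proof (intro mult_left_mono)
    have "(SUM r:?X. (ln (z / r)) ^ 0 / r) <= cW * ln z + C''" using C''(2)[OF z] by simp
    also have "... <= 1 * ln z + C''" using cW_le_1 lz by (intro add_mono mult_right_mono) auto
    also have "... <= (C'' + 1) * (1 + ln z)" using C''(1) lz by (simp add: algebra_simps)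
    finally show "(SUM r:?X. (ln (z / r)) ^ 0 / r) <= (C'' + 1) * (1 + ln z)" .
   qed (use C(1) lz in auto)
   finally show ?thesis by (simp add: mult_ac)
  qed
  have e2: "\<bar>?A * (SUM r:?X. (ln (z / r)) ^ ?J / r) - ?A * (cW * (ln z) ^ Suc ?J / Suc ?J)\<bar> <= ?A * (C' * (1 + ln z) ^ ?J)"
  proof -
   have "\<bar>A * s - A * t\<bar> <= A * e" if "A >= 0" "\<bar>s - t\<bar> <= e" for A s t e :: real
    using that by (metis abs_mult abs_of_nonneg mult_left_mono right_diff_distrib)
   from this[OF A0 C'(2)[OF z]] show ?thesis .
  qed
  have e3: "?A * (cW * (ln z) ^ Suc ?J / Suc ?J) = cW ^ Suc (Suc k) * (fact j / fact (Suc (Suc k) + j)) * (ln z) ^ (Suc (Suc k) + j)"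
   by (simp add: field_simps)
  show ?thesis using e1 e2 unfolding e3 by (simp only: distrib_right)
 qed
 show ?case by (intro exI[of _ "C * (C'' + 1) + ?A * C'"] conjI nn allI impI main)
qed

end

section \<open>From integers to squarefree products of primes\<close>

lemma sum_Pow_times_card:
 assumes "finite V"
 shows "(SUM S:Pow V. (k::real) ^ card (V - S)) = (k + 1) ^ card V"
proof -
 have "(SUM S:Pow V. k ^ card (V - S)) = (SUM S:Pow V. (PROD x:S. 1) * (PROD x:V - S. k))" by simp
 also have "... = (PROD x:V. 1 + k)" by (rule prod_add[OF assms, symmetric])
 finally show ?thesis by (simp add: add.commute)
qed

lemma sum_inverse_squares_le:
 assumes "finite P" "!!p. p : P ==> D < p" "D >= 1"
 shows "(SUM p:P. 1 / (real p)\<^sup>2) <= 1 / real D"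
proof -
 obtain M where M: "!!p. p : P ==> p <= M" using assms(1) by (metis finite_nat_set_iff_bounded_le)
 have "(SUM p:P. 1 / (real p)\<^sup>2) <= (SUM p:{D<..D + M}. 1 / (real p)\<^sup>2)"
  using assms M by (intro sum_mono2) (auto simp: trans_le_add2)
 also have "... <= 1 / real D - 1 / real (D + M)"
 proof (induction M)
  case (Suc M)
  have "{D<..D + Suc M} = insert (D + Suc M) {D<..D + M}" by auto
  hence "(SUM p:{D<..D + Suc M}. 1 / (real p)\<^sup>2) = 1 / (real (D + Suc M))\<^sup>2 + (SUM p:{D<..D + M}. 1 / (real p)\<^sup>2)" by simp
  also have "1 / (real (D + Suc M))\<^sup>2 <= 1 / real (D + M) - 1 / real (D + Suc M)"
  proof -
   define x where "x = real (D + M)"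
   have x: "x > 0" using assms(3) by (simp add: x_def)
   have "1 / (x + 1)\<^sup>2 <= 1 / (x * (x + 1))"
    using x by (intro divide_left_mono) (auto simp: power2_eq_square)
   also have "... = 1 / x - 1 / (x + 1)" using x by (simp add: field_simps)
   finally show ?thesis by (simp add: x_def add_ac)
  qed
  finally show ?case using Suc by simp
 qed simp
 also have "... <= 1 / real D" by simp
 finally show ?thesis .
qed

lemma sum_Pow_subset_swap:
 assumes "finite P"
 shows "(SUM V:Pow P. SUM S:Pow V. f S (V - S)) = (SUM S:Pow P. SUM T:Pow (P - S). f S T)"
proof -
 have "(SUM V:Pow P. SUM S:Pow V. f S (V - S)) = (SUM x:(SIGMA V:Pow P. Pow V). f (snd x) (fst x - snd x))"
  using assms by (subst sum.Sigma) (auto intro: finite_subset simp: case_prod_beta)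
 also have "... = (SUM x:(SIGMA S:Pow P. Pow (P - S)). f (fst x) (snd x))"
  by (rule sum.reindex_bij_witness[of _ "%x. (fst x Un snd x, fst x)" "%x. (snd x, fst x - snd x)"]) auto
 also have "... = (SUM S:Pow P. SUM T:Pow (P - S). f S T)"
  using assms by (subst sum.Sigma) (auto intro: finite_subset simp: case_prod_beta)
 finally show ?thesis .
qed

lemma sum_image_eq:
 assumes "inj_on h S" "!!x. x : S ==> f x = g (h x)"
 shows "sum f S = sum g (h ` S)"
 using assms by (simp add: sum.reindex)

lemma inj_on_prod_primes:
 assumes "!!p. p : P ==> prime (p::nat)" "finite P"
 shows "inj_on (%V. \<Prod>V) (Pow P)"
proof (rule inj_onI)
 fix V U assume VU: "V : Pow P" "U : Pow P" "\<Prod>V = \<Prod>U"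
 hence "finite V" "finite U" using assms(2) finite_subset by auto
 hence ab: "prime_factors (\<Prod>V) = V" "prime_factors (\<Prod>U) = U"
  using VU(1,2) assms(1) by (auto intro!: prime_factors_prod_primes(1))
 have "prime_factors (\<Prod>V) = prime_factors (\<Prod>U)" by (simp only: VU(3))
 thus "V = U" by (rule box_equals[OF _ ab])
qed

context presieve
begin

text \<open>The part of \<open>Bz k j\<close> carried by squarefree products of primes from
  \<open>P\<close>: \<open>k ^ card V\<close> counts the ordered factorisations of
  \<open>\<Prod>V\<close> into \<open>k\<close> factors.\<close>

definition Vs :: "nat => nat => nat set => real => real" where
 "Vs k j P z = (SUM V:Pow P. real k ^ card V / rP V * Bz 0 j (z / rP V))"

lemma Vs_0: assumes "finite P" shows "Vs 0 j P z = Bz 0 j z"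
proof -
 have "Vs 0 j P z = (SUM V:{{}}. real 0 ^ card V / rP V * Bz 0 j (z / rP V))"
  unfolding Vs_def using assms by (intro sum.mono_neutral_right) (auto simp: card_eq_0_iff dest: finite_subset)
 thus ?thesis by simp
qed

lemma Vs_Suc:
 assumes P: "finite P"
 shows "Vs (Suc k) j P z = (SUM S:Pow P. (SUM T:Pow (P - S). real k ^ card T / rP T * Bz 0 j (z / rP S / rP T)) / rP S)"
proof -
 define f where "f S T = real k ^ card T / rP T * Bz 0 j (z / rP S / rP T) / rP S" for S T
 have "Vs (Suc k) j P z = (SUM V:Pow P. SUM S:Pow V. f S (V - S))"
  unfolding Vs_def
 proof (intro sum.cong refl)
  fix V assume "V : Pow P"
  hence V: "finite V" using P finite_subset by auto
  have pr: "rP V = rP S * rP (V - S)" if "S : Pow V" for S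
   using that V by (simp only: of_nat_mult[symmetric]) (subst prod.subset_diff[of S V], auto simp: mult.commute)
  have "real (Suc k) ^ card V / rP V * Bz 0 j (z / rP V) = 
   (SUM S:Pow V. real k ^ card (V - S) / rP V * Bz 0 j (z / rP V))"
   using sum_Pow_times_card[OF V, of "real k"] by (simp add: sum_distrib_right[symmetric] sum_divide_distrib[symmetric] add.commute)
  also have "... = (SUM S:Pow V. f S (V - S))"
   unfolding f_def
  proof (intro sum.cong refl)
   fix S assume "S : Pow V"
   from pr[OF this] show "real k ^ card (V - S) / rP V * Bz 0 j (z / rP V) = 
    real k ^ card (V - S) / rP (V - S) * Bz 0 j (z / rP S / rP (V - S)) / rP S"
    by (simp del: Bz.simps of_nat_prod)
  qed
  finally show "real (Suc k) ^ card V / rP V * Bz 0 j (z / rP V) = (SUM S:Pow V. f S (V - S))" .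
 qed
 also have "... = (SUM S:Pow P. SUM T:Pow (P - S). f S T)" by (rule sum_Pow_subset_swap[OF P])
 finally show ?thesis by (simp only: f_def sum_divide_distrib)
qed

lemma Vs_term_nonneg: "0 <= real k ^ card V / rP V * Bz 0 j x"
 by (intro mult_nonneg_nonneg Bz_nonneg divide_nonneg_nonneg zero_le_power of_nat_0_le_iff)

lemma cop_prod:
 assumes P: "finite V" "!!p. p : V ==> prime p & D0 < p"
 shows "cop (\<Prod>V)" "\<Prod>V >= 1"
proof -
 have "\<Prod>V > 0" using prime_factors_prod_primes(3)[of V] P by blast
 thus "\<Prod>V >= 1" by linarith
 show "cop (\<Prod>V)" unfolding cop_def
 proof
  fix p assume p: "p : W0"
  show "~ p dvd \<Prod>V"
  proof
   assume "p dvd \<Prod>V"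
   then obtain qq where "qq : V" "p dvd qq" using P(1) prime_W0[OF p] prime_dvd_prod_iff[of V p "%x. x"] by auto
   hence "p = qq" using P prime_W0[OF p] primes_dvd_imp_eq by blast
   thus False using P(2)[OF \<open>qq : V\<close>] p by (simp add: W0_def)
  qed
 qed
qed

text \<open>Splitting off one of the \<open>k\<close> factors turns \<open>V\<close> into
  \<open>S\<close> and a remainder; the products \<open>\<Prod>S\<close> are distinct integers prime
  to \<open>W\<close>, and dropping their disjointness from the rest only enlarges the sum.\<close>

lemma Vs_le_Bz:
 assumes P: "finite P" "!!p. p : P ==> prime p & D0 < p"
 shows "Vs k j P z <= Bz k j z"
proof (induction k arbitrary: z)
 case 0
 thus ?case using Vs_0[OF P(1)] by simp
next
 case (Suc k)
 have "Vs (Suc k) j P z <= (SUM S:Pow P. Bz k j (z / rP S) / rP S)"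
  unfolding Vs_Suc[OF P(1)]
 proof (intro sum_mono divide_right_mono)
  fix S assume "S : Pow P"
  have "(SUM T:Pow (P - S). real k ^ card T / rP T * Bz 0 j (z / rP S / rP T)) <= Vs k j P (z / rP S)"
   unfolding Vs_def using P(1) by (intro sum_mono2 Vs_term_nonneg) auto
  also have "... <= Bz k j (z / rP S)" by (rule Suc.IH)
  finally show "(SUM T:Pow (P - S). real k ^ card T / rP T * Bz 0 j (z / rP S / rP T)) <= Bz k j (z / rP S)" .
 qed (rule of_nat_0_le_iff)
 also have "... = (SUM r:(%S. \<Prod>S) ` Pow P. Bz k j (z / real r) / real r)"
  by (subst sum.reindex[OF inj_on_prod_primes]) (use P in auto)
 also have "... <= Bz (Suc k) j z"
 proof (rule Bz_Suc_ge)
  fix r assume "r : (%S. \<Prod>S) ` Pow P"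
  then obtain S where "S \<subseteq> P" "r = \<Prod>S" by auto
  thus "r >= 1 & cop r" using cop_prod[of S] P finite_subset by blast
 qed (use P in auto)
 finally show ?case .
qed

text \<open>What \<open>Bz\<close> counts and \<open>Vs\<close> does not has a repeated prime factor
  beyond \<open>D0\<close>, and pulling it out twice costs the inverse square. When a new factor
  \<open>r\<close> joins a set \<open>T\<close>, either the square of a prime divides
  \<open>r\<close>, or a prime of \<open>r\<close> lies in \<open>T\<close>; the costs are 1 and
  \<open>k\<close> times \<open>1 / D0\<close>. As \<open>k ^ 2 + k + 1\<close> is at most
  \<open>(k + 1) ^ 2\<close>, the induction closes.\<close>

lemma Bz_le_Vs:
 assumes P: "finite P" "!!p. p : P ==> prime p & D0 < p"
 shows "(!!p. prime p ==> D0 < p ==> real p <= z ==> p : P) ==> Bz k j z <= Vs k j P z + real (k\<^sup>2) / D0 * Bz k j z"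
proof (induction k arbitrary: z)
 case 0
 thus ?case using Vs_0[OF P(1)] by simp
next
 case (Suc k)
 have D0r: "real D0 >= 1" using D0 by simp
 let ?X = "{r:{1..nat \<lfloor>z\<rfloor>}. cop r}"
 define t where "t r T = real k ^ card T / rP T * Bz 0 j (z / real r / rP T) / real r" for r :: nat and T
 have t0: "0 <= t r T" for r T unfolding t_def by (intro divide_nonneg_nonneg Vs_term_nonneg) auto
 have X: "r >= 1" "real r <= z" "cop r" if "r : ?X" for r using that by (auto simp: le_nat_floor_iff)
 have "Bz (Suc k) j z <= (SUM r:?X. (Vs k j P (z / r) + real (k\<^sup>2) / D0 * Bz k j (z / r)) / r)"
  unfolding Bz.simps(2)
 proof (intro sum_mono divide_right_mono Suc.IH)
  fix r p assume r: "r : ?X" and p: "prime p" "D0 < p" "real p <= z / real r"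
  have "z / real r <= z / 1" using X[OF r] by (intro divide_left_mono) auto
  hence "z / real r <= z" by simp
  thus "p : P" using p Suc.prems by force
 qed auto
 also have "... = (SUM r:?X. Vs k j P (z / r) / r) + real (k\<^sup>2) / D0 * Bz (Suc k) j z"
  by (simp add: add_divide_distrib sum.distrib sum_distrib_left)
 also have "(SUM r:?X. Vs k j P (z / r) / r) <= Vs (Suc k) j P z + (real k + 1) / D0 * Bz (Suc k) j z"
 proof -
  let ?good = "%r T. squarefree r & prime_factors r Int T = {}"
  let ?b1 = "%p r. p\<^sup>2 dvd r"
  let ?b2 = "%p r T. p dvd r & p : T"
  have pf: "prime_factors r \<subseteq> P" if "r : ?X" for r
  proof
   fix p assume p: "p : prime_factors r"
   hence "prime p" "p dvd r" by auto
   moreover have "D0 < p"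
   proof (rule ccontr)
    assume "~ D0 < p"
    hence "p : W0" using \<open>prime p\<close> by (simp add: W0_def)
    thus False using X(3)[OF that] \<open>p dvd r\<close> by (simp add: cop_def)
   qed
   moreover have "real p <= z"
   proof -
    have "p <= r" using X(1)[OF that] \<open>p dvd r\<close> by (intro dvd_imp_le) auto
    hence "real p <= real r" by simp
    thus ?thesis using X(2)[OF that] by linarith
   qed
   ultimately show "p : P" using Suc.prems by blast
  qed
  have "(SUM r:?X. Vs k j P (z / r) / r) = (SUM r:?X. SUM T:Pow P. t r T)"
   by (simp only: Vs_def t_def sum_divide_distrib)
  also have "... <= (SUM r:?X. SUM T:Pow P. (if ?good r T then t r T else 0) + (SUM p:P. (if ?b1 p r then t r T else 0) + (if ?b2 p r T then t r T else 0)))"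
  proof (intro sum_mono)
   fix r T assume r: "r : ?X" and T: "T : Pow P"
   show "t r T <= (if ?good r T then t r T else 0) + (SUM p:P. (if ?b1 p r then t r T else 0) + (if ?b2 p r T then t r T else 0))"
   proof (cases "?good r T")
    case True
    thus ?thesis using t0 by (auto intro!: sum_nonneg)
   next
    case False
    have "EX p:P. ?b1 p r | ?b2 p r T"
    proof (cases "squarefree r")
     case True
     then obtain p where "p : prime_factors r" "p : T" using False by blast
     thus ?thesis using pf[OF r] by auto
    next
     case F: False
     have "r ~= 0" using X(1)[OF r] by simp
     then obtain p where "prime p" "p\<^sup>2 dvd r" using F squarefree_factorial_semiring by blast
     hence "p : prime_factors r" using \<open>r ~= 0\<close> by (auto simp: prime_factors_dvd dest: dvd_trans[rotated] intro: dvd_trans[of p "p\<^sup>2" r])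
     thus ?thesis using pf[OF r] \<open>p\<^sup>2 dvd r\<close> by blast
    qed
    then obtain p where p: "p : P" "?b1 p r | ?b2 p r T" by blast
    hence "t r T <= (if ?b1 p r then t r T else 0) + (if ?b2 p r T then t r T else 0)" using t0 by auto
    also have "... <= (SUM p:P. (if ?b1 p r then t r T else 0) + (if ?b2 p r T then t r T else 0))"
     using P(1) p(1) t0 by (intro member_le_sum) auto
    finally show ?thesis unfolding if_not_P[OF False] by simp
   qed
  qed
  also have "... = (SUM r:?X. SUM T:Pow P. if ?good r T then t r T else 0) + 
   (SUM p:P. (SUM r:?X. SUM T:Pow P. if ?b1 p r then t r T else 0) + (SUM r:?X. SUM T:Pow P. if ?b2 p r T then t r T else 0))"
  proof -
   have sw: "(SUM r:?X. SUM T:Pow P. SUM p:P. g r T p) = (SUM p:P. SUM r:?X. SUM T:Pow P. g r T p)" for g :: "nat => nat set => nat => real"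
    by (subst sum.swap[of _ P "Pow P"]) (subst sum.swap[of _ P ?X], rule refl)
   show ?thesis by (simp only: sum.distrib sw)
  qed
  also have "(SUM r:?X. SUM T:Pow P. if ?good r T then t r T else 0) <= Vs (Suc k) j P z"
  proof -
   have "(SUM r:?X. SUM T:Pow P. if ?good r T then t r T else 0) = (SUM r:{r:?X. squarefree r}. SUM T:Pow (P - prime_factors r). t r T)"
   proof (rule sum.mono_neutral_cong_right)
    show "(SUM T:Pow P. if ?good r T then t r T else 0) = (SUM T:Pow (P - prime_factors r). t r T)" if "r : {r:?X. squarefree r}" for r
     by (rule sum.mono_neutral_cong_right) (use that P(1) in auto)
   qed auto
   also have "... = (SUM S:prime_factors ` {r:?X. squarefree r}. SUM T:Pow (P - S). t (\<Prod>S) T)"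
   proof (subst sum.reindex)
    show "inj_on prime_factors {r:?X. squarefree r}"
     by (rule inj_onI) (metis (mono_tags, lifting) mem_Collect_eq prod_prime_factors_squarefree)
   qed (auto simp: prod_prime_factors_squarefree intro!: sum.cong)
   also have "... <= (SUM S:Pow P. SUM T:Pow (P - S). t (\<Prod>S) T)"
    using pf P(1) t0 by (intro sum_mono2 sum_nonneg) auto
   also have "... = Vs (Suc k) j P z" unfolding Vs_Suc[OF P(1)] t_def by (simp only: sum_divide_distrib)
   finally show ?thesis .
  qed
  also have "(SUM p:P. (SUM r:?X. SUM T:Pow P. if ?b1 p r then t r T else 0) + (SUM r:?X. SUM T:Pow P. if ?b2 p r T then t r T else 0)) <=
   (SUM p:P. (1 / (real p)\<^sup>2) * Bz (Suc k) j z + (real k * (1 / (real p)\<^sup>2)) * Bz (Suc k) j z)"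
  proof (intro sum_mono add_mono)
   fix p assume p: "p : P"
   have p0: "p >= 1" "real p >= 1" "D0 < p" "prime p" using P(2)[OF p] by auto
   have div: "cop (r div d) & r div d >= 1" if "r : ?X" "d dvd r" for r d
   proof -
    have "r div d >= 1" using X(1)[OF that(1)] that(2) by (metis One_nat_def Suc_leI dvd_div_eq_0_iff neq0_conv not_one_le_zero)
    moreover have "cop (r div d)" using X(3)[OF that(1)] that(2) unfolding cop_def by (metis div_dvd_iff_mult dvd_div_mult_self dvd_mult2 dvd_trans dvd_triv_left)
    ultimately show ?thesis by blast
   qed
   have shrink: "Bz (Suc k) j (z / (real p)\<^sup>2) <= Bz (Suc k) j z"
   proof (cases "z >= 0")
    case True
    have "z / (real p)\<^sup>2 <= z / 1" using p0 True by (intro divide_left_mono) auto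
    thus ?thesis by (intro Bz_mono) simp
   next
    case False
    hence "z / (real p)\<^sup>2 < 1" by (simp add: divide_less_eq) (smt (verit) zero_le_power2)
    thus ?thesis by (simp only: Bz_less_1 Bz_nonneg)
   qed
   have Vt: "(SUM T:Pow P. t' r T) <= Bz k j (z' / r) / r" if "!!T. t' r T = real k ^ card T / rP T * Bz 0 j (z' / real r / rP T) / real r" for t' z' and r :: nat
    unfolding that sum_divide_distrib[symmetric] using Vs_le_Bz[OF P, of k j "z' / r"] by (intro divide_right_mono) (simp_all add: Vs_def del: Bz.simps)
   show "(SUM r:?X. SUM T:Pow P. if ?b1 p r then t r T else 0) <= 1 / (real p)\<^sup>2 * Bz (Suc k) j z"
   proof -
    have "(SUM r:?X. SUM T:Pow P. if ?b1 p r then t r T else 0) = (SUM r:{r:?X. p\<^sup>2 dvd r}. SUM T:Pow P. t r T)"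
     by (rule sum.mono_neutral_cong_right) auto
    also have "... <= (SUM r:{r:?X. p\<^sup>2 dvd r}. Bz k j (z / r) / r)"
     by (intro sum_mono Vt) (simp only: t_def)
    also have "... = (SUM r:(%r. r div p\<^sup>2) ` {r:?X. p\<^sup>2 dvd r}. 1 / (real p)\<^sup>2 * (Bz k j (z / (real p)\<^sup>2 / r) / r))"
    proof (rule sum_image_eq)
     show "inj_on (%r. r div p\<^sup>2) {r:?X. p\<^sup>2 dvd r}" by (rule inj_onI) (metis (mono_tags, lifting) dvd_div_mult_self mem_Collect_eq)
     fix r assume "r : {r:?X. p\<^sup>2 dvd r}"
     hence "real r = (real p)\<^sup>2 * real (r div p\<^sup>2)" by (auto simp flip: of_nat_power of_nat_mult)
     thus "Bz k j (z / r) / r = 1 / (real p)\<^sup>2 * (Bz k j (z / (real p)\<^sup>2 / (r div p\<^sup>2)) / (r div p\<^sup>2))" by simp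
    qed
    also have "... <= 1 / (real p)\<^sup>2 * Bz (Suc k) j (z / (real p)\<^sup>2)"
     unfolding sum_distrib_left[symmetric] using div by (intro mult_left_mono Bz_Suc_ge) auto
    also have "... <= 1 / (real p)\<^sup>2 * Bz (Suc k) j z" using shrink by (intro mult_left_mono) auto
    finally show ?thesis .
   qed
   show "(SUM r:?X. SUM T:Pow P. if ?b2 p r T then t r T else 0) <= real k * (1 / (real p)\<^sup>2) * Bz (Suc k) j z"
   proof -
    have "(SUM r:?X. SUM T:Pow P. if ?b2 p r T then t r T else 0) = (SUM r:{r:?X. p dvd r}. SUM T:{T:Pow P. p : T}. t r T)"
    proof (rule sum.mono_neutral_cong_right)
     show "(SUM T:Pow P. if ?b2 p r T then t r T else 0) = (SUM T:{T:Pow P. p : T}. t r T)" if "r : {r:?X. p dvd r}" for r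
      by (rule sum.mono_neutral_cong_right) (use that P(1) in auto)
    qed auto
    also have "... = (SUM r:{r:?X. p dvd r}. SUM T:Pow (P - {p}). t r (insert p T))"
     by (rule sum.cong[OF refl], rule sum.reindex_bij_witness[of _ "insert p" "%T. T - {p}"])
      (use p in \<open>auto simp: insert_absorb\<close>)
    also have "... <= (SUM r:{r:?X. p dvd r}. real k / real p * (Bz k j (z / p / r) / r))"
    proof (intro sum_mono)
     fix r assume "r : {r:?X. p dvd r}"
     have "(SUM T:Pow (P - {p}). t r (insert p T)) = (SUM T:Pow (P - {p}). real k / real p * (real k ^ card T / rP T * Bz 0 j (z / p / real r / rP T) / real r))"
     proof (intro sum.cong refl)
      fix T assume T: "T : Pow (P - {p})"
      hence "finite T" "p ~: T" using P(1) finite_subset by auto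
      thus "t r (insert p T) = real k / real p * (real k ^ card T / rP T * Bz 0 j (z / p / real r / rP T) / real r)"
       unfolding t_def by (simp add: mult_ac del: Bz.simps)
     qed
     also have "... <= (SUM T:Pow P. real k / real p * (real k ^ card T / rP T * Bz 0 j (z / p / real r / rP T) / real r))"
      using P(1) by (intro sum_mono2 mult_nonneg_nonneg[OF _ divide_nonneg_nonneg[OF Vs_term_nonneg]]) auto
     also have "... <= real k / real p * (Bz k j (z / p / r) / r)"
      unfolding sum_distrib_left[symmetric] by (intro mult_left_mono Vt) auto
     finally show "(SUM T:Pow (P - {p}). t r (insert p T)) <= real k / real p * (Bz k j (z / p / r) / r)" .
    qed
    also have "... = (SUM r:(%r. r div p) ` {r:?X. p dvd r}. real k * (1 / (real p)\<^sup>2) * (Bz k j (z / (real p)\<^sup>2 / r) / r))"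
    proof (rule sum_image_eq)
     show "inj_on (%r. r div p) {r:?X. p dvd r}" by (rule inj_onI) (metis (mono_tags, lifting) dvd_div_mult_self mem_Collect_eq)
     fix r assume "r : {r:?X. p dvd r}"
     hence "real r = real p * real (r div p)" by (auto simp flip: of_nat_power of_nat_mult)
     thus "real k / real p * (Bz k j (z / p / r) / r) = real k * (1 / (real p)\<^sup>2) * (Bz k j (z / (real p)\<^sup>2 / (r div p)) / (r div p))"
      by (simp add: power2_eq_square mult.assoc)
    qed
    also have "... <= real k * (1 / (real p)\<^sup>2) * Bz (Suc k) j (z / (real p)\<^sup>2)"
     unfolding sum_distrib_left[symmetric] using div by (intro mult_left_mono Bz_Suc_ge) auto
    also have "... <= real k * (1 / (real p)\<^sup>2) * Bz (Suc k) j z" using shrink by (intro mult_left_mono) auto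
    finally show ?thesis .
   qed
  qed
  also have "... = (real k + 1) * (SUM p:P. 1 / (real p)\<^sup>2) * Bz (Suc k) j z"
   unfolding sum.distrib[symmetric] sum_distrib_left sum_distrib_right
   by (intro sum.cong refl) (simp only: algebra_simps)
  also have "... <= (real k + 1) * (1 / D0) * Bz (Suc k) j z"
   using P D0 by (intro mult_right_mono mult_left_mono sum_inverse_squares_le Bz_nonneg) auto
  finally show ?thesis by simp
 qed
 finally have "Bz (Suc k) j z <= Vs (Suc k) j P z + (real k + 1) / D0 * Bz (Suc k) j z + real (k\<^sup>2) / D0 * Bz (Suc k) j z" by simp
 also have "... = Vs (Suc k) j P z + (real k + 1 + real (k\<^sup>2)) / D0 * Bz (Suc k) j z" by (simp add: add_divide_distrib distrib_right del: Bz.simps)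
 also have "... <= Vs (Suc k) j P z + real ((Suc k)\<^sup>2) / D0 * Bz (Suc k) j z"
  using D0r by (intro add_left_mono mult_right_mono divide_right_mono Bz_nonneg) (auto simp: power2_eq_square algebra_simps)
 finally show ?case .
qed

text \<open>The factors \<open>1 + a p\<close> are multiplied out. What remains next to each
  perturbation is again bounded by \<open>Vs\<close>, and the perturbations together give a product
  over primes beyond \<open>D0\<close>, which converges to within
  \<open>exp (k * A / D0)\<close>.\<close>

lemma inflated_sum_le:
 fixes a :: "nat => real"
 assumes P: "finite P" "!!p. p : P ==> prime p & D0 < p" and a: "!!p. p : P ==> 0 <= a p & a p <= A / p" and A: "0 <= A"
 shows "(SUM V:Pow P. (if rP V <= z then (PROD p:V. real k / p * (1 + a p)) else 0)) <= exp (k * A / D0) * Bz k 0 z"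
proof -
 let ?z1 = "PROD p:P. real k / p * a p + 1"
 have dl: "(if rP V <= z then 1 else 0) = Bz 0 0 (z / rP V)" if "V : Pow P" for V
 proof -
  have "finite V" "!!p. p : V ==> prime p & D0 < p" using that P finite_subset by auto
  hence "\<Prod>V >= 1" by (rule cop_prod(2))
  hence "rP V > 0" by (simp only: of_nat_0_less_iff)
  thus ?thesis by (simp add: le_divide_eq)
 qed
 define f where "f E U = (PROD p:E. real k / p * a p) * ((PROD p:U. real k / p) * Bz 0 0 (z / rP E / rP U))" for E U
 have "(SUM V:Pow P. (if rP V <= z then (PROD p:V. real k / p * (1 + a p)) else 0)) =
   (SUM V:Pow P. SUM E:Pow V. f E (V - E))"
 proof (intro sum.cong refl)
  fix V assume V: "V : Pow P"
  hence fV: "finite V" using P(1) finite_subset by auto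
  have "(if rP V <= z then (PROD p:V. real k / p * (1 + a p)) else 0) = (PROD p:V. real k / p * a p + real k / p) * Bz 0 0 (z / rP V)"
   unfolding dl[OF V, symmetric] distrib_left by (simp add: add.commute)
  also have "... = (SUM E:Pow V. (PROD p:E. real k / p * a p) * (PROD p:V - E. real k / p)) * Bz 0 0 (z / rP V)"
   by (subst prod_add[OF fV]) simp
  also have "... = (SUM E:Pow V. f E (V - E))"
   unfolding sum_distrib_right f_def
  proof (intro sum.cong refl)
   fix E assume "E : Pow V"
   hence "rP V = rP E * rP (V - E)"
    using fV by (simp only: of_nat_mult[symmetric]) (subst prod.subset_diff[of E V], auto simp: mult.commute)
   thus "(PROD p:E. real k / p * a p) * (PROD p:V - E. real k / p) * Bz 0 0 (z / rP V) =
    (PROD p:E. real k / p * a p) * ((PROD p:V - E. real k / p) * Bz 0 0 (z / rP E / rP (V - E)))"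
    by (simp del: Bz.simps of_nat_prod)
  qed
  finally show "(if rP V <= z then (PROD p:V. real k / p * (1 + a p)) else 0) = (SUM E:Pow V. f E (V - E))" .
 qed
 also have "... = (SUM E:Pow P. SUM U:Pow (P - E). f E U)" by (rule sum_Pow_subset_swap[OF P(1)])
 also have "... <= (SUM E:Pow P. (PROD p:E. real k / p * a p) * Bz k 0 z)"
 proof (intro sum_mono)
  fix E assume E: "E : Pow P"
  have pos: "0 <= (PROD p:E. real k / p * a p)" using E a by (intro prod_nonneg) auto
  have "(SUM U:Pow (P - E). f E U) <= (PROD p:E. real k / p * a p) * (SUM U:Pow P. (PROD p:U. real k / p) * Bz 0 0 (z / rP E / rP U))"
   unfolding f_def sum_distrib_left[symmetric]
   using P(1) by (intro mult_left_mono[OF _ pos] sum_mono2 mult_nonneg_nonneg Bz_nonneg prod_nonneg) auto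
  also have "(SUM U:Pow P. (PROD p:U. real k / p) * Bz 0 0 (z / rP E / rP U)) = Vs k 0 P (z / rP E)"
   unfolding Vs_def by (intro sum.cong refl) (simp add: prod_dividef del: Bz.simps)
  also have "... <= Bz k 0 (z / rP E)" by (rule Vs_le_Bz[OF P])
  also have "... <= Bz k 0 z"
  proof (cases "z >= 0")
   case True
   have "finite E" "!!p. p : E ==> prime p & D0 < p" using E P finite_subset by auto
   hence "\<Prod>E >= 1" by (rule cop_prod(2))
   hence "rP E >= 1" by (rule real_of_nat_ge_one_iff[THEN iffD2])
   hence "z / rP E <= z / 1" using True by (intro divide_left_mono) auto
   thus ?thesis by (intro Bz_mono) simp
  next
   case False
   hence "z / rP E <= 0" by (intro divide_nonpos_nonneg of_nat_0_le_iff) auto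
   thus ?thesis by (subst Bz_less_1) (auto simp: Bz_nonneg)
  qed
  finally show "(SUM U:Pow (P - E). f E U) <= (PROD p:E. real k / p * a p) * Bz k 0 z" using pos by (simp add: mult_left_mono)
 qed
 also have "... = (SUM E:Pow P. (PROD p:E. real k / p * a p) * (PROD p:P - E. 1)) * Bz k 0 z" by (simp add: sum_distrib_right)
 also have "... = ?z1 * Bz k 0 z" by (subst prod_add[OF P(1)]) simp
 also have "... <= exp (k * A / D0) * Bz k 0 z"
 proof (intro mult_right_mono Bz_nonneg)
  have "?z1 <= (PROD p:P. exp (real k * A * (1 / (real p)\<^sup>2)))"
  proof (intro prod_mono conjI)
   fix p assume p: "p : P"
   have p0: "real p > 0" using P(2)[OF p] prime_gt_0_nat by auto
   show "0 <= real k / p * a p + 1" using a[OF p] by (intro add_nonneg_nonneg mult_nonneg_nonneg) auto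
   have "real k / p * a p <= real k / p * (A / p)" using a[OF p] by (intro mult_left_mono) auto
   also have "... = real k * A * (1 / (real p)\<^sup>2)" by (simp add: power2_eq_square)
   finally have "real k / p * a p <= real k * A * (1 / (real p)\<^sup>2)" .
   thus "real k / p * a p + 1 <= exp (real k * A * (1 / (real p)\<^sup>2))"
    using exp_ge_add_one_self[of "real k * A * (1 / (real p)\<^sup>2)"] by linarith
  qed
  also have "... = exp (real k * A * (SUM p:P. 1 / (real p)\<^sup>2))" using P(1) by (simp add: exp_sum sum_distrib_left)
  also have "... <= exp (k * A / D0)"
  proof -
   have "real k * A * (SUM p:P. 1 / (real p)\<^sup>2) <= real k * A * (1 / D0)"
    using P D0 A by (intro mult_left_mono sum_inverse_squares_le) auto
   thus ?thesis by simp
  qed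
  finally show "?z1 <= exp (k * A / D0)" .
 qed
 finally show ?thesis .
qed

end

section \<open>Selberg weights\<close>

lemma sum_Pow_split:
 assumes "V \<subseteq> P" "finite P"
 shows "(SUM D:Pow P. F D) = (SUM D1:Pow V. SUM D2:Pow (P - V). F (D1 Un D2))"
proof -
 have "(SUM D:Pow P. F D) = (SUM x:Pow V \<times> Pow (P - V). F (fst x Un snd x))"
  by (rule sum.reindex_bij_witness[of _ "%x. fst x Un snd x" "%D. (D Int V, D - V)"])
   (use assms in \<open>auto simp: Int_Un_distrib2 intro: arg_cong[of _ _ F]\<close>)
 thus ?thesis by (simp add: sum.cartesian_product case_prod_beta)
qed

lemma prod_Un_eq:
 fixes h :: "'a => real"
 assumes "finite D" "finite E" "!!p. p : D Un E ==> h p ~= 0"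
 shows "(PROD p:D Un E. 1 / h p) = (PROD p:D. 1 / h p) * (PROD p:E. 1 / h p) * (PROD p:D Int E. h p)"
proof -
 have "(PROD p:D. 1 / h p) * (PROD p:E. 1 / h p) = (PROD p:D Un E. 1 / h p) * (PROD p:D Int E. 1 / h p)"
  using assms by (simp add: prod.union_inter)
 moreover have "(PROD p:D Int E. 1 / h p) * (PROD p:D Int E. h p) = 1"
  unfolding prod.distrib[symmetric] using assms by (intro prod.neutral) auto
 ultimately show ?thesis by (metis mult.assoc mult.right_neutral)
qed

text \<open>On \<open>D Int E\<close> the product of \<open>h = (h - 1) + 1\<close> is expanded over
  subsets \<open>S\<close>; after that the variables \<open>D\<close> and \<open>E\<close>
  separate.\<close>

lemma selberg_diagonal:
 fixes h :: "'a => real"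
 assumes P: "finite P" and h: "!!p. p : P ==> h p ~= 0"
 shows "(SUM D:Pow P. SUM E:Pow P. a D * b E * (PROD p:D Un E. 1 / h p)) =
  (SUM S:Pow P. (PROD p:S. h p - 1) * (SUM D:{D:Pow P. S \<subseteq> D}. a D * (PROD p:D. 1 / h p)) * (SUM E:{E:Pow P. S \<subseteq> E}. b E * (PROD p:E. 1 / h p)))"
proof -
 define A where "A D = a D * (PROD p:D. 1 / h p)" for D
 define B where "B D = b D * (PROD p:D. 1 / h p)" for D
 define G where "G S = (PROD p:S. h p - 1)" for S
 have fin: "finite D" if "D : Pow P" for D using that P finite_subset by auto
 have "(SUM D:Pow P. SUM E:Pow P. a D * b E * (PROD p:D Un E. 1 / h p)) =
   (SUM D:Pow P. SUM E:Pow P. SUM S:{S:Pow P. S \<subseteq> D & S \<subseteq> E}. A D * B E * G S)"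
 proof (intro sum.cong refl)
  fix D E assume D: "D : Pow P" and E: "E : Pow P"
  have "(PROD p:D Int E. h p) = (PROD p:D Int E. (h p - 1) + 1)" by simp
  also have "... = (SUM S:Pow (D Int E). (PROD p:S. h p - 1) * (PROD p:D Int E - S. 1))"
   using fin[OF D] by (intro prod_add) auto
  also have "Pow (D Int E) = {S:Pow P. S \<subseteq> D & S \<subseteq> E}" using D by auto
  finally have "(PROD p:D Int E. h p) = (SUM S:{S:Pow P. S \<subseteq> D & S \<subseteq> E}. G S)" by (simp add: G_def)
  moreover have "a D * b E * (PROD p:D Un E. 1 / h p) = A D * B E * (PROD p:D Int E. h p)"
   using prod_Un_eq[of D E h] fin D E h by (auto simp: A_def B_def mult_ac)
  ultimately show "a D * b E * (PROD p:D Un E. 1 / h p) = (SUM S:{S:Pow P. S \<subseteq> D & S \<subseteq> E}. A D * B E * G S)"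
   by (simp add: sum_distrib_left)
 qed
 also have "... = (SUM D:Pow P. SUM E:Pow P. SUM S:Pow P. if S \<subseteq> D & S \<subseteq> E then A D * B E * G S else 0)"
  using P by (intro sum.cong refl sum.mono_neutral_cong_left) auto
 also have "... = (SUM D:Pow P. SUM S:Pow P. SUM E:Pow P. if S \<subseteq> D & S \<subseteq> E then A D * B E * G S else 0)"
  by (intro sum.cong refl sum.swap)
 also have "... = (SUM S:Pow P. SUM D:Pow P. SUM E:Pow P. if S \<subseteq> D & S \<subseteq> E then A D * B E * G S else 0)"
  by (rule sum.swap)
 also have "... = (SUM S:Pow P. SUM D:{D:Pow P. S \<subseteq> D}. SUM E:{E:Pow P. S \<subseteq> E}. A D * B E * G S)"
 proof (rule sum.cong[OF refl])
  fix S
  have "(SUM D:Pow P. SUM E:Pow P. if S \<subseteq> D & S \<subseteq> E then A D * B E * G S else 0) =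
   (SUM D:{D:Pow P. S \<subseteq> D}. SUM E:Pow P. if S \<subseteq> E then A D * B E * G S else 0)"
   using P by (intro sum.mono_neutral_cong_right) auto
  also have "... = (SUM D:{D:Pow P. S \<subseteq> D}. SUM E:{E:Pow P. S \<subseteq> E}. A D * B E * G S)"
   using P by (intro sum.cong refl sum.mono_neutral_cong_right) auto
  finally show "(SUM D:Pow P. SUM E:Pow P. if S \<subseteq> D & S \<subseteq> E then A D * B E * G S else 0) =
   (SUM D:{D:Pow P. S \<subseteq> D}. SUM E:{E:Pow P. S \<subseteq> E}. A D * B E * G S)" .
 qed
 also have "... = (SUM S:Pow P. G S * (SUM D:{D:Pow P. S \<subseteq> D}. A D) * (SUM E:{E:Pow P. S \<subseteq> E}. B E))"
  by (simp add: sum_product sum_distrib_left sum_distrib_right mult_ac)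
 finally show ?thesis by (simp add: A_def B_def G_def)
qed

text \<open>\<open>1 / fS p\<close> is the proportion of \<open>n\<close> for which \<open>p\<close>
  divides one of the eight \<open>n + h\<close>; \<open>1 / gS p\<close> is the same proportion for
  the seven other shifts when one \<open>n + h\<close> is known to be prime to \<open>p\<close>.
  \<open>hS\<close> is the reciprocal of \<open>fS - 1\<close>.\<close>

definition fS :: "nat => real" where "fS p = real p / 8"
definition gS :: "nat => real" where "gS p = (real p - 1) / 7"
definition hS :: "nat => real" where "hS p = 8 / (real p - 8)"

text \<open>Selberg's weights, recovered by Moebius inversion from the diagonal variables
  \<open>y\<close>: the form with density \<open>1 / fS\<close> becomes diagonal in the freely
  chosen \<open>y\<close>.\<close>

definition lamw :: "nat set => (nat set => real) => nat set => real" where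
 "lamw P y D = (-1) ^ card D * (prod fS D) * (SUM T:{T:Pow P. D \<subseteq> T}. y T * (prod hS T))"

lemma signed_sum_between:
 fixes u :: "'a => real"
 assumes T: "finite T" "S \<subseteq> T"
 shows "(SUM D:{D. S \<subseteq> D & D \<subseteq> T}. (-1) ^ card D * (PROD p:D. u p)) = (-1) ^ card S * (PROD p:S. u p) * (PROD p:T - S. 1 - u p)"
proof -
 have fS: "finite S" using T finite_subset by auto
 have "(SUM D:{D. S \<subseteq> D & D \<subseteq> T}. (-1) ^ card D * (PROD p:D. u p)) = (SUM X:Pow (T - S). (-1) ^ card (S Un X) * (PROD p:S Un X. u p))"
  by (rule sum.reindex_bij_witness[of _ "%X. S Un X" "%D. D - S"]) (use T in \<open>auto simp: Un_absorb1\<close>)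
 also have "... = (SUM X:Pow (T - S). (-1) ^ card S * (PROD p:S. u p) * ((PROD p:X. - u p) * (PROD p:T - S - X. 1)))"
 proof (intro sum.cong refl)
  fix X assume X: "X : Pow (T - S)"
  hence fX: "finite X" "S Int X = {}" using finite_subset[of X T] T(1) by auto
  have "(PROD p:X. - u p) = (PROD p:X. (-1) * u p)" by simp
  also have "... = (-1) ^ card X * (PROD p:X. u p)" by (simp only: prod.distrib prod_constant)
  finally show "(-1) ^ card (S Un X) * (PROD p:S Un X. u p) = (-1) ^ card S * (PROD p:S. u p) * ((PROD p:X. - u p) * (PROD p:T - S - X. 1))"
   using fS fX by (simp add: card_Un_disjoint prod.union_disjoint power_add)
 qed
 also have "... = (-1) ^ card S * (PROD p:S. u p) * (PROD p:T - S. - u p + 1)"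
  unfolding sum_distrib_left[symmetric] using T by (subst prod_add) auto
 finally show ?thesis by simp
qed

text \<open>The diagonal variables with respect to another density \<open>1 / g\<close>. For
  \<open>g = fS\<close> only \<open>T = {}\<close> survives, which is the inversion; for
  \<open>g = gS\<close> the factor at each prime of \<open>T\<close> is \<open>1 / (p - 1)\<close>,
  which leads to \<open>Ysum\<close>.\<close>

lemma lamw_transform:
 assumes P: "finite P" and S: "S : Pow P"
 shows "(SUM D:{D:Pow P. S \<subseteq> D}. lamw P y D * (PROD p:D. 1 / g p)) =
  (-1) ^ card S * (PROD p:S. fS p / g p * hS p) * (SUM T:Pow (P - S). y (S Un T) * (PROD p:T. (1 - fS p / g p) * hS p))"
proof -
 let ?z1 = "{T:Pow P. S \<subseteq> T}"
 let ?z2 = "PROD p:S. fS p / g p"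
 have fin: "finite D" if "D : Pow P" for D using that P finite_subset by auto
 have "(SUM D:{D:Pow P. S \<subseteq> D}. lamw P y D * (PROD p:D. 1 / g p)) =
   (SUM D:{D:Pow P. S \<subseteq> D}. SUM T:{T:Pow P. D \<subseteq> T}. (-1) ^ card D * (PROD p:D. fS p / g p) * (y T * (prod hS T)))"
  unfolding lamw_def sum_distrib_left sum_distrib_right
  by (intro sum.cong refl) (simp add: prod_dividef)
 also have "... = (SUM D:{D:Pow P. S \<subseteq> D}. SUM T:{T:?z1. D \<subseteq> T}. (-1) ^ card D * (PROD p:D. fS p / g p) * (y T * (prod hS T)))"
  by (intro sum.cong refl) auto
 also have "... = (SUM T:?z1. SUM D:{D:{D:Pow P. S \<subseteq> D}. D \<subseteq> T}. (-1) ^ card D * (PROD p:D. fS p / g p) * (y T * (prod hS T)))"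
  using P by (intro sum.swap_restrict) auto
 also have "... = (SUM T:?z1. (-1) ^ card S * ?z2 * (PROD p:T - S. 1 - fS p / g p) * (y T * (prod hS T)))"
 proof (intro sum.cong refl)
  fix T assume T: "T : ?z1"
  hence "{D:{D:Pow P. S \<subseteq> D}. D \<subseteq> T} = {D. S \<subseteq> D & D \<subseteq> T}" by auto
  thus "(SUM D:{D:{D:Pow P. S \<subseteq> D}. D \<subseteq> T}. (-1) ^ card D * (PROD p:D. fS p / g p) * (y T * (prod hS T))) =
   (-1) ^ card S * ?z2 * (PROD p:T - S. 1 - fS p / g p) * (y T * (prod hS T))"
   using T fin by (simp only: sum_distrib_right[symmetric]) (subst signed_sum_between, auto)
 qed
 also have "... = (SUM T:Pow (P - S). (-1) ^ card S * ?z2 * (PROD p:T. 1 - fS p / g p) * (y (S Un T) * (PROD p:S Un T. hS p)))"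
  by (rule sum.reindex_bij_witness[of _ "%X. S Un X" "%D. D - S"])
   (use S in \<open>auto simp: Un_absorb1 Un_Diff_cancel\<close>)
 also have "... = (SUM T:Pow (P - S). (-1) ^ card S * (PROD p:S. fS p / g p * hS p) * (y (S Un T) * (PROD p:T. (1 - fS p / g p) * hS p)))"
 proof (intro sum.cong refl)
  fix T assume T: "T : Pow (P - S)"
  hence "finite T" "finite S" "S Int T = {}" using S finite_subset[OF _ P] by auto
  thus "(-1) ^ card S * ?z2 * (PROD p:T. 1 - fS p / g p) * (y (S Un T) * (PROD p:S Un T. hS p)) =
   (-1) ^ card S * (PROD p:S. fS p / g p * hS p) * (y (S Un T) * (PROD p:T. (1 - fS p / g p) * hS p))"
   by (simp only: prod.union_disjoint prod.distrib) (simp add: mult_ac)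
 qed
 finally show ?thesis by (simp add: sum_distrib_left)
qed

lemma sieve_values:
 assumes "p >= (16::nat)"
 shows "fS p > 0" "gS p > 0" "hS p > 0" "fS p - 1 = 1 / hS p" "(1 - fS p / gS p) * hS p = 1 / (real p - 1)"
  "fS p * hS p <= 2" "1 + hS p <= 2" "fS p * hS p = 1 + hS p" "(1 - fS p) * hS p = - 1"
proof -
 have p: "real p >= 16" using assms by simp
 hence ne: "real p - 8 ~= 0" "real p - 1 ~= 0" "real p ~= 0" by auto
 show "fS p > 0" "gS p > 0" "hS p > 0" "fS p * hS p <= 2" "1 + hS p <= 2"
  using p unfolding fS_def gS_def hS_def by (auto simp: field_simps)
 show "fS p - 1 = 1 / hS p" "fS p * hS p = 1 + hS p" "(1 - fS p) * hS p = - 1"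
  using ne unfolding fS_def hS_def by (simp_all add: field_simps)
 have "1 - fS p / gS p = (real p - 8) / (8 * (real p - 1))"
  using ne unfolding fS_def gS_def by (simp add: field_simps)
 moreover have "(x - 8) / (8 * (x - 1)) * (8 / (x - 8)) = 1 / (x - 1)" if "x - 8 ~= 0" "x - 1 ~= 0" for x :: real
 proof -
  have "a / (8 * b) * (8 / a) = 1 / b" if "a ~= 0" "b ~= 0" for a b :: real using that by simp
  from this[OF that] show ?thesis .
 qed
 ultimately show "(1 - fS p / gS p) * hS p = 1 / (real p - 1)" using ne unfolding hS_def by metis
qed

text \<open>The diagonal coefficient of the form with density \<open>1 / gS\<close> in the variables
  \<open>Ysum\<close>; it is close to \<open>7 / p\<close>.\<close>

definition coefS :: "nat => real" where "coefS p = 7 * (real p)\<^sup>2 / ((real p - 1)\<^sup>2 * (real p - 8))"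

lemma coefS:
 assumes "p >= (16::nat)"
 shows "(gS p - 1) * (fS p / gS p * hS p)\<^sup>2 = coefS p" "7 / real p <= coefS p" "coefS p <= 7 / p * (1 + 40 / p)"
proof -
 define x where "x = real p - 16"
 have x: "x >= 0" "real p = x + 16" using assms by (auto simp: x_def)
 have g: "gS p - 1 = (real p - 8) / 7" by (simp add: gS_def field_simps)
 have qq: "fS p / gS p * hS p = 7 * real p / ((real p - 1) * (real p - 8))"
 proof -
  have k: "(x / 8) / ((x - 1) / 7) * (8 / (x - 8)) = 7 * x / ((x - 1) * (x - 8))" if "x - 1 ~= 0" "x - 8 ~= 0" for x :: real
   using that by (simp add: divide_simps)
  show ?thesis unfolding fS_def gS_def hS_def by (rule k) (use x in auto)
 qed
 have ne: "real p - 8 ~= 0" "real p - 1 ~= 0" using x by auto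
 show "(gS p - 1) * (fS p / gS p * hS p)\<^sup>2 = coefS p"
 proof -
  have k: "a / 7 * (7 * x / (b * a))\<^sup>2 = 7 * x\<^sup>2 / (b\<^sup>2 * a)" if "a ~= 0" "b ~= 0" for a b x :: real
   using that by (simp add: power2_eq_square divide_simps)
  show ?thesis unfolding g qq coefS_def by (rule k[OF ne])
 qed
 show "7 / real p <= coefS p"
  unfolding coefS_def x(2) using x(1) by (simp add: divide_simps) (simp add: power2_eq_square algebra_simps)
 have pos: "0 < (real p - 1)\<^sup>2 * (real p - 8)" "0 < real p" using x by auto
 have "(real p)\<^sup>2 * real p * real p <= (real p + 40) * ((real p - 1)\<^sup>2 * (real p - 8))"
  unfolding x(2) using x(1) by (simp add: power2_eq_square algebra_simps)
 hence "7 * (real p)\<^sup>2 * (real p * real p) <= 7 * (real p + 40) * ((real p - 1)\<^sup>2 * (real p - 8))"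
  unfolding mult.assoc by (intro mult_left_mono) auto
 moreover have "a / b <= c / d" if "a * d <= c * b" "0 < b" "0 < d" for a b c d :: real
  using that by (simp add: field_simps)
 moreover have "0 < real p * real p" using pos by simp
 ultimately have "coefS p <= 7 * (real p + 40) / (real p * real p)"
  unfolding coefS_def using pos(1) by blast
 also have "... = 7 / p * (1 + 40 / p)" using pos by (simp add: field_simps)
 finally show "coefS p <= 7 / p * (1 + 40 / p)" .
qed

definition Ysum :: "nat set => (nat set => real) => nat set => real" where
 "Ysum P y S = (SUM T:Pow (P - S). y (S Un T) * iph T)"

lemma lamw_form_g:
 assumes P: "finite P" "!!p. p : P ==> p >= 16"
 shows "(SUM D:Pow P. SUM E:Pow P. lamw P y D * lamw P y' E * (PROD p:D Un E. 1 / gS p)) =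
  (SUM S:Pow P. (prod coefS S) * Ysum P y S * Ysum P y' S)"
proof -
 have tr: "(SUM D:{D:Pow P. S \<subseteq> D}. lamw P y D * (PROD p:D. 1 / gS p)) =
  (-1) ^ card S * (PROD p:S. fS p / gS p * hS p) * Ysum P y S" if S: "S : Pow P" for S y
 proof -
  have "(PROD p:T. (1 - fS p / gS p) * hS p) = iph T" if "T : Pow (P - S)" for T
   using that P by (intro prod.cong refl sieve_values) auto
  thus ?thesis unfolding lamw_transform[OF P(1) S] Ysum_def by simp
 qed
 have "(SUM D:Pow P. SUM E:Pow P. lamw P y D * lamw P y' E * (PROD p:D Un E. 1 / gS p)) =
  (SUM S:Pow P. (PROD p:S. gS p - 1) * ((-1) ^ card S * (PROD p:S. fS p / gS p * hS p) * Ysum P y S) * 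
    ((-1) ^ card S * (PROD p:S. fS p / gS p * hS p) * Ysum P y' S))"
 proof (subst selberg_diagonal[OF P(1)])
  show "gS p ~= 0" if "p : P" for p using sieve_values(2)[OF P(2)[OF that]] by simp
 qed (intro sum.cong refl, simp only: tr)
 also have "... = (SUM S:Pow P. (prod coefS S) * Ysum P y S * Ysum P y' S)"
 proof (intro sum.cong refl)
  fix S assume S: "S : Pow P"
  have "(prod coefS S) = (PROD p:S. (gS p - 1) * ((fS p / gS p * hS p) * (fS p / gS p * hS p)))"
   using S P coefS(1) unfolding power2_eq_square by (intro prod.cong refl) (metis PowD subsetD)
  hence c: "(prod coefS S) = (PROD p:S. gS p - 1) * ((PROD p:S. fS p / gS p * hS p) * (PROD p:S. fS p / gS p * hS p))"
   by (simp only: prod.distrib)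
  have sg: "(-1::real) ^ card S * (-1) ^ card S = 1" by (metis minus_one_mult_self)
  have alg: "a * (s * b * u) * (s * b * v) = a * (b * b) * u * v" if "s * s = 1" for a b s u v :: real
  proof -
   have "a * (s * b * u) * (s * b * v) = (s * s) * (a * (b * b) * u * v)" by (simp only: mult_ac)
   thus ?thesis using that by simp
  qed
  show "(PROD p:S. gS p - 1) * ((-1) ^ card S * (PROD p:S. fS p / gS p * hS p) * Ysum P y S) * 
    ((-1) ^ card S * (PROD p:S. fS p / gS p * hS p) * Ysum P y' S) = (prod coefS S) * Ysum P y S * Ysum P y' S"
   unfolding c by (rule alg[OF sg])
 qed
 finally show ?thesis .
qed

lemma lamw_form_f:
 assumes P: "finite P" "!!p. p : P ==> p >= 16"
 shows "(SUM D:Pow P. SUM E:Pow P. lamw P y D * lamw P y E * (PROD p:D Un E. 1 / fS p)) =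
  (SUM S:Pow P. (prod hS S) * (y S)\<^sup>2)"
proof -
 have tr: "(SUM D:{D:Pow P. S \<subseteq> D}. lamw P y D * (PROD p:D. 1 / fS p)) = (-1) ^ card S * (prod hS S) * y S" if S: "S : Pow P" for S
 proof -
  have z: "(PROD p:T. (1 - fS p / fS p) * hS p) = (if T = {} then 1 else 0)" if "T : Pow (P - S)" for T
  proof (cases "T = {}")
   case False
   then obtain p where p: "p : T" by blast
   have "finite T" by (rule finite_subset[OF _ P(1)]) (use that in auto)
   moreover have "fS p ~= 0" using sieve_values(1)[OF P(2)] p that by force
   ultimately show ?thesis using p False by (auto intro: prod_zero)
  qed simp
  have "(SUM T:Pow (P - S). y (S Un T) * (PROD p:T. (1 - fS p / fS p) * hS p)) = (SUM T:{{}}. y (S Un T) * (PROD p:T. (1 - fS p / fS p) * hS p))"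
   using P(1) z by (intro sum.mono_neutral_right) auto
  moreover have "(PROD p:S. fS p / fS p * hS p) = (prod hS S)"
   using sieve_values(1)[OF P(2)] S by (intro prod.cong refl) force
  ultimately show ?thesis unfolding lamw_transform[OF P(1) S] by simp
 qed
 have "(SUM D:Pow P. SUM E:Pow P. lamw P y D * lamw P y E * (PROD p:D Un E. 1 / fS p)) =
  (SUM S:Pow P. (PROD p:S. fS p - 1) * ((-1) ^ card S * (prod hS S) * y S) * ((-1) ^ card S * (prod hS S) * y S))"
 proof (subst selberg_diagonal[OF P(1)])
  show "fS p ~= 0" if "p : P" for p using sieve_values(1)[OF P(2)[OF that]] by simp
 qed (intro sum.cong refl, simp only: tr)
 also have "... = (SUM S:Pow P. (prod hS S) * (y S)\<^sup>2)"
 proof (intro sum.cong refl)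
  fix S assume S: "S : Pow P"
  have "(PROD p:S. fS p - 1) * (prod hS S) = (PROD p:S. 1)"
   unfolding prod.distrib[symmetric] using S sieve_values(3,4)[OF P(2)] by (intro prod.cong refl) force
  hence c: "(PROD p:S. fS p - 1) * (prod hS S) = 1" by simp
  have sg: "(-1::real) ^ card S * (-1) ^ card S = 1" by (metis minus_one_mult_self)
  have alg: "a * (s * b * v) * (s * b * v) = b * v\<^sup>2" if "s * s = 1" "a * b = 1" for a b s v :: real
  proof -
   have "a * (s * b * v) * (s * b * v) = (s * s) * (a * b) * (b * v\<^sup>2)" by (simp only: power2_eq_square mult_ac)
   thus ?thesis using that by simp
  qed
  show "(PROD p:S. fS p - 1) * ((-1) ^ card S * (prod hS S) * y S) * ((-1) ^ card S * (prod hS S) * y S) = (prod hS S) * (y S)\<^sup>2"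
   by (rule alg[OF sg c])
 qed
 finally show ?thesis .
qed

text \<open>Freezing the part \<open>D1\<close> of a divisor inside \<open>V\<close> leaves Selberg
  weights on the primes outside \<open>V\<close>, with a new \<open>y\<close> that sums the old one
  over sets inside \<open>V\<close>. Estimates for the diagonal form thus apply with the primes of
  \<open>V\<close> removed.\<close>

lemma lamw_restrict:
 assumes P: "finite P" and V: "V \<subseteq> P" and D1: "D1 \<subseteq> V" and D2: "D2 \<subseteq> P - V"
 shows "lamw P y (D1 Un D2) = lamw (P - V) (%T. (-1) ^ card D1 * (prod fS D1) * (SUM X:Pow (V - D1). y (D1 Un X Un T) * (PROD p:D1 Un X. hS p))) D2"
proof -
 let ?z1 = "SUM T:{T:Pow (P - V). D2 \<subseteq> T}. (SUM X:Pow (V - D1). y (D1 Un X Un T) * (PROD p:D1 Un X. hS p)) * (prod hS T)"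
 let ?z2 = "{T:Pow P. D1 Un D2 \<subseteq> T}"
 let ?z3 = "{T:Pow (P - V). D2 \<subseteq> T}"
 have fin: "finite D1" "finite D2" "finite V" using P V D1 D2 by (meson finite_subset Diff_subset)+
 have dis: "D1 Int D2 = {}" using D1 D2 by auto
 have "(SUM T:?z2. y T * (prod hS T)) =
   (SUM x:?z3 \<times> Pow (V - D1). y (D1 Un snd x Un fst x) * (PROD p:D1 Un snd x Un fst x. hS p))"
 proof (rule sum.reindex_bij_witness[of _ "%x. D1 Un snd x Un fst x" "%T. (T - V, (T Int V) - D1)"])
  fix T assume T: "T : ?z2"
  show e: "D1 Un snd (T - V, T Int V - D1) Un fst (T - V, T Int V - D1) = T" using T D1 by auto
  show "y (D1 Un snd (T - V, T Int V - D1) Un fst (T - V, T Int V - D1)) *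
    (PROD p:D1 Un snd (T - V, T Int V - D1) Un fst (T - V, T Int V - D1). hS p) = y T * (prod hS T)"
   unfolding e by (rule refl)
 qed (use V D1 D2 in auto)
 also have "... = (SUM T:?z3. SUM X:Pow (V - D1). y (D1 Un X Un T) * (PROD p:D1 Un X Un T. hS p))"
  by (simp add: sum.cartesian_product case_prod_beta)
 also have "... = ?z1"
 proof (intro sum.cong refl)
  fix T assume T: "T : ?z3"
  have "(PROD p:D1 Un X Un T. hS p) = (PROD p:D1 Un X. hS p) * (prod hS T)" if "X : Pow (V - D1)" for X
   using that T P fin D1 by (intro prod.union_disjoint) (auto intro: finite_subset)
  thus "(SUM X:Pow (V - D1). y (D1 Un X Un T) * (PROD p:D1 Un X Un T. hS p)) =
    (SUM X:Pow (V - D1). y (D1 Un X Un T) * (PROD p:D1 Un X. hS p)) * (prod hS T)"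
   by (simp add: sum_distrib_right mult.assoc)
 qed
 finally have inner: "(SUM T:?z2. y T * (prod hS T)) = 
  ?z1" .
 show ?thesis unfolding lamw_def inner card_Un_disjoint[OF fin(1,2) dis] prod.union_disjoint[OF fin(1,2) dis] power_add
  by (simp add: sum_distrib_left mult_ac)
qed

text \<open>If \<open>p1\<close> certainly divides the product of the \<open>n + h\<close>, divisors
  with and without \<open>p1\<close> occur in pairs. Because \<open>hS - fS * hS = -1\<close>, such
  a pair is a single weight whose variable is a difference of values of \<open>y\<close>.\<close>

lemma lamw_merge_prime:
 assumes P: "finite P" "!!p. p : P ==> p >= 16" and p1: "p1 : P" and D: "D \<subseteq> P - {p1}"
 shows "lamw P y D + lamw P y (insert p1 D) = lamw (P - {p1}) (%T. y T - y (insert p1 T)) D"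
proof -
 have V: "{p1} \<subseteq> P" using p1 by auto
 have 1: "lamw P y D = lamw (P - {p1}) (%T. y T + y (insert p1 T) * hS p1) D"
 proof -
  have "Pow ({p1} - {}) = {{}, {p1}}" by auto
  thus ?thesis using lamw_restrict[OF P(1) V, of "{}" D y] D by simp
 qed
 have 2: "lamw P y (insert p1 D) = lamw (P - {p1}) (%T. - fS p1 * (y (insert p1 T) * hS p1)) D"
  using lamw_restrict[OF P(1) V, of "{p1}" D y] D by simp
 have "lamw (P - {p1}) y1 D + lamw (P - {p1}) y2 D = lamw (P - {p1}) (%T. y1 T + y2 T) D" for y1 y2
  unfolding lamw_def by (simp add: distrib_left distrib_right sum.distrib)
 moreover have "y T + y (insert p1 T) * hS p1 + - fS p1 * (y (insert p1 T) * hS p1) = y T - y (insert p1 T)" for T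
 proof -
  have "hS p1 - fS p1 * hS p1 = -1" using sieve_values(8)[OF P(2)[OF p1]] by simp
  hence "y (insert p1 T) * (hS p1 - fS p1 * hS p1) = - y (insert p1 T)" by simp
  thus ?thesis by (simp add: algebra_simps)
 qed
 ultimately show ?thesis unfolding 1 2 by (simp only:)
qed

text \<open>Coefficient, in the squared weight, of the product of the centred indicators over
  \<open>V\<close>. The empty set gives the main term, all other \<open>V\<close> belong to the
  error term.\<close>

definition Cc :: "nat set => (nat set => real) => nat set => real" where
 "Cc P y V = (SUM D:Pow P. SUM E:Pow P. if V \<subseteq> D Un E then lamw P y D * lamw P y E * (PROD p:(D Un E) - V. 1 / gS p) else 0)"

text \<open>Each indicator of \<open>p : Z\<close> is its mean \<open>1 / gS p\<close> plus a
  centred part, and the products are multiplied out.\<close>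

lemma sieve_square_expand:
 assumes P: "finite P" and Z: "Z \<subseteq> P"
 shows "(SUM D:Pow Z. lamw P y D)\<^sup>2 = (SUM V:Pow P. Cc P y V * (PROD p:V. (if p : Z then 1 else 0) - 1 / gS p))"
proof -
 define x where "x p = (if p : Z then 1 else 0) - 1 / gS p" for p
 have ind: "(if U \<subseteq> Z then 1 else 0) = (SUM V:Pow P. if V \<subseteq> U then (PROD p:V. x p) * (PROD p:U - V. 1 / gS p) else 0)" if U: "U : Pow P" for U
 proof -
  have fU: "finite U" using U P finite_subset by auto
  have "(if U \<subseteq> Z then 1 else (0::real)) = (PROD p:U. if p : Z then 1 else 0)"
   using fU by (cases "U \<subseteq> Z") (auto intro!: prod_zero prod.neutral)
  also have "... = (PROD p:U. x p + 1 / gS p)" by (simp add: x_def)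
  also have "... = (SUM V:Pow U. (PROD p:V. x p) * (PROD p:U - V. 1 / gS p))" by (rule prod_add[OF fU])
  also have "... = (SUM V:Pow P. if V \<subseteq> U then (PROD p:V. x p) * (PROD p:U - V. 1 / gS p) else 0)"
   using U P by (intro sum.mono_neutral_cong_left) auto
  finally show ?thesis .
 qed
 have "(SUM D:Pow Z. lamw P y D)\<^sup>2 = (SUM D:Pow P. if D \<subseteq> Z then lamw P y D else 0)\<^sup>2"
  using Z P by (intro arg_cong[of _ _ "%x. x\<^sup>2"] sum.mono_neutral_cong_left) auto
 also have "... = (SUM D:Pow P. SUM E:Pow P. lamw P y D * lamw P y E * (if D Un E \<subseteq> Z then 1 else 0))"
  unfolding power2_eq_square sum_product by (intro sum.cong refl) auto
 also have "... = (SUM D:Pow P. SUM E:Pow P. SUM V:Pow P. (if V \<subseteq> D Un E then lamw P y D * lamw P y E * (PROD p:D Un E - V. 1 / gS p) else 0) * (PROD p:V. x p))"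
  by (intro sum.cong refl) (subst ind, auto simp: sum_distrib_left intro!: sum.cong)
 also have "... = (SUM D:Pow P. SUM V:Pow P. SUM E:Pow P. (if V \<subseteq> D Un E then lamw P y D * lamw P y E * (PROD p:D Un E - V. 1 / gS p) else 0) * (PROD p:V. x p))"
  by (intro sum.cong refl sum.swap)
 also have "... = (SUM V:Pow P. SUM D:Pow P. SUM E:Pow P. (if V \<subseteq> D Un E then lamw P y D * lamw P y E * (PROD p:D Un E - V. 1 / gS p) else 0) * (PROD p:V. x p))"
  by (rule sum.swap)
 finally show ?thesis by (simp only: Cc_def x_def sum_distrib_right)
qed

lemma Cc_empty:
 assumes P: "finite P" "!!p. p : P ==> p >= 16"
 shows "Cc P y {} = (SUM S:Pow P. (prod coefS S) * (Ysum P y S)\<^sup>2)"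
 using lamw_form_g[OF P, of y y] unfolding Cc_def by (simp add: power2_eq_square mult.assoc)

lemma lamw_zero:
 assumes P: "finite P" "!!p. p : P ==> p >= 16" and y: "!!T. T \<subseteq> P ==> rP T > R ==> y T = 0"
  and D: "D \<subseteq> P" "rP D > R"
 shows "lamw P y D = 0"
proof -
 have "y T = 0" if T: "T \<subseteq> P" "D \<subseteq> T" for T
 proof (rule y[OF T(1)])
  have fT: "finite T" using finite_subset[OF T(1) P(1)] .
  have "\<Prod>D dvd \<Prod>T" using fT T by (intro prod_dvd_prod_subset) auto
  moreover have "\<Prod>T > 0" using T P(2) by (intro prod_pos) force
  ultimately have "\<Prod>D <= \<Prod>T" by (intro dvd_imp_le)
  hence "rP D <= rP T" by (rule of_nat_mono)
  thus "rP T > R" using D(2) by linarith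
 qed
 thus ?thesis unfolding lamw_def by simp
qed

text \<open>The parts of both divisors inside \<open>V\<close> are frozen, in at most
  \<open>4 ^ card V\<close> ways. Freezing enlarges the \<open>y\<close> of each of the two weights
  by at most \<open>2 ^ card V\<close>, because \<open>fS * hS\<close> and \<open>1 + hS\<close> are
  at most 2. Together this is \<open>16 ^ card V\<close>; the diagonal form outside \<open>V\<close>
  is then estimated term by term.\<close>

lemma Cc_bound:
 assumes P: "finite P" "!!p. p : P ==> p >= 16" and y: "!!T. T \<subseteq> P ==> \<bar>y T\<bar> <= (if rP T <= R then 1 else 0)"
  and V: "V \<subseteq> P"
 shows "\<bar>Cc P y V\<bar> <= 16 ^ card V * ((SUM S:Pow P. if rP S <= R then (prod coefS S) else 0) *
  (SUM T:Pow P. if rP T <= R then iph T else 0)\<^sup>2)"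
proof -
 let ?Q = "P - V"
 let ?L = "%D1 E1. SUM D2:Pow ?Q. SUM E2:Pow ?Q. lamw P y (D1 Un D2) * lamw P y (E1 Un E2) * (PROD p:D2 Un E2. 1 / gS p)"
 let ?K = "%D1 E1. SUM D2:Pow ?Q. SUM E2:Pow ?Q. if V \<subseteq> D1 Un D2 Un (E1 Un E2) then lamw P y (D1 Un D2) * lamw P y (E1 Un E2) * (PROD p:(D1 Un D2 Un (E1 Un E2)) - V. 1 / gS p) else 0"
 let ?e = "%D1. (prod fS D1) * (prod hS D1) * (SUM X:Pow (V - D1). (prod hS X) * (PROD p:V - D1 - X. 1))"
 let ?i = "%S a. if rP S <= R then a else (0::real)"
 have Q: "finite ?Q" "!!p. p : ?Q ==> p >= 16" using P by auto
 have fV: "finite V" using V P finite_subset by auto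
 have mono: "\<Prod>A <= \<Prod>B" if "A \<subseteq> B" "B \<subseteq> P" for A B
 proof -
  have "finite B" using finite_subset[OF that(2) P(1)] .
  hence "\<Prod>A dvd \<Prod>B" using that by (intro prod_dvd_prod_subset) auto
  moreover have "\<Prod>B > 0" using that P(2) by (intro prod_pos) force
  ultimately show ?thesis by (intro dvd_imp_le)
 qed
 define M1 where "M1 = (SUM S:Pow P. if rP S <= R then (prod coefS S) else 0)"
 define M2 where "M2 = (SUM T:Pow P. if rP T <= R then iph T else 0)"
 have coef0: "0 <= (prod coefS S)" if "S \<subseteq> P" for S
  using that P(2) coefS(2) by (intro prod_nonneg) (smt (verit) divide_nonneg_nonneg of_nat_0_le_iff subsetD)
 have inv0: "0 <= iph T" if "T \<subseteq> P" for T
  using that P(2) by (intro prod_nonneg) force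
 have M2_0: "0 <= M2" unfolding M2_def using inv0 by (intro sum_nonneg) auto
 define yt where "yt D1 T = (-1) ^ card D1 * (prod fS D1) * (SUM X:Pow (V - D1). y (D1 Un X Un T) * (PROD p:D1 Un X. hS p))" for D1 T
 have yt: "\<bar>yt D1 T\<bar> <= (if rP T <= R then 2 ^ card V else 0)" if D1: "D1 \<subseteq> V" and T: "T \<subseteq> ?Q" for D1 T
 proof -
  let ?i = "if rP T <= R then 1 else (0::real)"
  have f0: "0 <= (prod fS D1)" and h0: "!!X. X \<subseteq> V ==> 0 <= (prod hS X)"
   by (rule prod_nonneg, rule less_imp_le, rule sieve_values, rule P(2), use D1 V in blast)+
  have "\<bar>yt D1 T\<bar> = (prod fS D1) * \<bar> SUM X:Pow (V - D1). y (D1 Un X Un T) * (PROD p:D1 Un X. hS p)\<bar>"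
   using f0 by (simp add: yt_def abs_mult power_abs)
  also have "... <= (prod fS D1) * (SUM X:Pow (V - D1). ?i * (PROD p:D1 Un X. hS p))"
  proof (intro mult_left_mono f0 order.trans[OF sum_abs] sum_mono)
   fix X assume X: "X : Pow (V - D1)"
   have sub: "D1 Un X Un T \<subseteq> P" "D1 Un X \<subseteq> V" using X D1 T V by auto
   have "\<Prod>T <= \<Prod>(D1 Un X Un T)" using sub by (intro mono) auto
   hence le: "rP T <= rP (D1 Un X Un T)" by (rule of_nat_mono)
   have "\<bar>y (D1 Un X Un T)\<bar> <= ?i" using y[OF sub(1)] le by (auto split: if_splits)
   thus "\<bar>y (D1 Un X Un T) * (PROD p:D1 Un X. hS p)\<bar> <= ?i * (PROD p:D1 Un X. hS p)"
    using h0[OF sub(2)] by (simp only: abs_mult abs_of_nonneg mult_right_mono)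
  qed
  also have "... = ?i * (?e D1)"
  proof -
   have "(PROD p:D1 Un X. hS p) = (prod hS D1) * (prod hS X)" if "X : Pow (V - D1)" for X
    using that fV D1 by (intro prod.union_disjoint) (auto intro: finite_subset)
   thus ?thesis by (simp add: sum_distrib_left mult_ac)
  qed
  finally have 1: "\<bar>yt D1 T\<bar> <= ?i * (?e D1)" .
  have "(SUM X:Pow (V - D1). (prod hS X) * (PROD p:V - D1 - X. 1)) = (PROD p:V - D1. hS p + 1)"
   using fV by (intro prod_add[symmetric]) auto
  hence "?e D1 =
   (PROD p:D1. fS p * hS p) * (PROD p:V - D1. hS p + 1)" by (simp only: prod.distrib)
  also have "... <= (PROD p:D1. 2) * (PROD p:V - D1. 2)"
  proof (intro mult_mono prod_mono prod_nonneg conjI)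
   have VP: "p >= 16" if "p : V" for p using that V P by auto
   show "0 <= fS p * hS p" "fS p * hS p <= 2" if "p : D1" for p
    using sieve_values(1,3,6)[OF VP[of p]] that D1 by auto
   show "0 <= hS p + 1" "hS p + 1 <= 2" if "p : V - D1" for p
    using sieve_values(3,7)[OF VP[of p]] that by auto
  qed (use sieve_values(3) V P(2) in \<open>auto intro!: add_nonneg_nonneg intro: less_imp_le\<close>)
  also have "... = (PROD p:V. 2)" using prod.subset_diff[OF D1 fV, of "%_. 2::real"] by (simp add: mult.commute)
  also have "... = 2 ^ card V" by simp
  finally have "?i * (?e D1) <= ?i * 2 ^ card V"
   by (intro mult_left_mono) auto
  with 1 show ?thesis by (auto split: if_splits)
 qed
 have Yb: "\<bar>Ysum ?Q (yt D1) S\<bar> <= ?i S (2 ^ card V * M2)" if D1: "D1 \<subseteq> V" and S: "S \<subseteq> ?Q" for D1 S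
 proof -
  have "\<bar>Ysum ?Q (yt D1) S\<bar> <= (SUM T:Pow (?Q - S). (if rP S <= R then 2 ^ card V else 0) * (if rP T <= R then iph T else 0))"
   unfolding Ysum_def
  proof (intro order.trans[OF sum_abs] sum_mono)
   fix T assume T: "T : Pow (?Q - S)"
   have sub: "S Un T \<subseteq> ?Q" "S Un T \<subseteq> P" "T \<subseteq> P" using S T by auto
   have "\<Prod>S <= \<Prod>(S Un T)" "\<Prod>T <= \<Prod>(S Un T)" using sub by (auto intro!: mono)
   hence le: "rP S <= rP (S Un T)" "rP T <= rP (S Un T)" by (auto intro: of_nat_mono simp del: of_nat_prod)
   have "\<bar>yt D1 (S Un T)\<bar> <= (if rP S <= R then 2 ^ card V else 0) * (if rP T <= R then 1 else 0)"
    using yt[OF D1 sub(1)] le by (auto split: if_splits)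
   hence "\<bar>yt D1 (S Un T)\<bar> * iph T <= 
    ((if rP S <= R then 2 ^ card V else 0) * (if rP T <= R then 1 else 0)) * iph T"
    by (intro mult_right_mono inv0 sub)
   thus "\<bar>yt D1 (S Un T) * iph T\<bar> <= (if rP S <= R then 2 ^ card V else 0) * (if rP T <= R then iph T else 0)"
    unfolding abs_mult abs_of_nonneg[OF inv0[OF sub(3)]] by (auto split: if_splits)
  qed
  also have "... <= (if rP S <= R then 2 ^ card V else 0) * M2"
   unfolding sum_distrib_left[symmetric] M2_def using P(1) inv0 by (intro mult_left_mono sum_mono2) auto
  finally show ?thesis by (auto split: if_splits)
 qed
 have form: "\<bar>?L D1 E1\<bar> <= 4 ^ card V * (M1 * M2\<^sup>2)"
  if DE: "D1 \<subseteq> V" "E1 \<subseteq> V" for D1 E1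
 proof -
  have "?L D1 E1 =
    (SUM D2:Pow ?Q. SUM E2:Pow ?Q. lamw ?Q (yt D1) D2 * lamw ?Q (yt E1) E2 * (PROD p:D2 Un E2. 1 / gS p))"
  proof (intro sum.cong refl)
   fix D2 E2 assume a: "D2 : Pow ?Q" "E2 : Pow ?Q"
   have "lamw P y (D1 Un D2) = lamw ?Q (yt D1) D2" "lamw P y (E1 Un E2) = lamw ?Q (yt E1) E2"
    unfolding yt_def using a DE V P by (intro lamw_restrict; simp)+
   thus "lamw P y (D1 Un D2) * lamw P y (E1 Un E2) * (PROD p:D2 Un E2. 1 / gS p) = 
    lamw ?Q (yt D1) D2 * lamw ?Q (yt E1) E2 * (PROD p:D2 Un E2. 1 / gS p)" by simp
  qed
  also have "... = (SUM S:Pow ?Q. (prod coefS S) * Ysum ?Q (yt D1) S * Ysum ?Q (yt E1) S)" by (rule lamw_form_g[OF Q])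
  also have "\<bar>...\<bar> <= (SUM S:Pow ?Q. (if rP S <= R then (prod coefS S) else 0) * (4 ^ card V * M2\<^sup>2))"
  proof (intro order.trans[OF sum_abs] sum_mono)
   fix S assume S: "S : Pow ?Q"
   have c0: "0 <= (prod coefS S)" using S by (intro coef0) auto
   have m: "\<bar>Ysum ?Q (yt D1) S\<bar> * \<bar>Ysum ?Q (yt E1) S\<bar> <= ?i S (2 ^ card V * M2) * ?i S (2 ^ card V * M2)"
    using Yb S DE M2_0 by (intro mult_mono) auto
   have f: "(2 ^ card V * M2) * (2 ^ card V * M2) = 4 ^ card V * M2\<^sup>2"
   proof -
    have "(2::real) ^ card V * 2 ^ card V = 4 ^ card V" by (simp add: power_mult_distrib[symmetric])
    thus ?thesis by (simp add: power2_eq_square mult_ac)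
   qed
   have "\<bar>(prod coefS S) * Ysum ?Q (yt D1) S * Ysum ?Q (yt E1) S\<bar> = (prod coefS S) * (\<bar>Ysum ?Q (yt D1) S\<bar> * \<bar>Ysum ?Q (yt E1) S\<bar>)"
    unfolding abs_mult abs_of_nonneg[OF c0] by simp
   also have "... <= (prod coefS S) * (?i S (2 ^ card V * M2) * ?i S (2 ^ card V * M2))"
    by (intro mult_left_mono m c0)
   also have "... = (if rP S <= R then (prod coefS S) else 0) * (4 ^ card V * M2\<^sup>2)" by (simp add: f)
   finally show "\<bar>(prod coefS S) * Ysum ?Q (yt D1) S * Ysum ?Q (yt E1) S\<bar> <= (if rP S <= R then (prod coefS S) else 0) * (4 ^ card V * M2\<^sup>2)" .
  qed
  also have "... <= M1 * (4 ^ card V * M2\<^sup>2)"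
   unfolding sum_distrib_right[symmetric] M1_def using P(1) coef0 by (intro mult_right_mono sum_mono2) auto
  finally show ?thesis by (simp add: mult_ac)
 qed
 have M1_0: "0 <= M1" unfolding M1_def using coef0 by (intro sum_nonneg) auto
 have "Cc P y V = (SUM D1:Pow V. SUM D2:Pow ?Q. SUM E1:Pow V. SUM E2:Pow ?Q. if V \<subseteq> D1 Un D2 Un (E1 Un E2) then lamw P y (D1 Un D2) * lamw P y (E1 Un E2) * (PROD p:(D1 Un D2 Un (E1 Un E2)) - V. 1 / gS p) else 0)"
  unfolding Cc_def by (simp only: sum_Pow_split[OF V P(1)])
 also have "... = (SUM D1:Pow V. SUM E1:Pow V. ?K D1 E1)"
  by (intro sum.cong refl sum.swap)
 also have "... = (SUM D1:Pow V. SUM E1:Pow V. if V \<subseteq> D1 Un E1 then ?L D1 E1 else 0)"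
 proof (intro sum.cong refl)
  fix D1 E1 assume a: "D1 : Pow V" "E1 : Pow V"
  have "V \<subseteq> D1 Un D2 Un (E1 Un E2) \<longleftrightarrow> V \<subseteq> D1 Un E1" "(D1 Un D2 Un (E1 Un E2)) - V = D2 Un E2" if "D2 : Pow ?Q" "E2 : Pow ?Q" for D2 E2
   using that a by auto
  hence "?K D1 E1 =
   (SUM D2:Pow ?Q. SUM E2:Pow ?Q. if V \<subseteq> D1 Un E1 then lamw P y (D1 Un D2) * lamw P y (E1 Un E2) * (PROD p:D2 Un E2. 1 / gS p) else 0)"
   by (intro sum.cong refl) (simp only:)
  thus "?K D1 E1 =
   (if V \<subseteq> D1 Un E1 then ?L D1 E1 else 0)"
   by simp
 qed
 also have "\<bar>...\<bar> <= (SUM D1:Pow V. SUM E1:Pow V. 4 ^ card V * (M1 * M2\<^sup>2))"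
 proof (intro order.trans[OF sum_abs] sum_mono)
  fix D1 E1 assume a: "D1 : Pow V" "E1 : Pow V"
  have "0 <= 4 ^ card V * (M1 * M2\<^sup>2)" using M1_0 by simp
  thus "\<bar>if V \<subseteq> D1 Un E1 then ?L D1 E1 else 0\<bar> <= 4 ^ card V * (M1 * M2\<^sup>2)"
   using form[of D1 E1] a by auto
 qed
 also have "... = 16 ^ card V * (M1 * M2\<^sup>2)"
 proof -
  have "real (card (Pow V)) * (real (card (Pow V)) * 4 ^ card V) = 16 ^ card V"
   by (simp add: card_Pow[OF fV] power_mult_distrib[symmetric])
  thus ?thesis by simp
 qed
 finally show ?thesis by (simp add: M1_def M2_def)
qed

section \<open>The bilinear error term\<close>

lemma harm_le_ln: assumes "n >= 1" shows "harm n <= 1 + ln (real n)"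
proof -
 have "harm n <= 1 + ln (real n)" using assms
 proof (induction n rule: nat_induct_at_least)
  case base
  thus ?case by (simp add: harm_def)
 next
  case (Suc n)
  have "1 / real (Suc n) <= ln (real (Suc n)) - ln (real n)"
  proof -
   have "ln (real n / real (Suc n)) <= real n / real (Suc n) - 1" using Suc by (intro ln_le_minus_one) auto
   also have "... = - 1 / real (Suc n)" by (simp add: field_simps)
   finally show ?thesis using Suc by (simp add: ln_div)
  qed
  thus ?case using Suc by (simp add: harm_Suc inverse_eq_divide)
 qed
 thus ?thesis .
qed

lemma sum_norm_square_blocks:
 fixes z :: "nat => complex"
 shows "(norm (SUM b<J. z b))\<^sup>2 <= real J * (SUM b<J. (norm (z b))\<^sup>2)"
proof -
 have "(norm (SUM b<J. z b))\<^sup>2 <= (SUM b<J. 1 * norm (z b))\<^sup>2"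
  by (intro power_mono) (auto intro: norm_sum)
 also have "... <= (SUM b<J. 1\<^sup>2) * (SUM b<J. (norm (z b))\<^sup>2)" by (rule Cauchy_Schwarz_ineq_sum)
 finally show ?thesis by simp
qed

definition cform :: "nat set set => nat set => (nat => real) => real" where
 "cform \<V> A \<alpha> = (SUM V:\<V>. SUM m:A. SUM m':A. \<alpha> m * \<alpha> m' * ckern V m m')"

text \<open>Splitting the support costs a factor \<open>J\<close> by Cauchy-Schwarz; in exchange the
  length \<open>N b\<close> is matched to the size of the coefficients in its own block.\<close>

lemma large_sieve_blocks:
 assumes fin: "finite \<V>" and \<V>: "!!V. V : \<V> ==> finite V" "!!V p. V : \<V> ==> p : V ==> prime p" "!!V. V : \<V> ==> \<Prod>V <= Q"
  and A: "!!b. b < J ==> Ab b \<subseteq> {M b<..M b + N b}" and Q: "Q >= 1" and dis: "disjoint_family_on Ab {..<J}"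
 shows "cform \<V> (UN b<J. Ab b) \<alpha> <= real J * (SUM b<J. (real (N b) + 2 * real (Q\<^sup>2) * harm (Q\<^sup>2)) * (SUM m:Ab b. (\<alpha> m)\<^sup>2))"
proof -
 have finA: "finite (Ab b)" if "b < J" for b using A[OF that] finite_subset by blast
 define S where "S V a B = (SUM m:B. of_real (\<alpha> m) * cis (2 * pi * (real m * fpt (V, a))))" for V a B
 have c: "cform \<V> B \<alpha> = (SUM V:\<V>. SUM a:PiE V (%p. {1..<p}). (norm (S V a B))\<^sup>2)" for B
  unfolding cform_def S_def using \<V> by (intro sum.cong refl fpts_sum_eq_ckern[symmetric]) auto
 have SU: "S V a (UN b<J. Ab b) = (SUM b<J. S V a (Ab b))" for V a
  unfolding S_def using finA dis by (intro sum.UNION_disjoint) (auto simp: disjoint_family_on_def)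
 have "cform \<V> (UN b<J. Ab b) \<alpha> <= (SUM V:\<V>. SUM a:PiE V (%p. {1..<p}). real J * (SUM b<J. (norm (S V a (Ab b)))\<^sup>2))"
  unfolding c SU by (intro sum_mono sum_norm_square_blocks)
 also have "... = real J * (SUM V:\<V>. SUM a:PiE V (%p. {1..<p}). SUM b<J. (norm (S V a (Ab b)))\<^sup>2)"
  by (simp add: sum_distrib_left)
 also have "(SUM V:\<V>. SUM a:PiE V (%p. {1..<p}). SUM b<J. (norm (S V a (Ab b)))\<^sup>2) = (SUM V:\<V>. SUM b<J. SUM a:PiE V (%p. {1..<p}). (norm (S V a (Ab b)))\<^sup>2)"
  by (rule sum.cong[OF refl], rule sum.swap)
 also have "... = (SUM b<J. cform \<V> (Ab b) \<alpha>)"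
  unfolding c by (rule sum.swap)
 also have "real J * ... <= real J * (SUM b<J. (real (N b) + 2 * real (Q\<^sup>2) * harm (Q\<^sup>2)) * (SUM m:Ab b. (\<alpha> m)\<^sup>2))"
 proof (intro mult_left_mono sum_mono)
  fix b assume "b : {..<J}"
  hence "b < J" by simp
  show "cform \<V> (Ab b) \<alpha> <= (real (N b) + 2 * real (Q\<^sup>2) * harm (Q\<^sup>2)) * (SUM m:Ab b. (\<alpha> m)\<^sup>2)"
   unfolding cform_def by (rule large_sieve[OF fin \<V> A[OF \<open>b < J\<close>] Q])
 qed simp
 finally show ?thesis .
qed

lemma card_primes_dyadic:
 assumes "M >= 2"
 shows "real (card {p. prime p & M < p & p <= 2 * M}) * ln M <= 2 * real M"
proof -
 let ?A = "{p. prime p & M < p & p <= 2 * M}"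
 have fin: "finite ?A" by (rule finite_subset[of _ "{..2 * M}"]) auto
 have "real (card ?A) * ln M = (SUM p:?A. ln (real M))" by simp
 also have "... <= (SUM p:?A. Lam p)" using assms by (intro sum_mono) auto
 also have "... <= (SUM p:{M<..2 * M}. Lam p)" by (intro sum_mono2) (auto simp: mangoldt_nonneg)
 also have "... <= 2 * real M * ln 2" by (rule Lam_dyadic)
 also have "... <= 2 * real M * 1" using ln_2_less_1 by (intro mult_left_mono) auto
 finally show ?thesis by simp
qed

text \<open>With 12544 = (16 * 7)^2, divisor-type factors \<open>12544 ^ card V\<close> are below the 192nd root of \<open>\<Prod>V\<close>,
 so they cost at most one factor \<open>y\<close> on moduli up to \<open>y ^ 192\<close>.\<close>

locale bigsieve = presieve +
 assumes D0big: "D0 >= 12544 ^ 192"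
begin

text \<open>The primes that can divide a divisor counted by the weights: beyond the presieved ones
  and up to the level.\<close>

definition Py :: "nat => nat set" where "Py y = {p. prime p & D0 < p & p <= y ^ 96}"
abbreviation PyL :: "nat => nat => nat set set" where "PyL y n \<equiv> {V:Pow (Py y). \<Prod>V <= y ^ n}"
definition cell :: "nat => nat => nat set" where "cell y i = {p. prime p & y ^ i < p & p <= y ^ Suc i}"

lemma finite_Py [simp]: "finite (Py y)" by (rule finite_subset[of _ "{..y ^ 96}"]) (auto simp: Py_def)
lemma finite_cell [simp]: "finite (cell y i)" by (rule finite_subset[of _ "{..y ^ Suc i}"]) (auto simp: cell_def)
lemma PyD: "p : Py y ==> prime p & D0 < p" by (simp add: Py_def)

lemma Py_prod:
 assumes "V \<subseteq> Py y"
 shows "finite V" "!!p. p : V ==> prime p" "\<Prod>V >= 1" "cop (\<Prod>V)"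
proof -
 show f: "finite V" using assms finite_Py finite_subset by blast
 show "!!p. p : V ==> prime p" using assms PyD by auto
 have *: "prime p & D0 < p" if "p : V" for p using that assms PyD by auto
 show "\<Prod>V >= 1" "cop (\<Prod>V)" using cop_prod[OF f *] by (auto simp del: cop_def)
qed

lemma card_power_le:
 assumes V: "V \<subseteq> Py y"
 shows "(12544 ^ 192) ^ card V <= \<Prod>V"
proof -
 have "(PROD p:V. 12544 ^ 192) <= \<Prod>V"
 proof (intro prod_mono conjI)
  fix p assume "p : V"
  hence "D0 < p" using V PyD by auto
  thus "(12544::nat) ^ 192 <= p" using D0big by (meson le_trans less_imp_le)
 qed (rule zero_le)
 thus ?thesis by (simp only: prod_constant)
qed

lemma card_power_le_y:
 assumes V: "V \<subseteq> Py y" and N: "\<Prod>V <= y ^ 192"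
 shows "12544 ^ card V <= y"
proof -
 have "(12544 ^ card V) ^ 192 = ((12544::nat) ^ 192) ^ card V" by (simp only: power_mult[symmetric] mult.commute)
 also have "... <= y ^ 192" using card_power_le[OF V] N by linarith
 finally have *: "(12544 ^ card V) ^ 192 <= y ^ 192" .
 thus ?thesis by (rule power_le_imp_le_base[of _ 191, unfolded Suc_numeral semiring_norm]) simp
qed

text \<open>\<open>100352 = 16 ^ 2 * 4 * 7 ^ 2 * 2\<close> collects the losses per prime on
  middle-sized moduli: the squared coefficients, the congruent pairs, the squared number of shifts
  and the normalisation of \<open>Hform\<close>.\<close>

lemma card_power_sq_le:
 assumes V: "V \<subseteq> Py y"
 shows "(100352 ^ card V)\<^sup>2 <= \<Prod>V"
proof -
 have "(100352 ^ card V)\<^sup>2 = ((100352::nat)\<^sup>2) ^ card V" by (simp only: power_mult[symmetric] mult.commute)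
 also have "... <= (12544 ^ 192) ^ card V"
 proof (rule power_mono)
  have "(100352::nat)\<^sup>2 <= 12544 ^ 4" by simp
  also have "... <= 12544 ^ 192" by (rule power_increasing) auto
  finally show "(100352::nat)\<^sup>2 <= 12544 ^ 192" .
 qed auto
 also have "... <= \<Prod>V" by (rule card_power_le[OF V])
 finally show ?thesis .
qed

lemma not_dvd_cell:
 assumes "m : cell y i" "p : V" "V \<subseteq> Py y" "\<Prod>V <= y ^ i"
 shows "~ p dvd m"
proof
 assume "p dvd m"
 moreover have "prime m" using assms by (simp add: cell_def)
 ultimately have "p = m" using primes_dvd_imp_eq[of p m] Py_prod(2)[OF assms(3,2)] by simp
 have "p dvd \<Prod>V" using assms Py_prod by (intro dvd_prodI) auto
 hence "p <= \<Prod>V" using Py_prod(3)[OF assms(3)] by (intro dvd_imp_le) auto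
 thus False using assms \<open>p = m\<close> by (auto simp: cell_def)
qed

text \<open>After the expansion of \<open>ckern\<close> and the regrouping \<open>V = S Un T\<close>
  all terms are nonnegative, so any part of them is a lower bound. Keeping the sets \<open>T\<close>
  with \<open>\<Prod>T <= Q2\<close>, and not just the empty one, is what gains a logarithm.\<close>

lemma cform_ge:
 assumes A: "A \<subseteq> cell y j" and Q: "Q <= y ^ j" and Q12: "Q1 * Q2 <= Q"
 shows "(SUM S:{S:Pow (Py y). \<Prod>S <= Q1}. rP S * Hform A \<alpha> S * (SUM T:{T:Pow (Py y - S). \<Prod>T <= Q2}. iph T)) <=
  cform {V:Pow (Py y). \<Prod>V <= Q} A \<alpha>"
proof -
 let ?P = "Py y"
 define F where "F S T = rP S * Hform A \<alpha> S * iph T" for S T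
 have prods: "\<Prod>(S Un T) = \<Prod>S * \<Prod>T" if "S \<subseteq> ?P" "T \<subseteq> ?P - S" for S T
  using that by (intro prod.union_disjoint) (auto intro: finite_subset[OF _ finite_Py[of y]])
 have H0: "0 <= Hform A \<alpha> S" if "S \<subseteq> V" "V : Pow ?P" "\<Prod>V <= Q" for S V
 proof (rule Hform_nonneg)
  have sub: "S \<subseteq> ?P" using that by auto
  show "finite S" "!!p. p : S ==> prime p" using Py_prod[OF sub] by auto
  fix m p assume "m : A" "p : S"
  thus "~ p dvd m" using not_dvd_cell[of m y j p V] A that Q by auto
 qed
 have T0: "0 <= iph T" if "T \<subseteq> ?P" for T
 proof (rule prod_nonneg)
  fix p assume "p : T"
  hence "p > 1" using Py_prod(2)[OF that] prime_gt_1_nat by blast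
  thus "0 <= 1 / (real p - 1)" by simp
 qed
 have "(SUM S:{S:Pow ?P. \<Prod>S <= Q1}. rP S * Hform A \<alpha> S * (SUM T:{T:Pow (?P - S). \<Prod>T <= Q2}. iph T)) =
   (SUM S:{S:Pow ?P. \<Prod>S <= Q1}. SUM T:{T:Pow (?P - S). \<Prod>T <= Q2}. F S T)"
  by (simp add: F_def sum_distrib_left)
 also have "... <= (SUM S:Pow ?P. SUM T:Pow (?P - S). if \<Prod>(S Un T) <= Q then F S T else 0)"
 proof (rule order.trans[OF sum_mono sum_mono2])
  fix S assume S: "S : {S:Pow ?P. \<Prod>S <= Q1}"
  have "(SUM T:{T:Pow (?P - S). \<Prod>T <= Q2}. F S T) = (SUM T:{T:Pow (?P - S). \<Prod>T <= Q2}. if \<Prod>(S Un T) <= Q then F S T else 0)"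
  proof (intro sum.cong refl)
   fix T assume T: "T : {T:Pow (?P - S). \<Prod>T <= Q2}"
   have "\<Prod>S * \<Prod>T <= Q1 * Q2" using S T by (intro mult_mono) auto
   hence "\<Prod>(S Un T) <= Q" using prods[of S T] S T Q12 by auto
   thus "F S T = (if \<Prod>(S Un T) <= Q then F S T else 0)" by simp
  qed
  also have "... <= (SUM T:Pow (?P - S). if \<Prod>(S Un T) <= Q then F S T else 0)"
  proof (rule sum_mono2)
   show "0 <= (if \<Prod>(S Un T) <= Q then F S T else 0)" if "T : Pow (?P - S) - {T:Pow (?P - S). \<Prod>T <= Q2}" for T
    using H0[of S "S Un T"] T0[of T] S that unfolding F_def by (auto intro!: mult_nonneg_nonneg of_nat_0_le_iff simp del: of_nat_prod)
  qed auto
  finally show "(SUM T:{T:Pow (?P - S). \<Prod>T <= Q2}. F S T) <= (SUM T:Pow (?P - S). if \<Prod>(S Un T) <= Q then F S T else 0)" .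
 next
  fix S assume S: "S : Pow ?P - {S:Pow ?P. \<Prod>S <= Q1}"
  show "0 <= (SUM T:Pow (?P - S). if \<Prod>(S Un T) <= Q then F S T else 0)"
  proof (intro sum_nonneg)
   fix T assume "T : Pow (?P - S)"
   thus "0 <= (if \<Prod>(S Un T) <= Q then F S T else 0)"
    using H0[of S "S Un T"] T0[of T] S unfolding F_def by (auto intro!: mult_nonneg_nonneg of_nat_0_le_iff simp del: of_nat_prod)
  qed
 qed auto
 also have "... = (SUM V:Pow ?P. SUM S:Pow V. if \<Prod>(S Un (V - S)) <= Q then F S (V - S) else 0)"
  by (rule sum_Pow_subset_swap[OF finite_Py, symmetric])
 also have "... = (SUM V:Pow ?P. if \<Prod>V <= Q then (SUM S:Pow V. F S (V - S)) else 0)"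
  by (intro sum.cong refl) (auto simp: Un_absorb1 intro!: sum.cong sum.neutral)
 also have "... = (SUM V:{V:Pow ?P. \<Prod>V <= Q}. SUM S:Pow V. F S (V - S))"
  by (rule sum.mono_neutral_cong_right) auto
 also have "... = cform {V:Pow ?P. \<Prod>V <= Q} A \<alpha>"
  unfolding cform_def F_def
 proof (intro sum.cong refl)
  fix V assume "V : {V:Pow ?P. \<Prod>V <= Q}"
  hence "finite V" "!!p. p : V ==> prime p" using Py_prod[of V] by auto
  thus "(SUM S:Pow V. rP S * Hform A \<alpha> S * iph (V - S)) = (SUM m:A. SUM m':A. \<alpha> m * \<alpha> m' * ckern V m m')"
   by (rule ckern_form_expand[symmetric])
 qed
 finally show ?thesis .
qed

text \<open>Without disjointness from \<open>S\<close> the sum is bounded below by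
  \<open>Bz 1 0 y\<close>, up to a factor 2. Splitting off the part of the set inside
  \<open>S\<close> costs factors \<open>1 + 1 / (p - 1) <= 2\<close>, hence
  \<open>2 ^ card S\<close>.\<close>

lemma sum_inv_totient_ge:
 "EX y0. ALL y>=y0. ALL S<=Py y. cW / 4 * ln y / 2 ^ card S <= (SUM T:{T:Pow (Py y - S). \<Prod>T <= y}. iph T)"
proof -
 obtain C where C: "!!z. z >= 1 ==> \<bar>Bz (Suc 0) 0 z - cW ^ Suc 0 * (fact 0 / fact (Suc 0 + 0)) * (ln z) ^ (Suc 0 + 0)\<bar> <= C * (1 + ln z) ^ (0 + 0)"
  using Bz_asymp[of 0 0] by blast
 have "EX y0>=1. ALL y>=y0. cW * ln (real y) >= 2 * C"
 proof -
  obtain N :: nat where N: "N >= 1" "ln (real N) > 2 * C / cW" using ex_nat_ln_gt by blast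
  have "cW * ln (real y) >= 2 * C" if "y >= N" for y
  proof -
   have "2 * C / cW <= ln (real y)" using N that by (smt (verit) ln_mono of_nat_le_iff of_nat_0_less_iff less_eq_Suc_le One_nat_def)
   thus ?thesis using cW_pos by (simp add: divide_le_eq mult.commute)
  qed
  thus ?thesis using N by blast
 qed
 then obtain y0 where y0: "y0 >= 1" "!!y. y >= y0 ==> cW * ln (real y) >= 2 * C" by blast
 have "cW / 4 * ln y / 2 ^ card S <= (SUM T:{T:Pow (Py y - S). \<Prod>T <= y}. iph T)" if y: "y >= y0" and S: "S \<subseteq> Py y" for y S
 proof -
  let ?P = "Py y"
  have y1: "real y >= 1" using y y0 by simp
  have D2: "real D0 >= 2"
  proof -
   have "(2::nat) <= 12544 ^ 192" by (rule order.trans[OF _ self_le_power]) auto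
   hence "D0 >= 2" using D0big by linarith
   thus ?thesis by simp
  qed
  have "Bz 1 0 y <= Vs 1 0 ?P y + real (1\<^sup>2) / D0 * Bz 1 0 y"
  proof (rule Bz_le_Vs)
   fix p assume "prime p" "D0 < p" "real p <= real y"
   moreover from this have "p <= y ^ 96" using y1 self_le_power[of y 96] by (simp add: order.trans)
   ultimately show "p : ?P" by (simp add: Py_def)
  qed (use PyD in auto)
  also have "real (1\<^sup>2) / D0 * Bz 1 0 y <= 1 / 2 * Bz 1 0 y"
   using D2 by (intro mult_right_mono Bz_nonneg) (auto simp: divide_le_eq)
  finally have v: "Bz 1 0 y <= 2 * Vs 1 0 ?P y" by simp
  have "cW * ln y - C <= Bz 1 0 y" using C[OF y1] by (simp add: abs_le_iff del: Bz.simps)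
  hence lo: "cW / 4 * ln y <= Vs 1 0 ?P y" using v y0(2)[OF y] by linarith
  have inv: "1 / real p <= 1 / (real p - 1)" "0 <= 1 / (real p - 1)" "1 + 1 / (real p - 1) <= 2" if "p : ?P" for p
  proof -
   have "real p >= 2" using PyD[OF that] prime_ge_2_nat by force
   thus "1 / real p <= 1 / (real p - 1)" "0 <= 1 / (real p - 1)" "1 + 1 / (real p - 1) <= 2"
    by (auto intro!: divide_left_mono simp: divide_le_eq)
  qed
  have inv0: "0 <= iph T" if "T \<subseteq> ?P" for T
   using that inv by (intro prod_nonneg) auto
  have fS: "finite S" using S by (rule finite_subset) simp
  have dvdle: "\<Prod>T2 <= y" if "T1 \<subseteq> S" "T2 \<subseteq> ?P - S" "rP (T1 Un T2) <= real y" for T1 T2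
  proof -
   have sub: "T1 Un T2 \<subseteq> ?P" using that S by auto
   have "\<Prod>T2 dvd \<Prod>(T1 Un T2)" using Py_prod(1)[OF sub] by (intro prod_dvd_prod_subset) auto
   hence "\<Prod>T2 <= \<Prod>(T1 Un T2)" using Py_prod(3)[OF sub] by (intro dvd_imp_le) auto
   thus ?thesis using that(3) by (simp only: of_nat_le_iff)
  qed
  have "Vs 1 0 ?P y = (SUM T:Pow ?P. if rP T <= y then (PROD p:T. 1 / real p) else 0)"
   unfolding Vs_def
  proof (intro sum.cong refl)
   fix T assume "T : Pow ?P"
   hence "\<Prod>T >= 1" using Py_prod(3)[of T y] by blast
   hence "rP T > 0" by (simp only: of_nat_0_less_iff)
   hence iff: "1 <= real y / rP T \<longleftrightarrow> rP T <= real y" by (simp only: le_divide_eq) simp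
   show "real 1 ^ card T / rP T * Bz 0 0 (real y / rP T) = (if rP T <= y then (PROD p:T. 1 / real p) else 0)"
    unfolding Bz.simps(1) iff by (simp add: prod_dividef)
  qed
  also have "... <= (SUM T:Pow ?P. if rP T <= y then iph T else 0)"
   using inv by (intro sum_mono) (auto intro!: prod_mono)
  also have "... = (SUM T1:Pow S. SUM T2:Pow (?P - S). if rP (T1 Un T2) <= y then iph (T1 Un T2) else 0)"
   by (rule sum_Pow_split[OF S finite_Py])
  also have "... <= (SUM T1:Pow S. SUM T2:Pow (?P - S). iph T1 * (if \<Prod>T2 <= y then iph T2 else 0))"
  proof (intro sum_mono)
   fix T1 T2 assume T: "T1 : Pow S" "T2 : Pow (?P - S)"
   have "iph (T1 Un T2) = iph T1 * iph T2"
    using T by (intro prod.union_disjoint) (auto intro: finite_subset[OF _ fS] finite_subset[OF _ finite_Py[of y]])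
   thus "(if rP (T1 Un T2) <= y then iph (T1 Un T2) else 0) <= 
    iph T1 * (if \<Prod>T2 <= y then iph T2 else 0)"
    using dvdle[of T1 T2] T mult_nonneg_nonneg[OF inv0[of T1] inv0[of T2]] S by (auto simp del: of_nat_prod)
  qed
  also have "... = (SUM T1:Pow S. iph T1 * (PROD p:S - T1. 1)) * (SUM T2:Pow (?P - S). if \<Prod>T2 <= y then iph T2 else 0)"
   by (simp add: sum_product)
  also have "(SUM T1:Pow S. iph T1 * (PROD p:S - T1. 1)) = (PROD p:S. 1 / (real p - 1) + 1)"
   by (rule prod_add[OF fS, symmetric])
  also have "(SUM T2:Pow (?P - S). if \<Prod>T2 <= y then iph T2 else 0) = (SUM T:{T:Pow (?P - S). \<Prod>T <= y}. iph T)"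
   by (rule sum.mono_neutral_cong_right) auto
  finally have 1: "Vs 1 0 ?P y <= (PROD p:S. 1 / (real p - 1) + 1) * (SUM T:{T:Pow (?P - S). \<Prod>T <= y}. iph T)" .
  have "(PROD p:S. 1 / (real p - 1) + 1) <= (PROD p:S. 2)"
   using S inv by (intro prod_mono) (force simp: add.commute)
  hence "(PROD p:S. 1 / (real p - 1) + 1) <= 2 ^ card S" by simp
  hence "(PROD p:S. 1 / (real p - 1) + 1) * (SUM T:{T:Pow (?P - S). \<Prod>T <= y}. iph T) <=
   2 ^ card S * (SUM T:{T:Pow (?P - S). \<Prod>T <= y}. iph T)"
   using inv0 by (intro mult_right_mono sum_nonneg) auto
  hence "cW / 4 * ln y <= 2 ^ card S * (SUM T:{T:Pow (?P - S). \<Prod>T <= y}. iph T)" using 1 lo by linarith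
  thus ?thesis by (simp add: divide_le_eq mult.commute)
 qed
 thus ?thesis by blast
qed

end

text \<open>The oscillating sum over the second prime \<open>m\<close>, as a function of the first
  prime \<open>c\<close>: at each \<open>p\<close> in \<open>V\<close> the centred indicators of all
  shifts in \<open>I\<close> are added.\<close>

definition Gk :: "nat set => (nat => nat => nat) => nat set => (nat => real) => nat set => nat => real" where
 "Gk I e A \<beta> V c = (SUM m:A. \<beta> m * (PROD p:V. SUM h:I. eker p (e h p) c m))"

lemma eker_mod: "eker p x (c mod p) m = eker p x c m" "eker p x c (m mod p) = eker p x c m"
 by (simp_all add: eker_def dvd_mod_iff mod_mult_left_eq mod_mult_right_eq)

lemma Gk_mod:
 assumes "finite V"
 shows "Gk I e A \<beta> V (c mod \<Prod>V) = Gk I e A \<beta> V c"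
proof -
 have "eker p x (c mod \<Prod>V) m = eker p x c m" if "p : V" for p x m
 proof -
  have "p dvd \<Prod>V" using assms that by (rule dvd_prodI)
  hence "c mod \<Prod>V mod p = c mod p" by (rule mod_mod_cancel)
  thus ?thesis using eker_mod(1)[of p x "c mod \<Prod>V" m] eker_mod(1)[of p x c m] by simp
 qed
 thus ?thesis unfolding Gk_def by simp
qed

text \<open>The product is opened into one term for each choice of a shift at every prime.
  Cauchy-Schwarz over these \<open>card I ^ card V\<close> choices suffices, as each of them has the
  same mean square \<open>Hform\<close>.\<close>

lemma Gk_square_sum:
 assumes V: "finite V" "!!p. p : V ==> prime p" and A: "!!m p. m : A ==> p : V ==> ~ p dvd m" and I: "finite I"
  and e: "!!h p. h : I ==> p : V ==> ~ p dvd e h p"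
 shows "(SUM c<\<Prod>V. (Gk I e A \<beta> V c)\<^sup>2) <= real (card I ^ card V) ^ 2 * Hform A \<beta> V"
proof -
 let ?J = "PiE V (%_. I)"
 define F where "F \<phi> c = (SUM m:A. \<beta> m * (PROD p:V. eker p (e (\<phi> p) p) c m))" for \<phi> c
 have cJ: "card ?J = card I ^ card V" using V by (simp add: card_PiE)
 have "Gk I e A \<beta> V c = (SUM \<phi>:?J. F \<phi> c)" for c
 proof -
  have "Gk I e A \<beta> V c = (SUM m:A. SUM \<phi>:?J. \<beta> m * (PROD p:V. eker p (e (\<phi> p) p) c m))"
   unfolding Gk_def using V(1) I by (simp add: prod_sum_PiE sum_distrib_left)
  also have "... = (SUM \<phi>:?J. F \<phi> c)" unfolding F_def by (rule sum.swap)
  finally show ?thesis .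
 qed
 hence "(SUM c<\<Prod>V. (Gk I e A \<beta> V c)\<^sup>2) = (SUM c<\<Prod>V. (SUM \<phi>:?J. 1 * F \<phi> c)\<^sup>2)" by simp
 also have "... <= (SUM c<\<Prod>V. (SUM \<phi>:?J. 1\<^sup>2) * (SUM \<phi>:?J. (F \<phi> c)\<^sup>2))"
  by (intro sum_mono Cauchy_Schwarz_ineq_sum)
 also have "... = real (card ?J) * (SUM c<\<Prod>V. SUM \<phi>:?J. (F \<phi> c)\<^sup>2)" by (simp add: sum_distrib_left)
 also have "(SUM c<\<Prod>V. SUM \<phi>:?J. (F \<phi> c)\<^sup>2) = (SUM \<phi>:?J. SUM c<\<Prod>V. (F \<phi> c)\<^sup>2)" by (rule sum.swap)
 also have "... = (SUM \<phi>:?J. Hform A \<beta> V)"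
  unfolding F_def using e by (intro sum.cong refl Hform_eq_square_sum[OF V A]) (auto simp: PiE_iff)
 also have "real (card ?J) * ... = real (card I ^ card V) ^ 2 * Hform A \<beta> V" by (simp add: cJ power2_eq_square)
 finally show ?thesis .
qed

text \<open>\<open>Gk\<close> sees its argument only modulo \<open>\<Prod>V\<close>. Cauchy-Schwarz
  over the residues separates the two variables: the first survives as a count of congruent pairs,
  the second as \<open>Hform\<close>.\<close>

lemma weighted_Gk_square:
 assumes V: "finite V" "!!p. p : V ==> prime p" and A: "!!m p. m : A ==> p : V ==> ~ p dvd m" and I: "finite I"
  and e: "!!h p. h : I ==> p : V ==> ~ p dvd e h p" and B: "finite B" and w: "!!m. w m >= 0"
 shows "(SUM m:B. w m * \<bar>Gk I e A \<beta> V m\<bar>)\<^sup>2 <=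
  (SUM m:B. SUM m':B. w m * w m' * (if ALL p:V. m mod p = m' mod p then 1 else 0)) * (real (card I ^ card V) ^ 2 * Hform A \<beta> V)"
proof -
 let ?z1 = "SUM m:B. SUM m':B. w m * w m' * (if ALL p:V. m mod p = m' mod p then 1 else 0)"
 let ?z2 = "SUM m:B. w m * \<bar>Gk I e A \<beta> V m\<bar>"
 let ?z3 = "real (card I ^ card V) ^ 2 * Hform A \<beta> V"
 let ?N = "\<Prod>V"
 define a where "a c = (SUM m:{m:B. m mod ?N = c}. w m)" for c
 have N0: "?N > 0" using V prime_gt_0_nat by (intro prod_pos) auto
 have "?z2 = (SUM c<?N. SUM m:{m:B. m mod ?N = c}. w m * \<bar>Gk I e A \<beta> V m\<bar>)"
  using N0 by (intro sum.group[symmetric] B) auto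
 also have "... = (SUM c<?N. a c * \<bar>Gk I e A \<beta> V c\<bar>)"
  unfolding a_def sum_distrib_right by (intro sum.cong refl) (use Gk_mod[OF V(1), symmetric] in auto)
 finally have 1: "?z2\<^sup>2 = (SUM c<?N. a c * \<bar>Gk I e A \<beta> V c\<bar>)\<^sup>2" by simp
 have "(SUM c<?N. a c * \<bar>Gk I e A \<beta> V c\<bar>)\<^sup>2 <= (SUM c<?N. (a c)\<^sup>2) * (SUM c<?N. \<bar>Gk I e A \<beta> V c\<bar>\<^sup>2)"
  by (rule Cauchy_Schwarz_ineq_sum)
 also have "... <= (SUM c<?N. (a c)\<^sup>2) * ?z3"
  using Gk_square_sum[OF V A I e] by (intro mult_left_mono sum_nonneg) (auto simp: power2_abs)
 also have "... <= ?z1 * ?z3"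
 proof (rule mult_right_mono)
  have "(SUM c<?N. (a c)\<^sup>2) = (SUM c<?N. SUM m:{m:B. m mod ?N = c}. w m * a (m mod ?N))"
   by (intro sum.cong refl) (simp add: a_def power2_eq_square sum_distrib_right)
  also have "... = (SUM m:B. w m * a (m mod ?N))"
   using N0 by (intro sum.group B) auto
  also have "... = (SUM m:B. SUM m':{m':B. m' mod ?N = m mod ?N}. w m * w m')"
   by (simp add: a_def sum_distrib_left)
  also have "... <= ?z1"
  proof (rule sum_mono)
   fix m
   have "(SUM m':{m':B. m' mod ?N = m mod ?N}. w m * w m') = (SUM m':{m':B. m' mod ?N = m mod ?N}. w m * w m' * (if ALL p:V. m mod p = m' mod p then 1 else 0))"
   proof (rule sum.cong[OF refl])
    fix m' assume m': "m' : {m':B. m' mod ?N = m mod ?N}"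
    have "m mod p = m' mod p" if "p : V" for p
    proof -
     have "p dvd ?N" using V(1) that by (rule dvd_prodI)
     thus ?thesis using m' by (metis (mono_tags, lifting) mem_Collect_eq mod_mod_cancel)
    qed
    thus "w m * w m' = w m * w m' * (if ALL p:V. m mod p = m' mod p then 1 else 0)" by simp
   qed
   also have "... <= (SUM m':B. w m * w m' * (if ALL p:V. m mod p = m' mod p then 1 else 0))"
    using w B by (intro sum_mono2) auto
   finally show "(SUM m':{m':B. m' mod ?N = m mod ?N}. w m * w m') <= (SUM m':B. w m * w m' * (if ALL p:V. m mod p = m' mod p then 1 else 0))" .
  qed
  finally show "(SUM c<?N. (a c)\<^sup>2) <= ?z1" .
  show "0 <= real (card I ^ card V) ^ 2 * Hform A \<beta> V"
   using Hform_nonneg[OF V A] by simp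
 qed
 finally show ?thesis using 1 by simp
qed

context bigsieve
begin

lemma harm_le_linear: assumes "n >= 1" shows "harm (n ^ k) <= (1 + real k) * real n"
proof -
 have "harm (n ^ k) <= 1 + ln (real (n ^ k))" using assms by (intro harm_le_ln) simp
 also have "ln (real (n ^ k)) = real k * ln (real n)" using assms by (simp add: ln_realpow)
 also have "... <= real k * real n" using assms ln_bound[of "real n"] by (intro mult_left_mono) auto
 finally show ?thesis using assms by (simp add: algebra_simps)
qed

text \<open>In the block \<open>(M, 2 M]\<close> there are at most \<open>2 * M / ln y\<close>
  primes with coefficients at most \<open>1 / M\<close>, so the large sieve gives
  \<open>62 / ln y\<close> per block. With \<open>J <= 3 * ln y\<close> blocks the total
  \<open>J ^ 2 * 62 / ln y\<close> has one logarithm, where counting all integers would give two.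
  The square of \<open>y ^ 7\<close> and its harmonic factor need \<open>y ^ 15\<close>, whence
  \<open>15 <= j\<close>.\<close>

lemma cform_small:
 assumes A: "A \<subseteq> cell y j" and j: "j >= 15" and \<alpha>: "!!p. p : A ==> \<bar>\<alpha> p\<bar> <= 1 / real p" and y: "ln (real y) >= 1"
 shows "cform (PyL y 7) A \<alpha> <= 1000 * ln y"
proof -
 have y1: "y >= 2" using y by (cases "y <= 1") (auto simp: le_Suc_eq)
 obtain n where "y <= 2 ^ n" by (meson less_exp less_imp_le)
 define J where "J = (LEAST n. y <= 2 ^ n)"
 have yJ: "y <= 2 ^ J" unfolding J_def by (rule LeastI) fact
 have J0: "J > 0" using yJ y1 by (cases J) auto
 have "~ y <= 2 ^ (J - 1)" unfolding J_def by (rule not_less_Least) (use J0 in \<open>simp add: J_def\<close>)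
 hence "real (2 ^ (J - 1)) <= y" by (simp only: of_nat_le_iff)
 hence "2 ^ (J - 1) <= real y" by simp
 hence "ln (2 ^ (J - 1) :: real) <= ln y" by (intro ln_mono) auto
 hence "real (J - 1) * ln 2 <= ln y" by (simp add: ln_realpow)
 moreover have "real (J - 1) * (1 / 2) <= real (J - 1) * ln 2" using ln2_ge_two_thirds by (intro mult_left_mono) auto
 ultimately have J: "real J <= 3 * ln y" using y J0 by (simp add: of_nat_diff)
 define M where "M b = 2 ^ b * y ^ j" for b :: nat
 define Ab where "Ab b = A Int {M b<..M b + M b}" for b
 have finA: "finite A" using A finite_cell finite_subset by blast
 have M2: "M (Suc b) = M b + M b" for b by (simp add: M_def)
 have mono: "M b <= M b'" if "b <= b'" for b b' :: nat unfolding M_def using that by (simp add: power_increasing)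
 have dis: "disjoint_family_on Ab {..<J}"
  unfolding disjoint_family_on_def
 proof (intro ballI impI)
  fix b b' :: nat assume "b ~= b'"
  then consider "Suc b <= b'" | "Suc b' <= b" by linarith
  thus "Ab b Int Ab b' = {}" using mono[of "Suc b" b'] mono[of "Suc b'" b] M2[of b] M2[of b']
   by cases (auto simp: Ab_def)
 qed
 have UN: "(UN b<J. Ab b) = A"
 proof
  show "A \<subseteq> (UN b<J. Ab b)"
  proof
   fix p assume p: "p : A"
   hence p1: "M 0 < p" "p <= M J" using A yJ y1 by (auto simp: cell_def M_def intro: order.trans[of _ "y * y ^ j"])
   define b where "b = (LEAST b. p <= M b)"
   have pb: "p <= M b" unfolding b_def by (rule LeastI) (rule p1(2))
   have "b <= J" unfolding b_def by (rule Least_le) (rule p1(2))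
   moreover have b0: "b > 0" using pb p1 by (cases b) auto
   moreover have "~ p <= M (b - 1)" unfolding b_def by (rule not_less_Least) (use b0 in \<open>simp add: b_def\<close>)
   ultimately show "p : (UN b<J. Ab b)" using p pb M2[of "b - 1"] by (auto simp: Ab_def intro!: bexI[of _ "b - 1"])
  qed
 qed (auto simp: Ab_def)
 have "cform (PyL y 7) (UN b<J. Ab b) \<alpha> <= real J * (SUM b<J. (real (M b) + 2 * real ((y ^ 7)\<^sup>2) * harm ((y ^ 7)\<^sup>2)) * (SUM m:Ab b. (\<alpha> m)\<^sup>2))"
 proof (rule large_sieve_blocks[where M = M])
  show "Ab b \<subseteq> {M b<..M b + M b}" for b by (simp add: Ab_def)
 qed (use Py_prod(1,2)[of _ y] dis y1 in auto)
 also have "... <= real J * (SUM b<J. 62 / ln y)"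
 proof (intro mult_left_mono sum_mono)
  fix b assume "b : {..<J}"
  have My: "y ^ j <= M b" by (simp add: M_def)
  have y15: "y ^ 15 <= y ^ j" using j y1 by (intro power_increasing) auto
  have yM: "y <= M b" using y1 j My self_le_power[of y j] by linarith
  have M2': "M b >= 2" using yM y1 by linarith
  have "harm ((y ^ 7)\<^sup>2) = harm (y ^ 14)" by (simp flip: power_mult)
  also have "... <= 15 * real y" using harm_le_linear[of y 14] y1 by simp
  finally have "2 * real ((y ^ 7)\<^sup>2) * harm ((y ^ 7)\<^sup>2) <= 2 * real ((y ^ 7)\<^sup>2) * (15 * real y)"
   by (intro mult_left_mono) auto
  also have "... = 30 * real (y ^ 15)" by (simp add: power_numeral_reduce power2_eq_square)
  also have "... <= 30 * real (M b)" using order.trans[OF y15 My] by (intro mult_left_mono) (simp_all only: of_nat_le_iff)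
  finally have 1: "real (M b) + 2 * real ((y ^ 7)\<^sup>2) * harm ((y ^ 7)\<^sup>2) <= 31 * real (M b)" by simp
  have "(SUM m:Ab b. (\<alpha> m)\<^sup>2) <= (SUM m:Ab b. (1 / real (M b))\<^sup>2)"
  proof (rule sum_mono)
   fix m assume m: "m : Ab b"
   hence "\<bar>\<alpha> m\<bar> <= 1 / real m" using \<alpha> by (simp add: Ab_def)
   also have "... <= 1 / real (M b)" using m M2' by (intro divide_left_mono) (auto simp: Ab_def)
   finally show "(\<alpha> m)\<^sup>2 <= (1 / real (M b))\<^sup>2" by (metis abs_ge_zero power2_abs power_mono)
  qed
  also have "... = real (card (Ab b)) * (1 / real (M b))\<^sup>2" by simp
  also have "real (card (Ab b)) <= 2 * real (M b) / ln y"
  proof -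
   have "card (Ab b) <= card {p. prime p & M b < p & p <= 2 * M b}"
    by (rule card_mono) (use A in \<open>auto simp: Ab_def cell_def\<close>)
   hence "real (card (Ab b)) * ln (M b) <= real (card {p. prime p & M b < p & p <= 2 * M b}) * ln (M b)"
    using M2' by (intro mult_right_mono) auto
   also have "... <= 2 * real (M b)" by (rule card_primes_dyadic[OF M2'])
   finally have "real (card (Ab b)) * ln (M b) <= 2 * real (M b)" .
   moreover have "real (card (Ab b)) * ln y <= real (card (Ab b)) * ln (M b)"
    using yM y1 by (intro mult_left_mono ln_mono) auto
   ultimately show ?thesis using y by (simp add: le_divide_eq)
  qed
  finally have 2: "(SUM m:Ab b. (\<alpha> m)\<^sup>2) <= 2 * real (M b) / ln y * (1 / real (M b))\<^sup>2" by (simp add: mult_right_mono)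
  have "(real (M b) + 2 * real ((y ^ 7)\<^sup>2) * harm ((y ^ 7)\<^sup>2)) * (SUM m:Ab b. (\<alpha> m)\<^sup>2) <= 31 * real (M b) * (2 * real (M b) / ln y * (1 / real (M b))\<^sup>2)"
   by (intro mult_mono 1 2 sum_nonneg) auto
  also have "... = 62 / ln y" using M2' by (simp add: power2_eq_square)
  finally show "(real (M b) + 2 * real ((y ^ 7)\<^sup>2) * harm ((y ^ 7)\<^sup>2)) * (SUM m:Ab b. (\<alpha> m)\<^sup>2) <= 62 / ln y" .
 qed auto
 also have "... = 62 * (real J * real J) / ln y" by simp
 also have "... <= 62 * (3 * ln y * (3 * ln y)) / ln y" using J y by (intro divide_right_mono mult_left_mono mult_mono) auto
 also have "... = 558 * ln y" using y by simp
 also have "... <= 1000 * ln y" using y by simp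
 finally show ?thesis unfolding UN .
qed

text \<open>The logarithm in \<open>cform_small\<close> is cancelled by the sum of reciprocal
  totients over \<open>\<Prod>T <= y\<close>, and an absolute constant remains. The exponent 7 is
  split as 6 for \<open>S\<close> and 1 for \<open>T\<close>.\<close>

lemma Hform_small_range:
 "EX K>=1. EX y0. ALL y>=y0. ALL j>=15. ALL A<=cell y j. ALL \<alpha>. (ALL p:A. \<bar>\<alpha> p\<bar> <= 1 / real p) -->
  (SUM S:PyL y 6. rP S * Hform A \<alpha> S / 2 ^ card S) <= K"
proof -
 obtain y0 where y0: "!!y S. y >= y0 ==> S \<subseteq> Py y ==> cW / 4 * ln y / 2 ^ card S <= (SUM T:{T:Pow (Py y - S). \<Prod>T <= y}. iph T)"
  using sum_inv_totient_ge by blast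
 obtain N :: nat where N: "N >= 1" "ln (real N) > 1" using ex_nat_ln_gt by blast
 have "(SUM S:PyL y 6. rP S * Hform A \<alpha> S / 2 ^ card S) <= 4000 / cW"
  if y: "y >= max y0 N" and j: "j >= 15" and A: "A \<subseteq> cell y j" and \<alpha>: "ALL p:A. \<bar>\<alpha> p\<bar> <= 1 / real p" for y j A \<alpha>
 proof -
  let ?\<S> = "PyL y 6"
  have "ln (real N) <= ln y" using y N by (intro ln_mono) auto
  hence l: "ln (real y) >= 1" using N by linarith
  have y1: "y >= 1" using y N by linarith
  have yj: "y ^ 7 <= y ^ j" "y ^ 6 <= y ^ j" using y1 j by (auto intro!: power_increasing)
  have "cW / 4 * ln y * (SUM S:?\<S>. rP S * Hform A \<alpha> S / 2 ^ card S) = (SUM S:?\<S>. rP S * Hform A \<alpha> S * (cW / 4 * ln y / 2 ^ card S))"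
   by (simp add: sum_distrib_left mult_ac del: of_nat_prod)
  also have "... <= (SUM S:?\<S>. rP S * Hform A \<alpha> S * (SUM T:{T:Pow (Py y - S). \<Prod>T <= y}. iph T))"
  proof (intro sum_mono mult_left_mono)
   fix S assume S: "S : ?\<S>"
   thus "cW / 4 * ln y / 2 ^ card S <= (SUM T:{T:Pow (Py y - S). \<Prod>T <= y}. iph T)"
    using y0[of y S] y by simp
   have sub: "S \<subseteq> Py y" using S by simp
   have "0 <= Hform A \<alpha> S"
   proof (rule Hform_nonneg[OF Py_prod(1,2)[OF sub]])
    fix m p assume "m : A" "p : S"
    thus "~ p dvd m" using not_dvd_cell[of m y j p S] A S sub yj by auto
   qed
   thus "0 <= rP S * Hform A \<alpha> S" by (intro mult_nonneg_nonneg of_nat_0_le_iff)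
  qed
  also have "... <= cform (PyL y 7) A \<alpha>"
   by (rule cform_ge[OF A yj(1)]) (simp flip: power_Suc2)
  also have "... <= 1000 * ln y" using \<alpha> by (intro cform_small[OF A j _ l]) auto
  finally have "ln y * (cW / 4 * (SUM S:?\<S>. rP S * Hform A \<alpha> S / 2 ^ card S)) <= ln y * 1000" by (simp add: mult_ac del: of_nat_prod)
  hence "cW / 4 * (SUM S:?\<S>. rP S * Hform A \<alpha> S / 2 ^ card S) <= 1000" using l by (simp only: mult_le_cancel_left_pos[of "ln y"]) 
  thus ?thesis using cW_pos by (simp add: le_divide_eq mult_ac del: of_nat_prod)
 qed
 moreover have "4000 / cW >= 1" using cW_pos cW_le_1 by (simp add: le_divide_eq)
 ultimately show ?thesis by blast
qed

text \<open>Where powers of \<open>y\<close> may be lost, \<open>T = {}\<close> alone is kept, every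
  coefficient is replaced by \<open>1 / y ^ j\<close>, and the harmonic factor of the large sieve is
  absorbed into powers of \<open>y\<close>.\<close>

lemma Hform_large_range:
 assumes A: "A \<subseteq> cell y j" and \<alpha>: "!!p. p : A ==> \<bar>\<alpha> p\<bar> <= 1 / real p" and y: "y >= 1000" and t: "t <= 192" "t <= j"
 shows "(SUM S:PyL y t. rP S * Hform A \<alpha> S) <= real y ^ 2 + real y ^ (2 * t + 3) / real y ^ j"
proof -
 let ?z1 = "SUM m:A. (\<alpha> m)\<^sup>2"
 let ?\<S> = "PyL y t"
 have yj: "y ^ t <= y ^ j" using y t by (intro power_increasing) auto
 have "(SUM S:?\<S>. rP S * Hform A \<alpha> S) <= (SUM S:?\<S>. rP S * Hform A \<alpha> S * (SUM T:{T:Pow (Py y - S). \<Prod>T <= 1}. iph T))"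
 proof (rule sum_mono)
  fix S assume S: "S : ?\<S>"
  have sub: "S \<subseteq> Py y" using S by simp
  have "0 <= Hform A \<alpha> S"
  proof (rule Hform_nonneg[OF Py_prod(1,2)[OF sub]])
   fix m p assume "m : A" "p : S"
   thus "~ p dvd m" using not_dvd_cell[of m y j p S] A S sub yj by auto
  qed
  hence *: "0 <= rP S * Hform A \<alpha> S" by (intro mult_nonneg_nonneg of_nat_0_le_iff)
  have "(SUM T:{{}}. iph T) <= (SUM T:{T:Pow (Py y - S). \<Prod>T <= 1}. iph T)"
  proof (rule sum_mono2)
   fix T assume "T : {T:Pow (Py y - S). \<Prod>T <= 1} - {{}}"
   hence "T \<subseteq> Py y" by auto
   hence "p > 1" if "p : T" for p using Py_prod(2)[of T y] that prime_gt_1_nat by blast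
   thus "0 <= iph T" by (intro prod_nonneg) (auto simp: less_imp_le)
  qed auto
  hence "1 <= (SUM T:{T:Pow (Py y - S). \<Prod>T <= 1}. iph T)" by simp
  from mult_left_mono[OF this *] show "rP S * Hform A \<alpha> S <= rP S * Hform A \<alpha> S * (SUM T:{T:Pow (Py y - S). \<Prod>T <= 1}. iph T)" by simp
 qed
 also have "... <= cform ?\<S> A \<alpha>" by (rule cform_ge[OF A yj]) simp
 also have "... <= (real (y ^ Suc j) + 2 * real ((y ^ t)\<^sup>2) * harm ((y ^ t)\<^sup>2)) * ?z1"
  unfolding cform_def
  by (rule large_sieve[where M = 0]) (use Py_prod(1,2)[of _ y] A y in \<open>auto simp: cell_def\<close>)
 also have "... <= (real y ^ Suc j + real y ^ (2 * t + 2)) * (real y / real y ^ j)"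
 proof (rule mult_mono)
  have "harm ((y ^ t)\<^sup>2) = harm (y ^ (2 * t))" by (simp flip: power_mult add: mult.commute)
  also have "... <= (1 + real (2 * t)) * real y" using y by (intro harm_le_linear) auto
  also have "... <= 400 * real y" using t by (intro mult_right_mono) auto
  finally have "2 * real ((y ^ t)\<^sup>2) * harm ((y ^ t)\<^sup>2) <= 2 * real ((y ^ t)\<^sup>2) * (400 * real y)" by (intro mult_left_mono) auto
  also have "... = real y ^ (2 * t) * (800 * real y)" by (simp flip: power_mult add: mult.commute)
  also have "... <= real y ^ (2 * t) * (real y * real y)" using y by (intro mult_left_mono mult_right_mono) auto
  finally show "real (y ^ Suc j) + 2 * real ((y ^ t)\<^sup>2) * harm ((y ^ t)\<^sup>2) <= real y ^ Suc j + real y ^ (2 * t + 2)"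
   by (simp add: power_add power2_eq_square mult_ac)
  have "?z1 <= (SUM m:A. (1 / real y ^ j)\<^sup>2)"
  proof (rule sum_mono)
   fix m assume m: "m : A"
   hence "\<bar>\<alpha> m\<bar> <= 1 / real m" using \<alpha> by simp
   also have "... <= 1 / real (y ^ j)" using m A y by (intro divide_left_mono) (auto simp: cell_def less_imp_le simp flip: of_nat_power)
   finally have "\<bar>\<alpha> m\<bar> <= 1 / real y ^ j" by simp
   thus "(\<alpha> m)\<^sup>2 <= (1 / real y ^ j)\<^sup>2" by (metis abs_ge_zero power2_abs power_mono)
  qed
  also have "... = real (card A) * (1 / real y ^ j)\<^sup>2" by simp
  also have "... <= real (y ^ Suc j) * (1 / real y ^ j)\<^sup>2"
  proof (rule mult_right_mono)
   have "card A <= card {1..y ^ Suc j}" using A prime_gt_0_nat by (intro card_mono) (auto simp: cell_def Suc_le_eq)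
   thus "real (card A) <= real (y ^ Suc j)" by (simp only: of_nat_le_iff card_atLeastAtMost diff_Suc_1)
  qed simp
  also have "... = real y / real y ^ j" by (simp add: power2_eq_square)
  finally show "?z1 <= real y / real y ^ j" .
 qed (auto intro: sum_nonneg)
 also have "... = real y ^ 2 + real y ^ (2 * t + 3) / real y ^ j"
  using y by (simp add: field_simps power_add power2_eq_square power3_eq_cube)
 finally show ?thesis .
qed

end

section \<open>Congruent pairs of primes in a cell\<close>

lemma cong_prod_primes_iff:
 assumes V: "finite V" "!!p. p : V ==> prime (p::nat)"
 shows "m mod \<Prod>V = n mod \<Prod>V \<longleftrightarrow> (ALL p:V. m mod p = n mod p)"
proof
 assume *: "m mod \<Prod>V = n mod \<Prod>V"
 show "ALL p:V. m mod p = n mod p"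
 proof
  fix p assume "p : V"
  hence "p dvd \<Prod>V" using V(1) by (intro dvd_prodI) auto
  thus "m mod p = n mod p" by (metis * mod_mod_cancel)
 qed
next
 assume *: "ALL p:V. m mod p = n mod p"
 have "[m = n] (mod (PROD p:V. p))"
  using V(2) * by (intro coprime_cong_prod_nat) (auto simp: Cong.cong_def primes_coprime)
 thus "m mod \<Prod>V = n mod \<Prod>V" by (simp add: Cong.cong_def)
qed

lemma card_residue_class_le:
 assumes "r >= 1"
 shows "real (card {n:{1..N}. n mod r = a}) <= real N / real r + 1"
proof -
 let ?z1 = "{n:{1..N}. n mod r = a}"
 have inj: "inj_on (%n. n div r) ?z1"
 proof (rule inj_onI)
  fix m n assume "m : ?z1" "n : ?z1" "m div r = n div r"
  thus "m = n" using div_mult_mod_eq[of m r] div_mult_mod_eq[of n r] by simp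
 qed
 have "card ?z1 = card ((%n. n div r) ` ?z1)"
  by (rule card_image[OF inj, symmetric])
 also have "... <= card {..N div r}" by (intro card_mono) (auto intro: div_le_mono)
 finally have "card ?z1 <= N div r + 1" by simp
 hence "real (card ?z1) <= real (N div r) + 1" by linarith
 also have "real (N div r) <= real N / real r" by (rule of_nat_div_le_of_nat)
 finally show ?thesis by simp
qed

lemma sum_square_le_of_prod:
 fixes x a b :: "'a => real"
 assumes "!!i. i : S ==> 0 <= a i" "!!i. i : S ==> 0 <= b i" "!!i. i : S ==> 0 <= x i" "!!i. i : S ==> (x i)\<^sup>2 <= a i * b i"
 shows "(SUM i:S. x i)\<^sup>2 <= (SUM i:S. a i) * (SUM i:S. b i)"
proof -
 have "(SUM i:S. x i)\<^sup>2 <= (SUM i:S. sqrt (a i) * sqrt (b i))\<^sup>2"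
 proof (intro power_mono sum_mono sum_nonneg)
  fix i assume i: "i : S"
  have "x i <= sqrt (a i * b i)" using assms(4)[OF i] by (rule real_le_rsqrt)
  thus "x i <= sqrt (a i) * sqrt (b i)" by (simp add: real_sqrt_mult)
 qed (use assms in auto)
 also have "... <= (SUM i:S. (sqrt (a i))\<^sup>2) * (SUM i:S. (sqrt (b i))\<^sup>2)" by (rule Cauchy_Schwarz_ineq_sum)
 also have "... = (SUM i:S. a i) * (SUM i:S. b i)" using assms by simp
 finally show ?thesis .
qed

definition Epair :: "nat set => nat set => real" where
 "Epair A V = (SUM m:A. SUM m':A. 1 / real m * (1 / real m') * (if ALL p:V. m mod p = m' mod p then 1 else 0))"

lemma Epair_nonneg: "0 <= Epair A V"
 unfolding Epair_def by (intro sum_nonneg) auto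

context bigsieve
begin

text \<open>Every subset \<open>S\<close> of \<open>V\<close> occurs in the sum bounded by
  \<open>K\<close>, so each single form is at most \<open>K * 2 ^ card S / \<Prod>S\<close>.
  Completing \<open>\<Prod>S\<close> to \<open>\<Prod>V\<close> and adding over the
  \<open>2 ^ card V\<close> subsets gives \<open>4 ^ card V\<close>.\<close>

lemma Epair_small:
 assumes A: "A \<subseteq> cell y i" and i: "i >= 6" and y: "y >= 1" and V: "V \<subseteq> Py y" "\<Prod>V <= y ^ 6"
  and K: "(SUM S:PyL y 6. rP S * Hform A (%p. 1 / real p) S / 2 ^ card S) <= K"
 shows "Epair A V <= K * 4 ^ card V / rP V"
proof -
 let ?H = "Hform A (%p. 1 / real p)" and ?\<S> = "PyL y 6"
 have yi: "y ^ 6 <= y ^ i" using y i by (intro power_increasing) auto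
 have fV: "finite V" using Py_prod(1)[OF V(1)] .
 have H0: "0 <= ?H S" if "S : ?\<S>" for S
 proof -
  have sub: "S \<subseteq> Py y" using that by simp
  show ?thesis
  proof (rule Hform_nonneg[OF Py_prod(1,2)[OF sub]])
   fix m p assume "m : A" "p : S"
   thus "~ p dvd m" using not_dvd_cell[of m y i p S] A that yi by auto
  qed
 qed
 have "Epair A V = (SUM S:Pow V. ?H S * iph (V - S))"
  unfolding Epair_def by (rule congruent_pairs_expand[OF fV])
 also have "... <= (SUM S:Pow V. K * 2 ^ card V / rP V)"
 proof (rule sum_mono)
  fix S assume S: "S : Pow V"
  have VS: "\<Prod>V = \<Prod>(V - S) * \<Prod>S" using prod.subset_diff[of S V "%x. x"] S fV by simp
  have sub: "S \<subseteq> Py y" "V - S \<subseteq> Py y" using S V by auto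
  have "1 * \<Prod>S <= \<Prod>V" unfolding VS using Py_prod(3)[OF sub(2)] by (intro mult_right_mono) auto
  hence S6: "S : ?\<S>" using V sub by auto
  have "rP S * ?H S / 2 ^ card S <= (SUM S:?\<S>. rP S * ?H S / 2 ^ card S)"
   using H0 by (intro member_le_sum[OF S6]) (auto intro!: divide_nonneg_pos mult_nonneg_nonneg of_nat_0_le_iff simp del: of_nat_prod)
  hence "rP S * ?H S / 2 ^ card S <= K" using K by linarith
  hence a: "?H S <= K * 2 ^ card S / rP S"
   using Py_prod(3)[OF sub(1)] by (simp add: field_simps del: of_nat_prod)
  have b: "iph (V - S) <= (PROD p:V - S. 2 / real p)"
  proof (rule prod_mono)
   fix p assume "p : V - S"
   hence "prime p" using Py_prod(2)[OF V(1)] by auto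
   hence "real p >= 2" using prime_ge_2_nat by force
   thus "0 <= 1 / (real p - 1) & 1 / (real p - 1) <= 2 / real p" by (simp add: field_simps)
  qed
  have "?H S * iph (V - S) <= ?H S * (PROD p:V - S. 2 / real p)"
   by (rule mult_left_mono[OF b H0[OF S6]])
  also have "... <= K * 2 ^ card S / rP S * (PROD p:V - S. 2 / real p)"
   by (rule mult_right_mono[OF a]) (auto intro: prod_nonneg)
  also have "... = K * (2 ^ card S * 2 ^ card (V - S)) / rP V"
   unfolding VS by (simp add: prod_dividef mult_ac)
  also have "2 ^ card S * 2 ^ card (V - S) = (2::real) ^ card V"
   using S fV by (simp add: card_Diff_subset finite_subset card_mono flip: power_add)
  finally show "?H S * iph (V - S) <= K * 2 ^ card V / rP V" .
 qed
 also have "... = K * (2 ^ card V * 2 ^ card V) / rP V" using fV by (simp add: card_Pow)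
 also have "2 ^ card V * 2 ^ card V = (4::real) ^ card V" by (simp flip: power_mult_distrib)
 finally show ?thesis .
qed

text \<open>All integers of a residue class are counted in place of primes; the term
  \<open>1 / y ^ i\<close> is for moduli longer than the cell.\<close>

lemma Epair_large:
 assumes A: "A \<subseteq> cell y i" and y: "y >= 1" and V: "V \<subseteq> Py y"
 shows "Epair A V <= real y * (real y / rP V + 1 / real y ^ i)"
proof -
 let ?z1 = "real y / rP V + 1 / real y ^ i"
 have finA: "finite A" using A finite_cell finite_subset by blast
 have inv: "1 / real m <= 1 / real y ^ i" if "m : A" for m
 proof -
  have "real (y ^ i) <= real m" using that A by (simp only: of_nat_le_iff) (auto simp: cell_def)
  thus ?thesis using y by (simp add: frac_le)
 qed
 have A1: "A \<subseteq> {1..y ^ Suc i}" using A prime_gt_0_nat by (auto simp: cell_def Suc_le_eq)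
 have inner: "(SUM m':A. 1 / real m' * (if ALL p:V. m mod p = m' mod p then 1 else 0)) <= real y / rP V + 1 / real y ^ i" for m
 proof -
  let ?r = "\<Prod>V"
  have "(SUM m':A. 1 / real m' * (if ALL p:V. m mod p = m' mod p then 1 else 0)) = (SUM m':{m':A. m' mod ?r = m mod ?r}. 1 / real m')"
  proof -
   have iff: "(ALL p:V. m mod p = m' mod p) \<longleftrightarrow> m' mod ?r = m mod ?r" for m'
    using cong_prod_primes_iff[OF Py_prod(1,2)[OF V], of m m'] by auto
   show ?thesis unfolding iff by (rule sum.mono_neutral_cong_right) (use finA in auto)
  qed
  also have "... <= (SUM m':{m':A. m' mod ?r = m mod ?r}. 1 / real y ^ i)" using inv by (intro sum_mono) auto
  also have "... = real (card {m':A. m' mod ?r = m mod ?r}) * (1 / real y ^ i)" by simp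
  also have "... <= (real (y ^ Suc i) / real ?r + 1) * (1 / real y ^ i)"
  proof (rule mult_right_mono)
   have "card {m':A. m' mod ?r = m mod ?r} <= card {m':{1..y ^ Suc i}. m' mod ?r = m mod ?r}"
    using A1 by (intro card_mono) auto
   thus "real (card {m':A. m' mod ?r = m mod ?r}) <= real (y ^ Suc i) / real ?r + 1"
    using card_residue_class_le[OF Py_prod(3)[OF V], of "y ^ Suc i" "m mod ?r"] by linarith
  qed simp
  also have "... = real y / real ?r + 1 / real y ^ i" using y by (simp add: field_simps del: of_nat_prod)
  finally show ?thesis .
 qed
 have nn: "0 <= real y / rP V + 1 / real y ^ i" by (intro add_nonneg_nonneg divide_nonneg_nonneg of_nat_0_le_iff) auto
 have "Epair A V = (SUM m:A. 1 / real m * (SUM m':A. 1 / real m' * (if ALL p:V. m mod p = m' mod p then 1 else 0)))"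
  unfolding Epair_def by (simp add: sum_distrib_left mult.assoc)
 also have "... <= (SUM m:A. 1 / real y ^ i * ?z1)"
  using inv inner by (intro sum_mono mult_mono) (auto intro!: sum_nonneg)
 also have "... = real (card A) * (1 / real y ^ i) * ?z1" by simp
 also have "... <= real (y ^ Suc i) * (1 / real y ^ i) * ?z1"
 proof (intro mult_right_mono nn)
  have "card A <= card {1..y ^ Suc i}" using A1 by (intro card_mono) auto
  thus "real (card A) <= real (y ^ Suc i)" by (simp only: of_nat_le_iff card_atLeastAtMost diff_Suc_1)
 qed simp
 also have "real (y ^ Suc i) * (1 / real y ^ i) = real y" using y by simp
 finally show ?thesis .
qed

text \<open>A minorant of \<open>1 / p\<close> on the cell, since there \<open>ln p\<close> is at
  most \<open>(j + 1) * ln y\<close>. Its sums over residue classes are differences of Mertens sums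
  and so are known without the prime number theorem.\<close>

definition betaw :: "nat => nat => nat => real" where "betaw y j p = ln (real p) / (real p * (real (Suc j) * ln (real y)))"
definition clscell :: "nat => nat => nat => nat set" where "clscell y j b = {p:cell y j. ALL q:W0. p mod q = b mod q}"

lemma betaw_le:
 assumes "p : cell y j" "y >= 3"
 shows "\<bar>betaw y j p\<bar> <= 1 / real p"
proof -
 let ?z1 = "real (Suc j) * ln (real y)"
 have p: "p >= 2" "p <= y ^ Suc j" using assms prime_ge_2_nat by (auto simp: cell_def)
 have l: "ln (real y) > 0" using assms by simp
 have "real p <= real (y ^ Suc j)" using p by (simp only: of_nat_le_iff)
 hence "ln (real p) <= ln (real (y ^ Suc j))" using p by (intro ln_mono) auto
 also have "... = real (Suc j) * ln (real y)" unfolding of_nat_power by (rule ln_realpow)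
 finally have "ln (real p) <= real (Suc j) * ln (real y)" .
 hence "ln (real p) / ?z1 <= 1" using l by (subst divide_le_eq_1) auto
 moreover have "0 <= ln (real p) / ?z1" using l p by simp
 note ** = this
 ultimately have "1 / real p * \<bar>ln (real p) / ?z1\<bar> <= 1 / real p * 1" unfolding abs_of_nonneg[OF **] by (intro mult_left_mono) auto
 moreover have "betaw y j p = 1 / real p * (ln (real p) / ?z1)" by (simp add: betaw_def)
 ultimately show ?thesis by (simp only: abs_mult) simp
qed

text \<open>The main terms of the Mertens sums at the two ends of the cell differ by
  \<open>ln y\<close> over the totient; their bounded errors become \<open>O (1 / ln y)\<close>
  after normalisation.\<close>

lemma betaw_class_sum:
 assumes U: "finite U" "!!p. p : U ==> prime p" and r: "!!p. p : U ==> ~ p dvd r"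
 shows "EX C. ALL y>=2. \<bar>(SUM m:{m:cell y j. ALL q:U. m mod q = r mod q}. betaw y j m) - 1 / (real (Suc j) * (PROD p:U. real (p - 1)))\<bar> <= C / ln (real y)"
proof -
 obtain C where C: "!!N. N >= 1 ==> \<bar>(SUM p:{p:{1..N}. prime p & (ALL q:U. p mod q = r mod q)}. ln (real p) / real p) - ln (real N) / (PROD p:U. real (p - 1))\<bar> <= C"
  using dirichlet_mertens[OF U r] by blast
 let ?\<kappa> = "1 / (real (Suc j) * (PROD p:U. real (p - 1)))"
 have "\<bar>(SUM m:{m:cell y j. ALL q:U. m mod q = r mod q}. betaw y j m) - ?\<kappa>\<bar> <= 2 * C / ln (real y)" if y2: "y >= 2" for y
 proof -
  have l: "ln (real y) > 0" using y2 by simp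
  define T where "T = (SUM m:{m:cell y j. ALL q:U. m mod q = r mod q}. betaw y j m)"
define Sg where "Sg N = (SUM p:{p:{1..N}. prime p & (ALL q:U. p mod q = r mod q)}. ln (real p) / real p)" for N :: nat
have "y ^ j <= y ^ Suc j" using y2 by (intro power_increasing) auto
hence set: "{p:{1..y ^ Suc j}. prime p & (ALL q:U. p mod q = r mod q)} =
  {p:{1..y ^ j}. prime p & (ALL q:U. p mod q = r mod q)} Un {m:cell y j. ALL q:U. m mod q = r mod q}"
 unfolding cell_def by (auto simp: Suc_le_eq prime_gt_0_nat simp del: power_Suc)
have "Sg (y ^ Suc j) = Sg (y ^ j) + (SUM m:{m:cell y j. ALL q:U. m mod q = r mod q}. ln (real m) / real m)"
 unfolding Sg_def set by (rule sum.union_disjoint) (auto simp: cell_def)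
moreover have "(SUM m:{m:cell y j. ALL q:U. m mod q = r mod q}. ln (real m) / real m) = real (Suc j) * ln y * T"
 using l unfolding T_def sum_distrib_left by (intro sum.cong) (auto simp: betaw_def)
ultimately have 1: "real (Suc j) * ln y * T = Sg (y ^ Suc j) - Sg (y ^ j)" by simp
let ?\<phi> = "PROD p:U. real (p - 1)"
have a: "\<bar>Sg (y ^ Suc j) - ln (real (y ^ Suc j)) / ?\<phi>\<bar> <= C" "\<bar>Sg (y ^ j) - ln (real (y ^ j)) / ?\<phi>\<bar> <= C"
 using C[of "y ^ Suc j"] C[of "y ^ j"] y2 unfolding Sg_def by auto
have "ln (real (y ^ Suc j)) / ?\<phi> - ln (real (y ^ j)) / ?\<phi> = ln y / ?\<phi>"
 using y2 by (simp add: ln_realpow ln_mult algebra_simps diff_divide_distrib[symmetric] add_divide_distrib)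
hence 2: "\<bar>real (Suc j) * ln y * T - ln y / ?\<phi>\<bar> <= 2 * C" using a 1 by linarith
have "real (Suc j) * ln y * T - ln y / ?\<phi> = real (Suc j) * ln y * (T - ?\<kappa>)"
proof -
 have "real (Suc j) * ln y * ?\<kappa> = ln y / ?\<phi>" by (simp del: of_nat_Suc)
 thus ?thesis by (simp only: right_diff_distrib)
qed
hence "real (Suc j) * ln y * \<bar>T - ?\<kappa>\<bar> <= 2 * C" using 2 l by (simp only: abs_mult abs_of_pos[OF l] abs_of_nat)
moreover have "1 * ln y * \<bar>T - ?\<kappa>\<bar> <= real (Suc j) * ln y * \<bar>T - ?\<kappa>\<bar>"
 using l by (intro mult_right_mono) auto
ultimately have "1 * ln y * \<bar>T - ?\<kappa>\<bar> <= 2 * C" by linarith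
hence "\<bar>T - ?\<kappa>\<bar> <= 2 * C / ln y" by (simp only: pos_le_divide_eq[OF l] mult_1 mult.commute)
  thus ?thesis unfolding T_def .
 qed
 thus ?thesis by blast
qed

text \<open>For fixed \<open>V\<close> the product over \<open>V\<close> and the condition modulo
  \<open>W\<close> depend only on \<open>m\<close> modulo \<open>\<Prod>U\<close>. The class sums
  that occur share one limit, while \<open>F\<close> has mean 0 over the residues because the
  centred indicators at any prime of \<open>V\<close> do.\<close>

lemma Gk_fixed_tendsto:
 assumes V: "finite V" "V ~= {}" "!!p. p : V ==> prime p & D0 < p" and c: "!!p. p : V ==> ~ p dvd c" and I: "finite I"
  and e: "!!h p. h : I ==> p : V ==> ~ p dvd e h p" and b: "!!q. q : W0 ==> ~ q dvd b" and j: "j >= 1"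
 shows "EX C. ALL y>\<Prod>V. \<bar>Gk I e (clscell y j b) (betaw y j) V c\<bar> <= C / ln (real y)"
proof -
 define U where "U = W0 Un V"
 have WV: "W0 Int V = {}" using V(3) by (force simp: W0_def)
 have U: "finite U" "!!p. p : U ==> prime p" using V by (auto simp: U_def W0_def)
 define f where "f p x = (if p : V then (if x = 0 then 0 else SUM h:I. eker p (e h p) c x) else if x = b mod p then 1 else 0)" for p x
 define F where "F r = (PROD p:U. f p (r mod p))" for r
 let ?\<kappa> = "1 / (real (Suc j) * (PROD p:U. real (p - 1)))"
 have F0: "(SUM r<\<Prod>U. F r) = 0"
 proof -
  obtain p where p: "p : V" using V(2) by blast
  have "(SUM x<p. f p x) = (SUM x:{0<..<p}. SUM h:I. eker p (e h p) c x)"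
   by (rule sum.mono_neutral_cong_right) (use p in \<open>auto simp: f_def\<close>)
  also have "... = (SUM h:I. SUM x:{0<..<p}. eker p (e h p) c x)" by (rule sum.swap)
  also have "... = 0" using sum_eker_zero[of p c] V(3)[OF p] c[OF p] e[OF _ p] by simp
  finally have "(SUM x<p. f p x) = 0" .
  moreover have "(SUM r<\<Prod>U. F r) = (PROD p:U. SUM x<p. f p x)" unfolding F_def by (rule sum_crt_prod[OF U])
  ultimately show ?thesis using p U(1) by (auto simp: U_def intro: prod_zero)
 qed
 \<comment> \<open>A class with \<open>F r = 0\<close> may share a factor with the modulus, where
   Dirichlet's theorem says nothing; it also carries no weight.\<close>
 define ok where "ok r C \<longleftrightarrow> (F r ~= 0 --> (ALL y>=2. \<bar>(SUM m:{m:cell y j. ALL q:U. m mod q = r mod q}. betaw y j m) - ?\<kappa>\<bar> <= C / ln (real y)))" for r C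
 have ok: "EX C. ok r C" for r
 proof (cases "F r = 0")
  case False
  have "~ p dvd r" if "p : U" for p
  proof
   assume "p dvd r"
   hence "f p (r mod p) = 0" using that b[of p] by (auto simp: f_def U_def mod_eq_0_iff_dvd)
   thus False using False U(1) that by (auto simp: F_def)
  qed
  from betaw_class_sum[OF U this] show ?thesis unfolding ok_def by blast
 qed (simp add: ok_def)
 obtain Cr where Cr': "ALL r. ok r (Cr r)" using choice[of ok] ok by blast
 have Cr: "\<bar>(SUM m:{m:cell y j. ALL q:U. m mod q = r mod q}. betaw y j m) - ?\<kappa>\<bar> <= Cr r / ln (real y)"
  if "F r ~= 0" "y >= 2" for r y using Cr'[unfolded ok_def, rule_format, OF that] .
 have "\<bar>Gk I e (clscell y j b) (betaw y j) V c\<bar> <= (SUM r<\<Prod>U. \<bar>F r\<bar> * Cr r) / ln (real y)" if y: "y > \<Prod>V" for y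
 proof -
  have V1: "\<Prod>V >= 1" using cop_prod(2)[OF V(1,3)] .
  have y2: "y >= 2" using V1 y by linarith
  have l: "ln (real y) > 0" using y2 by simp
  have pVy: "p < y" if "p : V" for p
  proof -
   have "p <= \<Prod>V" by (rule dvd_imp_le[OF dvd_prodI[OF V(1) that]]) (use V1 in linarith)
   thus ?thesis using y by simp
  qed
  have Fm: "(if m : clscell y j b then (PROD p:V. SUM h:I. eker p (e h p) c m) else 0) = F (m mod \<Prod>U)" if m: "m : cell y j" for m
  proof -
   have pm: "prime m" "y ^ j < m" using m by (auto simp: cell_def)
   have ym: "y < m" using pm self_le_power[of y j] y2 j by linarith
   have "F (m mod \<Prod>U) = (PROD p:U. f p (m mod p))" unfolding F_def
    using U by (intro prod.cong refl arg_cong[of _ _ "f _"]) (metis dvd_prodI mod_mod_cancel)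
   also have "... = (PROD p:W0. f p (m mod p)) * (PROD p:V. f p (m mod p))"
    unfolding U_def by (rule prod.union_disjoint) (use WV V in auto)
   also have "(PROD p:W0. f p (m mod p)) = (if m : clscell y j b then 1 else 0)"
   proof (cases "m : clscell y j b")
    case True
    thus ?thesis using WV by (auto simp: f_def clscell_def intro!: prod.neutral)
   next
    case False
    then obtain q where q: "q : W0" "m mod q ~= b mod q" using m by (auto simp: clscell_def)
    hence "f q (m mod q) = 0" using WV by (auto simp: f_def)
    hence "(PROD p:W0. f p (m mod p)) = 0" using q by (intro prod_zero) auto
    thus ?thesis using False by simp
   qed
   also have "(PROD p:V. f p (m mod p)) = (PROD p:V. SUM h:I. eker p (e h p) c m)"
   proof (rule prod.cong[OF refl])
    fix p assume p: "p : V"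
    have "~ p dvd m"
    proof
     assume "p dvd m"
     hence "p = m" using pm V(3)[OF p] primes_dvd_imp_eq[of p m] by blast
     thus False using pVy[OF p] ym by simp
    qed
    thus "f p (m mod p) = (SUM h:I. eker p (e h p) c m)" using p by (simp add: f_def eker_mod mod_eq_0_iff_dvd)
   qed
   finally show ?thesis by simp
  qed
  define T where "T r = (SUM m:{m:cell y j. m mod \<Prod>U = r}. betaw y j m)" for r
  have U0: "\<Prod>U > 0" using U prime_gt_0_nat by (intro prod_pos) auto
  have "Gk I e (clscell y j b) (betaw y j) V c = (SUM m:cell y j. betaw y j m * F (m mod \<Prod>U))"
  proof -
   have "Gk I e (clscell y j b) (betaw y j) V c = (SUM m:cell y j. betaw y j m * (if m : clscell y j b then (PROD p:V. SUM h:I. eker p (e h p) c m) else 0))"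
    unfolding Gk_def by (rule sum.mono_neutral_cong_left) (auto simp: clscell_def)
   thus ?thesis using Fm by simp
  qed
  also have "... = (SUM r<\<Prod>U. SUM m:{m:cell y j. m mod \<Prod>U = r}. betaw y j m * F (m mod \<Prod>U))"
   using U0 by (intro sum.group[symmetric]) auto
  also have "... = (SUM r<\<Prod>U. F r * T r)"
   unfolding T_def sum_distrib_left by (intro sum.cong refl) (simp add: mult.commute)
  also have "... = (SUM r<\<Prod>U. F r * (T r - ?\<kappa>))"
  proof -
   have "(SUM r<\<Prod>U. F r * (T r - ?\<kappa>)) = (SUM r<\<Prod>U. F r * T r) - (SUM r<\<Prod>U. F r) * ?\<kappa>"
    by (simp only: right_diff_distrib sum_subtractf sum_distrib_right)
   thus ?thesis by (simp only: F0 mult_zero_left diff_zero)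
  qed
  finally have "\<bar>Gk I e (clscell y j b) (betaw y j) V c\<bar> <= (SUM r<\<Prod>U. \<bar>F r * (T r - ?\<kappa>)\<bar>)" by simp
  also have "... <= (SUM r<\<Prod>U. \<bar>F r\<bar> * (Cr r / ln y))"
  proof (rule sum_mono)
   fix r assume r: "r : {..<\<Prod>U}"
   show "\<bar>F r * (T r - ?\<kappa>)\<bar> <= \<bar>F r\<bar> * (Cr r / ln y)"
   proof (cases "F r = 0")
    case False
    have "T r = (SUM m:{m:cell y j. ALL q:U. m mod q = r mod q}. betaw y j m)"
     unfolding T_def using r cong_prod_primes_iff[OF U, of _ r] by (intro sum.cong) auto
    hence "\<bar>T r - ?\<kappa>\<bar> <= Cr r / ln y" using Cr[OF False y2] by simp
    thus ?thesis unfolding abs_mult by (intro mult_left_mono) auto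
   qed simp
  qed
  also have "... = (SUM r<\<Prod>U. \<bar>F r\<bar> * Cr r) / ln y" by (simp add: sum_divide_distrib)
  finally show ?thesis .
 qed
 thus ?thesis by blast
qed

end

section \<open>Small, middle and large moduli in the error term\<close>

lemma ex_power_between:
 assumes "y ^ a < (N::nat)" "N <= y ^ b" "y >= 1"
 shows "EX t>=a. t < b & y ^ t < N & N <= y ^ Suc t"
proof -
 define s where "s = (LEAST s. N <= y ^ (a + s))"
 show ?thesis
 proof (cases "a <= b")
  case True
  have s: "N <= y ^ (a + s)" unfolding s_def by (rule LeastI[of _ "b - a"]) (use True assms in simp)
  have sb: "s <= b - a" unfolding s_def by (rule Least_le) (use True assms in simp)
  have s0: "s > 0" using s assms by (cases s) auto
  have "~ N <= y ^ (a + (s - 1))" unfolding s_def by (rule not_less_Least) (use s0 in \<open>simp add: s_def\<close>)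
  thus ?thesis using s sb s0 True by (intro exI[of _ "a + (s - 1)"]) auto
 next
  case False
  hence "y ^ b <= y ^ a" using assms by (intro power_increasing) auto
  thus ?thesis using assms by linarith
 qed
qed

lemma sum_Un_le:
 fixes f :: "'a => real"
 assumes "finite A" "finite B" "!!x. f x >= 0"
 shows "sum f (A Un B) <= sum f A + sum f B"
 using assms by (simp add: sum_Un sum_nonneg)

lemma sum_UNION_le:
 fixes f :: "'a => real"
 assumes "finite T" "!!t. t : T ==> finite (A t)" "!!x. f x >= 0"
 shows "sum f (UN t:T. A t) <= (SUM t:T. sum f (A t))"
 using assms
proof (induction T rule: finite_induct)
 case (insert t T)
 have "sum f (A t Un (UN t:T. A t)) <= sum f (A t) + sum f (UN t:T. A t)"
  using insert by (intro sum_Un_le) auto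
 moreover have "sum f (UN t:T. A t) <= (SUM t:T. sum f (A t))" using insert by auto
 ultimately show ?case using insert by simp
qed simp

lemma square_pow16_mult: "((16::real) ^ n * x)\<^sup>2 = 256 ^ n * x\<^sup>2"
proof -
 have "((16::real) ^ n)\<^sup>2 = (16\<^sup>2) ^ n" by (simp only: power_mult[symmetric] mult.commute)
 thus ?thesis by (simp add: power_mult_distrib)
qed

context bigsieve
begin

text \<open>Cauchy-Schwarz over \<open>V\<close> puts the weight \<open>\<Prod>V\<close> on
  \<open>Hform\<close> and its reciprocal on the congruent pairs; the divisor factors cost one
  \<open>y\<close>. Four terms arise, with exponents \<open>5 - t\<close>, \<open>5 - i\<close>,
  \<open>t + 8 - j\<close> and \<open>2 * t + 8 - i - j\<close>. The conditions on \<open>t\<close>,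
  \<open>i\<close>, \<open>j\<close> and \<open>i + j\<close> make each of them at most -1.\<close>

lemma large_block:
 assumes t: "6 <= t" "t < 192" and i: "15 <= i" and j: "201 <= j" and ij: "400 <= i + j" and y: "y >= 1000"
  and A1: "A1 \<subseteq> cell y i" and A2: "A2 \<subseteq> cell y j" and \<beta>: "!!p. p : A2 ==> \<bar>\<beta> p\<bar> <= 1 / real p"
  and X: "!!V. V \<subseteq> Py y ==> \<Prod>V <= y ^ 192 ==> 0 <= X V & (X V)\<^sup>2 <= Epair A1 V * (49 ^ card V * Hform A2 \<beta> V)"
 shows "(SUM V:{V:Pow (Py y). y ^ t < \<Prod>V & \<Prod>V <= y ^ Suc t}. 16 ^ card V * X V) <= 2 / sqrt y"
proof -
 let ?z1 = "%V. \<Prod>V"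
 let ?\<V> = "{V:Pow (Py y). y ^ t < \<Prod>V & \<Prod>V <= y ^ Suc t}"
 let ?Y = "real y"
 have Y: "?Y > 0" "?Y >= 1" using y by auto
 have t192: "y ^ Suc t <= y ^ 192" "y ^ Suc t <= y ^ j" using t j y by (auto intro!: power_increasing simp del: power_Suc)
 have V: "V \<subseteq> Py y" "\<Prod>V <= y ^ 192" "\<Prod>V <= y ^ j" "rP V > 0" "?Y ^ t <= rP V" if "V : ?\<V>" for V
 proof -
  show sub: "V \<subseteq> Py y" using that by simp
  show "\<Prod>V <= y ^ 192" "\<Prod>V <= y ^ j" using that t192 by auto
  show "rP V > 0" using Py_prod(3)[OF sub] by (simp only: of_nat_0_less_iff)
  have "real (y ^ t) <= rP V" using that by (simp only: of_nat_le_iff) simp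
  thus "?Y ^ t <= rP V" by simp
 qed
 have H0: "0 <= Hform A2 \<beta> V" if V': "V : ?\<V>" for V
 proof (rule Hform_nonneg[OF Py_prod(1,2)[OF V(1)[OF V']]])
  fix m p assume "m : A2" "p : V"
  thus "~ p dvd m" using not_dvd_cell[of m y j p V] A2 V[OF V'] by auto
 qed
 have "(SUM V:?\<V>. 16 ^ card V * X V)\<^sup>2 <= (SUM V:?\<V>. rP V * Hform A2 \<beta> V) * (SUM V:?\<V>. ?Y * Epair A1 V / rP V)"
 proof (rule sum_square_le_of_prod)
  fix V assume V': "V : ?\<V>"
  note VV = V[OF V']
  show "0 <= rP V * Hform A2 \<beta> V" using H0[OF V'] VV by (intro mult_nonneg_nonneg) auto
  show "0 <= ?Y * Epair A1 V / rP V" using Epair_nonneg VV by (intro divide_nonneg_pos mult_nonneg_nonneg) auto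
  show "0 <= 16 ^ card V * X V" using X VV by simp
  have "(12544 ^ card V :: nat) <= y" by (rule card_power_le_y[OF VV(1,2)])
  hence c: "(12544 ^ card V :: real) <= ?Y" by (metis of_nat_le_iff of_nat_numeral of_nat_power)
  have "(16 ^ card V * X V)\<^sup>2 = 256 ^ card V * (X V)\<^sup>2" by (rule square_pow16_mult)
  also have "... <= 256 ^ card V * (Epair A1 V * (49 ^ card V * Hform A2 \<beta> V))" using X VV by (intro mult_left_mono) auto
  also have "... = 12544 ^ card V * (Epair A1 V * Hform A2 \<beta> V)"
  proof -
   have *: "(12544::real) ^ card V = 256 ^ card V * 49 ^ card V" by (simp flip: power_mult_distrib)
   show ?thesis unfolding * by (simp only: mult_ac)
  qed
  also have "... <= ?Y * (Epair A1 V * Hform A2 \<beta> V)" using c H0[OF V'] Epair_nonneg by (intro mult_right_mono) auto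
  also have "... = rP V * Hform A2 \<beta> V * (?Y * Epair A1 V / rP V)" using VV(4) by (simp del: of_nat_prod)
  finally show "(16 ^ card V * X V)\<^sup>2 <= rP V * Hform A2 \<beta> V * (?Y * Epair A1 V / rP V)" .
 qed
 also have "... <= (?Y ^ 2 + ?Y ^ (2 * t + 5) / ?Y ^ j) * (?Y ^ 3 / ?Y ^ t + ?Y ^ 3 / ?Y ^ i)"
 proof (rule mult_mono)
  have "(SUM V:?\<V>. rP V * Hform A2 \<beta> V) <= (SUM V:PyL y (Suc t). rP V * Hform A2 \<beta> V)"
  proof (rule sum_mono2)
   fix V assume V': "V : PyL y (Suc t) - ?\<V>"
   hence sub: "V \<subseteq> Py y" by simp
   have "0 <= Hform A2 \<beta> V"
   proof (rule Hform_nonneg[OF Py_prod(1,2)[OF sub]])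
    fix m p assume "m : A2" "p : V"
    thus "~ p dvd m" using not_dvd_cell[of m y j p V] A2 V' t192 by auto
   qed
   thus "0 <= rP V * Hform A2 \<beta> V" by (intro mult_nonneg_nonneg of_nat_0_le_iff)
  qed auto
  also have "... <= ?Y ^ 2 + ?Y ^ (2 * Suc t + 3) / ?Y ^ j"
   using t j by (intro Hform_large_range[OF A2 \<beta> y]) auto
  finally show "(SUM V:?\<V>. rP V * Hform A2 \<beta> V) <= ?Y ^ 2 + ?Y ^ (2 * t + 5) / ?Y ^ j" by (simp add: numeral_eq_Suc)
  have inj: "inj_on ?z1 ?\<V>"
   by (rule inj_on_subset[OF inj_on_prod_primes[of "Py y"]]) (use PyD in auto)
  have "(SUM V:?\<V>. ?Y * Epair A1 V / rP V) <= (SUM V:?\<V>. ?Y ^ 3 * (1 / (rP V)\<^sup>2) + ?Y ^ 2 / (?Y ^ i * ?Y ^ t))"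
  proof (rule sum_mono)
   fix V assume V': "V : ?\<V>"
   note VV = V[OF V']
   have "?Y * Epair A1 V / rP V <= ?Y * (?Y * (?Y / rP V + 1 / ?Y ^ i)) / rP V"
    using Epair_large[OF A1 _ VV(1)] y VV by (intro divide_right_mono mult_left_mono) auto
   also have "... = ?Y ^ 3 * (1 / (rP V)\<^sup>2) + ?Y ^ 2 / (?Y ^ i * rP V)"
    using VV Y by (simp add: power2_eq_square power3_eq_cube field_simps del: of_nat_prod)
   also have "?Y ^ 2 / (?Y ^ i * rP V) <= ?Y ^ 2 / (?Y ^ i * ?Y ^ t)"
    using VV Y by (intro divide_left_mono mult_left_mono mult_pos_pos) auto
   finally show "?Y * Epair A1 V / rP V <= ?Y ^ 3 * (1 / (rP V)\<^sup>2) + ?Y ^ 2 / (?Y ^ i * ?Y ^ t)" by simp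
  qed
  also have "... = ?Y ^ 3 * (SUM V:?\<V>. 1 / (rP V)\<^sup>2) + real (card ?\<V>) * (?Y ^ 2 / (?Y ^ i * ?Y ^ t))"
   by (simp add: sum.distrib sum_distrib_left del: of_nat_prod)
  also have "(SUM V:?\<V>. 1 / (rP V)\<^sup>2) = (SUM n:?z1 ` ?\<V>. 1 / (real n)\<^sup>2)"
   by (rule sum_image_eq[OF inj]) simp
  also have "... <= 1 / real (y ^ t)" by (rule sum_inverse_squares_le) (use y in auto)
  also have "real (card ?\<V>) <= real (y ^ Suc t)"
  proof -
   have "card ?\<V> = card (?z1 ` ?\<V>)" by (rule card_image[OF inj, symmetric])
   also have "... <= card {1..y ^ Suc t}" by (intro card_mono) auto
   finally show ?thesis by (simp only: of_nat_le_iff card_atLeastAtMost diff_Suc_1)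
  qed
  finally have "(SUM V:?\<V>. ?Y * Epair A1 V / rP V) <= ?Y ^ 3 * (1 / real (y ^ t)) + real (y ^ Suc t) * (?Y ^ 2 / (?Y ^ i * ?Y ^ t))"
   using Y by (simp add: mult_left_mono mult_right_mono divide_right_mono)
  also have "... = ?Y ^ 3 / ?Y ^ t + ?Y ^ 3 / ?Y ^ i" using Y by (simp add: power2_eq_square power3_eq_cube)
  finally show "(SUM V:?\<V>. ?Y * Epair A1 V / rP V) <= ?Y ^ 3 / ?Y ^ t + ?Y ^ 3 / ?Y ^ i" .
 next
  show "0 <= (SUM V:?\<V>. ?Y * Epair A1 V / rP V)" using Epair_nonneg Y
   by (intro sum_nonneg divide_nonneg_nonneg mult_nonneg_nonneg of_nat_0_le_iff) auto
 qed (use Y in auto)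
 also have "... <= 4 / ?Y"
 proof -
  have le: "?Y ^ a / ?Y ^ b <= 1 / ?Y" if "Suc a <= b" for a b :: nat
  proof -
   have "?Y ^ Suc a <= ?Y ^ b" using that Y by (intro power_increasing) auto
   thus ?thesis using Y by (simp add: field_simps)
  qed
  have "(?Y ^ 2 + ?Y ^ (2 * t + 5) / ?Y ^ j) * (?Y ^ 3 / ?Y ^ t + ?Y ^ 3 / ?Y ^ i) =
   ?Y ^ 5 / ?Y ^ t + ?Y ^ 5 / ?Y ^ i + ?Y ^ (2 * t + 8) / ?Y ^ (t + j) + ?Y ^ (2 * t + 8) / ?Y ^ (i + j)"
   using Y by (simp add: field_simps power_add eval_nat_numeral)
  also have "... <= 1 / ?Y + 1 / ?Y + 1 / ?Y + 1 / ?Y" using t i j ij by (intro add_mono le) auto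
  finally show ?thesis by simp
 qed
 also have "4 / ?Y = (2 / sqrt y)\<^sup>2" using Y by (simp add: power_divide)
 finally have *: "(SUM V:?\<V>. 16 ^ card V * X V)\<^sup>2 <= (2 / sqrt y)\<^sup>2" .
 show ?thesis by (rule power2_le_imp_le[OF *]) simp
qed

text \<open>No power of \<open>y\<close> can be spared, so both factors are bounded by the constant
  \<open>K\<close>. Smallness comes from the tail of \<open>\<Prod>V powr (- (3 / 2))\<close> beyond
  \<open>D1\<close>, the divisor factors being at most the square root of
  \<open>\<Prod>V\<close>.\<close>

lemma middle_block:
 assumes D1: "!!T. finite T ==> (!!n. n : T ==> D1 < n) ==> (SUM n:T. real n powr (- (3 / 2))) <= \<eta>"
  and i: "15 <= i" and j: "15 <= j" and y: "y >= 1"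
  and A1: "A1 \<subseteq> cell y i" and A2: "A2 \<subseteq> cell y j"
  and K1: "(SUM S:PyL y 6. rP S * Hform A1 (%p. 1 / real p) S / 2 ^ card S) <= K"
  and K2: "(SUM S:PyL y 6. rP S * Hform A2 \<beta> S / 2 ^ card S) <= K" and K: "K >= 1"
  and X: "!!V. V \<subseteq> Py y ==> \<Prod>V <= y ^ 6 ==> 0 <= X V & (X V)\<^sup>2 <= Epair A1 V * (49 ^ card V * Hform A2 \<beta> V)"
 shows "(SUM V:{V:Pow (Py y). D1 < \<Prod>V & \<Prod>V <= y ^ 6}. 16 ^ card V * X V)\<^sup>2 <= K * (K * \<eta>)"
proof -
 let ?\<V> = "{V:Pow (Py y). D1 < \<Prod>V & \<Prod>V <= y ^ 6}"
 have yj: "y ^ 6 <= y ^ j" using j y by (intro power_increasing) auto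
 have H0: "0 <= Hform A2 \<beta> V" if V': "V \<subseteq> Py y" "\<Prod>V <= y ^ 6" for V
 proof (rule Hform_nonneg[OF Py_prod(1,2)[OF V'(1)]])
  fix m p assume "m : A2" "p : V"
  thus "~ p dvd m" using not_dvd_cell[of m y j p V] A2 V' yj by auto
 qed
 have h0: "0 <= rP V * Hform A2 \<beta> V / 2 ^ card V" if "V \<subseteq> Py y" "\<Prod>V <= y ^ 6" for V
  using H0[OF that] by (intro divide_nonneg_pos mult_nonneg_nonneg of_nat_0_le_iff) auto
 have "(SUM V:?\<V>. 16 ^ card V * X V)\<^sup>2 <= (SUM V:?\<V>. rP V * Hform A2 \<beta> V / 2 ^ card V) * (SUM V:?\<V>. K * rP V powr (- (3 / 2)))"
 proof (rule sum_square_le_of_prod)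
  fix V assume "V : ?\<V>"
  hence V: "V \<subseteq> Py y" "\<Prod>V <= y ^ 6" by auto
  show "0 <= rP V * Hform A2 \<beta> V / 2 ^ card V" by (rule h0[OF V])
  show "0 <= K * rP V powr (- (3 / 2))" using K by simp
  show "0 <= 16 ^ card V * X V" using X V by simp
  let ?N = "rP V"
  have N: "?N >= 1" "?N > 0" using Py_prod(3)[OF V(1)] by (simp_all only: real_of_nat_ge_one_iff of_nat_0_less_iff)
  have "(16 ^ card V * X V)\<^sup>2 = 256 ^ card V * (X V)\<^sup>2" by (rule square_pow16_mult)
  also have "... <= 256 ^ card V * (Epair A1 V * (49 ^ card V * Hform A2 \<beta> V))" using X V by (intro mult_left_mono) auto
  also have "... <= 256 ^ card V * (K * 4 ^ card V / ?N * (49 ^ card V * Hform A2 \<beta> V))"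
   using H0[OF V] i by (intro mult_left_mono mult_right_mono Epair_small[OF A1 _ y V K1]) auto
  also have "... = (?N * Hform A2 \<beta> V / 2 ^ card V) * (K * (100352 ^ card V / ?N\<^sup>2))"
  proof -
   have "(100352::real) ^ card V = 256 ^ card V * 4 ^ card V * 49 ^ card V * 2 ^ card V" by (simp flip: power_mult_distrib)
   thus ?thesis using N by (simp add: power2_eq_square field_simps del: of_nat_prod)
  qed
  also have "... <= (?N * Hform A2 \<beta> V / 2 ^ card V) * (K * ?N powr (- (3 / 2)))"
  proof (intro mult_left_mono h0[OF V])
   have "real ((100352 ^ card V)\<^sup>2) <= ?N" using card_power_sq_le[OF V(1)] by (simp only: of_nat_le_iff)
   hence "(100352 ^ card V)\<^sup>2 <= ?N" by (simp del: of_nat_prod)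
   hence "100352 ^ card V <= sqrt ?N" by (rule real_le_rsqrt)
   hence "100352 ^ card V / ?N\<^sup>2 <= ?N powr (1 / 2) / ?N powr 2" using N by (simp add: powr_half_sqrt divide_right_mono del: of_nat_prod)
   also have "... = ?N powr (1 / 2 - 2)" by (rule powr_diff[symmetric])
   also have "... = ?N powr (- (3 / 2))" by simp
   finally show "100352 ^ card V / ?N\<^sup>2 <= ?N powr (- (3 / 2))" .
  qed (use K in auto)
  finally show "(16 ^ card V * X V)\<^sup>2 <= (?N * Hform A2 \<beta> V / 2 ^ card V) * (K * ?N powr (- (3 / 2)))" .
 qed
 also have "... <= K * (K * \<eta>)"
 proof (rule mult_mono)
  have "(SUM V:?\<V>. rP V * Hform A2 \<beta> V / 2 ^ card V) <= (SUM S:PyL y 6. rP S * Hform A2 \<beta> S / 2 ^ card S)"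
   using h0 by (intro sum_mono2) auto
  thus "(SUM V:?\<V>. rP V * Hform A2 \<beta> V / 2 ^ card V) <= K" using K2 by linarith
  have inj: "inj_on (%V. \<Prod>V) ?\<V>"
   by (rule inj_on_subset[OF inj_on_prod_primes[of "Py y"]]) (use PyD in auto)
  have "(SUM V:?\<V>. rP V powr (- (3 / 2))) = (SUM n:(%V. \<Prod>V) ` ?\<V>. real n powr (- (3 / 2)))"
   by (rule sum_image_eq[OF inj]) simp
  also have "... <= \<eta>" by (rule D1) auto
  finally have "(SUM V:?\<V>. rP V powr (- (3 / 2))) <= \<eta>" .
  thus "(SUM V:?\<V>. K * rP V powr (- (3 / 2))) <= K * \<eta>"
   unfolding sum_distrib_left[symmetric] using K by (intro mult_left_mono) auto
 qed (use K in \<open>auto intro: sum_nonneg\<close>)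
 finally show ?thesis .
qed

lemma powr_tail:
 assumes "\<eta> > 0"
 obtains D1 :: nat where "!!T. finite T ==> (!!n. n : T ==> D1 < n) ==> (SUM n:T. real n powr (- (3 / 2))) <= \<eta>"
proof -
 let ?f = "%n. real n powr (- (3 / 2))"
 have s: "summable ?f" by (simp add: summable_real_powr_iff)
 obtain N where N: "ALL n>=N. \<bar>suminf (%i. ?f (i + n))\<bar> < \<eta>" using suminf_exist_split[OF assms s] by auto
 have "(SUM n:T. ?f n) <= \<eta>" if T: "finite T" "!!n. n : T ==> N < n" for T
 proof -
  have "(SUM n:T. ?f n) = (SUM k:(%n. n - N) ` T. ?f (k + N))"
   by (rule sum.reindex_bij_witness[of _ "%k. k + N" "%n. n - N"]) (use T in \<open>force+\<close>)
  also have "... <= suminf (%i. ?f (i + N))"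
   using T s summable_iff_shift[of ?f N] by (intro sum_le_suminf) auto
  also have "... <= \<eta>" using N[rule_format, OF le_refl] by linarith
  finally show ?thesis .
 qed
 thus ?thesis by (rule that)
qed

text \<open>The coefficients \<open>c p V\<close> depend on both variables and are used only through
  their size; after taking absolute values, the sets containing \<open>p\<close> may be put
  back.\<close>

lemma weighted_sum_bound:
 assumes fin: "finite A1" "finite P" and cb: "!!p V. p : A1 ==> V : Pow (P - {p}) ==> \<bar>c p V\<bar> <= 16 ^ card V * (M::real)" and M: "M >= 0"
 shows "\<bar> SUM p:A1. 1 / real p * (SUM V:{V:Pow (P - {p}). V ~= {} & \<Prod>V <= N}. c p V * G V p)\<bar> <=
  M * (SUM V:{V:Pow P. V ~= {} & \<Prod>V <= N}. 16 ^ card V * (SUM p:A1. 1 / real p * \<bar>G V p\<bar>))"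
proof -
 let ?\<V> = "{V:Pow P. V ~= {} & \<Prod>V <= N}"
 have "\<bar> SUM p:A1. 1 / real p * (SUM V:{V:Pow (P - {p}). V ~= {} & \<Prod>V <= N}. c p V * G V p)\<bar> <=
   (SUM p:A1. SUM V:?\<V>. M * (16 ^ card V * (1 / real p * \<bar>G V p\<bar>)))"
 proof (rule order.trans[OF sum_abs], rule sum_mono)
  fix p assume p: "p : A1"
  let ?\<V>' = "{V:Pow (P - {p}). V ~= {} & \<Prod>V <= N}"
  have "\<bar>1 / real p * (SUM V:?\<V>'. c p V * G V p)\<bar> <= 1 / real p * (SUM V:?\<V>'. \<bar>c p V * G V p\<bar>)"
  proof -
   have "\<bar>1 / real p * x\<bar> = 1 / real p * \<bar>x\<bar>" for x by (simp add: abs_mult)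
   thus ?thesis by (simp only: mult_left_mono[OF sum_abs] zero_le_divide_1_iff of_nat_0_le_iff)
  qed
  also have "... <= 1 / real p * (SUM V:?\<V>'. 16 ^ card V * M * \<bar>G V p\<bar>)"
   using cb[OF p] by (intro mult_left_mono sum_mono) (auto simp: abs_mult intro!: mult_right_mono)
  also have "... <= 1 / real p * (SUM V:?\<V>. 16 ^ card V * M * \<bar>G V p\<bar>)"
   using fin M by (intro mult_left_mono sum_mono2) auto
  also have "... = (SUM V:?\<V>. M * (16 ^ card V * (1 / real p * \<bar>G V p\<bar>)))"
   unfolding sum_distrib_left by (intro sum.cong refl) simp
  finally show "\<bar>1 / real p * (SUM V:?\<V>'. c p V * G V p)\<bar> <= (SUM V:?\<V>. M * (16 ^ card V * (1 / real p * \<bar>G V p\<bar>)))" .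
 qed
 also have "... = (SUM V:?\<V>. SUM p:A1. M * (16 ^ card V * (1 / real p * \<bar>G V p\<bar>)))" by (rule sum.swap)
 also have "... = M * (SUM V:?\<V>. 16 ^ card V * (SUM p:A1. 1 / real p * \<bar>G V p\<bar>))"
  by (simp only: sum_distrib_left)
 finally show ?thesis .
qed

text \<open>\<open>Gk\<close> depends on \<open>c\<close> modulo \<open>\<Prod>V\<close> only, so
  finitely many constants are added up.\<close>

lemma Gk_fixed_uniform:
 assumes V: "finite V" "V ~= {}" "!!p. p : V ==> prime p & D0 < p" and I: "finite I"
  and e: "!!h p. h : I ==> p : V ==> ~ p dvd e h p" and b: "!!q. q : W0 ==> ~ q dvd b" and j: "j >= 1"
 shows "EX C>=0. ALL y>\<Prod>V. ALL c. (ALL p:V. ~ p dvd c) --> \<bar>Gk I e (clscell y j b) (betaw y j) V c\<bar> <= C / ln (real y)"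
proof -
 define ok where "ok c C \<longleftrightarrow> ((ALL p:V. ~ p dvd c) --> (ALL y>\<Prod>V. \<bar>Gk I e (clscell y j b) (betaw y j) V c\<bar> <= C / ln (real y)))" for c C
 have "EX C. ok c C" for c
  using Gk_fixed_tendsto[OF V _ I e b j, of c] unfolding ok_def by (cases "ALL p:V. ~ p dvd c") auto
 then obtain C where C: "ALL c. ok c (C c)" using choice[of ok] by blast
 have V1: "\<Prod>V >= 1" using cop_prod(2)[OF V(1,3)] .
 have "\<bar>Gk I e (clscell y j b) (betaw y j) V c\<bar> <= (SUM c<\<Prod>V. \<bar>C c\<bar>) / ln (real y)" if y: "y > \<Prod>V" and c: "ALL p:V. ~ p dvd c" for y c
 proof -
  let ?c = "c mod \<Prod>V"
  have "~ p dvd ?c" if "p : V" for p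
  proof -
   have "p dvd \<Prod>V" using V(1) that by (intro dvd_prodI) auto
   hence "p dvd ?c \<longleftrightarrow> p dvd c" by (rule dvd_mod_iff)
   thus ?thesis using c that by blast
  qed
  hence "\<bar>Gk I e (clscell y j b) (betaw y j) V ?c\<bar> <= C ?c / ln (real y)" using C y unfolding ok_def by blast
  also have "... <= (SUM c<\<Prod>V. \<bar>C c\<bar>) / ln (real y)"
  proof (rule divide_right_mono)
   have "C ?c <= \<bar>C ?c\<bar>" by simp
   also have "... <= (SUM c<\<Prod>V. \<bar>C c\<bar>)" using V1 by (intro member_le_sum) auto
   finally show "C ?c <= (SUM c<\<Prod>V. \<bar>C c\<bar>)" .
   show "0 <= ln (real y)" using V1 y by simp
  qed
  finally show ?thesis unfolding Gk_mod[OF V(1)] .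
 qed
 thus ?thesis by (intro exI[of _ "SUM c<\<Prod>V. \<bar>C c\<bar>"]) (auto intro: sum_nonneg)
qed

text \<open>Each range of \<open>\<Prod>V\<close> is allowed a third of \<open>\<epsilon>\<close>:
  finitely many sets up to \<open>D1\<close> by Dirichlet's theorem, then up to \<open>y ^ 6\<close>
  the bound with constant \<open>K\<close>, then blocks of one factor \<open>y\<close> up to
  \<open>y ^ 192\<close>. \<open>D1\<close> depends only on \<open>\<epsilon>\<close> and
  \<open>K\<close> and is fixed before \<open>y\<close> grows.\<close>

theorem bilinear_error:
 assumes I: "finite I" "card I = 7" and e: "!!h p. h : I ==> prime p ==> D0 < p ==> ~ p dvd e h p"
  and b: "!!q. q : W0 ==> ~ q dvd b" and i: "15 <= i" and j: "201 <= j" and ij: "400 <= i + j" and \<epsilon>: "\<epsilon> > 0"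
 shows "EX y0. ALL y>=y0. ALL A1<=cell y i. ALL c M. (ALL p:A1. ALL V:Pow (Py y - {p}). \<bar>c p V\<bar> <= 16 ^ card V * M) --> M >= 0 -->
  \<bar> SUM p:A1. 1 / real p * (SUM V:{V:Pow (Py y - {p}). V ~= {} & \<Prod>V <= y ^ 192}. c p V * Gk I e (clscell y j b) (betaw y j) V p)\<bar> <= \<epsilon> * M"
proof -
 obtain K y1 where K1: "K >= 1" and K': "ALL y>=y1. ALL j>=15. ALL A<=cell y j. ALL \<alpha>. (ALL p:A. \<bar>\<alpha> p\<bar> <= 1 / real p) -->
  (SUM S:PyL y 6. rP S * Hform A \<alpha> S / 2 ^ card S) <= K"
  using Hform_small_range by (elim exE conjE)
 note K = K1 K'[rule_format]
 define \<eta> where "\<eta> = (\<epsilon> / (3 * K))\<^sup>2"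
 have "\<eta> > 0" using \<epsilon> K by (simp add: \<eta>_def)
 then obtain D1 :: nat where D1: "!!T. finite T ==> (!!n. n : T ==> D1 < n) ==> (SUM n:T. real n powr (- (3 / 2))) <= \<eta>"
  using powr_tail by metis
 define \<V>0 where "\<V>0 = {V:Pow {..D1}. V ~= {} & (ALL p:V. prime p & D0 < p) & \<Prod>V <= D1}"
 have fin0: "finite \<V>0" by (simp add: \<V>0_def)
 define ok where "ok V C \<longleftrightarrow> (V : \<V>0 --> C >= 0 & (ALL y>\<Prod>V. ALL c. (ALL p:V. ~ p dvd c) --> \<bar>Gk I e (clscell y j b) (betaw y j) V c\<bar> <= C / ln (real y)))" for V C
 have "EX C. ok V C" for V
 proof (cases "V : \<V>0")
  case True
  have "finite V" using True by (auto simp: \<V>0_def intro: finite_subset)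
  thus ?thesis using Gk_fixed_uniform[of V I e b j] True I e b j by (auto simp: \<V>0_def ok_def)
 qed (simp add: ok_def)
 then obtain CV where CV: "ALL V. ok V (CV V)" using choice[of ok] by blast
 define C0 where "C0 = (SUM V:\<V>0. 16 ^ card V * (K * CV V))"
 obtain N1 :: nat where N1: "N1 >= 1" "ln (real N1) > 3 * C0 / \<epsilon>" using ex_nat_ln_gt by blast
 \<comment> \<open>The 186 blocks of size \<open>2 / sqrt y\<close> stay below
   \<open>384 / sqrt y\<close>, which is at most \<open>\<epsilon> / 3\<close> from here on.\<close>
 obtain N2 :: nat where N2: "real N2 > (1152 / \<epsilon>)\<^sup>2" using reals_Archimedean2 by blast
 define y0 where "y0 = Max {y1, N1, N2, 1000, Suc D1}"
 have "\<bar> SUM p:A1. 1 / real p * (SUM V:{V:Pow (Py y - {p}). V ~= {} & \<Prod>V <= y ^ 192}. c p V * Gk I e (clscell y j b) (betaw y j) V p)\<bar> <= \<epsilon> * M"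
  if y: "y >= y0" and A1: "A1 \<subseteq> cell y i" and cb: "!!p V. p : A1 ==> V : Pow (Py y - {p}) ==> \<bar>c p V\<bar> <= 16 ^ card V * M" and M: "M >= 0" for y A1 c M
 proof -
  have y': "y >= y1" "y >= N1" "y >= N2" "y >= 1000" "y > D1" using y by (auto simp: y0_def)
  let ?A2 = "clscell y j b" and ?\<beta> = "betaw y j"
  define X where "X V = (SUM p:A1. 1 / real p * \<bar>Gk I e ?A2 ?\<beta> V p\<bar>)" for V
  have X0: "0 <= X V" for V unfolding X_def by (intro sum_nonneg) auto
  have finA1: "finite A1" using A1 finite_cell finite_subset by blast
  have A2: "?A2 \<subseteq> cell y j" by (auto simp: clscell_def)
  have \<beta>: "\<bar>?\<beta> p\<bar> <= 1 / real p" if "p : ?A2" for p using betaw_le[of p y j] A2 that y' by auto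
  have K1: "(SUM S:PyL y 6. rP S * Hform A1 (%p. 1 / real p) S / 2 ^ card S) <= K"
   using i y' by (intro K(2)[OF _ _ A1]) auto
  have K2: "(SUM S:PyL y 6. rP S * Hform ?A2 ?\<beta> S / 2 ^ card S) <= K"
   using j y' \<beta> by (intro K(2)[OF _ _ A2]) auto
  have X2: "0 <= X V & (X V)\<^sup>2 <= Epair A1 V * (49 ^ card V * Hform ?A2 ?\<beta> V)" if V: "V \<subseteq> Py y" "\<Prod>V <= y ^ 192" for V
  proof
   have "(X V)\<^sup>2 <= Epair A1 V * (real (card I ^ card V) ^ 2 * Hform ?A2 ?\<beta> V)"
    unfolding X_def Epair_def
   proof (rule weighted_Gk_square[OF Py_prod(1,2)[OF V(1)]])
    fix m p assume "m : ?A2" "p : V"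
    moreover have "y ^ 192 <= y ^ j" using j y' by (intro power_increasing) auto
    ultimately show "~ p dvd m" using not_dvd_cell[of m y j p V] A2 V by auto
   next
    fix h p assume "h : I" "p : V"
    thus "~ p dvd e h p" using e PyD V by auto
   qed (use I finA1 in auto)
   also have "real (card I ^ card V) ^ 2 = 49 ^ card V" using I by (simp flip: power_mult power_mult_distrib add: power2_eq_square)
   finally show "(X V)\<^sup>2 <= Epair A1 V * (49 ^ card V * Hform ?A2 ?\<beta> V)" .
  qed (rule X0)
  have 1: "(SUM V:\<V>0. 16 ^ card V * X V) <= \<epsilon> / 3"
  proof -
   have l: "ln (real y) > 0" using y' by simp
   have "X V <= K * (CV V / ln y)" if V: "V : \<V>0" for V
   proof -
    have CV': "CV V >= 0" "!!c. (ALL p:V. ~ p dvd c) ==> \<bar>Gk I e ?A2 ?\<beta> V c\<bar> <= CV V / ln (real y)"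
     using CV V y' unfolding ok_def by (auto simp: \<V>0_def)
    have "X V <= (SUM p:A1. 1 / real p * (CV V / ln y))"
     unfolding X_def
    proof (intro sum_mono mult_left_mono CV'(2) ballI)
     fix p r assume p: "p : A1" and r: "r : V"
     have "prime p" "y ^ i < p" using p A1 by (auto simp: cell_def)
     moreover have "y <= y ^ i" using y' i by (intro self_le_power) auto
     moreover have "prime r" "r <= D1" using r V by (auto simp: \<V>0_def)
     ultimately show "~ r dvd p" using y' primes_dvd_imp_eq[of r p] by auto
    qed auto
    also have "... = (SUM p:A1. 1 / real p) * (CV V / ln y)" by (rule sum_distrib_right[symmetric])
    also have "... <= K * (CV V / ln y)"
    proof (rule mult_right_mono)
     have "((SUM p:A1. 1 / real p))\<^sup>2 = Epair A1 {}" by (simp add: Epair_def power2_eq_square sum_product)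
     also have "... <= K * 4 ^ card ({} :: nat set) / real (\<Prod>{})"
      by (rule Epair_small[OF A1 _ _ _ _ K1]) (use i y' in auto)
     also have "... <= K\<^sup>2" using K by (simp add: power2_eq_square)
     finally show "(SUM p:A1. 1 / real p) <= K" by (rule power2_le_imp_le) (use K in simp)
     show "0 <= CV V / ln y" using CV' l by simp
    qed
    finally show ?thesis .
   qed
   hence "(SUM V:\<V>0. 16 ^ card V * X V) <= (SUM V:\<V>0. 16 ^ card V * (K * (CV V / ln y)))"
    by (intro sum_mono mult_left_mono) auto
   also have "... = C0 / ln y" by (simp add: C0_def sum_divide_distrib)
   also have "... <= \<epsilon> / 3"
   proof -
    have "ln (real N1) <= ln y" using y' N1 by (intro ln_mono) auto
    hence "3 * C0 / \<epsilon> <= ln y" using N1 by linarith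
    thus ?thesis using l \<epsilon> by (simp add: field_simps)
   qed
   finally show ?thesis .
  qed
  let ?\<V>1 = "{V:Pow (Py y). D1 < \<Prod>V & \<Prod>V <= y ^ 6}"
  let ?\<V>2 = "%t. {V:Pow (Py y). y ^ t < \<Prod>V & \<Prod>V <= y ^ Suc t}"
  have y6: "y ^ 6 <= y ^ 192" using y' by (intro power_increasing) auto
  have 2: "(SUM V:?\<V>1. 16 ^ card V * X V) <= \<epsilon> / 3"
  proof -
   have "(SUM V:?\<V>1. 16 ^ card V * X V)\<^sup>2 <= K * (K * \<eta>)"
    by (rule middle_block[OF D1 _ _ _ A1 A2 K1 K2 K(1) X2[OF _ order.trans[OF _ y6]]]) (use i j y' in auto)
   also have "... = (\<epsilon> / 3)\<^sup>2" using K by (simp add: \<eta>_def power2_eq_square field_simps)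
   finally show ?thesis by (rule power2_le_imp_le) (use \<epsilon> in simp)
  qed
  have 3: "(SUM t:{6..<192}. SUM V:?\<V>2 t. 16 ^ card V * X V) <= \<epsilon> / 3"
  proof -
   have "(SUM t:{6..<192}. SUM V:?\<V>2 t. 16 ^ card V * X V) <= (SUM t:{6..<192::nat}. 2 / sqrt y)"
    using y' i j ij A1 A2 \<beta> X2 by (intro sum_mono large_block[where i = i and j = j]) auto
   also have "... <= 384 / sqrt y" by (simp add: divide_right_mono)
   also have "... <= \<epsilon> / 3"
   proof -
    have "(1152 / \<epsilon>)\<^sup>2 <= real y" using N2 y' by linarith
    hence "1152 / \<epsilon> <= sqrt y" by (rule real_le_rsqrt)
    thus ?thesis using \<epsilon> y' by (simp add: field_simps)
   qed
   finally show ?thesis .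
  qed
  have "\<bar> SUM p:A1. 1 / real p * (SUM V:{V:Pow (Py y - {p}). V ~= {} & \<Prod>V <= y ^ 192}. c p V * Gk I e ?A2 ?\<beta> V p)\<bar> <=
    M * (SUM V:{V:Pow (Py y). V ~= {} & \<Prod>V <= y ^ 192}. 16 ^ card V * X V)"
   unfolding X_def using finA1 cb M by (intro weighted_sum_bound) auto
  also have "... <= M * \<epsilon>"
  proof (rule mult_left_mono[OF _ M])
   have nn: "0 <= 16 ^ card V * X V" for V using X0 by simp
   have "{V:Pow (Py y). V ~= {} & \<Prod>V <= y ^ 192} \<subseteq> \<V>0 Un ?\<V>1 Un (UN t:{6..<192}. ?\<V>2 t)"
   proof
    fix V assume V: "V : {V:Pow (Py y). V ~= {} & \<Prod>V <= y ^ 192}"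
    hence sub: "V \<subseteq> Py y" by simp
    show "V : \<V>0 Un ?\<V>1 Un (UN t:{6..<192}. ?\<V>2 t)"
    proof (cases "y ^ 6 < \<Prod>V")
     case True
     then obtain t where "t >= 6" "t < 192" "y ^ t < \<Prod>V" "\<Prod>V <= y ^ Suc t"
      using ex_power_between[of y 6 "\<Prod>V" 192] V y' by auto
     thus ?thesis using sub by auto
    next
     case False
     show ?thesis
     proof (cases "\<Prod>V <= D1")
      case True
      have "p <= D1" if "p : V" for p
      proof -
       have "p <= \<Prod>V" by (rule dvd_imp_le[OF dvd_prodI[OF Py_prod(1)[OF sub] that]]) (use Py_prod(3)[OF sub] in linarith)
       thus ?thesis using True by simp
      qed
      thus ?thesis using V True PyD by (auto simp: \<V>0_def)
     qed (use False sub in auto)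
    qed
   qed
   hence "(SUM V:{V:Pow (Py y). V ~= {} & \<Prod>V <= y ^ 192}. 16 ^ card V * X V) <= (SUM V:\<V>0 Un ?\<V>1 Un (UN t:{6..<192}. ?\<V>2 t). 16 ^ card V * X V)"
    using fin0 nn by (intro sum_mono2) auto
   also have "... <= (SUM V:\<V>0 Un ?\<V>1. 16 ^ card V * X V) + (SUM V:(UN t:{6..<192}. ?\<V>2 t). 16 ^ card V * X V)"
    using fin0 nn by (intro sum_Un_le) auto
   also have "(SUM V:\<V>0 Un ?\<V>1. 16 ^ card V * X V) <= (SUM V:\<V>0. 16 ^ card V * X V) + (SUM V:?\<V>1. 16 ^ card V * X V)"
    using fin0 nn by (intro sum_Un_le) auto
   also have "(SUM V:(UN t:{6..<192}. ?\<V>2 t). 16 ^ card V * X V) <= (SUM t:{6..<192}. SUM V:?\<V>2 t. 16 ^ card V * X V)"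
    using nn by (intro sum_UNION_le) auto
   finally show "(SUM V:{V:Pow (Py y). V ~= {} & \<Prod>V <= y ^ 192}. 16 ^ card V * X V) <= \<epsilon>" using 1 2 3 by linarith
  qed
  finally show ?thesis by (simp add: mult.commute)
 qed
 from this show ?thesis by (intro exI[of _ y0] allI impI) (simp only: Ball_def)
qed

end

section \<open>Comparison of the two weighted sums\<close>

context bigsieve
begin

section \<open>Numerical consequences of the size of D0, and limits of the sieve sums\<close>

lemma D0_large: "D0 >= 10 ^ 100"
proof -
 have "(10::nat) ^ 100 <= 12544 ^ 100" by (rule power_mono) auto
 also have "... <= 12544 ^ 192" by (rule power_increasing) auto
 finally show ?thesis using D0big by linarith
qed

lemma Py_ge: "p : Py y ==> p >= 10 ^ 100" using D0_large PyD[of p y] by linarith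

lemma Py_ge_100: "p : Py y ==> p >= 100"
proof -
 have "(100::nat) <= 10 ^ 100" by (rule order.trans[of _ "10 ^ 2"], simp, rule power_increasing) auto
 thus "p : Py y ==> p >= 100" using Py_ge[of p y] by linarith
qed

lemma Py_ge_16: "p : Py y ==> p >= 16"
 using Py_ge_100[of p y] by linarith

lemma Bz_tendsto:
 "((%y. Bz (Suc k) j (real y ^ a) / ln (real y) ^ (Suc k + j)) \<longlongrightarrow> cW ^ Suc k * (fact j / fact (Suc k + j)) * real a ^ (Suc k + j)) sequentially"
proof -
 obtain C where C: "C >= 0" "!!z. z >= 1 ==> \<bar>Bz (Suc k) j z - cW ^ Suc k * (fact j / fact (Suc k + j)) * (ln z) ^ (Suc k + j)\<bar> <= C * (1 + ln z) ^ (k + j)"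
  using Bz_asymp by blast
 let ?m = "cW ^ Suc k * (fact j / fact (Suc k + j)) * real a ^ (Suc k + j)"
 have "((%y. Bz (Suc k) j (real y ^ a) / ln (real y) ^ (Suc k + j) - ?m) \<longlongrightarrow> 0) sequentially"
 proof (rule Lim_null_comparison)
  show "((%y. C * (1 + real a) ^ (k + j) * (1 / ln (real y))) \<longlongrightarrow> 0) sequentially" by real_asymp
  show "\<forall>\<^sub>F y in sequentially. norm (Bz (Suc k) j (real y ^ a) / ln (real y) ^ (Suc k + j) - ?m) <= C * (1 + real a) ^ (k + j) * (1 / ln (real y))"
  proof (rule eventually_sequentiallyI[of 3])
   fix y :: nat assume y: "y >= 3"
   let ?l = "ln (real y)"
   have "1 = ln (exp (1::real))" by simp
   also have "... <= ?l" using y exp_le by (intro ln_mono) auto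
   finally have l: "?l >= 1" .
   have ya: "real y ^ a >= 1" using y by simp
   have la: "ln (real y ^ a) = real a * ?l" by (rule ln_realpow)
   have "\<bar>Bz (Suc k) j (real y ^ a) - ?m * ?l ^ (Suc k + j)\<bar> <= C * (1 + real a * ?l) ^ (k + j)"
    using C(2)[OF ya] unfolding la power_mult_distrib by (simp only: mult.assoc)
   also have "... <= C * ((1 + real a) * ?l) ^ (k + j)"
    using l C by (intro mult_left_mono power_mono) (auto simp: algebra_simps)
   finally have 1: "\<bar>Bz (Suc k) j (real y ^ a) - ?m * ?l ^ (Suc k + j)\<bar> <= C * (1 + real a) ^ (k + j) * ?l ^ (k + j)"
    by (simp only: power_mult_distrib mult.assoc)
   have p: "?l ^ (Suc k + j) > 0" using l by simp
   have "norm (Bz (Suc k) j (real y ^ a) / ?l ^ (Suc k + j) - ?m) = \<bar>Bz (Suc k) j (real y ^ a) - ?m * ?l ^ (Suc k + j)\<bar> / ?l ^ (Suc k + j)"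
   proof -
    have "x / d - m = (x - m * d) / d" if "d > 0" for x d m :: real using that by (simp add: field_simps)
    thus ?thesis using p by (simp only: real_norm_def abs_divide abs_of_pos)
   qed
   also have "... <= C * (1 + real a) ^ (k + j) * ?l ^ (k + j) / ?l ^ (Suc k + j)" using 1 p by (intro divide_right_mono) auto
   also have "... = C * (1 + real a) ^ (k + j) * (1 / ?l)" using l by simp
   finally show "norm (Bz (Suc k) j (real y ^ a) / ?l ^ (Suc k + j) - ?m) <= C * (1 + real a) ^ (k + j) * (1 / ?l)" .
  qed
 qed
 thus ?thesis by (rule LIM_zero_cancel)
qed

lemma betaw_class_tendsto:
 assumes "finite U" "!!p. p : U ==> prime p" "!!p. p : U ==> ~ p dvd r"
 shows "((%y. SUM m:{m:cell y j. ALL q:U. m mod q = r mod q}. betaw y j m) \<longlongrightarrow> 1 / (real (Suc j) * (PROD p:U. real (p - 1)))) sequentially"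
proof -
 let ?z1 = "real (Suc j) * (PROD p:U. real (p - 1))"
 obtain C where C: "!!y. y >= 2 ==> \<bar>(SUM m:{m:cell y j. ALL q:U. m mod q = r mod q}. betaw y j m) - 1 / ?z1\<bar> <= C / ln (real y)"
  using betaw_class_sum[OF assms] by blast
 have "((%y. (SUM m:{m:cell y j. ALL q:U. m mod q = r mod q}. betaw y j m) - 1 / ?z1) \<longlongrightarrow> 0) sequentially"
 proof (rule Lim_null_comparison)
  show "((%y. C / ln (real y)) \<longlongrightarrow> 0) sequentially" by real_asymp
 qed (use C in \<open>auto intro!: eventually_sequentiallyI[of 2] simp only: real_norm_def\<close>)
 thus ?thesis by (rule LIM_zero_cancel)
qed

text \<open>The diagonal variables behind the weights: constant up to the level
  \<open>y ^ 96\<close>.\<close>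

definition YR :: "nat => nat set => real" where "YR y T = (if \<Prod>T <= y ^ 96 then 1 else 0)"
definition Fy :: "nat => real" where "Fy y = (SUM S:Pow (Py y). (prod hS S) * (YR y S)\<^sup>2)"
text \<open>The size of the coefficients \<open>Cd\<close>, from \<open>Cc_bound\<close>. It is of
  order \<open>ln y ^ 9\<close>, like the main term, so an error bounded by it must come with an
  arbitrarily small factor.\<close>

definition My :: "nat => real" where
 "My y = (SUM S:Pow (Py y). if rP S <= real y ^ 96 then (prod coefS S) else 0) *
  (SUM T:Pow (Py y). if rP T <= real y ^ 96 then iph T else 0)\<^sup>2"

lemma prod_le_iff: "rP T <= real y ^ n \<longleftrightarrow> \<Prod>T <= y ^ n"
 unfolding of_nat_power[symmetric] by (rule of_nat_le_iff)

text \<open>Perturbations \<open>1 + A / p\<close> at primes beyond \<open>10 ^ 100\<close> cost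
  less than the factor 101/100, which reappears in the constant
  \<open>3131 / 100 = 31 * 101 / 100\<close>.\<close>

lemma weighted_sum_le_Bz:
 assumes f: "!!p. p : Py y ==> 0 <= f p & f p <= real k / p * (1 + A / p)" and A: "A >= 0" "real k * A <= 1000"
 shows "(SUM V:Pow (Py y). if rP V <= real y ^ 96 then (PROD p:V. f p) else 0) <= 101 / 100 * Bz k 0 (real y ^ 96)"
proof -
 have "(SUM V:Pow (Py y). if rP V <= real y ^ 96 then (PROD p:V. f p) else 0) <=
   (SUM V:Pow (Py y). if rP V <= real y ^ 96 then (PROD p:V. real k / p * (1 + A / p)) else 0)"
  by (intro sum_mono) (use f in \<open>auto intro!: prod_mono simp del: of_nat_prod\<close>)
 also have "... <= exp (k * A / D0) * Bz k 0 (real y ^ 96)"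
  using A PyD by (intro inflated_sum_le) auto
 also have "... <= 101 / 100 * Bz k 0 (real y ^ 96)"
 proof (rule mult_right_mono[OF _ Bz_nonneg])
  have "real D0 >= real (10 ^ 100)" using D0_large by (simp only: of_nat_le_iff)
  hence "real D0 >= 10 ^ 100" by simp
  hence "k * A / D0 <= 1000 / 10 ^ 100" using A by (intro frac_le) auto
  also have "... <= 1 / 200" by simp
  finally have "exp (k * A / D0) <= exp (1 / 200)" by simp
  also have "... <= 1 + 1 / 200 + (1 / 200)\<^sup>2" by (rule exp_bound) auto
  also have "... <= 101 / 100" by (simp add: power2_eq_square)
  finally show "exp (k * A / D0) <= 101 / 100" .
 qed
 finally show ?thesis .
qed

lemma Fy_le: "Fy y <= 101 / 100 * Bz 8 0 (real y ^ 96)" "Fy y >= 0"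
proof -
 have "Fy y = (SUM V:Pow (Py y). if rP V <= real y ^ 96 then (prod hS V) else 0)"
  unfolding Fy_def YR_def prod_le_iff by (intro sum.cong refl) auto
 also have "... <= 101 / 100 * Bz 8 0 (real y ^ 96)"
 proof (rule weighted_sum_le_Bz[where A = 16])
  fix p assume "p : Py y"
  hence p: "real p >= 100" using Py_ge_100 by force
  thus "0 <= hS p & hS p <= real 8 / p * (1 + 16 / p)" by (simp add: hS_def field_simps)
 qed auto
 finally show "Fy y <= 101 / 100 * Bz 8 0 (real y ^ 96)" .
 show "Fy y >= 0" unfolding Fy_def
 proof (intro sum_nonneg mult_nonneg_nonneg prod_nonneg)
  fix S p assume "S : Pow (Py y)" "p : S"
  hence "p >= 16" using Py_ge_100[of p y] by auto
  thus "0 <= hS p" using sieve_values(3)[of p] by simp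
 qed simp
qed

text \<open>Seven logarithms come from the sum of \<open>coefS\<close> and one from each of the two
  sums of \<open>iph\<close>.\<close>

lemma My_bounded: "EX C. \<forall>\<^sub>F y in sequentially. My y <= C * ln (real y) ^ 9"
proof -
 let ?B7 = "%y. Bz (Suc 6) 0 (real y ^ 96)" and ?B1 = "%y. Bz (Suc 0) 0 (real y ^ 96)"
 define m where "m = cW ^ Suc 6 * (fact 0 / fact (Suc 6 + 0)) * real 96 ^ (Suc 6 + 0) * (cW ^ Suc 0 * (fact 0 / fact (Suc 0 + 0)) * real 96 ^ (Suc 0 + 0))\<^sup>2"
 have "((%y. ?B7 y / ln (real y) ^ (Suc 6 + 0) * (?B1 y / ln (real y) ^ (Suc 0 + 0))\<^sup>2) \<longlongrightarrow> m) sequentially"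
  unfolding m_def by (intro tendsto_mult tendsto_power Bz_tendsto)
 hence "\<forall>\<^sub>F y in sequentially. ?B7 y / ln (real y) ^ (Suc 6 + 0) * (?B1 y / ln (real y) ^ (Suc 0 + 0))\<^sup>2 < m + 1"
  by (rule order_tendstoD) simp
 hence "\<forall>\<^sub>F y in sequentially. My y <= (101 / 100) ^ 3 * (m + 1) * ln (real y) ^ 9"
  using eventually_gt_at_top[of 2]
 proof eventually_elim
  case (elim y)
  have l: "ln (real y) > 0" using elim by simp
  have p: "p >= 16 & real p >= 100" if "p : Py y" for p using Py_ge_100[OF that] by auto
  have 1: "(SUM S:Pow (Py y). if rP S <= real y ^ 96 then (prod coefS S) else 0) <= 101 / 100 * Bz 7 0 (real y ^ 96)"
  proof (rule weighted_sum_le_Bz[where A = 40])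
   fix p assume "p : Py y"
   hence "p >= 16" using p by blast
   hence "7 / real p <= coefS p" "coefS p <= real 7 / p * (1 + 40 / p)" using coefS(2,3)[of p] by auto
   moreover have "0 <= 7 / real p" by simp
   ultimately show "0 <= coefS p & coefS p <= real 7 / p * (1 + 40 / p)" by linarith
  qed auto
  have 2: "(SUM T:Pow (Py y). if rP T <= real y ^ 96 then iph T else 0) <= 101 / 100 * Bz 1 0 (real y ^ 96)"
   (is "?s2 <= _")
  proof (rule weighted_sum_le_Bz[where A = 2])
   fix p assume "p : Py y"
   hence "real p >= 100" using p by blast
   thus "0 <= 1 / (real p - 1) & 1 / (real p - 1) <= real 1 / p * (1 + 2 / p)" by (simp add: field_simps)
  qed auto
  have s2: "0 <= ?s2"
  proof (intro sum_nonneg)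
   fix T assume T: "T : Pow (Py y)"
   have "0 <= iph T" by (intro prod_nonneg) (use T p in force)
   thus "0 <= (if rP T <= real y ^ 96 then iph T else 0)" by simp
  qed
  have "My y <= 101 / 100 * Bz 7 0 (real y ^ 96) * (101 / 100 * Bz 1 0 (real y ^ 96))\<^sup>2"
   unfolding My_def by (intro mult_mono power_mono 1 2 s2 zero_le_power2 mult_nonneg_nonneg Bz_nonneg) simp
  also have "... = (101 / 100) ^ 3 * (Bz 7 0 (real y ^ 96) * (Bz 1 0 (real y ^ 96))\<^sup>2)"
   by (simp only: power2_eq_square power3_eq_cube mult_ac)
  also have "... <= (101 / 100) ^ 3 * ((m + 1) * ln (real y) ^ 9)"
  proof (rule mult_left_mono)
   have "Bz 7 0 (real y ^ 96) * (Bz 1 0 (real y ^ 96))\<^sup>2 / ln (real y) ^ 9 < m + 1"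
    using elim(1) unfolding power_divide times_divide_times_eq by (simp add: eval_nat_numeral del: Bz.simps)
   thus "Bz 7 0 (real y ^ 96) * (Bz 1 0 (real y ^ 96))\<^sup>2 <= (m + 1) * ln (real y) ^ 9"
    using l by (simp add: divide_less_eq del: Bz.simps)
  qed simp
  finally show ?case by (simp only: mult.assoc)
 qed
 thus ?thesis by blast
qed

end

section \<open>The tuple, its roots modulo primes, and the plain weighted sum\<close>

definition Hs :: "nat set" where "Hs = {0, 2, 6, 8, 12, 18, 20, 26}"

lemma Hs: "finite Hs" "card Hs = 8" "h : Hs ==> h <= 26"
 by (auto simp: Hs_def)

lemma prod_indicator: "finite V ==> (PROD p:V. if P p then 1 else 0) = (if ALL p:V. P p then 1 else (0 :: real))"
 by (auto intro: prod_zero)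

lemma sum_inverse_le_ln:
 assumes "x0 >= 1" "x0 <= x1"
 shows "(SUM n:{x0<..x1}. 1 / real n) <= ln (real x1) - ln (real x0)"
 using assms(2)
proof (induction x1 rule: dec_induct)
 case (step n)
 have n: "n >= 1" using step assms by simp
 have "ln (real n / real (Suc n)) <= real n / real (Suc n) - 1" using n by (intro ln_le_minus_one) auto
 also have "... = - (1 / real (Suc n))" by (simp add: field_simps)
 finally have "1 / real (Suc n) <= ln (real (Suc n)) - ln (real n)" using n by (simp add: ln_div)
 moreover have "{x0<..Suc n} = insert (Suc n) {x0<..n}" using step by auto
 ultimately show ?case using step by simp
qed simp

context bigsieve
begin

definition Zn :: "nat => nat => nat set" where "Zn y n = {p:Py y. EX h:Hs. p dvd n + h}"
definition wt :: "nat => nat => real" where "wt y n = (SUM D:Pow (Zn y n). lamw (Py y) (YR y) D)\<^sup>2"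

lemma card_roots:
 assumes "p >= (100::nat)"
 shows "card {x:{..<p}. EX h:Hs. p dvd x + h} = 8"
proof -
 let ?z1 = "{x:{..<p}. EX h:Hs. p dvd x + h}"
 let ?z2 = "%h. (p - h) mod p"
 have "?z1 = ?z2 ` Hs"
 proof (rule subset_antisym; rule subsetI)
  fix x assume "x : ?z1"
  then obtain h where h: "x < p" "h : Hs" "p dvd x + h" by auto
  hence "h < p" using Hs(3)[of h] assms by linarith
  obtain k where k: "x + h = p * k" using h(3) by blast
  have "p * k < p * 2" using k h \<open>h < p\<close> by linarith
  hence "k = 0 | k = 1" by auto
  hence "x = (p - h) mod p" using k h(1) by (cases "h = 0") auto
  thus "x : ?z2 ` Hs" using h by blast
 next
  fix x assume "x : ?z2 ` Hs"
  then obtain h where h: "h : Hs" "x = (p - h) mod p" by auto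
  have "p dvd x + h" unfolding h(2) using Hs(3)[OF h(1)] assms by (simp add: dvd_eq_mod_eq_0 mod_add_left_eq)
  thus "x : ?z1" using h assms by auto
 qed
 moreover have "inj_on ?z2 Hs"
 proof (rule inj_onI)
  fix h h' assume h: "h : Hs" "h' : Hs" "(p - h) mod p = (p - h') mod p"
  have *: "(p - k) mod p = (if k = 0 then 0 else p - k)" for k using assms by (cases "k = 0") auto
  have "(if h = 0 then 0 else p - h) = (if h' = 0 then 0 else p - h')" using h(3) unfolding * .
  thus "h = h'" using Hs(3)[OF h(1)] Hs(3)[OF h(2)] assms by (auto split: if_splits)
 qed
 ultimately show ?thesis using Hs(2) by (simp add: card_image)
qed

text \<open>The condition on \<open>n\<close> is periodic modulo \<open>W * \<Prod>U\<close>, with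
  mean given by the eight roots at each prime of \<open>U\<close> and one class at each small prime.
  Subtracting the mean leaves bounded interval sums, and Abel summation handles the weight
  \<open>1 / n\<close>.\<close>

lemma progression_sum:
 assumes U: "U \<subseteq> Py y" and x: "x0 >= 1"
 shows "\<bar>(SUM n:{n:{x0<..x1}. (ALL q:W0. n mod q = v mod q) & U \<subseteq> Zn y n}. 1 / real n) -
  (PROD p:U. 1 / fS p) / real W * (SUM n:{x0<..x1}. 1 / real n)\<bar> <= 2 * real (W * \<Prod>U) / real x0"
proof -
 define V where "V = W0 Un U"
 have "p ~: W0" if "p : U" for p using PyD[OF subsetD[OF U that]] by (simp add: W0_def)
 hence WU: "W0 Int U = {}" by blast
 have V: "finite V" "!!p. p : V ==> prime p" using Py_prod(1,2)[OF U] prime_W0 by (auto simp: V_def)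
 have fU: "finite U" using Py_prod(1)[OF U] .
 have PV: "\<Prod>V = W * \<Prod>U" unfolding V_def W_def by (rule prod.union_disjoint) (use WU fU in auto)
 have V0: "\<Prod>V > 0" using V prime_gt_0_nat by (intro prod_pos) auto
 define g where "g p x = (if p : U then (if EX h:Hs. p dvd x + h then 1 else 0) else if x = v mod p then 1 else (0::real))" for p x
 define b where "b n = (PROD p:V. g p (n mod p))" for n
 let ?\<kappa> = "(PROD p:U. 1 / fS p) / real W"
 have b: "b n = (if (ALL q:W0. n mod q = v mod q) & U \<subseteq> Zn y n then 1 else 0)" for n
 proof -
  have "g p (n mod p) = (if (if p : U then p : Zn y n else n mod p = v mod p) then 1 else 0)" if "p : V" for p
   using U by (auto simp: g_def Zn_def dvd_eq_mod_eq_0 mod_add_left_eq)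
  hence "b n = (PROD p:V. if (if p : U then p : Zn y n else n mod p = v mod p) then 1 else 0)" unfolding b_def by simp
  also have "... = (if ALL p:V. if p : U then p : Zn y n else n mod p = v mod p then 1 else 0)"
   by (rule prod_indicator[OF V(1)])
  also have "(ALL p:V. if p : U then p : Zn y n else n mod p = v mod p) \<longleftrightarrow> (ALL q:W0. n mod q = v mod q) & U \<subseteq> Zn y n"
   using WU by (auto simp: V_def split: if_splits)
  finally show ?thesis .
 qed
 have "(SUM c<\<Prod>V. b c) = (PROD p:V. SUM x<p. g p x)" unfolding b_def by (rule sum_crt_prod[OF V])
 also have "... = (PROD p:V. if p : U then 8 else 1)"
 proof (rule prod.cong[OF refl])
  fix p assume p: "p : V"
  have p0: "p > 0" using V(2)[OF p] prime_gt_0_nat by blast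
  show "(SUM x<p. g p x) = (if p : U then 8 else 1)"
  proof (cases "p : U")
   case True
   hence "p >= 100" using U Py_ge_100 by blast
   have "(SUM x<p. g p x) = (SUM x:{x:{..<p}. EX h:Hs. p dvd x + h}. 1)"
    by (rule sum.mono_neutral_cong_right) (use True in \<open>auto simp: g_def\<close>)
   thus ?thesis using True card_roots[OF \<open>p >= 100\<close>] by simp
  next
   case False
   have "(SUM x<p. g p x) = (SUM x:{v mod p}. 1)"
    by (rule sum.mono_neutral_cong_right) (use False p0 in \<open>auto simp: g_def\<close>)
   thus ?thesis using False by simp
  qed
 qed
 also have "... = (PROD p:U. 8)" unfolding V_def using fU WU by (subst prod.union_disjoint) (auto intro!: prod.neutral)
 finally have tot: "(SUM c<\<Prod>V. b c) = 8 ^ card U" by simp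
 have \<kappa>: "?\<kappa> * rP V = 8 ^ card U"
 proof -
  have "(PROD p:U. 1 / fS p) = 8 ^ card U / rP U" by (simp add: fS_def prod_dividef)
  thus ?thesis using W_pos V0 by (simp add: PV del: of_nat_prod)
 qed
 have \<kappa>1: "0 <= ?\<kappa>" "?\<kappa> <= 1"
 proof -
  show "0 <= ?\<kappa>" by (intro divide_nonneg_nonneg prod_nonneg) (auto simp: fS_def)
  have "(SUM c<\<Prod>V. b c) <= (SUM c<\<Prod>V. 1)" by (intro sum_mono) (simp add: b)
  hence "?\<kappa> * rP V <= 1 * rP V" unfolding \<kappa> tot by simp
  thus "?\<kappa> <= 1" using V0 by (simp only: mult_le_cancel_right_pos of_nat_0_less_iff)
 qed
 define a where "a n = complex_of_real (b n - ?\<kappa>)" for n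
 have per: "a (n + \<Prod>V) = a n" for n
 proof -
  have "(n + \<Prod>V) mod p = n mod p" if "p : V" for p
  proof -
   have "p dvd \<Prod>V" using V(1) that by (rule dvd_prodI)
   thus ?thesis by (metis add.right_neutral dvd_imp_mod_0 mod_add_right_eq)
  qed
  thus ?thesis by (simp add: a_def b_def)
 qed
 have "(SUM c<\<Prod>V. a c) = complex_of_real ((SUM c<\<Prod>V. b c) - rP V * ?\<kappa>)"
  unfolding a_def of_real_sum[symmetric] sum_subtractf by (simp del: of_nat_prod)
 moreover have "(SUM c<\<Prod>V. b c) - rP V * ?\<kappa> = 0" using tot \<kappa> by (simp only: mult.commute)
 ultimately have zero: "(SUM c<\<Prod>V. a c) = 0" by (simp only: of_real_0)
 have nrm: "norm (a n) <= 1" for n unfolding a_def norm_of_real using \<kappa>1 by (simp add: b abs_le_iff)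
 have "norm (SUM n:{x0<..x1}. (1 / real n) *\<^sub>R a n) <= 2 * rP V * (1 / real (Suc x0))"
  using periodic_sum_bound[of a "\<Prod>V", OF per zero V0 nrm] by (rule abel_decreasing_bound) (auto intro: divide_left_mono)
 moreover have "(SUM n:{x0<..x1}. (1 / real n) *\<^sub>R a n) = complex_of_real ((SUM n:{x0<..x1}. 1 / real n * b n) - ?\<kappa> * (SUM n:{x0<..x1}. 1 / real n))"
  unfolding a_def of_real_diff sum_distrib_left by (simp add: scaleR_conv_of_real algebra_simps sum_subtractf)
 ultimately have "\<bar>(SUM n:{x0<..x1}. 1 / real n * b n) - ?\<kappa> * (SUM n:{x0<..x1}. 1 / real n)\<bar> <= 2 * rP V * (1 / real (Suc x0))"
  by (simp only: norm_of_real)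
 also have "... <= 2 * rP V * (1 / real x0)"
  using x by (intro mult_left_mono divide_left_mono mult_nonneg_nonneg of_nat_0_le_iff) auto
 also have "(SUM n:{x0<..x1}. 1 / real n * b n) = (SUM n:{n:{x0<..x1}. (ALL q:W0. n mod q = v mod q) & U \<subseteq> Zn y n}. 1 / real n)"
  by (rule sum.mono_neutral_cong_right) (auto simp: b)
 finally show ?thesis unfolding PV by (simp only: times_divide_eq_right mult_1_right)
qed

text \<open>With \<open>D\<close> frozen by \<open>lamw_restrict\<close>, each of its primes
  contributes \<open>fS * hS <= 2\<close>; the sum over the remaining primes is part of
  \<open>Fy\<close>, because \<open>YR\<close> decreases when the set grows.\<close>

lemma lamw_abs_le:
 assumes D: "D \<subseteq> Py y"
 shows "\<bar>lamw (Py y) (YR y) D\<bar> <= (if \<Prod>D <= y ^ 96 then 2 ^ card D * Fy y else 0)"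
proof (cases "\<Prod>D <= y ^ 96")
 case False
 have "lamw (Py y) (YR y) D = 0"
  by (rule lamw_zero[where R = "real y ^ 96"]) (use D False Py_ge_16[of _ y] in \<open>auto simp: YR_def prod_le_iff not_le[symmetric] simp del: of_nat_prod\<close>)
 thus ?thesis using False by simp
next
 case True
 have p: "hS p > 0" "0 <= fS p * hS p" "fS p * hS p <= 2" if "p : Py y" for p
  using sieve_values[of p] Py_ge_100[OF that] by auto
 have h0: "0 <= (prod hS T) * YR y T" if "T \<subseteq> Py y" for T
  using p that by (intro mult_nonneg_nonneg prod_nonneg) (auto simp: YR_def intro!: less_imp_le)
 let ?g = "%T. (-1) ^ card D * (prod fS D) * (SUM X:Pow (D - D). YR y (D Un X Un T) * (PROD p:D Un X. hS p))"
 have "lamw (Py y) (YR y) D = lamw (Py y - D) ?g {}"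
  using lamw_restrict[OF finite_Py D subset_refl, of "{}" "YR y"] by simp
 also have "... = (SUM T:Pow (Py y - D). (-1) ^ card D * (prod fS D) * (YR y (D Un T) * (prod hS D)) * (prod hS T))"
  by (simp add: lamw_def) (simp add: Pow_def)
 also have "\<bar>...\<bar> <= (SUM T:Pow (Py y - D). (PROD p:D. fS p * hS p) * ((prod hS T) * YR y T))"
 proof (rule order.trans[OF sum_abs], rule sum_mono)
  fix T assume T: "T : Pow (Py y - D)"
  have YY: "YR y (D Un T) <= YR y T"
  proof -
   have sub: "D Un T \<subseteq> Py y" using D T by auto
   have "\<Prod>T dvd \<Prod>(D Un T)" using Py_prod(1)[OF sub] by (intro prod_dvd_prod_subset) auto
   hence "\<Prod>T <= \<Prod>(D Un T)" by (rule dvd_imp_le) (use Py_prod(3)[OF sub] in linarith)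
   thus ?thesis by (auto simp: YR_def)
  qed
  have nn: "0 <= (PROD p:D. fS p * hS p)" "0 <= (prod hS T)"       by (intro prod_nonneg, use p D in auto) (intro prod_nonneg less_imp_le p(1), use T in auto)
  have "\<bar>(-1) ^ card D * (prod fS D) * (YR y (D Un T) * (prod hS D)) * (prod hS T)\<bar> = (PROD p:D. fS p * hS p) * (prod hS T) * YR y (D Un T)"
  proof -
   note nn
   moreover have "0 <= YR y (D Un T)" by (simp add: YR_def)
   moreover have "(-1) ^ card D * (prod fS D) * (YR y (D Un T) * (prod hS D)) * (prod hS T) = (-1) ^ card D * ((PROD p:D. fS p * hS p) * (prod hS T) * YR y (D Un T))"
    by (simp add: prod.distrib mult_ac)
   ultimately show ?thesis by (simp only: abs_mult power_abs abs_minus_cancel abs_one power_one mult_1 abs_of_nonneg)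
  qed
  also have "... <= (PROD p:D. fS p * hS p) * (prod hS T) * YR y T"
   by (rule mult_left_mono[OF YY mult_nonneg_nonneg[OF nn]])
  finally show "\<bar>(-1) ^ card D * (prod fS D) * (YR y (D Un T) * (prod hS D)) * (prod hS T)\<bar> <= (PROD p:D. fS p * hS p) * ((prod hS T) * YR y T)"
   by (simp only: mult.assoc)
 qed
 also have "... = (PROD p:D. fS p * hS p) * (SUM T:Pow (Py y - D). (prod hS T) * YR y T)" by (rule sum_distrib_left[symmetric])
 also have "... <= 2 ^ card D * Fy y"
 proof (rule mult_mono)
  have "(PROD p:D. fS p * hS p) <= (PROD p:D. 2)" using p D by (intro prod_mono) auto
  thus "(PROD p:D. fS p * hS p) <= 2 ^ card D" by simp
  have "(SUM T:Pow (Py y - D). (prod hS T) * YR y T) <= (SUM T:Pow (Py y). (prod hS T) * YR y T)"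
   using h0 by (intro sum_mono2) auto
  also have "... = Fy y" unfolding Fy_def by (intro sum.cong) (auto simp: YR_def)
  finally show "(SUM T:Pow (Py y - D). (prod hS T) * YR y T) <= Fy y" .
 qed (use h0 in \<open>auto intro!: sum_nonneg\<close>)
 finally show ?thesis using True by simp
qed

text \<open>The square is opened and each pair of divisors is counted in progressions. The main
  terms reassemble to the diagonal form with value \<open>Fy\<close>; the error is a fixed power of
  \<open>y\<close> divided by \<open>x0\<close>.\<close>

lemma sieve_upper_bound:
 assumes x: "x0 >= 1" "x0 <= x1" and y: "y >= 1"
 shows "(SUM n:{n:{x0<..x1}. ALL q:W0. n mod q = v mod q}. wt y n / real n) <=
  (ln (real x1) - ln (real x0)) / real W * Fy y + 2 * real W * real y ^ 192 / real x0 * (real y ^ 97 * Fy y)\<^sup>2"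
proof -
 let ?z1 = "2 * real W * real y ^ 192 / real x0"
 let ?N = "{n:{x0<..x1}. ALL q:W0. n mod q = v mod q}" and ?P = "Pow (Py y)" and ?l = "lamw (Py y) (YR y)"
 define I where "I = (SUM n:{x0<..x1}. 1 / real n)"
 define e where "e = 2 * real W * real y ^ 192 / real x0"
 define T where "T U = (SUM n:{n:{x0<..x1}. (ALL q:W0. n mod q = v mod q) & U \<subseteq> Zn y n}. 1 / real n)" for U
 have w: "wt y n / real n = (SUM D:?P. SUM E:?P. ?l D * ?l E * (if D Un E \<subseteq> Zn y n then 1 / real n else 0))" for n
 proof -
  have Z: "Pow (Zn y n) = {D:?P. D \<subseteq> Zn y n}" by (auto simp: Zn_def)
  have "(SUM D:Pow (Zn y n). ?l D) = (SUM D:?P. ?l D * (if D \<subseteq> Zn y n then 1 else 0))"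
   unfolding Z by (rule sum.mono_neutral_cong_left) auto
  hence "wt y n / real n = (SUM D:?P. SUM E:?P. ?l D * (if D \<subseteq> Zn y n then 1 else 0) * (?l E * (if E \<subseteq> Zn y n then 1 else 0))) * (1 / real n)"
   unfolding wt_def power2_eq_square by (simp only: sum_product) simp
  also have "... = (SUM D:?P. SUM E:?P. ?l D * ?l E * (if D Un E \<subseteq> Zn y n then 1 / real n else 0))"
   unfolding sum_distrib_right by (rule sum.cong[OF refl], rule sum.cong[OF refl]) auto
  finally show ?thesis .
 qed
 have "(SUM n:?N. wt y n / real n) = (SUM D:?P. SUM E:?P. SUM n:?N. ?l D * ?l E * (if D Un E \<subseteq> Zn y n then 1 / real n else 0))"
  unfolding w by (subst sum.swap) (rule sum.cong[OF refl], rule sum.swap)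
 also have "... = (SUM D:?P. SUM E:?P. ?l D * ?l E * T (D Un E))"
 proof (rule sum.cong[OF refl], rule sum.cong[OF refl])
  fix D E
  have "(SUM n:?N. if D Un E \<subseteq> Zn y n then 1 / real n else 0) = T (D Un E)"
   unfolding T_def by (rule sum.mono_neutral_cong_right) auto
  thus "(SUM n:?N. ?l D * ?l E * (if D Un E \<subseteq> Zn y n then 1 / real n else 0)) = ?l D * ?l E * T (D Un E)"
   by (simp only: sum_distrib_left[symmetric])
 qed
 also have "... <= (SUM D:?P. SUM E:?P. ?l D * ?l E * ((PROD p:D Un E. 1 / fS p) / real W * I) + \<bar>?l D\<bar> * \<bar>?l E\<bar> * ?z1)"
 proof (intro sum_mono)
  fix D E assume D: "D : ?P" and E: "E : ?P"
  define c where "c = (PROD p:D Un E. 1 / fS p) / real W * I"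
  have "\<bar>?l D * ?l E * (T (D Un E) - c)\<bar> <= \<bar>?l D\<bar> * \<bar>?l E\<bar> * ?z1"
  proof (cases "\<Prod>D <= y ^ 96 & \<Prod>E <= y ^ 96")
   case True
   have sub: "D Un E \<subseteq> Py y" using D E by simp
   have "\<Prod>(D Un E) * 1 <= \<Prod>(D Un E) * \<Prod>(D Int E)" using Py_prod(3)[of "D Int E" y] D by (intro mult_left_mono) auto
   also have "... = \<Prod>D * \<Prod>E" using D E Py_prod(1)[of D y] Py_prod(1)[of E y] by (intro prod.union_inter) auto
   also have "... <= y ^ 96 * y ^ 96" using True by (intro mult_mono) auto
   finally have "\<Prod>(D Un E) <= y ^ 192" by (simp flip: power_add)
   hence U: "rP (D Un E) <= real y ^ 192" by (simp only: prod_le_iff)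
   have "\<bar>T (D Un E) - c\<bar> <= 2 * real (W * \<Prod>(D Un E)) / real x0"
    unfolding T_def c_def I_def by (rule progression_sum[OF sub x(1)])
   also have "... = 2 * real W * rP (D Un E) / real x0" by (simp only: of_nat_mult mult.assoc)
   also have "... <= 2 * real W * real y ^ 192 / real x0" by (intro divide_right_mono mult_left_mono U) auto
   finally show ?thesis unfolding abs_mult by (intro mult_left_mono) auto
  next
   case False
   hence "?l D = 0 | ?l E = 0" using lamw_abs_le[of D y] lamw_abs_le[of E y] D E by auto
   thus ?thesis by auto
  qed
  hence "?l D * ?l E * (T (D Un E) - c) <= \<bar>?l D\<bar> * \<bar>?l E\<bar> * ?z1" by linarith
  thus "?l D * ?l E * T (D Un E) <= ?l D * ?l E * ((PROD p:D Un E. 1 / fS p) / real W * I) + \<bar>?l D\<bar> * \<bar>?l E\<bar> * ?z1"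
   unfolding c_def[symmetric] by (simp add: right_diff_distrib)
 qed
 also have "... = I / real W * (SUM D:?P. SUM E:?P. ?l D * ?l E * (PROD p:D Un E. 1 / fS p)) + 2 * real W * real y ^ 192 / real x0 * (SUM D:?P. \<bar>?l D\<bar>)\<^sup>2"
 proof -
  have "(SUM D:?P. SUM E:?P. ?l D * ?l E * (f D E / real W * I)) = I / real W * (SUM D:?P. SUM E:?P. ?l D * ?l E * f D E)" for f
   unfolding sum_distrib_left by (rule sum.cong[OF refl], rule sum.cong[OF refl]) simp
  moreover have "(SUM D:?P. SUM E:?P. \<bar>?l D\<bar> * \<bar>?l E\<bar> * e) = e * (SUM D:?P. \<bar>?l D\<bar>)\<^sup>2"
   by (simp only: power2_eq_square sum_product) (simp only: sum_distrib_right mult.commute[of e])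
  ultimately show ?thesis unfolding e_def[symmetric] sum.distrib by simp
 qed
 also have "(SUM D:?P. SUM E:?P. ?l D * ?l E * (PROD p:D Un E. 1 / fS p)) = Fy y"
  unfolding Fy_def by (rule lamw_form_f) (use Py_ge_16[of _ y] in auto)
 finally have 1: "(SUM n:?N. wt y n / real n) <= I / real W * Fy y + e * (SUM D:?P. \<bar>?l D\<bar>)\<^sup>2" unfolding e_def .
 have 2: "(SUM D:?P. \<bar>?l D\<bar>)\<^sup>2 <= (real y ^ 97 * Fy y)\<^sup>2"
 proof (rule power_mono)
  have "(SUM D:?P. \<bar>?l D\<bar>) <= (SUM D:?P. if \<Prod>D <= y ^ 96 then 2 ^ card D * Fy y else 0)"
   by (intro sum_mono lamw_abs_le) auto
  also have "... = (SUM D:{D:?P. \<Prod>D <= y ^ 96}. 2 ^ card D * Fy y)" by (rule sum.mono_neutral_cong_right) auto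
  also have "... <= (SUM D:{D:?P. \<Prod>D <= y ^ 96}. real y * Fy y)"
  proof (intro sum_mono mult_right_mono Fy_le(2))
   fix D assume D: "D : {D:?P. \<Prod>D <= y ^ 96}"
   have "y ^ 96 <= y ^ 192" using y by (intro power_increasing) auto
   hence "(12544 ^ card D :: nat) <= y" using D by (intro card_power_le_y) auto
   moreover have "(2 ^ card D :: nat) <= 12544 ^ card D" by (intro power_mono) auto
   ultimately have "real (2 ^ card D) <= real y" by (simp only: of_nat_le_iff)
   thus "2 ^ card D <= real y" by simp
  qed
  also have "... = real (card {D:?P. \<Prod>D <= y ^ 96}) * (real y * Fy y)" by simp
  also have "... <= real (y ^ 96) * (real y * Fy y)"
  proof (intro mult_right_mono mult_nonneg_nonneg Fy_le(2))
   have inj: "inj_on (%V. \<Prod>V) {D:?P. \<Prod>D <= y ^ 96}"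
    by (rule inj_on_subset[OF inj_on_prod_primes[of "Py y"]]) (use PyD in auto)
   have "card {D:?P. \<Prod>D <= y ^ 96} = card ((%V. \<Prod>V) ` {D:?P. \<Prod>D <= y ^ 96})" by (rule card_image[OF inj, symmetric])
   also have "... <= card {1..y ^ 96}" using Py_prod(3)[of _ y] by (intro card_mono) auto
   finally show "real (card {D:?P. \<Prod>D <= y ^ 96}) <= real (y ^ 96)" by (simp only: of_nat_le_iff card_atLeastAtMost diff_Suc_1)
  qed simp
  also have "... = real y ^ 97 * Fy y" by (simp add: power_numeral_reduce)
  finally show "(SUM D:?P. \<bar>?l D\<bar>) <= real y ^ 97 * Fy y" .
 qed (auto intro: sum_nonneg)
 have "I / real W * Fy y <= (ln (real x1) - ln (real x0)) / real W * Fy y"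
  unfolding I_def using sum_inverse_le_ln[OF x] Fy_le(2) by (intro mult_right_mono divide_right_mono) auto
 moreover have "e * (SUM D:?P. \<bar>?l D\<bar>)\<^sup>2 <= e * (real y ^ 97 * Fy y)\<^sup>2" by (rule mult_left_mono[OF 2]) (simp add: e_def)
 ultimately show ?thesis using 1 unfolding e_def by linarith
qed


section \<open>The weight at integers n with n + h a product of two primes\<close>

definition Yd :: "nat => nat => nat set => real" where "Yd y p1 T = YR y T - YR y (insert p1 T)"
text \<open>The coefficients of the squared weight once \<open>p1\<close> has been merged into the
  variable \<open>Yd\<close>; if \<open>p1\<close> exceeds the level, \<open>Yd\<close> equals
  \<open>YR\<close> on sets of sieve primes.\<close>

definition Cd :: "nat => nat => nat set => real" where "Cd y p1 V = Cc (Py y - {p1}) (Yd y p1) V"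
text \<open>The residue of \<open>h - h'\<close> modulo \<open>p\<close>; \<open>p\<close> is added
  first so that the subtraction stays within the naturals.\<close>

definition eH :: "nat => nat => nat => nat" where "eH h h' p = h + p - h'"

lemma Yd_bounds:
 assumes "prime p1" "T \<subseteq> Py y - {p1}"
 shows "0 <= Yd y p1 T" "Yd y p1 T <= YR y T"
proof -
 have "\<Prod>T <= p1 * \<Prod>T" using prime_gt_0_nat[OF assms(1)] by simp
 also have "... = \<Prod>(insert p1 T)" using assms Py_prod(1)[of T y] by (subst prod.insert) auto
 finally show "0 <= Yd y p1 T" "Yd y p1 T <= YR y T" by (auto simp: Yd_def YR_def)
qed

lemma Cd_zero:
 assumes p1: "prime p1" and V: "V \<subseteq> Py y - {p1}" "\<Prod>V > y ^ 192"
 shows "Cd y p1 V = 0"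
proof -
 have l0: "lamw (Py y - {p1}) (Yd y p1) D = 0" if "D \<subseteq> Py y - {p1}" "\<Prod>D > y ^ 96" for D
 proof (rule lamw_zero[where R = "real y ^ 96"])
  show "Yd y p1 T = 0" if "T \<subseteq> Py y - {p1}" "rP T > real y ^ 96" for T
   using Yd_bounds[OF p1 that(1)] that(2) prod_le_iff[of T y 96] by (simp add: YR_def del: of_nat_prod split: if_splits)
  show "rP D > real y ^ 96" using that(2) prod_le_iff[of D y 96] by linarith
 qed (use that Py_ge_16 in auto)
 have "(if V \<subseteq> D Un E then lamw (Py y - {p1}) (Yd y p1) D * lamw (Py y - {p1}) (Yd y p1) E * (PROD p:(D Un E) - V. 1 / gS p) else 0) = 0"
  if D: "D : Pow (Py y - {p1})" and E: "E : Pow (Py y - {p1})" for D E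
 proof (cases "V \<subseteq> D Un E & \<Prod>D <= y ^ 96 & \<Prod>E <= y ^ 96")
  case True
  have sub: "D Un E \<subseteq> Py y" "D Int E \<subseteq> Py y" "D \<subseteq> Py y" "E \<subseteq> Py y" using D E by auto
  have "\<Prod>V <= \<Prod>(D Un E)"
   by (rule dvd_imp_le[OF prod_dvd_prod_subset[OF Py_prod(1)[OF sub(1)]]]) (use True Py_prod(3)[OF sub(1)] in auto)
  also have "\<Prod>(D Un E) * 1 <= \<Prod>(D Un E) * \<Prod>(D Int E)" using Py_prod(3)[OF sub(2)] by (intro mult_left_mono) auto
  also have "... = \<Prod>D * \<Prod>E" using Py_prod(1)[OF sub(3)] Py_prod(1)[OF sub(4)] by (intro prod.union_inter) auto
  also have "... <= y ^ 96 * y ^ 96" using True by (intro mult_mono) auto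
  finally have "\<Prod>V <= y ^ 192" by (simp flip: power_add)
  thus ?thesis using V(2) by linarith
 next
  case False
  hence "~ V \<subseteq> D Un E | lamw (Py y - {p1}) (Yd y p1) D = 0 | lamw (Py y - {p1}) (Yd y p1) E = 0"
   using l0[of D] l0[of E] D E by (auto simp: not_le)
  thus ?thesis by auto
 qed
 thus ?thesis unfolding Cd_def Cc_def by (intro sum.neutral ballI) auto
qed

lemma Cd_bound:
 assumes p1: "prime p1" and V: "V \<subseteq> Py y - {p1}"
 shows "\<bar>Cd y p1 V\<bar> <= 16 ^ card V * My y"
proof -
 let ?P = "Py y - {p1}"
 define s where "s f P = (SUM S:Pow P. if rP S <= real y ^ 96 then (PROD p:S. f p) else 0)" for f :: "nat => real" and P
 have "\<bar>Cc ?P (Yd y p1) V\<bar> <= 16 ^ card V * (s coefS ?P * (s (%p. 1 / (real p - 1)) ?P)\<^sup>2)"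
  unfolding s_def
 proof (rule Cc_bound[OF _ _ _ V])
  fix T assume T: "T \<subseteq> ?P"
  show "\<bar>Yd y p1 T\<bar> <= (if rP T <= real y ^ 96 then 1 else 0)"
   using Yd_bounds[OF p1 T] unfolding prod_le_iff by (auto simp: YR_def)
 qed (use Py_ge_16 in auto)
 also have "... <= 16 ^ card V * (s coefS (Py y) * (s (%p. 1 / (real p - 1)) (Py y))\<^sup>2)"
 proof -
  have s: "0 <= s f ?P" "s f ?P <= s f (Py y)" if f: "!!p. p : Py y ==> 0 <= f p" for f
  proof -
   have f0: "0 <= (PROD p:S. f p)" if "S \<subseteq> Py y" for S using f that by (intro prod_nonneg) auto
   show "0 <= s f ?P" unfolding s_def using f0 by (intro sum_nonneg) auto
   show "s f ?P <= s f (Py y)" unfolding s_def using f0 by (intro sum_mono2) auto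
  qed
  have "0 <= coefS p" "0 <= 1 / (real p - 1)" if "p : Py y" for p
   using coefS(2)[OF Py_ge_16[OF that]] Py_ge_16[OF that] by (auto intro: order.trans[rotated])
  thus ?thesis using s[of coefS] s[of "%p. 1 / (real p - 1)"] by (intro mult_left_mono mult_mono power_mono) auto
 qed
 finally show ?thesis unfolding Cd_def My_def s_def .
qed

lemma Cd_empty_nonneg: "0 <= Cd y p1 {}"
proof -
 have "0 <= coefS p" if "p : Py y" for p
  using coefS(2)[OF Py_ge_16[OF that]] by (rule order.trans[rotated]) simp
 thus ?thesis unfolding Cd_def using Py_ge_16
  by (subst Cc_empty) (auto intro!: sum_nonneg mult_nonneg_nonneg prod_nonneg)
qed

lemma dvd_shift_iff:
 assumes p: "p >= (100::nat)" and h: "h : Hs" "h' : Hs" and N: "n + h = N"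
 shows "p dvd n + h' \<longleftrightarrow> N mod p = eH h h' p mod p"
proof -
 have "(n + h') + eH h h' p = N + p" using Hs(3)[OF h(2)] p N by (simp add: eH_def)
 hence "N mod p = (n + h' + eH h h' p) mod p" by simp
 hence "N mod p = eH h h' p mod p \<longleftrightarrow> [n + h' + eH h h' p = 0 + eH h h' p] (mod p)" by (simp add: Cong.cong_def)
 also have "... \<longleftrightarrow> [n + h' = 0] (mod p)" by (rule cong_add_rcancel_nat)
 also have "... \<longleftrightarrow> p dvd n + h'" by (rule cong_0_iff)
 finally show ?thesis by simp
qed

lemma shift_unique:
 assumes "p >= (100::nat)" "h : Hs" "h' : Hs" "p dvd n + h" "p dvd n + h'"
 shows "h = h'"
proof (rule ccontr)
 assume "h ~= h'"
 have "int p dvd int (n + h) - int (n + h')" by (rule dvd_diff) (use assms(4,5) in \<open>simp_all only: int_dvd_int_iff\<close>)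
 moreover have "int (n + h) - int (n + h') = int h - int h'" by simp
 ultimately have "int p dvd int h - int h'" by simp
 moreover have "int h - int h' ~= 0" using \<open>h ~= h'\<close> by simp
 ultimately have "int p <= \<bar>int h - int h'\<bar>" using dvd_imp_le_int[of "int h - int h'" "int p"] by simp
 thus False using assms(1) Hs(3)[OF assms(2)] Hs(3)[OF assms(3)] by linarith
qed

text \<open>The prime factors of \<open>n + h\<close> are \<open>p1\<close> and \<open>p2\<close>;
  \<open>p2\<close> lies above the level, and \<open>p1\<close> is either merged into
  \<open>Yd\<close> or lies above it too. At any other sieve prime, divisibility of
  \<open>n + h'\<close> is a residue condition on \<open>p1 * p2\<close>, and at most one of the
  seven shifts can satisfy it, so the sum of indicators is again an indicator; the subtracted means
  add up to \<open>7 / (p - 1) = 1 / gS p\<close>.\<close>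

lemma wt_expand:
 assumes h: "h : Hs" and p1: "p1 : cell y i" "i >= 1" and p2: "p2 : cell y j" "j >= 96" and y: "y >= D0" "y >= 100"
 shows "wt y (p1 * p2 - h) = (SUM V:Pow (Py y - {p1}). Cd y p1 V * (PROD p:V. SUM h':Hs - {h}. eker p (eH h h' p) p1 p2))"
proof -
 let ?P = "Py y - {p1}"
 define n where "n = p1 * p2 - h"
 have pr: "prime p1" "prime p2" "y ^ i < p1" "y ^ j < p2" using p1 p2 by (auto simp: cell_def)
 have "y <= y ^ i" using y p1(2) by (intro self_le_power) auto
 hence p1y: "p1 > y" using pr by linarith
 have "y ^ 96 <= y ^ j" using y p2(2) by (intro power_increasing) auto
 hence p2y: "p2 > y ^ 96" using pr by linarith
 have "p1 * 1 <= p1 * p2" using pr prime_gt_0_nat[of p2] by (intro mult_left_mono) auto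
 hence "h <= p1 * p2" using Hs(3)[OF h] p1y y by linarith
 hence nh: "n + h = p1 * p2" unfolding n_def by simp
 define Zm where "Zm = {p:?P. EX h':Hs - {h}. p dvd n + h'}"
 have ndvd: "~ p dvd p1 * p2" if "p : ?P" for p
 proof
  assume "p dvd p1 * p2"
  moreover have "prime p" using that PyD by auto
  ultimately have "p = p1 | p = p2" using pr prime_dvd_mult_iff primes_dvd_imp_eq by blast
  thus False using that p2y by (auto simp: Py_def)
 qed
 have Z: "Zn y n - {p1} = Zm"
 proof (rule subset_antisym; rule subsetI)
  fix p assume "p : Zn y n - {p1}"
  then obtain h' where p: "p : ?P" "h' : Hs" "p dvd n + h'" by (auto simp: Zn_def)
  hence "h' ~= h" using ndvd[OF p(1)] nh by auto
  thus "p : Zm" using p by (auto simp: Zm_def)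
 qed (auto simp: Zn_def Zm_def)
 have "(SUM D:Pow (Zn y n). lamw (Py y) (YR y) D) = (SUM D:Pow Zm. lamw ?P (Yd y p1) D)"
 proof (cases "p1 : Py y")
  case True
  hence pZ: "{p1} \<subseteq> Zn y n" unfolding Zn_def using h by (auto intro!: bexI[of _ h] simp: nh)
  have fin: "finite (Zn y n)" by (simp add: Zn_def)
  have "Pow {p1} = {{}, {p1}}" by auto
  hence "(SUM D:Pow (Zn y n). lamw (Py y) (YR y) D) = (SUM D:Pow Zm. lamw (Py y) (YR y) D) + (SUM D:Pow Zm. lamw (Py y) (YR y) (insert p1 D))"
   unfolding sum_Pow_split[OF pZ fin] Z by simp
  also have "... = (SUM D:Pow Zm. lamw ?P (Yd y p1) D)"
   unfolding sum.distrib[symmetric] Yd_def[abs_def]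
   by (intro sum.cong refl lamw_merge_prime[OF finite_Py _ True]) (use Py_ge_16 in \<open>auto simp: Zm_def\<close>)
  finally show ?thesis .
 next
  case False
  hence P: "?P = Py y" "p1 ~: Zn y n" by (auto simp: Zn_def)
  have big: "p1 > y ^ 96" using False pr p1y y by (auto simp: Py_def)
  have "Yd y p1 T = YR y T" if T: "T : Pow (Py y)" for T
  proof -
   have "\<Prod>(insert p1 T) = p1 * \<Prod>T" using T False Py_prod(1)[of T y] by (subst prod.insert) auto
   moreover have "p1 * 1 <= p1 * \<Prod>T" using Py_prod(3)[of T y] T by (intro mult_left_mono) auto
   ultimately have "~ \<Prod>(insert p1 T) <= y ^ 96" using big by linarith
   thus ?thesis by (simp only: Yd_def YR_def if_False diff_zero)
  qed
  hence "lamw (Py y) (Yd y p1) D = lamw (Py y) (YR y) D" for D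
   unfolding lamw_def by (intro arg_cong2[of _ _ _ _ "(*)"] sum.cong refl) auto
  thus ?thesis using P Z by simp
 qed
 hence "wt y n = (SUM D:Pow Zm. lamw ?P (Yd y p1) D)\<^sup>2" unfolding wt_def by simp
 also have "... = (SUM V:Pow ?P. Cd y p1 V * (PROD p:V. (if p : Zm then 1 else 0) - 1 / gS p))"
  unfolding Cd_def by (rule sieve_square_expand) (auto simp: Zm_def)
 also have "... = (SUM V:Pow ?P. Cd y p1 V * (PROD p:V. SUM h':Hs - {h}. eker p (eH h h' p) p1 p2))"
 proof (rule sum.cong[OF refl], rule arg_cong[of _ _ "(*) _"], rule prod.cong[OF refl])
  fix V p assume "V : Pow ?P" "p : V"
  hence p: "p : ?P" by auto
  hence p100: "p >= 100" using Py_ge_100 by auto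
  have "~ p dvd p1" using ndvd[OF p] by auto
  hence "(SUM h':Hs - {h}. eker p (eH h h' p) p1 p2) = (SUM h':Hs - {h}. (if p dvd n + h' then 1 else 0) - 1 / (real p - 1))"
   by (intro sum.cong refl) (use dvd_shift_iff[OF p100 h _ nh] in \<open>auto simp: eker_def\<close>)
  also have "... = (SUM h':Hs - {h}. if p dvd n + h' then 1 else 0) - 1 / gS p"
   using h Hs(1,2) by (simp add: sum_subtractf gS_def card_Diff_subset)
  also have "(SUM h':Hs - {h}. if p dvd n + h' then 1 else 0) = (if p : Zm then 1 else (0::real))"
  proof (cases "p : Zm")
   case True
   then obtain h0 where h0: "h0 : Hs - {h}" "p dvd n + h0" by (auto simp: Zm_def)
   have "(SUM h':Hs - {h}. if p dvd n + h' then 1 else (0::real)) = (SUM h':{h0}. 1)"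
    by (rule sum.mono_neutral_cong_right) (use h0 Hs(1) shift_unique[OF p100, of _ h0 n] in auto)
   thus ?thesis using True by simp
  qed (use p in \<open>auto simp: Zm_def intro!: sum.neutral\<close>)
  finally show "(if p : Zm then 1 else 0) - 1 / gS p = (SUM h':Hs - {h}. eker p (eH h h' p) p1 p2)" by simp
 qed
 finally show ?thesis unfolding n_def .
qed

text \<open>The contribution of one shift and one pair of cells to the weighted count of products of
  two primes. The factor \<open>1 / n\<close> is replaced by the smaller
  \<open>betaw y j p2 / p1\<close>.\<close>

definition S2c :: "nat => nat => nat => nat => nat => real" where
 "S2c v h i j y = (SUM p1:cell y i. 1 / real p1 *
  (SUM p2:{p2:cell y j. ALL q:W0. p1 * p2 mod q = (v + h) mod q}. betaw y j p2 * wt y (p1 * p2 - h)))"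

lemma class_partner:
 assumes v: "cop v" and a: "cop a"
 shows "EX b. cop b & (ALL m. (ALL q:W0. a * m mod q = v mod q) \<longleftrightarrow> (ALL q:W0. m mod q = b mod q))"
proof -
 have cW: "coprime a W" unfolding W_def
  using a prime_W0 by (intro prod_coprime_right) (metis cop_def coprime_commute prime_imp_coprime)
 obtain a' where a': "[a * a' = 1] (mod W)" using cong_solve_coprime_nat[OF cW] by auto
 have a'q: "[a * a' = 1] (mod q)" if "q : W0" for q
  by (rule cong_dvd_modulus_nat[OF a']) (use that in \<open>auto simp: W_def intro!: dvd_prodI\<close>)
 have iff: "a * m mod q = v mod q \<longleftrightarrow> m mod q = v * a' mod q" if q: "q : W0" for q m
 proof -
  have "[a * m = v] (mod q) \<longleftrightarrow> [m = v * a'] (mod q)"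
  proof
   assume "[a * m = v] (mod q)"
   hence "[a * m * a' = v * a'] (mod q)" by (rule cong_scalar_right)
   moreover have "[a * a' * m = 1 * m] (mod q)" using a'q[OF q] by (rule cong_scalar_right)
   ultimately show "[m = v * a'] (mod q)" by (metis cong_sym cong_trans mult.assoc mult.commute mult_1)
  next
   assume "[m = v * a'] (mod q)"
   hence "[a * m = a * (v * a')] (mod q)" by (rule cong_scalar_left)
   moreover have "[a * a' * v = 1 * v] (mod q)" using a'q[OF q] by (rule cong_scalar_right)
   ultimately show "[a * m = v] (mod q)" by (metis cong_trans mult.assoc mult.commute mult_1)
  qed
  thus ?thesis by (simp add: Cong.cong_def)
 qed
 moreover have "cop (v * a')"
  unfolding cop_def
 proof (intro ballI notI)
  fix q assume q: "q : W0" "q dvd v * a'"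
  hence "q dvd a'" using v prime_W0 prime_dvd_mult_iff[of q v a'] by (auto simp: cop_def)
  hence "[a * a' = 0] (mod q)" by (simp add: cong_0_iff)
  hence "q dvd 1" using a'q[OF q(1)] by (metis cong_dvd_iff cong_0_iff)
  thus False using prime_W0[OF q(1)] by auto
 qed
 ultimately show ?thesis by blast
qed

lemma eH_not_dvd:
 assumes "h : Hs" "h' : Hs - {h}" "D0 < p"
 shows "~ p dvd eH h h' p"
proof
 assume "p dvd eH h h' p"
 then obtain k where k: "h + p - h' = p * k" unfolding eH_def by blast
 have "(100::nat) <= 10 ^ 100" by (rule order.trans[of _ "10 ^ 2"], simp, rule power_increasing) auto
 hence p: "p >= 100" using assms(3) D0_large by linarith
 have b: "h <= 26" "h' <= 26" "h ~= h'" using assms Hs(3) by auto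
 consider "k = 0" | "k = 1" | "2 <= k" by linarith
 thus False
 proof cases
  case 3
  hence "p * 2 <= p * k" by (rule mult_left_mono) simp
  thus False using k p b by linarith
 qed (use k p b in auto)
qed

text \<open>For \<open>p1\<close> in a fixed class \<open>a\<close> modulo \<open>W\<close> the
  prime \<open>p2\<close> runs through the single class \<open>bb a\<close>. The term
  \<open>V = {}\<close> gives \<open>Cd y p1 {}\<close> times a class sum of \<open>betaw\<close>;
  all other \<open>V\<close> form the bilinear error.\<close>

lemma cell_lower_bound:
 assumes h: "h : Hs" and v: "cop (v + h)" and i: "15 <= i" and j: "201 <= j" and ij: "400 <= i + j" and \<epsilon>: "\<epsilon> > 0"
 shows "\<forall>\<^sub>F y in sequentially. ALL C>=0. (ALL p1:cell y i. C <= Cd y p1 {}) -->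
  S2c v h i j y >= (1 / (real (Suc j) * phiW) - \<epsilon>) * (SUM p1:cell y i. 1 / real p1) * C - \<epsilon> * My y"
proof -
 let ?\<kappa> = "1 / (real (Suc j) * phiW)" and ?I = "Hs - {h}"
 let ?A = "{a:{..<W}. cop a}"
 define ok where "ok a b \<longleftrightarrow> (cop a --> cop b & (ALL m. (ALL q:W0. a * m mod q = (v + h) mod q) \<longleftrightarrow> (ALL q:W0. m mod q = b mod q)))" for a b
 have "EX b. ok a b" for a using class_partner[OF v, of a] unfolding ok_def by (cases "cop a") auto
 then obtain bb where bb: "ALL a. ok a (bb a)" using choice[of ok] by blast
 have I: "finite ?I" "card ?I = 7" using Hs(1,2) h by (auto simp: card_Diff_subset)
 have W1: "real W > 0" using W_pos by simp
 have ev1: "\<forall>\<^sub>F y in sequentially. ALL a:?A. (SUM m:clscell y j (bb a). betaw y j m) > ?\<kappa> - \<epsilon>"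
 proof (rule eventually_ball_finite)
  show "ALL a:?A. \<forall>\<^sub>F y in sequentially. (SUM m:clscell y j (bb a). betaw y j m) > ?\<kappa> - \<epsilon>"
  proof
   fix a assume "a : ?A"
   hence "cop (bb a)" using bb unfolding ok_def by blast
   hence "((%y. SUM m:{m:cell y j. ALL q:W0. m mod q = bb a mod q}. betaw y j m) \<longlongrightarrow> 1 / (real (Suc j) * (PROD p:W0. real (p - 1)))) sequentially"
    by (intro betaw_class_tendsto) (auto simp: prime_W0 cop_def)
   thus "\<forall>\<^sub>F y in sequentially. (SUM m:clscell y j (bb a). betaw y j m) > ?\<kappa> - \<epsilon>"
    unfolding clscell_def phiW_def by (rule order_tendstoD) (use \<epsilon> in simp)
  qed
 qed simp
 \<comment> \<open>The tolerance is \<open>\<epsilon> / W\<close> because the errors of up to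
   \<open>W\<close> classes are added.\<close>
 define bil where "bil a y \<longleftrightarrow> (ALL A1<=cell y i. ALL c M. (ALL p:A1. ALL V:Pow (Py y - {p}). \<bar>c p V\<bar> <= 16 ^ card V * M) --> M >= 0 -->
  \<bar> SUM p:A1. 1 / real p * (SUM V:{V:Pow (Py y - {p}). V ~= {} & \<Prod>V <= y ^ 192}. c p V * Gk ?I (eH h) (clscell y j (bb a)) (betaw y j) V p)\<bar> <= \<epsilon> / W * M)" for a y
 have ev2: "\<forall>\<^sub>F y in sequentially. ALL a:?A. bil a y"
 proof (rule eventually_ball_finite)
  show "ALL a:?A. \<forall>\<^sub>F y in sequentially. bil a y"
  proof
   fix a assume "a : ?A"
   hence "cop (bb a)" using bb unfolding ok_def by blast
   hence "EX y0. ALL y>=y0. bil a y" unfolding bil_def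
    using eH_not_dvd[OF h] \<epsilon> W1 by (intro bilinear_error[OF I _ _ i j ij]) (auto simp: cop_def)
   thus "\<forall>\<^sub>F y in sequentially. bil a y" unfolding eventually_sequentially .
  qed
 qed simp
 show ?thesis using ev1 ev2 eventually_ge_at_top[of D0] eventually_ge_at_top[of 100]
 proof eventually_elim
  case (elim y)
  show ?case
  proof (intro allI impI)
   fix C assume C: "C >= (0::real)" "ALL p1:cell y i. C <= Cd y p1 {}"
   have M0: "0 <= My y"
    using Cd_bound[of 2 "{}" y] two_is_prime_nat by (auto intro: order.trans[OF abs_ge_zero])
   let ?c = "%a. {p:cell y i. p mod W = a}"
 let ?X = "%p. SUM p2:{p2:cell y j. ALL q:W0. p * p2 mod q = (v + h) mod q}. betaw y j p2 * wt y (p * p2 - h)"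
 let ?VV = "%p. {V:Pow (Py y - {p}). V ~= {} & \<Prod>V <= y ^ 192}"
   define G where "G a V p = Gk ?I (eH h) (clscell y j (bb a)) (betaw y j) V p" for a V p
   define Er where "Er a = (SUM p:?c a. 1 / real p * (SUM V:?VV p. Cd y p V * G a V p))" for a
   have Er: "\<bar>Er a\<bar> <= \<epsilon> / W * My y" if a: "a : ?A" for a
   proof -
    have "bil a y" using elim(2) a by blast
    note b = this[unfolded bil_def, rule_format, of "?c a" "Cd y" "My y"]
    show ?thesis unfolding Er_def G_def by (rule b) (use Cd_bound M0 in \<open>auto simp: cell_def\<close>)
   qed
   have yD: "D0 <= y" "y >= 100" using elim by auto
   have copc: "cop p" if p: "p : cell y i" for p
    unfolding cop_def
   proof (intro ballI notI)
    fix q assume q: "q : W0" "q dvd p"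
    have "prime p" "y ^ i < p" using p by (auto simp: cell_def)
    hence "q = p" using q prime_W0[OF q(1)] primes_dvd_imp_eq by blast
    moreover have "y <= y ^ i" using yD i by (intro self_le_power) auto
    ultimately show False using q(1) \<open>y ^ i < p\<close> yD by (auto simp: W0_def)
   qed
   have inner: "?X p =
     Cd y p {} * (SUM m:clscell y j (bb a). betaw y j m) + (SUM V:?VV p. Cd y p V * G a V p)"
    if p: "p : cell y i" "p mod W = a" for p a
   proof -
    have am: "a * m mod q = p * m mod q" if "q : W0" for q m
    proof -
     have "q dvd W" unfolding W_def using that by (intro dvd_prodI) auto
     hence "a mod q = p mod q" using p(2) mod_mod_cancel by blast
     thus ?thesis by (metis mod_mult_left_eq)
    qed
    have "cop a" using copc[OF p(1)] cop_mod[of p a] p(2) by (auto simp: Cong.cong_def)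
    hence "(ALL q:W0. a * m mod q = (v + h) mod q) \<longleftrightarrow> (ALL q:W0. m mod q = bb a mod q)" for m
     using bb unfolding ok_def by blast
    hence "(ALL q:W0. p * m mod q = (v + h) mod q) \<longleftrightarrow> (ALL q:W0. m mod q = bb a mod q)" for m using am by simp
    hence set: "{p2:cell y j. ALL q:W0. p * p2 mod q = (v + h) mod q} = clscell y j (bb a)"
     unfolding clscell_def by simp
    have "(SUM p2:clscell y j (bb a). betaw y j p2 * wt y (p * p2 - h)) = (SUM p2:clscell y j (bb a). SUM V:Pow (Py y - {p}). Cd y p V * (betaw y j p2 * (PROD r:V. SUM h':?I. eker r (eH h h' r) p p2)))"
    proof (rule sum.cong[OF refl])
     fix p2 assume "p2 : clscell y j (bb a)"
     hence "p2 : cell y j" by (simp add: clscell_def)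
     thus "betaw y j p2 * wt y (p * p2 - h) = (SUM V:Pow (Py y - {p}). Cd y p V * (betaw y j p2 * (PROD r:V. SUM h':?I. eker r (eH h h' r) p p2)))"
      using wt_expand[OF h p(1) _ _ _ yD] i j by (simp add: sum_distrib_left mult_ac)
    qed
    also have "... = (SUM V:Pow (Py y - {p}). Cd y p V * G a V p)"
     unfolding G_def Gk_def sum_distrib_left by (rule sum.swap)
    also have "... = (SUM V:insert {} (?VV p). Cd y p V * G a V p)"
    proof (rule sum.mono_neutral_right)
     have "Cd y p V = 0" if "V \<subseteq> Py y - {p}" "~ \<Prod>V <= y ^ 192" for V
      using Cd_zero[of p V y] that p(1) by (auto simp: cell_def not_le)
     thus "ALL V:Pow (Py y - {p}) - insert {} (?VV p). Cd y p V * G a V p = 0" by auto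
    qed auto
    also have "... = Cd y p {} * G a {} p + (SUM V:?VV p. Cd y p V * G a V p)"
     by (rule sum.insert) auto
    also have "G a {} p = (SUM m:clscell y j (bb a). betaw y j m)" by (simp add: G_def Gk_def)
    finally show ?thesis unfolding set .
   qed
   define S where "S a = (SUM p:?c a. 1 / real p)" for a
   have part: "(SUM p:cell y i. f p) = (SUM a:?A. SUM p:?c a. f p)" for f :: "nat => real"
   proof (rule sum.group[symmetric])
    have "cop (p mod W)" if "p : cell y i" for p using copc[OF that] cop_mod[of "p mod W" p] by (simp add: Cong.cong_def)
    thus "(%p. p mod W) ` cell y i \<subseteq> ?A" using W_pos by auto
   qed auto
   have "(?\<kappa> - \<epsilon>) * (SUM p:cell y i. 1 / real p) * C - \<epsilon> * My y <= (SUM a:?A. (?\<kappa> - \<epsilon>) * S a * C - \<epsilon> / W * My y)"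
   proof -
    have "real (card ?A) * (\<epsilon> / W * My y) <= real W * (\<epsilon> / W * My y)"
     using \<epsilon> M0 W1 card_mono[of "{..<W}" ?A] by (intro mult_right_mono) auto
    thus ?thesis using W1 by (simp add: part[of "%p. 1 / real p"] S_def sum_subtractf flip: sum_distrib_left sum_distrib_right)
   qed
   also have "... <= (SUM a:?A. SUM p:?c a. 1 / real p * ?X p)"
   proof (rule sum_mono)
    fix a assume a: "a : ?A"
    let ?B = "SUM m:clscell y j (bb a). betaw y j m"
    have B: "?\<kappa> - \<epsilon> <= ?B" using elim(1) a by (simp add: less_imp_le)
    have B0: "0 <= ?B" using yD by (intro sum_nonneg) (auto simp: betaw_def clscell_def cell_def intro!: divide_nonneg_nonneg mult_nonneg_nonneg prime_ge_1_nat)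
    have "(?\<kappa> - \<epsilon>) * S a * C - \<epsilon> / W * My y <= ?B * S a * C + Er a"
     using Er[OF a] mult_right_mono[OF mult_right_mono[OF B] C(1), of "S a"] by (auto simp: S_def sum_nonneg abs_le_iff)
    also have "?B * S a * C = (SUM p:?c a. 1 / real p * (C * ?B))" by (simp add: S_def sum_distrib_left mult_ac)
    also have "... <= (SUM p:?c a. 1 / real p * (Cd y p {} * ?B))"
     using C(2) B0 by (intro sum_mono mult_left_mono mult_right_mono) auto
    also have "(SUM p:?c a. 1 / real p * (Cd y p {} * ?B)) + Er a = (SUM p:?c a. 1 / real p * ?X p)"
     unfolding Er_def sum.distrib[symmetric] by (intro sum.cong refl) (simp add: inner distrib_left del: mult_cancel_left mult_cancel_left1)
    finally show "(?\<kappa> - \<epsilon>) * S a * C - \<epsilon> / W * My y <= (SUM p:?c a. 1 / real p * ?X p)" by simp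
   qed
   also have "... = S2c v h i j y" unfolding S2c_def by (rule part[symmetric])
   finally show "S2c v h i j y >= (?\<kappa> - \<epsilon>) * (SUM p1:cell y i. 1 / real p1) * C - \<epsilon> * My y" .
  qed
 qed
qed

end

text \<open>Put each prime of \<open>U\<close> into \<open>S\<close> with probability 7/8: the total
  mass is \<open>8 ^ card U\<close>, and the expected \<open>ln (\<Prod>S)\<close> is
  \<open>7 / 8 * ln (\<Prod>U)\<close>.\<close>

lemma weighted_log_sum:
 assumes "finite U" "!!p. p : U ==> p > (0::nat)"
 shows "(SUM S:Pow U. 7 ^ card S * (L - ln (rP S))) = 8 ^ card U * (L - 7 / 8 * ln (rP U))"
 using assms
proof (induction U arbitrary: L rule: finite_induct)
 case (insert p U)
 have pos: "rP S > 0" if "S \<subseteq> U" for S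
  using that insert.prems by (simp only: of_nat_0_less_iff) (auto intro!: prod_pos)
 have lnins: "ln (rP (insert p S)) = ln (real p) + ln (rP S)" if S: "S \<subseteq> U" for S
 proof -
  have "finite S" "p ~: S" using insert.hyps S finite_subset by auto
  hence "rP (insert p S) = real p * rP S" by simp
  thus ?thesis using insert.prems[of p] pos[OF S] by (simp only: ln_mult_pos of_nat_0_less_iff insertI1)
 qed
 have inj: "inj_on (insert p) (Pow U)" using insert.hyps by (auto simp: inj_on_def)
 have "(SUM S:Pow (insert p U). 7 ^ card S * (L - ln (rP S))) =
   (SUM S:Pow U. 7 ^ card S * (L - ln (rP S))) + (SUM S:Pow U. 7 ^ card (insert p S) * (L - ln (rP (insert p S))))"
  unfolding Pow_insert using insert.hyps by (subst sum.union_disjoint) (auto simp: sum.reindex[OF inj])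
 also have "(SUM S:Pow U. 7 ^ card (insert p S) * (L - ln (rP (insert p S)))) = 7 * (SUM S:Pow U. 7 ^ card S * (L - ln (real p) - ln (rP S)))"
  unfolding sum_distrib_left
 proof (rule sum.cong[OF refl])
  fix S assume S: "S : Pow U"
  hence "p ~: S" "finite S" using insert.hyps finite_subset by auto
  thus "7 ^ card (insert p S) * (L - ln (rP (insert p S))) = 7 * (7 ^ card S * (L - ln (real p) - ln (rP S)))"
   using lnins[of S] S by simp
 qed
 also have "(SUM S:Pow U. 7 ^ card S * (L - ln (rP S))) + 7 * (SUM S:Pow U. 7 ^ card S * (L - ln (real p) - ln (rP S))) =
   8 ^ card (insert p U) * (L - 7 / 8 * ln (rP (insert p U)))"
 proof -
  have "(SUM S:Pow U. 7 ^ card S * (L - ln (rP S))) = 8 ^ card U * (L - 7 / 8 * ln (rP U))" for L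
   using insert by blast
  note ih = this this[of "L - ln (real p)"]
  show ?thesis unfolding lnins[OF subset_refl] ih using insert.hyps by (simp add: algebra_simps del: of_nat_prod prod.insert)
 qed
 finally show ?case .
qed simp

context bigsieve
begin

text \<open>A lower bound for the linear form in \<open>Cd_ge\<close>, keeping only sets
  \<open>U\<close> with \<open>Yd y p1 U = 1\<close>: \<open>\<Prod>U\<close> is within the level,
  but beyond it after multiplication by \<open>p1 > y ^ i\<close>.\<close>

definition Nn :: "nat => nat => nat => real" where
 "Nn y i p1 = (SUM U:{U:Pow (Py y - {p1}). y ^ (96 - i) < \<Prod>U & \<Prod>U <= y ^ 96}.
  8 ^ card U / rP U * (ln (real y ^ 96) - 7 / 8 * ln (rP U)))"

lemma Bz_0_eq:
 assumes "\<Prod>V >= 1"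
 shows "Bz 0 j (real y ^ n / rP V) = (if \<Prod>V <= y ^ n then (ln (real y ^ n) - ln (rP V)) ^ j else 0)"
proof -
 have N: "rP V > 0" using assms by (simp only: of_nat_0_less_iff)
 have iff: "1 <= real y ^ n / rP V \<longleftrightarrow> \<Prod>V <= y ^ n" using N prod_le_iff[of V y n] by (simp add: le_divide_eq del: of_nat_prod)
 have "ln (real y ^ n / rP V) = ln (real y ^ n) - ln (rP V)" if "\<Prod>V <= y ^ n"
 proof -
  have "y ^ n > 0" using that assms by linarith
  hence "real (y ^ n) > 0" by (simp only: of_nat_0_less_iff)
  thus ?thesis using N by (intro ln_divide_pos) auto
 qed
 thus ?thesis unfolding Bz.simps(1) iff by simp
qed

lemma Vs_eq: "Vs k j (Py y) (real y ^ n) = (SUM V:Pow (Py y). if \<Prod>V <= y ^ n then real k ^ card V / rP V * (ln (real y ^ n) - ln (rP V)) ^ j else 0)"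
 unfolding Vs_def
proof (rule sum.cong[OF refl])
 fix V assume "V : Pow (Py y)"
 hence "\<Prod>V >= 1" using Py_prod(3)[of V y] by blast
 from Bz_0_eq[OF this] show "real k ^ card V / rP V * Bz 0 j (real y ^ n / rP V) =
  (if \<Prod>V <= y ^ n then real k ^ card V / rP V * (ln (real y ^ n) - ln (rP V)) ^ j else 0)" by simp
qed

lemma ln_prod_bounds:
 assumes "V \<subseteq> Py y" "\<Prod>V <= y ^ n"
 shows "0 <= ln (rP V)" "ln (rP V) <= ln (real y ^ n)"
proof -
 have "rP V >= 1" using Py_prod(3)[OF assms(1)] by (simp only: real_of_nat_ge_one_iff)
 thus "0 <= ln (rP V)" by (rule ln_ge_zero)
 have "rP V <= real y ^ n" using assms(2) by (simp only: prod_le_iff)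
 thus "ln (rP V) <= ln (real y ^ n)" using \<open>rP V >= 1\<close> by (intro ln_mono) linarith+
qed

text \<open>Cauchy-Schwarz for the diagonal form against the test vector
  \<open>g S = ln (y ^ 96 / \<Prod>S)\<close>. This is proportional to the expected size of
  \<open>Ysum\<close> for constant variables, and both resulting sums can be evaluated through
  \<open>Bz\<close>.\<close>

lemma Cd_ge:
 assumes p1: "p1 : cell y i" and y: "y >= 1"
 shows "(Nn y i p1)\<^sup>2 <= Cd y p1 {} * Bz 7 2 (real y ^ 96)"
proof -
 let ?P = "Py y - {p1}" and ?L = "ln (real y ^ 96)"
 have pr: "prime p1" "y ^ i < p1" using p1 by (auto simp: cell_def)
 define c where "c S = (7::real) ^ card S / rP S" for S :: "nat set"
 define g where "g S = (if \<Prod>S <= y ^ 96 then ?L - ln (rP S) else 0)" for S :: "nat set"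
 have c0: "0 <= c S" for S unfolding c_def by (intro divide_nonneg_nonneg of_nat_0_le_iff) simp
 have g0: "0 <= g S" if "S \<subseteq> Py y" for S using ln_prod_bounds(2)[OF that] by (simp add: g_def)
 have Yd0: "0 <= Yd y p1 T" if "T \<subseteq> ?P" for T using Yd_bounds(1)[OF pr(1) that] .
 have inv: "0 <= 1 / real p" "1 / real p <= 1 / (real p - 1)" if "p : Py y" for p
  using Py_ge_16[OF that] by (auto intro!: divide_left_mono)
 have Ysum: "(SUM T:Pow (?P - S). Yd y p1 (S Un T) / rP T) <= Ysum ?P (Yd y p1) S" if S: "S : Pow ?P" for S
  unfolding Ysum_def
 proof (rule sum_mono)
  fix T assume T: "T : Pow (?P - S)"
  have "1 / rP T = (PROD p:T. 1 / real p)" by (simp add: prod_dividef)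
  also have "... <= iph T" using inv T by (intro prod_mono) auto
  finally have "Yd y p1 (S Un T) * (1 / rP T) <= Yd y p1 (S Un T) * iph T"
   using Yd0[of "S Un T"] S T by (intro mult_left_mono) auto
  thus "Yd y p1 (S Un T) / rP T <= Yd y p1 (S Un T) * iph T" by simp
 qed
 have Y0: "0 <= Ysum ?P (Yd y p1) S" if S: "S : Pow ?P" for S
  by (rule order.trans[OF _ Ysum[OF S]]) (use S in \<open>auto intro!: sum_nonneg divide_nonneg_nonneg of_nat_0_le_iff Yd0 simp del: of_nat_prod\<close>)
 have Nn0: "0 <= Nn y i p1" unfolding Nn_def
 proof (intro sum_nonneg mult_nonneg_nonneg divide_nonneg_nonneg of_nat_0_le_iff)
  fix U assume "U : {U:Pow ?P. y ^ (96 - i) < \<Prod>U & \<Prod>U <= y ^ 96}"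
  hence "0 <= ln (rP U)" "ln (rP U) <= ?L" using ln_prod_bounds[of U y 96] by blast+
  thus "0 <= ?L - 7 / 8 * ln (rP U)" by linarith
 qed simp
 \<comment> \<open>\<open>Yd\<close> is 1 at these \<open>U\<close>, so the inner sum over
   \<open>S\<close> depends on \<open>U\<close> alone and \<open>weighted_log_sum\<close> evaluates
   it.\<close>
 have "Nn y i p1 = (SUM U:{U:Pow ?P. y ^ (96 - i) < \<Prod>U & \<Prod>U <= y ^ 96}. SUM S:Pow U. c S * g S * (Yd y p1 (S Un (U - S)) / rP (U - S)))"
  unfolding Nn_def
 proof (rule sum.cong[OF refl])
  fix U assume U: "U : {U:Pow ?P. y ^ (96 - i) < \<Prod>U & \<Prod>U <= y ^ 96}"
  have sub: "U \<subseteq> Py y" using U by auto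
  have "y ^ 96 <= y ^ (i + (96 - i))" using y by (intro power_increasing) auto
  also have "... = y ^ i * y ^ (96 - i)" by (rule power_add)
  also have "... < p1 * \<Prod>U" using pr(2) U by (intro mult_strict_mono) auto
  also have "p1 * \<Prod>U = \<Prod>(insert p1 U)" using U Py_prod(1)[OF sub] by (subst prod.insert) auto
  finally have Y1: "Yd y p1 U = 1" using U by (auto simp: Yd_def YR_def)
  have "(SUM S:Pow U. c S * g S * (Yd y p1 (S Un (U - S)) / rP (U - S))) = (SUM S:Pow U. 1 / rP U * (7 ^ card S * (?L - ln (rP S))))"
  proof (rule sum.cong[OF refl])
   fix S assume S: "S : Pow U"
   have s: "S \<subseteq> Py y" "U - S \<subseteq> Py y" using S sub by auto
   have US: "\<Prod>U = \<Prod>(U - S) * \<Prod>S" using prod.subset_diff[of S U "%x. x"] S Py_prod(1)[OF sub] by simp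
   have "\<Prod>S <= \<Prod>U" using Py_prod(3)[OF s(2)] unfolding US by simp
   hence "g S = ?L - ln (rP S)" using U by (simp add: g_def)
   moreover have "S Un (U - S) = U" using S by auto
   ultimately show "c S * g S * (Yd y p1 (S Un (U - S)) / rP (U - S)) = 1 / rP U * (7 ^ card S * (?L - ln (rP S)))"
    unfolding US using Y1 by (simp add: c_def mult_ac del: of_nat_prod)
  qed
  also have "... = 8 ^ card U / rP U * (?L - 7 / 8 * ln (rP U))"
   unfolding sum_distrib_left[symmetric]
   by (subst weighted_log_sum) (use Py_prod(1,2)[OF sub] prime_gt_0_nat in \<open>auto simp del: of_nat_prod\<close>)
  finally show "8 ^ card U / rP U * (?L - 7 / 8 * ln (rP U)) = (SUM S:Pow U. c S * g S * (Yd y p1 (S Un (U - S)) / rP (U - S)))" by simp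
 qed
 also have "... <= (SUM U:Pow ?P. SUM S:Pow U. c S * g S * (Yd y p1 (S Un (U - S)) / rP (U - S)))"
 proof (rule sum_mono2)
  fix U assume "U : Pow ?P - {U:Pow ?P. y ^ (96 - i) < \<Prod>U & \<Prod>U <= y ^ 96}"
  thus "0 <= (SUM S:Pow U. c S * g S * (Yd y p1 (S Un (U - S)) / rP (U - S)))"
   by (intro sum_nonneg mult_nonneg_nonneg divide_nonneg_nonneg of_nat_0_le_iff c0 g0 Yd0) auto
 qed auto
 also have "... = (SUM S:Pow ?P. SUM T:Pow (?P - S). c S * g S * (Yd y p1 (S Un T) / rP T))"
  by (rule sum_Pow_subset_swap) simp
 also have "... <= (SUM S:Pow ?P. c S * g S * Ysum ?P (Yd y p1) S)"
  unfolding sum_distrib_left[symmetric] by (intro sum_mono mult_left_mono Ysum mult_nonneg_nonneg c0 g0) auto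
 finally have "(Nn y i p1)\<^sup>2 <= (SUM S:Pow ?P. c S * g S * Ysum ?P (Yd y p1) S)\<^sup>2" by (rule power_mono[OF _ Nn0])
 also have "... <= (SUM S:Pow ?P. c S * (Ysum ?P (Yd y p1) S)\<^sup>2) * (SUM S:Pow ?P. c S * (g S)\<^sup>2)"
  by (rule sum_square_le_of_prod) (use c0 g0[OF subset_trans[OF PowD Diff_subset]] Y0 in \<open>auto simp: power_mult_distrib power2_eq_square mult_ac intro!: mult_nonneg_nonneg\<close>)
 also have "... <= Cd y p1 {} * Bz 7 2 (real y ^ 96)"
 proof (rule mult_mono)
  show "(SUM S:Pow ?P. c S * (Ysum ?P (Yd y p1) S)\<^sup>2) <= Cd y p1 {}"
   unfolding Cd_def
  proof (subst Cc_empty)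
   show "(SUM S:Pow ?P. c S * (Ysum ?P (Yd y p1) S)\<^sup>2) <= (SUM S:Pow ?P. (prod coefS S) * (Ysum ?P (Yd y p1) S)\<^sup>2)"
   proof (intro sum_mono mult_right_mono)
    fix S assume "S : Pow ?P"
    hence "(PROD p:S. 7 / real p) <= (prod coefS S)" using coefS(2) Py_ge_16 by (intro prod_mono) auto
    thus "c S <= (prod coefS S)" by (simp add: c_def prod_dividef)
   qed simp
  qed (use Py_ge_16 in auto)
  have "(SUM S:Pow ?P. c S * (g S)\<^sup>2) <= (SUM S:Pow (Py y). c S * (g S)\<^sup>2)"
   using c0 by (intro sum_mono2) auto
  also have "... = Vs 7 2 (Py y) (real y ^ 96)" unfolding Vs_eq by (intro sum.cong) (auto simp: c_def g_def simp del: of_nat_prod)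
  also have "... <= Bz 7 2 (real y ^ 96)" using PyD by (intro Vs_le_Bz) auto
  finally show "(SUM S:Pow ?P. c S * (g S)\<^sup>2) <= Bz 7 2 (real y ^ 96)" .
 qed (use c0 Cd_empty_nonneg in \<open>auto intro!: sum_nonneg\<close>)
 finally show ?thesis .
qed

lemma Vs_ge:
 shows "Vs 8 j (Py y) (real y ^ 96) >= (1 - 1 / 10 ^ 90) * Bz 8 j (real y ^ 96)"
proof -
 have "Bz 8 j (real y ^ 96) <= Vs 8 j (Py y) (real y ^ 96) + real (8\<^sup>2) / D0 * Bz 8 j (real y ^ 96)"
 proof (rule Bz_le_Vs)
  fix p assume "prime p" "D0 < p" "real p <= real y ^ 96"
  thus "p : Py y" by (simp add: Py_def flip: of_nat_power)
 qed (use PyD in auto)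
 also have "real (8\<^sup>2) / D0 * Bz 8 j (real y ^ 96) <= 1 / 10 ^ 90 * Bz 8 j (real y ^ 96)"
 proof (rule mult_right_mono[OF _ Bz_nonneg])
  have "real D0 >= real (10 ^ 100)" using D0_large by (simp only: of_nat_le_iff)
  hence "real (8\<^sup>2) / D0 <= 64 / 10 ^ 100" by (intro frac_le) auto
  thus "real (8\<^sup>2) / D0 <= 1 / 10 ^ 90" by simp
 qed
 finally show ?thesis by (simp only: left_diff_distrib mult_1) simp
qed

text \<open>With \<open>L = ln (y ^ 96)\<close> the summand is written as
  \<open>L + 7 * (L - ln (\<Prod>U))\<close>, so that the sums at the levels \<open>y ^ 96\<close>
  and \<open>y ^ (96 - i)\<close> are combinations of \<open>Bz 8 0\<close> and
  \<open>Bz 8 1\<close>. Omitting the prime \<open>p1\<close> costs a further term smaller by a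
  factor \<open>1 / y\<close>.\<close>

lemma Nn_ge:
 assumes p1: "p1 : cell y i" and i: "i >= 1" and y: "y >= 2"
 shows "8 * Nn y i p1 >= (1 - 1 / 10 ^ 90) * (96 * ln y * Bz 8 0 (real y ^ 96) + 7 * Bz 8 1 (real y ^ 96)) - 6144 * ln y / y * Bz 8 0 (real y ^ 96)
  - ((96 + 7 * real (96 - (96 - i))) * ln y * Bz 8 0 (real y ^ (96 - i)) + 7 * Bz 8 1 (real y ^ (96 - i)))"
proof -
 let ?P = "Py y - {p1}" and ?L = "ln (real y ^ 96)" and ?a = "96 - i"
 have l: "ln (real y) > 0" using y by simp
 have L: "?L = 96 * ln y" using ln_realpow[of y 96] by simp
 have pr: "p1 > y" "p1 > 0"
 proof -
  have "y ^ i < p1" using p1 by (simp add: cell_def)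
  moreover have "y <= y ^ i" using y i by (intro self_le_power) auto
  ultimately show "p1 > y" "p1 > 0" by auto
 qed
 define w where "w U = (8::real) ^ card U / rP U" for U :: "nat set"
 define f where "f U = w U * (?L + 7 * (?L - ln (rP U)))" for U
 have w0: "0 <= w U" for U unfolding w_def by (intro divide_nonneg_nonneg of_nat_0_le_iff) simp
 define S where "S P n = (SUM U:Pow P. if \<Prod>U <= y ^ n then f U else 0)" for P n
 have f0: "0 <= f U" if "U \<subseteq> Py y" "\<Prod>U <= y ^ 96" for U
  using ln_prod_bounds[OF that] w0[of U] by (simp add: f_def del: of_nat_prod)
 have ya: "y ^ ?a <= y ^ 96" using y by (intro power_increasing) auto
 have "8 * Nn y i p1 = (SUM U:{U:Pow ?P. y ^ ?a < \<Prod>U & \<Prod>U <= y ^ 96}. f U)"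
  unfolding Nn_def sum_distrib_left by (intro sum.cong refl) (simp add: f_def w_def algebra_simps del: of_nat_prod)
 also have "... = (SUM U:Pow ?P. (if \<Prod>U <= y ^ 96 then f U else 0) - (if \<Prod>U <= y ^ ?a then f U else 0))"
  by (rule sum.mono_neutral_cong_left) (use ya in auto)
 also have "... = S ?P 96 - S ?P ?a" by (simp add: S_def sum_subtractf)
 finally have Nn: "8 * Nn y i p1 = S ?P 96 - S ?P ?a" .
 have "S ?P ?a <= S (Py y) ?a" unfolding S_def using f0 ya by (intro sum_mono2) auto
 also have "... = (?L + 7 * (?L - ln (real y ^ ?a))) * Vs 8 0 (Py y) (real y ^ ?a) + 7 * Vs 8 1 (Py y) (real y ^ ?a)"
  unfolding S_def Vs_eq sum_distrib_left sum.distrib[symmetric]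
  by (intro sum.cong refl) (simp add: f_def w_def algebra_simps add_divide_distrib diff_divide_distrib del: of_nat_prod)
 also have "... <= (?L + 7 * (?L - ln (real y ^ ?a))) * Bz 8 0 (real y ^ ?a) + 7 * Bz 8 1 (real y ^ ?a)"
 proof (intro add_mono mult_left_mono Vs_le_Bz)
  have "real ?a * ln (real y) <= 96 * ln (real y)" using l by (intro mult_right_mono) auto
  thus "0 <= ?L + 7 * (?L - ln (real y ^ ?a))" using l unfolding ln_realpow by (simp add: L)
 qed (use PyD in auto)
 also have "?L + 7 * (?L - ln (real y ^ ?a)) = (96 + 7 * real (96 - ?a)) * ln y"
  unfolding ln_realpow by (simp add: of_nat_diff algebra_simps)
 finally have 1: "S ?P ?a <= (96 + 7 * real (96 - ?a)) * ln y * Bz 8 0 (real y ^ ?a) + 7 * Bz 8 1 (real y ^ ?a)" .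
 have "S (Py y) 96 = ?L * Vs 8 0 (Py y) (real y ^ 96) + 7 * Vs 8 1 (Py y) (real y ^ 96)"
  unfolding S_def Vs_eq sum_distrib_left sum.distrib[symmetric]
  by (intro sum.cong refl) (simp add: f_def w_def algebra_simps del: of_nat_prod)
 moreover have "?L * Vs 8 0 (Py y) (real y ^ 96) >= ?L * ((1 - 1 / 10 ^ 90) * Bz 8 0 (real y ^ 96))"
  using l by (intro mult_left_mono Vs_ge) (simp add: L)
 moreover have "7 * Vs 8 1 (Py y) (real y ^ 96) >= 7 * ((1 - 1 / 10 ^ 90) * Bz 8 1 (real y ^ 96))"
  by (intro mult_left_mono Vs_ge) simp
 ultimately have 2: "S (Py y) 96 >= (1 - 1 / 10 ^ 90) * (96 * ln y * Bz 8 0 (real y ^ 96) + 7 * Bz 8 1 (real y ^ 96))"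
  unfolding L by (simp only: distrib_left mult_ac)
 \<comment> \<open>Adding \<open>p1\<close> to \<open>U\<close> multiplies the weight by
   \<open>8 / p1\<close>, and the remaining factor is at most \<open>8 * 96 * ln y\<close>; hence
   \<open>8 * 8 * 96 = 6144\<close>.\<close>
 have 3: "S (Py y) 96 <= S ?P 96 + 6144 * ln y / y * Bz 8 0 (real y ^ 96)"
 proof (cases "p1 : Py y")
  case False
  thus ?thesis using l Bz_nonneg[of 8 0 "real y ^ 96"] by (simp add: mult_nonneg_nonneg del: Bz.simps)
 next
  case True
  hence P1: "{p1} \<subseteq> Py y" by simp
  have "Pow {p1} = {{}, {p1}}" by auto
  hence "S (Py y) 96 = S ?P 96 + (SUM U:Pow ?P. if \<Prod>(insert p1 U) <= y ^ 96 then f (insert p1 U) else 0)"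
   unfolding S_def sum_Pow_split[OF P1 finite_Py] by (simp cong: if_cong)
  also have "(SUM U:Pow ?P. if \<Prod>(insert p1 U) <= y ^ 96 then f (insert p1 U) else 0) <= (SUM U:Pow ?P. 64 * ?L / y * (if \<Prod>U <= y ^ 96 then w U else 0))"
  proof (rule sum_mono)
   fix U assume U: "U : Pow ?P"
   have sub: "insert p1 U \<subseteq> Py y" using U True by auto
   have ins: "\<Prod>(insert p1 U) = p1 * \<Prod>U" "card (insert p1 U) = Suc (card U)"         using U Py_prod(1)[OF subset_trans[OF PowD[OF U] Diff_subset]] by (subst prod.insert card_insert_disjoint, auto)+
   show "(if \<Prod>(insert p1 U) <= y ^ 96 then f (insert p1 U) else 0) <= 64 * ?L / y * (if \<Prod>U <= y ^ 96 then w U else 0)"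
   proof (cases "\<Prod>(insert p1 U) <= y ^ 96")
    case True
    have "1 * \<Prod>U <= p1 * \<Prod>U" using pr by (intro mult_right_mono) auto
    hence U96: "\<Prod>U <= y ^ 96" using True unfolding ins by linarith
    have "f (insert p1 U) <= w (insert p1 U) * (8 * ?L)"
    proof -
     have "M + 7 * (M - x) <= 8 * M" if "0 <= x" for x M :: real using that by simp
     from this[OF ln_prod_bounds(1)[OF sub True]] show ?thesis unfolding f_def by (rule mult_left_mono[OF _ w0])
    qed
    also have "w (insert p1 U) = 8 / p1 * w U" unfolding w_def ins by simp
    also have "8 / p1 * w U * (8 * ?L) = 64 * ?L * w U * (1 / p1)" by simp
    also have "... <= 64 * ?L * w U * (1 / y)"
     using pr y l w0 by (intro mult_left_mono divide_left_mono) (auto simp: L)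
    finally show ?thesis using True U96 by (simp add: mult_ac)
   next
    case False
    thus ?thesis using w0 l by (simp add: L)
   qed
  qed
  also have "... <= 64 * ?L / y * Bz 8 0 (real y ^ 96)"
   unfolding sum_distrib_left[symmetric]
  proof (rule mult_left_mono)
   have "(SUM U:Pow ?P. if \<Prod>U <= y ^ 96 then w U else 0) <= (SUM U:Pow (Py y). if \<Prod>U <= y ^ 96 then w U else 0)"
    using w0 by (intro sum_mono2) auto
   also have "... = Vs 8 0 (Py y) (real y ^ 96)" unfolding Vs_eq by (intro sum.cong) (auto simp: w_def simp del: of_nat_prod)
   also have "... <= Bz 8 0 (real y ^ 96)" using PyD by (intro Vs_le_Bz) auto
   finally show "(SUM U:Pow ?P. if \<Prod>U <= y ^ 96 then w U else 0) <= Bz 8 0 (real y ^ 96)" .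
  qed (use l in \<open>simp add: L\<close>)
  also have "64 * ?L / y * Bz 8 0 (real y ^ 96) = 6144 * ln y / y * Bz 8 0 (real y ^ 96)" by (simp add: L)
  finally show ?thesis by simp
 qed
 show ?thesis using Nn 1 2 3 by linarith
qed

text \<open>\<open>NN i / (16 * 96 ^ 9)\<close> is \<open>1 - (1 - x) ^ 8 * (1 + 7 * x / 2)\<close> at \<open>x = min 1 (i / 96)\<close>; the truncated
 subtraction takes care of \<open>i > 96\<close>.\<close>

definition NN :: "nat => real" where
 "NN i = 16 * 96 ^ 9 - (real (96 - i)) ^ 8 * (6912 - 56 * real (96 - i))"

text \<open>The square of the bound for \<open>8 * Nn\<close> is divided by
  \<open>64 * Bz 7 2\<close>: eighteen logarithms against nine. The factor 128 is 64 times the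
  \<open>fact 2\<close> in the asymptotics of \<open>Bz 7 2\<close>, and the \<open>- 1\<close>
  after \<open>NN i\<close> absorbs the relative loss \<open>1 / 10 ^ 90\<close> from
  \<open>Vs_ge\<close>.\<close>

lemma Cd_lower:
 assumes i: "i >= 1"
 shows "EX C k. (\<forall>\<^sub>F y in sequentially. C y >= 0 & (ALL p1:cell y i. C y <= Cd y p1 {})) &
  ((%y. C y / ln (real y) ^ 9) \<longlongrightarrow> k) sequentially & k >= cW ^ 9 * (max 0 (NN i - 1))\<^sup>2 / (128 * fact 9 * 96 ^ 9)"
proof -
 let ?z1 = "128 * fact 9 * 96 ^ 9"
 let ?z2 = "fact 2 / fact (Suc 6 + 2)"
 let ?z3 = "cW ^ Suc 7 * (fact 0 / fact (Suc 7 + 0)) * real 96 ^ (Suc 7 + 0)"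
 let ?a = "96 - i"
 let ?l = "%y. ln (real y)"
 let ?b = "%k j a y. Bz (Suc k) j (real y ^ a) / ?l y ^ (Suc k + j)"
 define H where "H y = (1 - 1 / 10 ^ 90) * (96 * ?l y * Bz 8 0 (real y ^ 96) + 7 * Bz 8 1 (real y ^ 96)) - 6144 * ?l y / y * Bz 8 0 (real y ^ 96)
  - ((96 + 7 * real (96 - ?a)) * ?l y * Bz 8 0 (real y ^ ?a) + 7 * Bz 8 1 (real y ^ ?a))" for y :: nat
 \<comment> \<open>After multiplication by \<open>fact 9\<close> the sums at level 96 give
   \<open>(9 + 7) * 96 ^ 9\<close>, and those at level \<open>a = 96 - i\<close> give
   \<open>a ^ 8 * (9 * (768 - 7 * a) + 7 * a)\<close>, which is
   \<open>a ^ 8 * (6912 - 56 * a)\<close>.\<close>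
 define m where "m = (1 - 1 / 10 ^ 90) * (16 * 96 ^ 9) - (real ?a) ^ 8 * (6912 - 56 * real ?a)"
 have H: "((%y. H y / ?l y ^ 9) \<longlongrightarrow> cW ^ 8 / fact 9 * m) sequentially"
 proof (rule Lim_transform_eventually)
  have z: "((%y. 6144 / real y) \<longlongrightarrow> 0) sequentially" by real_asymp
  have p9: "real ?a ^ 9 = real ?a * real ?a ^ 8" using power_Suc[of "real ?a" 8] by simp
  have "real (96 - ?a) = 96 - real ?a" by (simp add: of_nat_diff)
  hence "cW ^ 8 / fact 9 * m = (1 - 1 / 10 ^ 90) * (96 * ?z3 + 7 * (cW ^ Suc 7 * (fact 1 / fact (Suc 7 + 1)) * real 96 ^ (Suc 7 + 1)))
   - 0 * ?z3
   - ((96 + 7 * real (96 - ?a)) * (cW ^ Suc 7 * (fact 0 / fact (Suc 7 + 0)) * real ?a ^ (Suc 7 + 0)) + 7 * (cW ^ Suc 7 * (fact 1 / fact (Suc 7 + 1)) * real ?a ^ (Suc 7 + 1)))"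
   using p9 by (simp add: m_def fact_numeral field_simps)
  thus "((%y. (1 - 1 / 10 ^ 90) * (96 * ?b 7 0 96 y + 7 * ?b 7 1 96 y) - 6144 / real y * ?b 7 0 96 y
   - ((96 + 7 * real (96 - ?a)) * ?b 7 0 ?a y + 7 * ?b 7 1 ?a y)) \<longlongrightarrow> cW ^ 8 / fact 9 * m) sequentially"
   by (simp only:) (intro tendsto_intros Bz_tendsto z)
  show "\<forall>\<^sub>F y in sequentially. (1 - 1 / 10 ^ 90) * (96 * ?b 7 0 96 y + 7 * ?b 7 1 96 y) - 6144 / real y * ?b 7 0 96 y
   - ((96 + 7 * real (96 - ?a)) * ?b 7 0 ?a y + 7 * ?b 7 1 ?a y) = H y / ?l y ^ 9"
  proof (rule eventually_sequentiallyI[of 2])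
   fix y :: nat assume "y >= 2"
   hence l: "?l y > 0" by simp
   have e: "x / ?l y ^ (Suc 7 + 0) = x * ?l y / ?l y ^ 9" for x using l by (simp add: power_numeral_reduce)
   have n: "Suc 7 = 8" "(8::nat) + 1 = 9" by simp_all
   show "(1 - 1 / 10 ^ 90) * (96 * ?b 7 0 96 y + 7 * ?b 7 1 96 y) - 6144 / real y * ?b 7 0 96 y
    - ((96 + 7 * real (96 - ?a)) * ?b 7 0 ?a y + 7 * ?b 7 1 ?a y) = H y / ?l y ^ 9"
    unfolding H_def e unfolding n diff_divide_distrib add_divide_distrib by (simp add: add_divide_distrib mult_ac del: Bz.simps)
  qed
 qed
 \<comment> \<open>The lower bound \<open>H\<close> may be negative, hence the maximum with 0 before
   squaring.\<close>
 define C where "C y = (max 0 (H y / 8))\<^sup>2 / Bz 7 2 (real y ^ 96)" for y :: nat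
 have B: "((%y. Bz (Suc 6) 2 (real y ^ 96) / ?l y ^ (Suc 6 + 2)) \<longlongrightarrow> cW ^ Suc 6 * ?z2 * real 96 ^ (Suc 6 + 2)) sequentially"
  by (rule Bz_tendsto)
 have Bpos: "cW ^ Suc 6 * ?z2 * real 96 ^ (Suc 6 + 2) > 0" using cW_pos by simp
 have B0: "\<forall>\<^sub>F y in sequentially. Bz 7 2 (real y ^ 96) > 0"
  using order_tendstoD(1)[OF B Bpos] eventually_ge_at_top[of 2]
 proof eventually_elim
  case (elim y)
  hence "?l y ^ (Suc 6 + 2) > 0" by simp
  thus ?case using elim(1) by (simp only: zero_less_divide_iff) simp
 qed
 have "\<forall>\<^sub>F y in sequentially. C y >= 0 & (ALL p1:cell y i. C y <= Cd y p1 {})"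
  using B0 eventually_ge_at_top[of 2]
 proof eventually_elim
  case (elim y)
  have "C y <= Cd y p1 {}" if p1: "p1 : cell y i" for p1
  proof -
   have "(max 0 (H y / 8))\<^sup>2 <= (max 0 (Nn y i p1))\<^sup>2" using Nn_ge[OF p1 i elim(2)] unfolding H_def by (intro power_mono) auto
   also have "... <= (Nn y i p1)\<^sup>2" by (simp add: max_def)
   also have "... <= Cd y p1 {} * Bz 7 2 (real y ^ 96)" using elim by (intro Cd_ge[OF p1]) simp
   finally show ?thesis unfolding C_def using elim by (simp only: pos_divide_le_eq)
  qed
  moreover have "C y >= 0" unfolding C_def using elim by (intro divide_nonneg_pos) auto
  ultimately show ?case by blast
 qed
 moreover have "((%y. C y / ?l y ^ 9) \<longlongrightarrow> cW ^ 9 * (max 0 m)\<^sup>2 / ?z1) sequentially"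
 proof (rule Lim_transform_eventually)
  have "(max 0 (cW ^ 8 / fact 9 * m / 8))\<^sup>2 / (cW ^ Suc 6 * ?z2 * real 96 ^ (Suc 6 + 2)) = cW ^ 9 * (max 0 m)\<^sup>2 / ?z1"
  proof -
   have "max 0 (cW ^ 8 / fact 9 * m / 8) = cW ^ 8 / fact 9 / 8 * max 0 m"
   proof -
    have "max 0 (k * m) = k * max 0 m" if "k > 0" for k :: real using that by (cases "0 <= m") (auto simp: max_def zero_le_mult_iff)
    from this[of "cW ^ 8 / fact 9 / 8"] show ?thesis using cW_pos by simp
   qed
   hence "(max 0 (cW ^ 8 / fact 9 * m / 8))\<^sup>2 = (cW ^ 8)\<^sup>2 / (fact 9)\<^sup>2 / 64 * (max 0 m)\<^sup>2"
    by (simp only:) (simp add: power_mult_distrib power_divide)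
   also have "(cW ^ 8)\<^sup>2 = cW ^ 7 * cW ^ 9" by (simp flip: power_mult power_add)
   finally have sq: "(max 0 (cW ^ 8 / fact 9 * m / 8))\<^sup>2 = cW ^ 7 * cW ^ 9 / (fact 9)\<^sup>2 / 64 * (max 0 m)\<^sup>2" .
   define k where "k = cW ^ 7"
   have "cW ^ Suc 6 = k" "k ~= 0" using cW_pos by (simp_all add: k_def)
   thus ?thesis unfolding sq k_def[symmetric] by (simp add: fact_numeral)
  qed
  moreover have "((%y. (max 0 (H y / ?l y ^ 9 / 8))\<^sup>2 / (Bz (Suc 6) 2 (real y ^ 96) / ?l y ^ (Suc 6 + 2))) \<longlongrightarrow> (max 0 (cW ^ 8 / fact 9 * m / 8))\<^sup>2 / (cW ^ Suc 6 * ?z2 * real 96 ^ (Suc 6 + 2))) sequentially"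
   using Bpos by (intro tendsto_intros H B) auto
  ultimately show "((%y. (max 0 (H y / ?l y ^ 9 / 8))\<^sup>2 / (Bz (Suc 6) 2 (real y ^ 96) / ?l y ^ (Suc 6 + 2))) \<longlongrightarrow> cW ^ 9 * (max 0 m)\<^sup>2 / ?z1) sequentially" by simp
  show "\<forall>\<^sub>F y in sequentially. (max 0 (H y / ?l y ^ 9 / 8))\<^sup>2 / (Bz (Suc 6) 2 (real y ^ 96) / ?l y ^ (Suc 6 + 2)) = C y / ?l y ^ 9"
   using eventually_ge_at_top[of 2]
  proof eventually_elim
   case (elim y)
   hence l: "?l y > 0" by simp
   define d where "d = ?l y ^ 9"
   have d: "d > 0" "?l y ^ (Suc 6 + 2) = d" using l by (simp_all add: d_def)
   have "max 0 (H y / d / 8) = max 0 (H y / 8) / d" using d by (auto simp: max_def divide_le_0_iff zero_le_divide_iff)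
   thus ?case unfolding C_def d(2) d_def[symmetric] using d(1) by (simp add: power2_eq_square del: Bz.simps)
  qed
 qed
 moreover have "cW ^ 9 * (max 0 (NN i - 1))\<^sup>2 / ?z1 <= cW ^ 9 * (max 0 m)\<^sup>2 / ?z1"
 proof (intro divide_right_mono mult_left_mono power_mono)
  show "max 0 (NN i - 1) <= max 0 m" by (simp add: m_def NN_def)
 qed (use cW_pos in auto)
 ultimately show ?thesis by blast
qed

end

section \<open>The numerical inequality behind the comparison\<close>

definition NNi :: "int => int" where
 "NNi i = 16 * 96 ^ 9 - (if i < 96 then (96 - i) ^ 8 * (6912 - 56 * (96 - i)) else 0) - 1"

text \<open>\<open>NNi i\<close> is \<open>NN i - 1\<close> as an integer and every term is rounded
  down, so the inequality is decided by exact arithmetic. For each \<open>i\<close> the 29 cells of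
  the larger prime are replaced by \<open>29 / (415 - i)\<close>. After removal of the common
  factors 4600 stands for \<open>8 * 4600 / (128 * 9)\<close>, about 31.94, against the 31.31 of the
  plain sum.\<close>

lemma NNi_numeric:
 "(\<Sum>i\<leftarrow>[15..199]. (NNi i)\<^sup>2 * 29 div ((i + 1) * (415 - i))) > 4600 * 96 ^ 17 & (ALL i:set [15..199]. NNi i >= 0)"
 by code_simp

lemma sum_over_Sigma:
 assumes "finite A" "!!x. x : A ==> finite (B x)"
 shows "sum f (Sigma A B) = (SUM x:A. SUM y:B x. f (x, y))"
 using assms by (subst sum.Sigma) auto

text \<open>Convexity: the 29 reciprocals are bounded below by the tangent at their midpoint
  \<open>415 - i\<close>, and the linear parts cancel.\<close>

lemma reciprocal_block_ge:
 assumes "i < 200"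
 shows "29 / (415 - real i) <= (SUM k<29. 1 / real (Suc (400 - i + k)))"
proof -
 let ?m = "415 - real i"
 have m: "?m > 0" using assms by simp
 have "1 / ?m + (14 - real k) / ?m\<^sup>2 <= 1 / real (Suc (400 - i + k))" for k
 proof -
  define x where "x = real (Suc (400 - i + k))"
  have x: "x = ?m - (14 - real k)" "x > 0" using assms by (simp_all add: x_def of_nat_diff)
  have "0 <= (14 - real k)\<^sup>2" by simp
  hence "(?m + (14 - real k)) * x <= ?m\<^sup>2" unfolding x(1) by (simp add: power2_eq_square algebra_simps)
  hence "(?m + (14 - real k)) / ?m\<^sup>2 <= 1 / x" using m x(2) by (simp add: field_simps)
  moreover have "1 / m + c / m\<^sup>2 = (m + c) / m\<^sup>2" if "m > 0" for m c :: real using that by (simp add: field_simps power2_eq_square)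
  ultimately show ?thesis using m by (simp only: x_def)
 qed
 hence "(SUM k<29. 1 / ?m + (14 - real k) / ?m\<^sup>2) <= (SUM k<29. 1 / real (Suc (400 - i + k)))" by (rule sum_mono)
 also have "(SUM k<29. 1 / ?m + (14 - real k) / ?m\<^sup>2) = 29 / ?m + (SUM k<29. 14 - real k) / ?m\<^sup>2"
  by (simp only: sum.distrib sum_divide_distrib[symmetric]) simp
 also have "(SUM k<29. 14 - real k) = 0" by (simp add: lessThan_nat_numeral lessThan_Suc)
 finally show ?thesis by simp
qed

text \<open>Admissibility of the tuple. Eight shifts cannot cover the classes of a prime that is at
  least 11; for 2, 3, 5 and 7 a free class is exhibited.\<close>

lemma residues_avoidable:
 fixes q :: nat
 assumes q: "prime q"
 shows "EX r. ALL h:Hs. ~ q dvd r + h"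
proof (cases "q < 11")
 case True
 have "prime (3::nat)" by simp
 hence "2 dvd q --> q = 2" "3 dvd q --> q = 3" using q primes_dvd_imp_eq two_is_prime_nat by metis+
 hence "q = 2 | q = 3 | q = 5 | q = 7" using prime_ge_2_nat[OF q] True by presburger
 thus ?thesis
  by (elim disjE; intro exI[of _ "if q = 2 then 1 else if q = 3 then 2 else if q = 5 then 1 else (4::nat)"]) (auto simp: Hs_def dest: dvd_imp_le)
next
 case False
 have "card ((%h. (h * (q - 1)) mod q) ` Hs) <= 8" using card_image_le[OF Hs(1), of "%h. (h * (q - 1)) mod q"] Hs(2) by simp
 hence "~ {..<q} \<subseteq> (%h. (h * (q - 1)) mod q) ` Hs" using card_mono[of "(%h. (h * (q - 1)) mod q) ` Hs" "{..<q}"] Hs(1) False by auto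
 then obtain r where r: "r < q" "r ~: (%h. (h * (q - 1)) mod q) ` Hs" by auto
 have "~ q dvd r + h" if h: "h : Hs" for h
 proof
  assume d: "q dvd r + h"
  have q0: "q > 0" using prime_gt_0_nat[OF q] .
  have "h * (q - 1) + h = h * q" using q0 by (cases q) auto
  hence "[h * (q - 1) + h = 0] (mod q)" by (simp add: cong_0_iff)
  moreover have "[0 = r + h] (mod q)" by (rule cong_sym) (use d in \<open>simp add: cong_0_iff\<close>)
  ultimately have "[h * (q - 1) + h = r + h] (mod q)" by (rule cong_trans)
  hence "[h * (q - 1) = r] (mod q)" by (simp only: cong_add_rcancel_nat)
  hence "r = h * (q - 1) mod q" using r(1) by (simp add: Cong.cong_def)
  thus False using r(2) h by auto
 qed
 thus ?thesis by blast
qed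

section \<open>Assembling all shifts and cells\<close>

context bigsieve
begin

lemma admissible_residue: "EX v. ALL h:Hs. cop (v + h)"
proof -
 define ok where "ok q r \<longleftrightarrow> (prime q --> (ALL h:Hs. ~ q dvd r + h))" for q r :: nat
 have "EX r. ok q r" for q using residues_avoidable[of q] unfolding ok_def by blast
 then obtain u where u: "ALL q. ok q (u q)" using choice[of ok] by blast
 have "EX v. ALL q:W0. [v = u q] (mod q)"
  by (rule chinese_remainder_nat) (auto simp: primes_coprime prime_W0)
 then obtain v where v: "ALL q:W0. [v = u q] (mod q)" by blast
 have "cop (v + h)" if "h : Hs" for h
  unfolding cop_def
 proof (intro ballI notI)
  fix q assume q: "q : W0" "q dvd v + h"
  have "[v + h = u q + h] (mod q)" using v q(1) by (simp add: cong_add_rcancel_nat)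
  hence "q dvd u q + h" using q(2) cong_dvd_iff by blast
  thus False using u prime_W0[OF q(1)] that unfolding ok_def by blast
 qed
 thus ?thesis by blast
qed

text \<open>The asymptotic lower bound, in units of \<open>ln y ^ 9\<close>, for one shift and one
  pair of cells: the constant of \<open>Cd_lower\<close> times the limits of the
  \<open>betaw\<close> sums over the first cell and over one class of the second.\<close>

definition tau :: "nat => nat => real" where
 "tau i j = cW ^ 9 * (max 0 (NN i - 1))\<^sup>2 / (128 * fact 9 * 96 ^ 9) / (real (Suc i) * (real (Suc j) * phiW))"

text \<open>The gap between \<open>\<theta>\<close> and \<open>tau i j\<close> leaves room for an
  \<open>\<epsilon>\<close> that covers both losses of \<open>cell_lower_bound\<close>, the one in
  the class sums and the multiple of \<open>My\<close>.\<close>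

lemma S2c_lower:
 assumes h: "h : Hs" and v: "cop (v + h)" and i: "15 <= i" and j: "201 <= j" and ij: "400 <= i + j" and \<theta>: "\<theta> < tau i j"
 shows "\<forall>\<^sub>F y in sequentially. \<theta> * ln (real y) ^ 9 <= S2c v h i j y"
proof -
 obtain C k where C: "\<forall>\<^sub>F y in sequentially. C y >= 0 & (ALL p1:cell y i. C y <= Cd y p1 {})"
   "((%y. C y / ln (real y) ^ 9) \<longlongrightarrow> k) sequentially" "k >= cW ^ 9 * (max 0 (NN i - 1))\<^sup>2 / (128 * fact 9 * 96 ^ 9)"
  using Cd_lower[of i] i by auto
 obtain Cm where Cm: "\<forall>\<^sub>F y in sequentially. My y <= Cm * ln (real y) ^ 9" using My_bounded by blast
 let ?\<kappa> = "1 / (real (Suc j) * phiW)" and ?s = "1 / real (Suc i)"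
 have \<kappa>: "?\<kappa> > 0" using phiW_pos by simp
 define s where "s y = (SUM p:cell y i. betaw y i p)" for y
 have s: "(s \<longlongrightarrow> ?s) sequentially" using betaw_class_tendsto[of "{}" 1 i] by (simp add: s_def[abs_def])
 have "\<theta> < ?\<kappa> * ?s * k"
 proof -
  have "tau i j = cW ^ 9 * (max 0 (NN i - 1))\<^sup>2 / (128 * fact 9 * 96 ^ 9) * (?\<kappa> * ?s)" by (simp add: tau_def)
  also have "... <= k * (?\<kappa> * ?s)" using \<kappa> by (intro mult_right_mono C(3)) simp
  finally show ?thesis using \<theta> by (simp add: mult_ac)
 qed
 moreover have "((%\<epsilon>. (?\<kappa> - \<epsilon>) * ?s * k - \<epsilon> * Cm) \<longlongrightarrow> (?\<kappa> - 0) * ?s * k - 0 * Cm) (at_right 0)" by (intro tendsto_intros)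
 ultimately have "\<forall>\<^sub>F \<epsilon> in at_right 0. \<theta> < (?\<kappa> - \<epsilon>) * ?s * k - \<epsilon> * Cm" by (intro order_tendstoD(1)) auto
 hence "\<forall>\<^sub>F \<epsilon> in at_right 0. \<theta> < (?\<kappa> - \<epsilon>) * ?s * k - \<epsilon> * Cm & \<epsilon> > 0 & \<epsilon> < ?\<kappa>"
  by (intro eventually_conj eventually_at_right_less order_tendstoD(2)[OF tendsto_ident_at \<kappa>])
 then obtain \<epsilon> where \<epsilon>: "\<theta> < (?\<kappa> - \<epsilon>) * ?s * k - \<epsilon> * Cm" "\<epsilon> > 0" "\<epsilon> < ?\<kappa>"
  using eventually_happens[of _ "at_right (0::real)"] by fastforce
 have "((%y. (?\<kappa> - \<epsilon>) * s y * (C y / ln (real y) ^ 9) - \<epsilon> * Cm) \<longlongrightarrow> (?\<kappa> - \<epsilon>) * ?s * k - \<epsilon> * Cm) sequentially"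
  by (intro tendsto_intros s C(2))
 from order_tendstoD(1)[OF this \<epsilon>(1)] C(1) Cm cell_lower_bound[OF h v i j ij \<epsilon>(2)] eventually_ge_at_top[of 3]
 show ?thesis
 proof eventually_elim
  case (elim y)
  have l: "ln (real y) ^ 9 > 0" using elim by simp
  have sle: "s y <= (SUM p1:cell y i. 1 / real p1)"
   unfolding s_def by (intro sum_mono order.trans[OF abs_ge_self betaw_le]) (use elim in auto)
  have "\<theta> * ln (real y) ^ 9 <= ((?\<kappa> - \<epsilon>) * s y * (C y / ln (real y) ^ 9) - \<epsilon> * Cm) * ln (real y) ^ 9"
   using elim(1) l by (intro mult_right_mono) auto
  also have "... = (?\<kappa> - \<epsilon>) * s y * C y - \<epsilon> * (Cm * ln (real y) ^ 9)"
  proof -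
   have "(K * (c / d) - e * f) * d = K * c - e * (f * d)" if "d > 0" for K c d e f :: real using that by (simp add: left_diff_distrib)
   from this[OF l] show ?thesis .
  qed
  also have "... <= (?\<kappa> - \<epsilon>) * (SUM p1:cell y i. 1 / real p1) * C y - \<epsilon> * My y"
   using sle elim \<epsilon> by (intro diff_mono mult_right_mono mult_left_mono) auto
  also have "... <= S2c v h i j y" using elim by blast
  finally show ?case .
 qed
qed

text \<open>The exponent 399 leaves room to subtract the shift from a product that is at least
  \<open>y ^ 400\<close>.\<close>

definition S1s :: "nat => nat => real" where
 "S1s v y = (SUM n:{n:{y ^ 399<..y ^ 430}. ALL q:W0. n mod q = v mod q}. wt y n / real n)"

text \<open>\<open>31 = 430 - 399\<close> is the logarithmic length of the range, and 101/100 is the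
  loss in \<open>Fy\<close>. The error has exponent \<open>192 + 2 * 97 - 399 = -13\<close> in
  \<open>y\<close>.\<close>

lemma S1s_upper:
 assumes "\<sigma> > 3131 / 100 * cW ^ 8 * 96 ^ 8 / (fact 8 * real W)"
 shows "\<forall>\<^sub>F y in sequentially. S1s v y <= \<sigma> * ln (real y) ^ 9"
proof -
 define B where "B y = Bz (Suc 7) 0 (real y ^ 96) / ln (real y) ^ (Suc 7 + 0)" for y :: nat
 define b where "b = cW ^ Suc 7 * (fact 0 / fact (Suc 7 + 0)) * real 96 ^ (Suc 7 + 0)"
 have B: "(B \<longlongrightarrow> b) sequentially" unfolding B_def b_def by (rule Bz_tendsto)
 have z: "((%y. ln (real y) ^ 7 / real y ^ 13) \<longlongrightarrow> 0) sequentially" by real_asymp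
 have "((%y. 31 / real W * (101 / 100 * B y) + 2 * real W * (101 / 100 * B y)\<^sup>2 * (ln (real y) ^ 7 / real y ^ 13)) \<longlongrightarrow>
   31 / real W * (101 / 100 * b) + 2 * real W * (101 / 100 * b)\<^sup>2 * 0) sequentially"
  by (intro tendsto_intros B z)
 moreover have "31 / real W * (101 / 100 * b) + 2 * real W * (101 / 100 * b)\<^sup>2 * 0 < \<sigma>" using assms by (simp add: b_def fact_numeral)
 ultimately have "\<forall>\<^sub>F y in sequentially. 31 / real W * (101 / 100 * B y) + 2 * real W * (101 / 100 * B y)\<^sup>2 * (ln (real y) ^ 7 / real y ^ 13) < \<sigma>"
  by (rule order_tendstoD(2))
 thus ?thesis using eventually_ge_at_top[of 2]
 proof eventually_elim
  case (elim y)
  define l where "l = ln (real y)"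
  have l: "l > 0" using elim by (simp add: l_def)
  have Y: "real y > 0" using elim by simp
  have F: "Fy y <= 101 / 100 * B y * l ^ 8" using Fy_le(1)[of y] l unfolding B_def l_def[symmetric] by simp
  have "S1s v y <= (ln (real (y ^ 430)) - ln (real (y ^ 399))) / real W * Fy y + 2 * real W * real y ^ 192 / real (y ^ 399) * (real y ^ 97 * Fy y)\<^sup>2"
   unfolding S1s_def using elim by (intro sieve_upper_bound) (auto intro!: power_increasing)
  also have "ln (real (y ^ 430)) - ln (real (y ^ 399)) = 31 * l" unfolding of_nat_power ln_realpow l_def by simp
  also have "31 * l / real W * Fy y + 2 * real W * real y ^ 192 / real (y ^ 399) * (real y ^ 97 * Fy y)\<^sup>2 <=
   31 * l / real W * (101 / 100 * B y * l ^ 8) + 2 * real W * real y ^ 192 / real (y ^ 399) * (real y ^ 97 * (101 / 100 * B y * l ^ 8))\<^sup>2"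
   using F Fy_le(2)[of y] l by (intro add_mono mult_left_mono power_mono mult_nonneg_nonneg divide_nonneg_nonneg) auto
  also have "2 * real W * real y ^ 192 / real (y ^ 399) * (real y ^ 97 * (101 / 100 * B y * l ^ 8))\<^sup>2 = 2 * real W * (101 / 100 * B y)\<^sup>2 * (l ^ 7 / real y ^ 13) * l ^ 9"
  proof -
   have "real y ^ 399 = real y ^ 192 * (real y ^ 97)\<^sup>2 * real y ^ 13" by (simp flip: power_mult power_add)
   note eq = this
   have gen: "2 * w * a / (a * b\<^sup>2 * c) * (b * (X * L))\<^sup>2 = 2 * w * X\<^sup>2 * (P / c) * Q" if "L\<^sup>2 = P * Q" "a ~= 0" "b ~= 0" for w a b c X L P Q :: real
    using that by (simp add: power_mult_distrib)
   show ?thesis unfolding of_nat_power eq by (rule gen) (use Y in \<open>simp_all flip: power_mult power_add\<close>)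
  qed
  also have "31 * l / real W * (101 / 100 * B y * l ^ 8) + 2 * real W * (101 / 100 * B y)\<^sup>2 * (l ^ 7 / real y ^ 13) * l ^ 9 =
   (31 / real W * (101 / 100 * B y) + 2 * real W * (101 / 100 * B y)\<^sup>2 * (l ^ 7 / real y ^ 13)) * l ^ 9"
   by (simp add: distrib_right power_numeral_reduce)
  also have "... <= \<sigma> * l ^ 9" using elim(1) l unfolding l_def[symmetric] by (intro mult_right_mono) auto
  finally show ?case unfolding l_def .
 qed
qed

lemma cell_unique:
 assumes "p : cell y i" "p : cell y j" "y >= 2"
 shows "i = j"
proof -
 have "~ i < j" if "p : cell y i" "p : cell y j" for i j
 proof
  assume "i < j"
  hence "y ^ Suc i <= y ^ j" using assms(3) by (intro power_increasing) auto
  thus False using that by (auto simp: cell_def)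
 qed
 thus ?thesis using assms by (meson linorder_neqE_nat)
qed

text \<open>If no \<open>n > y\<close> has two shifts that are products of two primes,
  \<open>n = p1 * p2 - h\<close> determines everything: first \<open>h\<close>, then the primes by
  unique factorisation and \<open>p1 < p2\<close>, then their cells. The map is injective, so all
  shifts and cells together are covered by the plain sum over \<open>n\<close>.\<close>

lemma S2c_sum_le:
 assumes y: "y >= 100" and sep: "!!n h h'. n > y ==> h : Hs ==> h' : Hs ==> n + h : E2 ==> n + h' : E2 ==> h = h'"
 shows "(SUM (h, i, k):Hs \<times> {15..<200} \<times> {..<29}. S2c v h i (400 - i + k) y) <= S1s v y"
proof -
 let ?z1 = "{n:{y ^ 399<..y ^ 430}. ALL q:W0. n mod q = v mod q}"
 let ?T = "Hs \<times> {15..<200::nat} \<times> {..<29::nat}"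
 define Bs where "Bs = (%(h, i, k). Sigma (cell y i) (%p1. {p2:cell y (400 - i + k). ALL q:W0. p1 * p2 mod q = (v + h) mod q}))"
 define n where "n = (%((h :: nat, i :: nat, k :: nat), p1, p2). p1 * p2 - h)"
 let ?\<Theta> = "Sigma ?T Bs"
 have fin: "finite ?T" "!!t. finite (Bs t)" using Hs(1) by (auto simp: Bs_def split: prod.splits)
 have props: "prime p1 & prime p2 & p1 < p2 & p1 * p2 - h + h = p1 * p2 & y ^ 399 < p1 * p2 - h & p1 * p2 - h <= y ^ 430"
  if t: "(h, i, k) : ?T" and p: "(p1, p2) : Bs (h, i, k)" for h i k p1 p2
 proof -
  have ik: "h : Hs" "15 <= i" "i < 200" "k < 29" using t by auto
  have c: "prime p1" "prime p2" "y ^ i < p1" "p1 <= y ^ Suc i" "y ^ (400 - i + k) < p2" "p2 <= y ^ Suc (400 - i + k)"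
   using p by (auto simp: Bs_def cell_def)
  have "y ^ Suc i <= y ^ (400 - i + k)" using ik y by (intro power_increasing) auto
  hence lt: "p1 < p2" using c by linarith
  have "y ^ 400 <= y ^ (i + (400 - i + k))" using ik y by (intro power_increasing) auto
  also have "... = y ^ i * y ^ (400 - i + k)" by (rule power_add)
  also have "... <= p1 * p2" using c by (intro mult_mono) auto
  finally have lo: "y ^ 400 <= p1 * p2" .
  have "p1 * p2 <= y ^ Suc i * y ^ Suc (400 - i + k)" using c by (intro mult_mono) auto
  also have "... = y ^ (Suc i + Suc (400 - i + k))" by (rule power_add[symmetric])
  also have "... <= y ^ 430" using ik y by (intro power_increasing) auto
  finally have hi: "p1 * p2 <= y ^ 430" .
  have "y ^ 400 = y * y ^ 399" by (simp flip: power_Suc)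
  moreover have "100 * y ^ 399 <= y * y ^ 399" using y by (intro mult_right_mono) auto
  moreover have "y ^ 399 > 0" using y by simp
  ultimately have "y ^ 399 + 26 < p1 * p2" using lo by linarith
  thus ?thesis using c lt hi Hs(3)[OF ik(1)] by auto
 qed
 have inj: "inj_on n ?\<Theta>"
 proof (rule inj_onI)
  fix x x' assume x: "x : ?\<Theta>" "x' : ?\<Theta>" "n x = n x'"
  obtain h i k p1 p2 where X: "x = ((h, i, k), p1, p2)" by (metis prod_cases3 surj_pair)
  obtain h' i' k' p1' p2' where X': "x' = ((h', i', k'), p1', p2')" by (metis prod_cases3 surj_pair)
  have t: "(h, i, k) : ?T" "(p1, p2) : Bs (h, i, k)" "(h', i', k') : ?T" "(p1', p2') : Bs (h', i', k')" using x X X' by auto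
  note P = props[OF t(1,2)] and P' = props[OF t(3,4)]
  have nn: "p1 * p2 - h = p1' * p2' - h'" using x X X' by (simp add: n_def)
  have E: "p1 * p2 : E2" "p1' * p2' : E2" using P P' unfolding E2_def by blast+
  have "y <= y ^ 399" using y by (intro self_le_power) auto
  hence hh: "h = h'" using sep[of "p1 * p2 - h" h h'] P P' E nn t by auto
  hence pp: "p1 * p2 = p1' * p2'" using P P' nn by metis
  hence "p1 dvd p1' * p2'" by (metis dvd_triv_left)
  hence "p1 = p1' | p1 = p2'" using P P' prime_dvd_mult_iff primes_dvd_imp_eq by blast
  moreover have "p1 ~= p2'"
  proof
   assume e: "p1 = p2'"
   hence "p2 = p1'" using pp P prime_gt_0_nat[of p1] by (simp add: mult.commute)
   thus False using P P' e by linarith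
  qed
  ultimately have "p1 = p1'" by blast
  moreover from this have "p2 = p2'" using pp P prime_gt_0_nat[of p1] by simp
  moreover have "i = i'" using cell_unique[of p1 y i i'] t \<open>p1 = p1'\<close> y by (auto simp: Bs_def)
  moreover have "400 - i + k = 400 - i' + k'" using cell_unique[of p2 y "400 - i + k" "400 - i' + k'"] t \<open>p2 = p2'\<close> y by (auto simp: Bs_def)
  ultimately show "x = x'" using X X' hh by auto
 qed
 have "(SUM (h, i, k):?T. S2c v h i (400 - i + k) y) = (SUM t:?T. SUM p:Bs t. 1 / real (fst p) * (betaw y (400 - fst (snd t) + snd (snd t)) (snd p) * wt y (n (t, p))))"
  unfolding S2c_def Bs_def n_def case_prod_beta
  by (intro sum.cong refl) (subst sum_over_Sigma, auto simp: sum_distrib_left)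
 also have "... <= (SUM t:?T. SUM p:Bs t. wt y (n (t, p)) / real (n (t, p)))"
 proof (intro sum_mono)
  fix t p assume tp: "t : ?T" "p : Bs t"
  obtain h i k p1 p2 where X: "t = (h, i, k)" "p = (p1, p2)" by (metis prod_cases3 surj_pair)
  have P: "prime p1 & prime p2 & p1 < p2 & p1 * p2 - h + h = p1 * p2 & y ^ 399 < p1 * p2 - h & p1 * p2 - h <= y ^ 430"
   using props tp X by blast
  have "p2 : cell y (400 - i + k)" using tp X by (auto simp: Bs_def)
  hence b: "betaw y (400 - i + k) p2 <= 1 / real p2" using betaw_le[of p2 y "400 - i + k"] y by (auto simp: abs_le_iff)
  have w: "0 <= wt y (p1 * p2 - h)" by (simp add: wt_def)
  have "1 / real p1 * (betaw y (400 - i + k) p2 * wt y (p1 * p2 - h)) <= 1 / real p1 * (1 / real p2 * wt y (p1 * p2 - h))"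
   using b w by (intro mult_left_mono mult_right_mono) auto
  also have "... = wt y (p1 * p2 - h) / real (p1 * p2)" by simp
  also have "... <= wt y (p1 * p2 - h) / real (p1 * p2 - h)"
   using w P by (intro divide_left_mono) (auto simp: prime_gt_0_nat simp del: of_nat_mult)
  finally show "1 / real (fst p) * (betaw y (400 - fst (snd t) + snd (snd t)) (snd p) * wt y (n (t, p))) <= wt y (n (t, p)) / real (n (t, p))"
   using X by (simp add: n_def)
 qed
 also have "... = (SUM x:?\<Theta>. wt y (n x) / real (n x))" using fin by (intro sum_over_Sigma[symmetric]) auto
 also have "... = (SUM m:n ` ?\<Theta>. wt y m / real m)" by (rule sum_image_eq[OF inj refl])
 also have "... <= S1s v y" unfolding S1s_def
 proof (rule sum_mono2)
  show "n ` ?\<Theta> \<subseteq> ?z1"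
  proof
   fix m assume "m : n ` ?\<Theta>"
   then obtain h i k p1 p2 where X: "m = p1 * p2 - h" "(h, i, k) : ?T" "(p1, p2) : Bs (h, i, k)" by (auto simp: n_def)
   note P = props[OF X(2,3)]
   have "m mod q = v mod q" if q: "q : W0" for q
   proof -
    have "p1 * p2 mod q = (v + h) mod q" using X(3) q by (auto simp: Bs_def)
    hence "[m + h = v + h] (mod q)" using P X(1) by (simp add: Cong.cong_def)
    hence "[m = v] (mod q)" by (simp only: cong_add_rcancel_nat)
    thus ?thesis by (simp add: Cong.cong_def)
   qed
   thus "m : ?z1" using P X(1) by auto
  qed
 qed (auto simp: wt_def)
 finally show ?thesis .
qed

text \<open>Since \<open>phiW = cW * W\<close> takes up one of the nine factors \<open>cW\<close>,
  both sides share \<open>cW ^ 8 / W\<close>; only pure numbers remain, with the factor 8 from the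
  number of shifts.\<close>

lemma tau_sum_gt:
 "3131 / 100 * cW ^ 8 * 96 ^ 8 / (fact 8 * real W) < (SUM (h, i, k):Hs \<times> {15..<200} \<times> {..<29}. tau i (400 - i + k))"
proof -
 let ?z1 = "SUM i:{15..<200}. (NNi (int i))\<^sup>2 * 29 div ((int i + 1) * (415 - int i))"
 define M where "M i = max 0 (NN i - 1)" for i
 have Mi: "M i = real_of_int (NNi (int i))" if "i : {15..<200}" for i
 proof -
  have "NN i - 1 = real_of_int (NNi (int i))"
   by (cases "i < 96") (simp_all add: NN_def NNi_def of_nat_diff)
  moreover have "NNi (int i) >= 0"
   by (rule bspec[OF conjunct2[OF NNi_numeric]], simp only: set_upto) (use that in auto)
  ultimately show ?thesis unfolding M_def by simp
 qed
 have "4600 * 96 ^ 17 < (\<Sum>i\<leftarrow>[15..199]. (NNi i)\<^sup>2 * 29 div ((i + 1) * (415 - i)))" using NNi_numeric by blast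
 also have "... = (SUM i:{15..199}. (NNi i)\<^sup>2 * 29 div ((i + 1) * (415 - i)))" by (subst sum_list_distinct_conv_sum_set) (simp_all only: distinct_upto set_upto)
 also have "... = ?z1"
  by (rule sum.reindex_bij_witness[of _ int nat]) auto
 finally have "real_of_int (4600 * 96 ^ 17) < real_of_int ?z1"
  by (simp only: of_int_less_iff)
 also have "... <= (SUM i:{15..<200}. (M i)\<^sup>2 / real (Suc i) * (29 / (415 - real i)))"
  unfolding of_int_sum
 proof (rule sum_mono)
  fix i :: nat assume i: "i : {15..<200}"
  have "real_of_int ((NNi (int i))\<^sup>2 * 29 div ((int i + 1) * (415 - int i))) <= real_of_int ((NNi (int i))\<^sup>2 * 29) / real_of_int ((int i + 1) * (415 - int i))"
   by (rule real_of_int_div4)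
  also have "... = (M i)\<^sup>2 / real (Suc i) * (29 / (415 - real i))" using Mi[OF i] by (simp add: add.commute)
  finally show "real_of_int ((NNi (int i))\<^sup>2 * 29 div ((int i + 1) * (415 - int i))) <= (M i)\<^sup>2 / real (Suc i) * (29 / (415 - real i))" .
 qed
 also have "... <= (SUM i:{15..<200}. (M i)\<^sup>2 / real (Suc i) * (SUM k<29. 1 / real (Suc (400 - i + k))))"
  by (intro sum_mono mult_left_mono reciprocal_block_ge) auto
 finally have num: "4600 * 96 ^ 17 < (SUM i:{15..<200}. (M i)\<^sup>2 / real (Suc i) * (SUM k<29. 1 / real (Suc (400 - i + k))))" by simp
 define c where "c = cW ^ 8 / (128 * fact 9 * 96 ^ 9 * real W)"
 have c: "c > 0" unfolding c_def using cW_pos W_pos by simp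
 have tau: "tau i j = c * ((M i)\<^sup>2 / real (Suc i) * (1 / real (Suc j)))" for i j
 proof -
  have "phiW = cW * W" "cW ^ 9 = cW * cW ^ 8" using W_pos by (simp_all add: cW_def flip: power_Suc)
  thus ?thesis unfolding tau_def M_def[symmetric] c_def using cW_pos by simp
 qed
 have "(SUM (h, i, k):Hs \<times> {15..<200} \<times> {..<29}. tau i (400 - i + k)) = 8 * (c * (SUM i:{15..<200}. (M i)\<^sup>2 / real (Suc i) * (SUM k<29. 1 / real (Suc (400 - i + k)))))"
  unfolding sum.cartesian_product[symmetric] tau sum_distrib_left using Hs(2) by (simp add: sum_distrib_left)
 moreover have "3131 / 100 * cW ^ 8 * 96 ^ 8 / (fact 8 * real W) < 8 * (c * (4600 * 96 ^ 17))"
  unfolding c_def using cW_pos W_pos by (simp add: fact_numeral field_simps)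
 moreover have "8 * (c * (4600 * 96 ^ 17)) <= 8 * (c * (SUM i:{15..<200}. (M i)\<^sup>2 / real (Suc i) * (SUM k<29. 1 / real (Suc (400 - i + k)))))"
  using num c by (intro mult_left_mono) auto
 ultimately show ?thesis by linarith
qed

text \<open>For large \<open>y\<close> each of the finitely many terms is within
  \<open>\<eta>\<close> of its limit or above it. \<open>\<eta>\<close> is chosen so that these
  losses add up to a quarter of the gap \<open>\<delta>\<close>; another quarter is allowed to the
  plain sum, and the inequality between the sums fails.\<close>

lemma close_almost_primes: "EX n>N. EX h:Hs. EX h':Hs. h ~= h' & n + h : E2 & n + h' : E2"
proof (rule ccontr)
 assume no: "~ ?thesis"
 obtain v where v: "!!h. h : Hs ==> cop (v + h)" using admissible_residue by blast
 let ?T = "Hs \<times> {15..<200::nat} \<times> {..<29::nat}"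
 let ?t = "3131 / 100 * cW ^ 8 * 96 ^ 8 / (fact 8 * real W)" and ?s = "SUM (h, i, k):?T. tau i (400 - i + k)"
 have fT: "finite ?T" "card ?T > 0" using Hs(1,2) by (auto simp: card_cartesian_product)
 define \<delta> where "\<delta> = ?s - ?t"
 define \<eta> where "\<eta> = \<delta> / (4 * real (card ?T))"
 have \<delta>: "\<delta> > 0" using tau_sum_gt by (simp add: \<delta>_def)
 have \<eta>: "\<eta> > 0" "real (card ?T) * \<eta> = \<delta> / 4"
 proof -
  have "0 < d / (4 * c)" "c * (d / (4 * c)) = d / 4" if "c > 0" "d > 0" for c d :: real using that by simp_all
  from this[OF fT(2)[folded of_nat_0_less_iff[where ?'a = real]] \<delta>] show "\<eta> > 0" "real (card ?T) * \<eta> = \<delta> / 4" unfolding \<eta>_def .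
 qed
 have "\<forall>\<^sub>F y in sequentially. ALL t:?T. case t of (h, i, k) => (tau i (400 - i + k) - \<eta>) * ln (real y) ^ 9 <= S2c v h i (400 - i + k) y"
 proof (intro eventually_ball_finite fT ballI)
  fix t assume t: "t : ?T"
  obtain h i k where X: "t = (h, i, k)" by (metis prod_cases3)
  have "h : Hs" "15 <= i" "201 <= 400 - i + k" "400 <= i + (400 - i + k)" using t X by auto
  thus "\<forall>\<^sub>F y in sequentially. case t of (h, i, k) => (tau i (400 - i + k) - \<eta>) * ln (real y) ^ 9 <= S2c v h i (400 - i + k) y"
   unfolding X prod.case using \<eta> v by (intro S2c_lower) auto
 qed
 moreover have "\<forall>\<^sub>F y in sequentially. S1s v y <= (?t + \<delta> / 4) * ln (real y) ^ 9" using \<delta> by (intro S1s_upper) simp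
 ultimately have "\<forall>\<^sub>F y in sequentially. False"
  using eventually_ge_at_top[of 100] eventually_ge_at_top[of N]
 proof eventually_elim
  case (elim y)
  have l: "ln (real y) ^ 9 > 0" using elim by simp
  have "(?s - \<delta> / 4) * ln (real y) ^ 9 = (SUM t:?T. (case t of (h, i, k) => tau i (400 - i + k)) - \<eta>) * ln (real y) ^ 9"
   unfolding sum_subtractf sum_constant \<eta>(2) ..
  also have "... = (SUM t:?T. case t of (h, i, k) => (tau i (400 - i + k) - \<eta>) * ln (real y) ^ 9)"
   unfolding sum_distrib_right by (intro sum.cong) auto
  also have "... <= (SUM (h, i, k):?T. S2c v h i (400 - i + k) y)" using elim(1) by (intro sum_mono) auto
  also have "... <= S1s v y" using no elim by (intro S2c_sum_le) (auto intro: less_le_trans le_less_trans)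
  also have "... <= (?t + \<delta> / 4) * ln (real y) ^ 9" by (rule elim(2))
  finally have "?s - \<delta> / 4 <= ?t + \<delta> / 4" using l by (simp only: mult_le_cancel_right_pos)
  moreover have "False" if "s - (s - t) / 4 <= t + (s - t) / 4" "0 < s - t" for s t :: real using that by (simp add: field_simps)
  ultimately show False using \<delta> unfolding \<delta>_def by blast
 qed
 thus False by simp
qed

end

theorem theorem3:
  shows "liminf (\<lambda>n. ereal (real (q (Suc n)) - real (q n))) \<le> 26"
proof -
 obtain D0 :: nat where D0: "D0 >= 12544 ^ 192" by blast
 interpret bigsieve D0
 proof
  have "(1::nat) <= 12544 ^ 192" by (rule one_le_power) simp
  thus "D0 >= 1" using D0 by (rule order.trans)
 qed (rule D0)
 have inf: "infinite E2"
 proof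
  assume "finite E2"
  then obtain N where "ALL m:E2. m <= N" using finite_nat_set_iff_bounded_le by blast
  thus False using close_almost_primes[of N] by fastforce
 qed
 \<comment> \<open>The two elements of \<open>E2\<close> found beyond \<open>q K\<close> need not be
   consecutive, but the successor of the smaller one is at most the larger one.\<close>
 have "EX k>=K. ereal (real (q (Suc k)) - real (q k)) <= 26" for K
 proof -
  obtain n h h' where n: "n > q K" "h : Hs" "h' : Hs" "h < h'" "n + h : E2" "n + h' : E2"
   using close_almost_primes[of "q K"] by (metis linorder_neqE_nat)
  obtain k where k: "q k = n + h" unfolding q_def using n(5) enumerate_Ex[OF inf n(5)] by blast
  obtain k' where k': "q k' = n + h'" unfolding q_def using n(6) enumerate_Ex[OF inf n(6)] by blast
  have mono: "strict_mono q" unfolding q_def[abs_def] by (rule strict_mono_enumerate[OF inf])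
  have "q K < q k" "q k < q k'" using k k' n by auto
  hence "K < k" "Suc k <= k'" using strict_mono_less[OF mono] by (auto simp: Suc_le_eq)
  hence "q (Suc k) <= n + h'" using strict_mono_less_eq[OF mono] k' by metis
  hence "ereal (real (q (Suc k)) - real (q k)) <= ereal 26" using k Hs(3)[OF n(3)] by simp
  thus ?thesis using \<open>K < k\<close> by (intro exI[of _ k]) auto
 qed
 hence fr: "\<exists>\<^sub>F n in sequentially. ereal (real (q (Suc n)) - real (q n)) <= 26"
  unfolding frequently_sequentially by blast
 show ?thesis
 proof (rule ccontr)
  assume "~ ?thesis"
  hence "\<forall>\<^sub>F n in sequentially. 26 < ereal (real (q (Suc n)) - real (q n))" by (intro less_LiminfD) simp
  thus False using fr by (simp add: frequently_def not_le)
 qed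
qed

end
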